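(* Let $\mathcal{C}$ be a small $\mathbb{C}$-linear category, let $p\in[1,\infty)$, and let $(\mathscr{H},\mathcal{F})$ be a $p$-summable even Fredholm module over $\mathcal{C}$. Let $m\ge0$ be an integer with $2m \geq p-1$, and let $\phi^{2m}$, $\phi^{2m+2}$ be the $2m$- and $(2m+2)$-dimensional characters of $(\mathscr H,\mathcal F)$. Then $$S(\phi^{2m})=-(m+1)\phi^{2m+2} \qquad \text{in } H^{2m+2}_\lambda(\mathcal{C}).$$
   Context: **Fredholm modules.** $SHilb_{\mathbb Z_2}$ is the category of $\mathbb Z_2$-graded separable complex Hilbert spaces with bounded linear maps; $\mathcal B^p(\mathcal H_1,\mathcal H_2)$ is the $p$-th Schatten class. A $p$-summable even Fredholm module over $\mathcal C$ is a pair $(\mathscr H,\mathcal F)$: a functor $\mathscr H:\mathcal C\to SHilb_{\mathbb Z_2}$ with each $\mathscr H(f)$ of degree $0$ (linear on Hom spaces), and a family $\mathcal F=\{\mathcal F_X:\mathscr H(X)\to\mathscr H(X)\}_{X\in Ob(\mathcal C)}$ of bounded operators of degree $1$ with $\mathcal F_X^2=\mathrm{id}$, such that for each $f\in Hom_{\mathcal C}(X,Y)$, $[\mathcal F,f]:=\mathcal F_Y\mathscr H(f)-\mathscr H(f)\mathcal F_X\in\mathcal B^p(\mathscr H(X),\mathscr H(Y))$. (Such a module is also $(p+2)$-summable.) **Characters.** For $T\in\mathcal B(\mathscr H(X),\mathscr H(X))$ homogeneous, put $[\mathcal F,T]=\mathcal F_XT-(-1)^{|T|}T\mathcal F_X$;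 if this is trace class, $Tr_s(T):=\frac12Tr(\epsilon\,\mathcal F_X[\mathcal F,T])$, with $\epsilon$ the grading operator and $Tr$ the operator trace. For $2m\ge p-1$, the $2m$-dimensional character is the cyclic cocycle $\phi^{2m}(f^0\otimes\cdots\otimes f^{2m})=Tr_s(\mathscr H(f^0)[\mathcal F,f^1]\cdots[\mathcal F,f^{2m}])$. **Cyclic cohomology.** $CN_n(\mathcal C)=\bigoplus_{(X_0,\dots,X_n)}Hom_{\mathcal C}(X_1,X_0)\otimes Hom_{\mathcal C}(X_2,X_1)\otimes\cdots\otimes Hom_{\mathcal C}(X_0,X_n)$; $CN^n(\mathcal C)$ is its linear dual. $(b\phi)(f^0\otimes\cdots\otimes f^{n+1})=\sum_{i=0}^n(-1)^i\phi(f^0\otimes\cdots\otimes f^if^{i+1}\otimes\cdots\otimes f^{n+1})+(-1)^{n+1}\phi(f^{n+1}f^0\otimes f^1\otimes\cdots\otimes f^n)$, $(\lambda\phi)(f^0\otimes\cdots\otimes f^n)=(-1)^n\phi(f^n\otimes f^0\otimes\cdots\otimes f^{n-1})$. $C^n_\lambda(\mathcal C)=\ker(1-\lambda)\subseteq CN^n(\mathcal C)$; $H^\bullet_\lambda(\mathcal C)$ is the cohomology of $(C^\bullet_\lambda(\mathcal C),b)$, with cocycles $Z^\bullet_\lambda(\mathcal C)$. **Periodicity operator.** A semicategory is a category without the requirement of identities. A DG-semicategory $(\mathcal S,\hat\partial)$ is a $\mathbb C$-linear semicategory whose Hom spaces are cochain complexes in degrees $\ge0$ with $\hat\partial(gf)=\hat\partial(g)f+(-1)^{\deg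 g}g\hat\partial(f)$. A closed graded trace of dimension $n$ is a collection of linear maps $\hat T_X:Hom^n_{\mathcal S}(X,X)\to\mathbb C$ vanishing on $\hat\partial(Hom^{n-1}_{\mathcal S}(X,X))$ with $\hat T_X(gg')=(-1)^{ij}\hat T_Y(g'g)$ for $g\in Hom^i(Y,X)$, $g'\in Hom^j(X,Y)$, $i+j=n$. An $n$-dimensional cycle over $\mathcal C$ is $(\mathcal S,\hat\partial,\hat T,\rho)$ with $\rho:\mathcal C\to\mathcal S^0$ a linear semifunctor; its character is $\phi(f^0\otimes\cdots\otimes f^n)=\hat T_{\rho(X_0)}(\rho(f^0)\hat\partial(\rho(f^1))\cdots\hat\partial(\rho(f^n)))$. The elements of $Z^n_\lambda(\mathcal C)$ are exactly the characters of $n$-dimensional cycles over $\mathcal C$. For $\phi\in Z^r_\lambda(\mathcal C)$, $\phi'\in Z^s_\lambda(\mathcal C')$ that are characters of cycles $(\mathcal S,\hat\partial,\hat T,\rho)$, $(\mathcal S',\hat\partial',\hat T',\rho')$, $\phi\#\phi'\in Z^{r+s}_\lambda(\mathcal C\otimes\mathcal C')$ is the character of $(\mathcal S\otimes\mathcal S',\hat\partial\otimes\hat\partial',\hat T\#\hat T',\rho\otimes\rho')$, where $(g\otimes g')(f\otimes f')=(-1)^{\deg(g')\deg(f)}gf\otimes g'f'$, $(\hat\partial\otimes\hat\partial')(f\otimes g)=\hat\partial f\otimes g+(-1)^{\deg f}f\otimes\hat\partial'g$, and $\hat T\#\hat T'$ is $f\otimes f'\mapsto\hat T(f)\hat T'(f')$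 on bidegree $(r,s)$ and zero on other bidegrees. With $\mathbb C$ regarded as the category with one object and endomorphism algebra $\mathbb C$, and $\psi\in Z^2_\lambda(\mathbb C)$ determined by $\psi(1\otimes1\otimes1)=1$, the periodicity operator is $S:Z^r_\lambda(\mathcal C)\to Z^{r+2}_\lambda(\mathcal C)$, $S(\phi)=\phi\#\psi$ (identifying $\mathcal C\otimes\mathbb C=\mathcal C$); it descends to cyclic cohomology. *)

theory Defs
  imports "HOL-Analysis.Analysis" "HOL-Library.Function_Algebras"
begin

section \<open>Complex vector spaces and complex Hilbert spaces\<close>

text \<open>Vector spaces and Hilbert spaces attached to the objects of a category are modelled, as usual in
  HOL, as linear subspaces (closed subspaces) of one ambient space. The ambient type is arbitrary; any
  small family of vector spaces (Hilbert spaces) embeds linearly (isometrically) in its direct sum.\<close>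

class complex_vector = ab_group_add +
  fixes scaleC :: "complex \<Rightarrow> 'a \<Rightarrow> 'a"  (infixr \<open>*\<^sub>C\<close> 75)
  assumes scaleC_add_right: "c *\<^sub>C (x + y) = c *\<^sub>C x + c *\<^sub>C y"
    and scaleC_add_left: "(c + d) *\<^sub>C x = c *\<^sub>C x + d *\<^sub>C x"
    and scaleC_scaleC: "c *\<^sub>C (d *\<^sub>C x) = (c * d) *\<^sub>C x"
    and scaleC_one: "1 *\<^sub>C x = x"

class complex_hilbert = complex_vector + banach +
  fixes cinner :: "'a \<Rightarrow> 'a \<Rightarrow> complex"
  assumes scaleR_conv_scaleC: "r *\<^sub>R x = complex_of_real r *\<^sub>C x"
    and cinner_add_right: "cinner x (y + z) = cinner x y + cinner x z"
    and cinner_scaleC_right: "cinner x (c *\<^sub>C y) = c * cinner x y"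
    and cinner_commute: "cinner x y = cnj (cinner y x)"
    and norm_eq_sqrt_cinner: "norm x = sqrt (Re (cinner x x))"

instantiation complex :: complex_hilbert
begin
definition scaleC_complex :: "complex \<Rightarrow> complex \<Rightarrow> complex" where "scaleC_complex c x = c * x"
definition cinner_complex :: "complex \<Rightarrow> complex \<Rightarrow> complex" where "cinner_complex x y = cnj x * y"
instance
  by standard
    (auto simp: scaleC_complex_def cinner_complex_def algebra_simps scaleR_conv_of_real
      cmod_def power2_eq_square)
end

instantiation "fun" :: (type, complex_vector) complex_vector
begin
definition scaleC_fun :: "complex \<Rightarrow> ('a \<Rightarrow> 'b) \<Rightarrow> 'a \<Rightarrow> 'b" where "scaleC_fun c f = (\<lambda>x. c *\<^sub>C f x)"
instance
  by standard
    (auto simp: scaleC_fun_def fun_eq_iff scaleC_add_right scaleC_add_left scaleC_scaleC scaleC_one)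
end

abbreviation csubspace :: "'a::complex_vector set \<Rightarrow> bool"
  where "csubspace \<equiv> module.subspace scaleC"

abbreviation cspan :: "'a::complex_vector set \<Rightarrow> 'a set"
  where "cspan \<equiv> module.span scaleC"

definition clinear_on :: "'a::complex_vector set \<Rightarrow> 'b::complex_vector set \<Rightarrow> ('a \<Rightarrow> 'b) \<Rightarrow> bool"
  where "clinear_on V W f \<longleftrightarrow>
    (\<forall>x\<in>V. f x \<in> W) \<and> (\<forall>x\<in>V. \<forall>y\<in>V. f (x + y) = f x + f y) \<and> (\<forall>c. \<forall>x\<in>V. f (c *\<^sub>C x) = c *\<^sub>C f x)"

definition cbilinear_on :: "'a::complex_vector set \<Rightarrow> 'b::complex_vector set \<Rightarrow> 'c::complex_vector set
    \<Rightarrow> ('a \<Rightarrow> 'b \<Rightarrow> 'c) \<Rightarrow> bool"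
  where "cbilinear_on V W U f \<longleftrightarrow>
    (\<forall>x\<in>V. clinear_on W U (f x)) \<and> (\<forall>y\<in>W. clinear_on V U (\<lambda>x. f x y))"


section \<open>Tensor products of vector spaces\<close>

text \<open>The algebraic tensor product of \<open>V\<close> and \<open>W\<close> is realised as the span of the evaluations
  \<open>v \<otimes> w : \<beta> \<mapsto> \<beta> v w\<close> inside the dual of the space of bilinear forms on \<open>V \<times> W\<close>.\<close>

type_synonym ('a, 'b) tensor = "('a \<Rightarrow> 'b \<Rightarrow> complex) \<Rightarrow> complex"

definition pure_tensor :: "'a::complex_vector set \<Rightarrow> 'b::complex_vector set \<Rightarrow> 'a \<Rightarrow> 'b \<Rightarrow> ('a, 'b) tensor"
  where "pure_tensor V W v w = (\<lambda>\<beta>. if cbilinear_on V W UNIV \<beta> then \<beta> v w else 0)"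

definition tensor_space :: "'a::complex_vector set \<Rightarrow> 'b::complex_vector set \<Rightarrow> ('a, 'b) tensor set"
  where "tensor_space V W = cspan {pure_tensor V W v w | v w. v \<in> V \<and> w \<in> W}"

text \<open>The linear map on \<open>V \<otimes> W\<close> induced by a bilinear map \<open>h\<close> into a space of complex functions, and the
  linear form induced by a bilinear form.\<close>

definition tensor_lift :: "('a \<Rightarrow> 'b \<Rightarrow> 'c \<Rightarrow> complex) \<Rightarrow> ('a, 'b) tensor \<Rightarrow> 'c \<Rightarrow> complex"
  where "tensor_lift h t = (\<lambda>z. t (\<lambda>v w. h v w z))"

definition tensor_form :: "('a \<Rightarrow> 'b \<Rightarrow> complex) \<Rightarrow> ('a, 'b) tensor \<Rightarrow> complex"
  where "tensor_form \<beta> t = t \<beta>"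

lemma tensor_lift_pure:
  assumes "cbilinear_on V W UNIV h"
  shows "tensor_lift h (pure_tensor V W v w) = h v w"
proof
  fix z
  have "cbilinear_on V W UNIV (\<lambda>v w. h v w z)"
    using assms by (auto simp: cbilinear_on_def clinear_on_def scaleC_fun_def)
  then show "tensor_lift h (pure_tensor V W v w) z = h v w z"
    by (simp add: tensor_lift_def pure_tensor_def)
qed

lemma tensor_form_pure:
  "cbilinear_on V W UNIV \<beta> \<Longrightarrow> tensor_form \<beta> (pure_tensor V W v w) = \<beta> v w"
  by (simp add: tensor_form_def pure_tensor_def)

lemma tensor_lift_linear:
  "tensor_lift h (s + t) = tensor_lift h s + tensor_lift h t"
  "tensor_lift h (c *\<^sub>C t) = c *\<^sub>C tensor_lift h t"
  by (auto simp: tensor_lift_def scaleC_fun_def fun_eq_iff)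

lemma cbilinear_on_pure_tensor: "cbilinear_on V W UNIV (pure_tensor V W)"
  unfolding cbilinear_on_def clinear_on_def pure_tensor_def scaleC_fun_def plus_fun_def
  by (auto simp: fun_eq_iff scaleC_complex_def)


section \<open>Linear categories\<close>

text \<open>\<open>comp C X Y Z g f\<close> is the composite \<open>g f\<close> of \<open>f : X \<rightarrow> Y\<close> and \<open>g : Y \<rightarrow> Z\<close>. The Hom spaces need not
  be disjoint.\<close>

record ('o, 'a) lin_cat =
  ob :: "'o set"
  hom :: "'o \<Rightarrow> 'o \<Rightarrow> 'a set"
  comp :: "'o \<Rightarrow> 'o \<Rightarrow> 'o \<Rightarrow> 'a \<Rightarrow> 'a \<Rightarrow> 'a"
  ident :: "'o \<Rightarrow> 'a"

definition linear_category :: "('o, 'a::complex_vector) lin_cat \<Rightarrow> bool"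
  where "linear_category C \<longleftrightarrow>
    (\<forall>X\<in>ob C. \<forall>Y\<in>ob C. csubspace (hom C X Y)) \<and>
    (\<forall>X\<in>ob C. \<forall>Y\<in>ob C. \<forall>Z\<in>ob C. cbilinear_on (hom C Y Z) (hom C X Y) (hom C X Z) (comp C X Y Z)) \<and>
    (\<forall>W\<in>ob C. \<forall>X\<in>ob C. \<forall>Y\<in>ob C. \<forall>Z\<in>ob C. \<forall>h\<in>hom C Y Z. \<forall>g\<in>hom C X Y. \<forall>f\<in>hom C W X.
      comp C W Y Z h (comp C W X Y g f) = comp C W X Z (comp C X Y Z h g) f) \<and>
    (\<forall>X\<in>ob C. ident C X \<in> hom C X X) \<and>
    (\<forall>X\<in>ob C. \<forall>Y\<in>ob C. \<forall>f\<in>hom C X Y.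
      comp C X X Y f (ident C X) = f \<and> comp C X Y Y (ident C Y) f = f)"

definition complex_cat :: "(unit, complex) lin_cat"
  where "complex_cat = \<lparr>ob = UNIV, hom = (\<lambda>_ _. UNIV), comp = (\<lambda>_ _ _ g f. g * f), ident = (\<lambda>_. 1)\<rparr>"

definition tensor_cat :: "('o, 'a::complex_vector) lin_cat \<Rightarrow> ('q, 'b::complex_vector) lin_cat
    \<Rightarrow> ('o \<times> 'q, ('a, 'b) tensor) lin_cat"
  where "tensor_cat C D = \<lparr>
    ob = ob C \<times> ob D,
    hom = (\<lambda>(X, X') (Y, Y'). tensor_space (hom C X Y) (hom D X' Y')),
    comp = (\<lambda>(X, X') (Y, Y') (Z, Z') s t.
      tensor_lift (\<lambda>g g'. tensor_lift (\<lambda>f f'.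
        pure_tensor (hom C X Z) (hom D X' Z') (comp C X Y Z g f) (comp D X' Y' Z' g' f')) t) s),
    ident = (\<lambda>(X, X'). pure_tensor (hom C X X) (hom D X' X') (ident C X) (ident D X'))\<rparr>"


section \<open>Cyclic cohomology\<close>

text \<open>An elementary tensor \<open>f\<^sup>0 \<otimes> \<dots> \<otimes> f\<^sup>n\<close> in the summand of \<open>CN\<^sub>n\<close> indexed by \<open>(X\<^sub>0, \<dots>, X\<^sub>n)\<close> is the
  list \<open>[(X\<^sub>0, f\<^sup>0), \<dots>, (X\<^sub>n, f\<^sup>n)]\<close>, where \<open>f\<^sup>i : X\<^bsub>i+1\<^esub> \<rightarrow> X\<^sub>i\<close> and indices of objects are cyclic.\<close>

type_synonym ('o, 'a) chain = "('o \<times> 'a) list"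

definition obj :: "('o, 'a) chain \<Rightarrow> nat \<Rightarrow> 'o"
  where "obj l i = fst (l ! (i mod length l))"

definition mor :: "('o, 'a) chain \<Rightarrow> nat \<Rightarrow> 'a"
  where "mor l i = snd (l ! i)"

definition chains :: "('o, 'a) lin_cat \<Rightarrow> nat \<Rightarrow> ('o, 'a) chain set"
  where "chains C n =
    {l. length l = n + 1 \<and> (\<forall>i\<le>n. obj l i \<in> ob C \<and> mor l i \<in> hom C (obj l (i + 1)) (obj l i))}"

text \<open>The linear dual of \<open>CN\<^sub>n\<close>: families of multilinear forms, extended by \<open>0\<close> outside \<open>chains C n\<close> so
  that equality of cochains is equality of functions.\<close>

definition cochains :: "('o, 'a::complex_vector) lin_cat \<Rightarrow> nat \<Rightarrow> (('o, 'a) chain \<Rightarrow> complex) set"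
  where "cochains C n =
    {\<phi>. (\<forall>l. l \<notin> chains C n \<longrightarrow> \<phi> l = 0) \<and>
        (\<forall>l\<in>chains C n. \<forall>i\<le>n.
          clinear_on (hom C (obj l (i + 1)) (obj l i)) UNIV (\<lambda>f. \<phi> (l[i := (obj l i, f)])))}"

definition face :: "('o, 'a) lin_cat \<Rightarrow> nat \<Rightarrow> ('o, 'a) chain \<Rightarrow> ('o, 'a) chain"
  where "face C i l = take i l @
    [(obj l i, comp C (obj l (i + 2)) (obj l (i + 1)) (obj l i) (mor l i) (mor l (i + 1)))] @
    drop (i + 2) l"

text \<open>\<open>f\<^bsup>n+1\<^esup>f\<^sup>0 \<otimes> f\<^sup>1 \<otimes> \<dots> \<otimes> f\<^sup>n\<close>, for a list of length \<open>n + 2\<close>.\<close>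

definition last_face :: "('o, 'a) lin_cat \<Rightarrow> ('o, 'a) chain \<Rightarrow> ('o, 'a) chain"
  where "last_face C l = (let k = length l - 1 in
    (obj l k, comp C (obj l 1) (obj l 0) (obj l k) (mor l k) (mor l 0)) # butlast (tl l))"

definition hochschild_b :: "('o, 'a) lin_cat \<Rightarrow> nat \<Rightarrow> (('o, 'a) chain \<Rightarrow> complex)
    \<Rightarrow> ('o, 'a) chain \<Rightarrow> complex"
  where "hochschild_b C n \<phi> l =
    (if l \<in> chains C (n + 1)
     then (\<Sum>i\<le>n. (-1) ^ i * \<phi> (face C i l)) + (-1) ^ (n + 1) * \<phi> (last_face C l)
     else 0)"

definition cyclic_op :: "('o, 'a) lin_cat \<Rightarrow> nat \<Rightarrow> (('o, 'a) chain \<Rightarrow> complex)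
    \<Rightarrow> ('o, 'a) chain \<Rightarrow> complex"
  where "cyclic_op C n \<phi> l = (if l \<in> chains C n then (-1) ^ n * \<phi> (last l # butlast l) else 0)"

definition cyclic_cochains :: "('o, 'a::complex_vector) lin_cat \<Rightarrow> nat
    \<Rightarrow> (('o, 'a) chain \<Rightarrow> complex) set"
  where "cyclic_cochains C n = {\<phi> \<in> cochains C n. \<phi> - cyclic_op C n \<phi> = 0}"

definition cyclic_cocycles :: "('o, 'a::complex_vector) lin_cat \<Rightarrow> nat
    \<Rightarrow> (('o, 'a) chain \<Rightarrow> complex) set"
  where "cyclic_cocycles C n = {\<phi> \<in> cyclic_cochains C n. hochschild_b C n \<phi> = 0}"

definition cyclic_coboundaries :: "('o, 'a::complex_vector) lin_cat \<Rightarrow> nat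
    \<Rightarrow> (('o, 'a) chain \<Rightarrow> complex) set"
  where "cyclic_coboundaries C n =
    (if n = 0 then {0} else hochschild_b C (n - 1) ` cyclic_cochains C (n - 1))"

text \<open>Two cocycles are related iff they are equal in
  \<open>H\<^sup>n\<^sub>\<lambda>(C) = cyclic_cocycles C n // cyclic_cohomologous C n\<close>.\<close>

definition cyclic_cohomologous :: "('o, 'a::complex_vector) lin_cat \<Rightarrow> nat
    \<Rightarrow> (('o, 'a) chain \<Rightarrow> complex) rel"
  where "cyclic_cohomologous C n =
    {(\<phi>, \<psi>). \<phi> \<in> cyclic_cocycles C n \<and> \<psi> \<in> cyclic_cocycles C n \<and> \<phi> - \<psi> \<in> cyclic_coboundaries C n}"


section \<open>DG-semicategories and cycles\<close>

text \<open>A DG-semicategory is given by its homogeneous parts: \<open>dg_hom S n X Y\<close> is the degree \<open>n\<close> part of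
  the Hom complex, \<open>dg_comp S i j X Y Z g f\<close> composes \<open>g\<close> of degree \<open>i\<close> from \<open>Y\<close> to \<open>Z\<close> with \<open>f\<close> of
  degree \<open>j\<close> from \<open>X\<close> to \<open>Y\<close>, and \<open>dg_d S n X Y\<close> is the differential on the degree \<open>n\<close> part.\<close>

record ('s, 'x) dg_semicat =
  dg_ob :: "'s set"
  dg_hom :: "nat \<Rightarrow> 's \<Rightarrow> 's \<Rightarrow> 'x set"
  dg_comp :: "nat \<Rightarrow> nat \<Rightarrow> 's \<Rightarrow> 's \<Rightarrow> 's \<Rightarrow> 'x \<Rightarrow> 'x \<Rightarrow> 'x"
  dg_d :: "nat \<Rightarrow> 's \<Rightarrow> 's \<Rightarrow> 'x \<Rightarrow> 'x"

definition dg_semicategory :: "('s, 'x::complex_vector) dg_semicat \<Rightarrow> bool"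
  where "dg_semicategory S \<longleftrightarrow>
    (\<forall>n. \<forall>X\<in>dg_ob S. \<forall>Y\<in>dg_ob S. csubspace (dg_hom S n X Y)) \<and>
    (\<forall>i j. \<forall>X\<in>dg_ob S. \<forall>Y\<in>dg_ob S. \<forall>Z\<in>dg_ob S.
      cbilinear_on (dg_hom S i Y Z) (dg_hom S j X Y) (dg_hom S (i + j) X Z) (dg_comp S i j X Y Z)) \<and>
    (\<forall>i j k. \<forall>W\<in>dg_ob S. \<forall>X\<in>dg_ob S. \<forall>Y\<in>dg_ob S. \<forall>Z\<in>dg_ob S.
      \<forall>h\<in>dg_hom S i Y Z. \<forall>g\<in>dg_hom S j X Y. \<forall>f\<in>dg_hom S k W X.
      dg_comp S i (j + k) W Y Z h (dg_comp S j k W X Y g f) =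
      dg_comp S (i + j) k W X Z (dg_comp S i j X Y Z h g) f) \<and>
    (\<forall>n. \<forall>X\<in>dg_ob S. \<forall>Y\<in>dg_ob S.
      clinear_on (dg_hom S n X Y) (dg_hom S (n + 1) X Y) (dg_d S n X Y)) \<and>
    (\<forall>n. \<forall>X\<in>dg_ob S. \<forall>Y\<in>dg_ob S. \<forall>f\<in>dg_hom S n X Y. dg_d S (n + 1) X Y (dg_d S n X Y f) = 0) \<and>
    (\<forall>i j. \<forall>X\<in>dg_ob S. \<forall>Y\<in>dg_ob S. \<forall>Z\<in>dg_ob S. \<forall>g\<in>dg_hom S i Y Z. \<forall>f\<in>dg_hom S j X Y.
      dg_d S (i + j) X Z (dg_comp S i j X Y Z g f) =
      dg_comp S (i + 1) j X Y Z (dg_d S i Y Z g) f +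
      (-1) ^ i *\<^sub>C dg_comp S i (j + 1) X Y Z g (dg_d S j X Y f))"

definition closed_graded_trace :: "('s, 'x::complex_vector) dg_semicat \<Rightarrow> nat \<Rightarrow> ('s \<Rightarrow> 'x \<Rightarrow> complex) \<Rightarrow> bool"
  where "closed_graded_trace S n T \<longleftrightarrow>
    (\<forall>X\<in>dg_ob S. clinear_on (dg_hom S n X X) UNIV (T X)) \<and>
    (\<forall>k. n = k + 1 \<longrightarrow> (\<forall>X\<in>dg_ob S. \<forall>f\<in>dg_hom S k X X. T X (dg_d S k X X f) = 0)) \<and>
    (\<forall>i j. i + j = n \<longrightarrow> (\<forall>X\<in>dg_ob S. \<forall>Y\<in>dg_ob S. \<forall>g\<in>dg_hom S i Y X. \<forall>g'\<in>dg_hom S j X Y.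
      T X (dg_comp S i j X Y X g g') = (-1) ^ (i * j) * T Y (dg_comp S j i Y X Y g' g)))"

text \<open>The data \<open>(S, d, T, \<rho>)\<close> of a cycle; the semifunctor \<open>\<rho>\<close> is \<open>cyc_ob\<close> on objects and
  \<open>cyc_mor c X Y\<close> on morphisms from \<open>X\<close> to \<open>Y\<close>.\<close>

record ('o, 'a, 's, 'x) cyc =
  cyc_dg :: "('s, 'x) dg_semicat"
  cyc_tr :: "'s \<Rightarrow> 'x \<Rightarrow> complex"
  cyc_ob :: "'o \<Rightarrow> 's"
  cyc_mor :: "'o \<Rightarrow> 'o \<Rightarrow> 'a \<Rightarrow> 'x"

definition cycle_over :: "('o, 'a::complex_vector) lin_cat \<Rightarrow> nat \<Rightarrow> ('o, 'a, 's, 'x::complex_vector) cyc \<Rightarrow> bool"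
  where "cycle_over C n c \<longleftrightarrow>
    dg_semicategory (cyc_dg c) \<and> closed_graded_trace (cyc_dg c) n (cyc_tr c) \<and>
    (\<forall>X\<in>ob C. cyc_ob c X \<in> dg_ob (cyc_dg c)) \<and>
    (\<forall>X\<in>ob C. \<forall>Y\<in>ob C.
      clinear_on (hom C X Y) (dg_hom (cyc_dg c) 0 (cyc_ob c X) (cyc_ob c Y)) (cyc_mor c X Y)) \<and>
    (\<forall>X\<in>ob C. \<forall>Y\<in>ob C. \<forall>Z\<in>ob C. \<forall>g\<in>hom C Y Z. \<forall>f\<in>hom C X Y.
      cyc_mor c X Z (comp C X Y Z g f) =
      dg_comp (cyc_dg c) 0 0 (cyc_ob c X) (cyc_ob c Y) (cyc_ob c Z) (cyc_mor c Y Z g) (cyc_mor c X Y f))"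

text \<open>\<open>cycle_word c l i\<close> is \<open>\<rho>(f\<^sup>0) d(\<rho>(f\<^sup>1)) \<dots> d(\<rho>(f\<^sup>i))\<close>, of degree \<open>i\<close> from \<open>\<rho>(X\<^bsub>i+1\<^esub>)\<close> to
  \<open>\<rho>(X\<^sub>0)\<close>.\<close>

primrec cycle_word :: "('o, 'a, 's, 'x) cyc \<Rightarrow> ('o, 'a) chain \<Rightarrow> nat \<Rightarrow> 'x"
  where
    "cycle_word c l 0 = cyc_mor c (obj l 1) (obj l 0) (mor l 0)"
  | "cycle_word c l (Suc i) =
      dg_comp (cyc_dg c) i 1 (cyc_ob c (obj l (i + 2))) (cyc_ob c (obj l (i + 1))) (cyc_ob c (obj l 0))
        (cycle_word c l i)
        (dg_d (cyc_dg c) 0 (cyc_ob c (obj l (i + 2))) (cyc_ob c (obj l (i + 1)))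
          (cyc_mor c (obj l (i + 2)) (obj l (i + 1)) (mor l (i + 1))))"

definition cycle_character :: "('o, 'a) lin_cat \<Rightarrow> nat \<Rightarrow> ('o, 'a, 's, 'x) cyc \<Rightarrow> ('o, 'a) chain \<Rightarrow> complex"
  where "cycle_character C n c l =
    (if l \<in> chains C n then cyc_tr c (cyc_ob c (obj l 0)) (cycle_word c l n) else 0)"


section \<open>Tensor products of cycles and the periodicity operator\<close>

text \<open>The degree \<open>n\<close> part of a Hom complex of the tensor product is \<open>\<Oplus>\<^bsub>i+j=n\<^esub> S\<^sup>i \<otimes> S'\<^sup>j\<close>; an element
  is a function \<open>x\<close> whose value \<open>x i\<close> is the component of bidegree \<open>(i, n - i)\<close>, zero for \<open>i > n\<close>.\<close>

definition tensor_dg :: "('s, 'x::complex_vector) dg_semicat \<Rightarrow> ('t, 'y::complex_vector) dg_semicat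
    \<Rightarrow> ('s \<times> 't, nat \<Rightarrow> ('x, 'y) tensor) dg_semicat"
  where "tensor_dg S S' = \<lparr>
    dg_ob = dg_ob S \<times> dg_ob S',
    dg_hom = (\<lambda>n (X, X') (Y, Y').
      {x. (\<forall>i\<le>n. x i \<in> tensor_space (dg_hom S i X Y) (dg_hom S' (n - i) X' Y')) \<and> (\<forall>i>n. x i = 0)}),
    dg_comp = (\<lambda>a b (X, X') (Y, Y') (Z, Z') x y k.
      \<Sum>(i, j)\<in>{(i, j). i \<le> a \<and> j \<le> b \<and> i + j = k}.
        (-1) ^ ((a - i) * j) *\<^sub>C
        tensor_lift (\<lambda>g g'. tensor_lift (\<lambda>f f'.
          pure_tensor (dg_hom S (i + j) X Z) (dg_hom S' ((a - i) + (b - j)) X' Z')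
            (dg_comp S i j X Y Z g f) (dg_comp S' (a - i) (b - j) X' Y' Z' g' f')) (y j)) (x i)),
    dg_d = (\<lambda>n (X, X') (Y, Y') x k.
      (if 1 \<le> k \<and> k \<le> n + 1
       then tensor_lift (\<lambda>f g.
          pure_tensor (dg_hom S k X Y) (dg_hom S' (n + 1 - k) X' Y') (dg_d S (k - 1) X Y f) g) (x (k - 1))
       else 0) +
      (if k \<le> n
       then (-1) ^ k *\<^sub>C tensor_lift (\<lambda>f g.
          pure_tensor (dg_hom S k X Y) (dg_hom S' (n + 1 - k) X' Y') f (dg_d S' (n - k) X' Y' g)) (x k)
       else 0))\<rparr>"

definition tensor_cycle :: "('o, 'a::complex_vector) lin_cat \<Rightarrow> ('q, 'b::complex_vector) lin_cat \<Rightarrow> nat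
    \<Rightarrow> ('o, 'a, 's, 'x::complex_vector) cyc \<Rightarrow> ('q, 'b, 't, 'y::complex_vector) cyc
    \<Rightarrow> ('o \<times> 'q, ('a, 'b) tensor, 's \<times> 't, nat \<Rightarrow> ('x, 'y) tensor) cyc"
  where "tensor_cycle C D r c c' = \<lparr>
    cyc_dg = tensor_dg (cyc_dg c) (cyc_dg c'),
    cyc_tr = (\<lambda>(X, X') x. tensor_form (\<lambda>f f'. cyc_tr c X f * cyc_tr c' X' f') (x r)),
    cyc_ob = map_prod (cyc_ob c) (cyc_ob c'),
    cyc_mor = (\<lambda>(X, X') (Y, Y') t k.
      if k = 0
      then tensor_lift (\<lambda>f f'.
          pure_tensor (dg_hom (cyc_dg c) 0 (cyc_ob c X) (cyc_ob c Y))
            (dg_hom (cyc_dg c') 0 (cyc_ob c' X') (cyc_ob c' Y')) (cyc_mor c X Y f) (cyc_mor c' X' Y' f')) t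
      else 0)\<rparr>"

text \<open>The universal DG-semicategory of a linear category over \<open>(o, a)\<close> has the same objects, and its
  degree \<open>n\<close> morphisms are spanned by the words \<open>f\<^sup>0 df\<^sup>1 \<dots> df\<^sup>n\<close> and (for \<open>n \<ge> 1\<close>) \<open>df\<^sup>1 \<dots> df\<^sup>n\<close>,
  subject to multilinearity; it embeds in the functionals on functions of words. So every cyclic cocycle is the
  character of a cycle of the following type.\<close>

type_synonym ('o, 'a) std_cyc = "('o, 'a, 'o, (('o, 'a) chain \<Rightarrow> complex) \<Rightarrow> complex) cyc"

text \<open>\<open>\<phi> # \<phi>'\<close> is the character of \<open>c \<otimes> c'\<close> for any cycles \<open>c\<close>, \<open>c'\<close> with characters \<open>\<phi>\<close>, \<open>\<phi>'\<close>.\<close>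

definition sharp :: "('o, 'a::complex_vector) lin_cat \<Rightarrow> ('q, 'b::complex_vector) lin_cat \<Rightarrow> nat \<Rightarrow> nat
    \<Rightarrow> (('o, 'a) chain \<Rightarrow> complex) \<Rightarrow> (('q, 'b) chain \<Rightarrow> complex)
    \<Rightarrow> ('o \<times> 'q, ('a, 'b) tensor) chain \<Rightarrow> complex"
  where "sharp C D r s \<phi> \<phi>' = (THE \<tau>. \<exists>(c :: ('o, 'a) std_cyc) (c' :: ('q, 'b) std_cyc).
    cycle_over C r c \<and> cycle_character C r c = \<phi> \<and>
    cycle_over D s c' \<and> cycle_character D s c' = \<phi>' \<and>
    \<tau> = cycle_character (tensor_cat C D) (r + s) (tensor_cycle C D r c c'))"

text \<open>The cyclic 2-cocycle on \<open>complex_cat\<close> with value \<open>1\<close> on \<open>1 \<otimes> 1 \<otimes> 1\<close>.\<close>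

definition psi2 :: "(unit, complex) chain \<Rightarrow> complex"
  where "psi2 l = (if length l = 3 then mor l 0 * mor l 1 * mor l 2 else 0)"

lemma psi2_unit: "psi2 [((), 1), ((), 1), ((), 1)] = 1"
  by (simp add: psi2_def mor_def)

lemma psi2_cyclic_cocycle: "psi2 \<in> cyclic_cocycles complex_cat 2"
proof -
  have ch: "chains complex_cat n = {l. length l = n + 1}" for n
    by (auto simp: chains_def complex_cat_def)
  have "psi2 \<in> cochains complex_cat 2"
    by (auto simp: cochains_def ch psi2_def clinear_on_def mor_def obj_def scaleC_complex_def
        nth_list_update algebra_simps)
  moreover have "psi2 - cyclic_op complex_cat 2 psi2 = 0"
    by (auto simp: fun_eq_iff cyclic_op_def ch psi2_def mor_def numeral_3_eq_3 length_Suc_conv)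
  moreover have "hochschild_b complex_cat 2 psi2 l = 0" for l
  proof (cases "length l = 4")
    case True
    then obtain a b c d where l: "l = [((), a), ((), b), ((), c), ((), d)]"
      by (auto simp: numeral_eq_Suc length_Suc_conv)
    have "{..2::nat} = {0, 1, 2}"
      by auto
    then show ?thesis
      unfolding hochschild_b_def l
      by (simp add: ch psi2_def mor_def face_def last_face_def complex_cat_def numeral_eq_Suc)
  qed (simp add: hochschild_b_def ch)
  ultimately show ?thesis
    by (simp add: cyclic_cocycles_def cyclic_cochains_def fun_eq_iff)
qed

text \<open>The chain over \<open>C \<otimes> \<complex>\<close> corresponding to a chain over \<open>C\<close> under \<open>f \<mapsto> f \<otimes> 1\<close>.\<close>

definition unit_chain :: "('o, 'a::complex_vector) lin_cat \<Rightarrow> ('o, 'a) chain \<Rightarrow> ('o \<times> unit, ('a, complex) tensor) chain"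
  where "unit_chain C l = map (\<lambda>i. ((obj l i, ()),
    pure_tensor (hom C (obj l (i + 1)) (obj l i)) (hom complex_cat () ()) (mor l i) 1)) [0..<length l]"

definition periodicity :: "('o, 'a::complex_vector) lin_cat \<Rightarrow> nat \<Rightarrow> (('o, 'a) chain \<Rightarrow> complex)
    \<Rightarrow> ('o, 'a) chain \<Rightarrow> complex"
  where "periodicity C r \<phi> l =
    (if l \<in> chains C (r + 2) then sharp C complex_cat r 2 \<phi> psi2 (unit_chain C l) else 0)"


section \<open>Operators, Schatten classes and the trace\<close>

definition bounded_op :: "'h::complex_hilbert set \<Rightarrow> 'h set \<Rightarrow> ('h \<Rightarrow> 'h) \<Rightarrow> bool"
  where "bounded_op V W T \<longleftrightarrow> clinear_on V W T \<and> (\<exists>B. \<forall>x\<in>V. norm (T x) \<le> B * norm x)"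

definition op_norm :: "'h::complex_hilbert set \<Rightarrow> ('h \<Rightarrow> 'h) \<Rightarrow> real"
  where "op_norm V T = (SUP x\<in>{x \<in> V. norm x \<le> 1}. norm (T x))"

definition rank_le :: "'h::complex_hilbert set \<Rightarrow> ('h \<Rightarrow> 'h) \<Rightarrow> nat \<Rightarrow> bool"
  where "rank_le V R n \<longleftrightarrow> (\<exists>B. finite B \<and> card B \<le> n \<and> R ` V \<subseteq> cspan B)"

text \<open>The \<open>n\<close>-th singular value (counted from \<open>0\<close>), as the distance to the operators of rank at most
  \<open>n\<close>.\<close>

definition singular_value :: "'h::complex_hilbert set \<Rightarrow> 'h set \<Rightarrow> ('h \<Rightarrow> 'h) \<Rightarrow> nat \<Rightarrow> real"
  where "singular_value V W T n =
    Inf {op_norm V (\<lambda>x. T x - R x) | R. bounded_op V W R \<and> rank_le V R n}"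

definition schatten_class :: "real \<Rightarrow> 'h::complex_hilbert set \<Rightarrow> 'h set \<Rightarrow> ('h \<Rightarrow> 'h) set"
  where "schatten_class p V W =
    {T. bounded_op V W T \<and> summable (\<lambda>n. singular_value V W T n powr p)}"

definition orthonormal_basis :: "'h::complex_hilbert set \<Rightarrow> 'h set \<Rightarrow> bool"
  where "orthonormal_basis V E \<longleftrightarrow>
    E \<subseteq> V \<and> (\<forall>e\<in>E. \<forall>e'\<in>E. cinner e e' = (if e = e' then 1 else 0)) \<and> closure (cspan E) = V"

text \<open>The operator trace on \<open>V\<close>; for trace class \<open>T\<close> the value does not depend on the basis.\<close>

definition op_trace :: "'h::complex_hilbert set \<Rightarrow> ('h \<Rightarrow> 'h) \<Rightarrow> complex"
  where "op_trace V T = (THE t. \<forall>E. orthonormal_basis V E \<longrightarrow> ((\<lambda>e. cinner e (T e)) has_sum t) E)"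


section \<open>Even Fredholm modules and their characters\<close>

text \<open>A graded Hilbert space is given by its even and odd parts.\<close>

record 'h graded_space =
  even_part :: "'h set"
  odd_part :: "'h set"

definition carrier_space :: "'h::complex_hilbert graded_space \<Rightarrow> 'h set"
  where "carrier_space K = {u + v | u v. u \<in> even_part K \<and> v \<in> odd_part K}"

definition graded_hilbert :: "'h::complex_hilbert graded_space \<Rightarrow> bool"
  where "graded_hilbert K \<longleftrightarrow>
    csubspace (even_part K) \<and> closed (even_part K) \<and> csubspace (odd_part K) \<and> closed (odd_part K) \<and>
    (\<forall>u\<in>even_part K. \<forall>v\<in>odd_part K. cinner u v = 0) \<and>
    (\<exists>D. countable D \<and> D \<subseteq> carrier_space K \<and> carrier_space K \<subseteq> closure D)"

definition grading_op :: "'h::complex_hilbert graded_space \<Rightarrow> 'h \<Rightarrow> 'h"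
  where "grading_op K x = (THE z. \<exists>u\<in>even_part K. \<exists>v\<in>odd_part K. x = u + v \<and> z = u - v)"

definition degree0 :: "'h::complex_hilbert graded_space \<Rightarrow> 'h graded_space \<Rightarrow> ('h \<Rightarrow> 'h) \<Rightarrow> bool"
  where "degree0 K L T \<longleftrightarrow> T ` even_part K \<subseteq> even_part L \<and> T ` odd_part K \<subseteq> odd_part L"

definition degree1 :: "'h::complex_hilbert graded_space \<Rightarrow> 'h graded_space \<Rightarrow> ('h \<Rightarrow> 'h) \<Rightarrow> bool"
  where "degree1 K L T \<longleftrightarrow> T ` even_part K \<subseteq> odd_part L \<and> T ` odd_part K \<subseteq> even_part L"

text \<open>\<open>fm_map M X Y f\<close> is the operator assigned to \<open>f : X \<rightarrow> Y\<close>; operators matter only on the carrier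
  of their source space.\<close>

record ('o, 'a, 'h) fredholm =
  fm_graded :: "'o \<Rightarrow> 'h graded_space"
  fm_map :: "'o \<Rightarrow> 'o \<Rightarrow> 'a \<Rightarrow> 'h \<Rightarrow> 'h"
  fm_F :: "'o \<Rightarrow> 'h \<Rightarrow> 'h"

definition fm_space :: "('o, 'a, 'h::complex_hilbert) fredholm \<Rightarrow> 'o \<Rightarrow> 'h set"
  where "fm_space M X = carrier_space (fm_graded M X)"

definition fm_comm :: "('o, 'a, 'h::complex_hilbert) fredholm \<Rightarrow> 'o \<Rightarrow> 'o \<Rightarrow> 'a \<Rightarrow> 'h \<Rightarrow> 'h"
  where "fm_comm M X Y f x = fm_F M Y (fm_map M X Y f x) - fm_map M X Y f (fm_F M X x)"

definition even_fredholm_module :: "('o, 'a::complex_vector) lin_cat \<Rightarrow> real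
    \<Rightarrow> ('o, 'a, 'h::complex_hilbert) fredholm \<Rightarrow> bool"
  where "even_fredholm_module C p M \<longleftrightarrow>
    (\<forall>X\<in>ob C. graded_hilbert (fm_graded M X)) \<and>
    (\<forall>X\<in>ob C. \<forall>Y\<in>ob C. \<forall>f\<in>hom C X Y.
      bounded_op (fm_space M X) (fm_space M Y) (fm_map M X Y f) \<and>
      degree0 (fm_graded M X) (fm_graded M Y) (fm_map M X Y f)) \<and>
    (\<forall>X\<in>ob C. \<forall>Y\<in>ob C. \<forall>x\<in>fm_space M X. clinear_on (hom C X Y) (fm_space M Y) (\<lambda>f. fm_map M X Y f x)) \<and>
    (\<forall>X\<in>ob C. \<forall>x\<in>fm_space M X. fm_map M X X (ident C X) x = x) \<and>
    (\<forall>X\<in>ob C. \<forall>Y\<in>ob C. \<forall>Z\<in>ob C. \<forall>g\<in>hom C Y Z. \<forall>f\<in>hom C X Y. \<forall>x\<in>fm_space M X.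
      fm_map M X Z (comp C X Y Z g f) x = fm_map M Y Z g (fm_map M X Y f x)) \<and>
    (\<forall>X\<in>ob C. bounded_op (fm_space M X) (fm_space M X) (fm_F M X) \<and>
      degree1 (fm_graded M X) (fm_graded M X) (fm_F M X) \<and>
      (\<forall>x\<in>fm_space M X. fm_F M X (fm_F M X x) = x)) \<and>
    (\<forall>X\<in>ob C. \<forall>Y\<in>ob C. \<forall>f\<in>hom C X Y.
      fm_comm M X Y f \<in> schatten_class p (fm_space M X) (fm_space M Y))"

text \<open>\<open>[F, T]\<close> and \<open>Tr\<^sub>s(T)\<close> for an operator \<open>T\<close> on the space of \<open>X\<close>, homogeneous of degree \<open>d\<close> mod 2.\<close>

definition graded_comm :: "('o, 'a, 'h::complex_hilbert) fredholm \<Rightarrow> 'o \<Rightarrow> nat \<Rightarrow> ('h \<Rightarrow> 'h) \<Rightarrow> 'h \<Rightarrow> 'h"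
  where "graded_comm M X d T x = fm_F M X (T x) - (-1) ^ d *\<^sub>C T (fm_F M X x)"

definition supertrace :: "('o, 'a, 'h::complex_hilbert) fredholm \<Rightarrow> 'o \<Rightarrow> nat \<Rightarrow> ('h \<Rightarrow> 'h) \<Rightarrow> complex"
  where "supertrace M X d T = 1 / 2 *
    op_trace (fm_space M X) (\<lambda>x. grading_op (fm_graded M X) (fm_F M X (graded_comm M X d T x)))"

text \<open>\<open>fm_word M l i\<close> is \<open>H(f\<^sup>0) [F, f\<^sup>1] \<dots> [F, f\<^sup>i]\<close>, homogeneous of degree \<open>i\<close>.\<close>

primrec fm_word :: "('o, 'a, 'h::complex_hilbert) fredholm \<Rightarrow> ('o, 'a) chain \<Rightarrow> nat \<Rightarrow> 'h \<Rightarrow> 'h"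
  where
    "fm_word M l 0 = fm_map M (obj l 1) (obj l 0) (mor l 0)"
  | "fm_word M l (Suc i) = fm_word M l i \<circ> fm_comm M (obj l (i + 2)) (obj l (i + 1)) (mor l (i + 1))"

text \<open>The \<open>n\<close>-dimensional character of an even Fredholm module, used for even \<open>n\<close>.\<close>

definition fm_character :: "('o, 'a) lin_cat \<Rightarrow> ('o, 'a, 'h::complex_hilbert) fredholm \<Rightarrow> nat
    \<Rightarrow> ('o, 'a) chain \<Rightarrow> complex"
  where "fm_character C M n l = (if l \<in> chains C n then supertrace M (obj l 0) n (fm_word M l n) else 0)"

end

theory Submission
  imports Defs
begin

text \<open>The graded commutator with \<open>F\<close> is a differential \<open>d\<close> on the operators \<open>\<omega>\<close> such that \<open>\<omega>\<close> and \<open>d\<omega>\<close>, for \<open>\<omega>\<close>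
  of degree \<open>n\<close>, lie in the Schatten classes of exponents \<open>p / n\<close> and \<open>p / (n + 1)\<close>. Let
  \<open>\<tau>(\<omega>) = Tr(\<epsilon> \<omega>)\<close> and \<open>\<theta>(\<omega>) = Tr(\<epsilon> F \<omega>)\<close>. In odd degrees \<open>\<theta>\<close> is a trace up to an error term:
  \<open>\<theta>(g g') = \<theta>(g' g) + \<tau>(dg g')\<close>. Hence \<open>T = \<theta> d / 2\<close> is a closed graded trace of dimension \<open>2m\<close>, with character
  \<open>\<phi>\<^bsup>2m\<^esup>\<close>, while \<open>\<tau> = \<theta> d / 2\<close> in degree \<open>2m + 2\<close> gives \<open>\<phi>\<^bsup>2m+2\<^esup>\<close>.

  Computing in the tensor product of cycles, \<open>S \<phi>\<^bsup>2m\<^esup>\<close> is the sum of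
  \<open>T(f\<^sup>0 df\<^sup>1 \<dots> df\<^bsup>i-1\<^esup> f\<^sup>i f\<^bsup>i+1\<^esup> df\<^bsup>i+2\<^esup> \<dots> df\<^bsup>2m+2\<^esup>)\<close> over \<open>1 \<le> i \<le> 2m + 1\<close>. Expressing \<open>T\<close> by \<open>\<theta>\<close> and
  using the trace property up to \<open>\<tau>\<close>, this sum becomes \<open>-(b N \<xi>) / 2 - (m + 1) \<phi>\<^bsup>2m+2\<^esup>\<close>, where
  \<open>\<xi>(f\<^sup>0, \<dots>, f\<^bsup>2m+1\<^esup>) = \<theta>(f\<^sup>0 df\<^sup>1 \<dots> df\<^bsup>2m+1\<^esup>)\<close> and \<open>N\<close> is the cyclic sum.\<close>

section \<open>Complex Hilbert spaces and bounded operators\<close>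

text \<open>Two obstacles shape the development. At the bound p = 2m + 1 a product of commutators is
  trace class although neither factor need be, so Tr(AB) = Tr(BA) cannot be reduced to one nuclear
  factor; one factor has to be approximated by finite rank operators. Moreover \<open>sharp\<close>
  is a definite description over cycles of type \<open>std_cyc\<close>, whereas the operators form a
  cycle of another type. The operator cycle is therefore replaced by a quotient that fits into the
  required type, and uniqueness comes from a formula for S \<phi> in terms of \<phi> alone.

  The factor m + 1 comes from counting error terms: b N \<xi> = N b' \<xi> collects one of them from
  each of the 2m + 3 rotations of a chain, the sum for S \<phi> contains one of its own, and (1 -
  (2m + 3)) / 2 = -(m + 1). The bound p \<le> 2m + 1 is enough for T because \<theta> is applied
  only to d\<omega>, which has degree 2m + 1.\<close>

global_interpretation cvs: vector_space "scaleC :: complex \<Rightarrow> 'a \<Rightarrow> 'a::complex_vector"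
  by standard (simp_all add: scaleC_add_right scaleC_add_left scaleC_scaleC scaleC_one)

lemma clinear_on_zero: "clinear_on V W f \<Longrightarrow> csubspace V \<Longrightarrow> f 0 = 0"
  unfolding clinear_on_def using cvs.subspace_0 cvs.scale_zero_left by metis

lemma clinear_on_mem: "clinear_on V W f \<Longrightarrow> x \<in> V \<Longrightarrow> f x \<in> W"
  and clinear_on_add: "clinear_on V W f \<Longrightarrow> x \<in> V \<Longrightarrow> y \<in> V \<Longrightarrow> f (x + y) = f x + f y"
  and clinear_on_scale: "clinear_on V W f \<Longrightarrow> x \<in> V \<Longrightarrow> f (c *\<^sub>C x) = c *\<^sub>C f x"
  by (auto simp: clinear_on_def)

lemma clinear_on_diff:
  assumes "clinear_on V W f" "csubspace V" "x \<in> V" "y \<in> V" shows "f (x - y) = f x - f y"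
proof -
  have "f (x + (-1) *\<^sub>C y) = f x + (-1) *\<^sub>C f y"
    using assms by (simp only: clinear_on_add clinear_on_scale cvs.subspace_scale)
  then show ?thesis by simp
qed

lemma clinear_on_sum:
  assumes "clinear_on V W f" "csubspace V" "\<And>i. i \<in> I \<Longrightarrow> g i \<in> V"
  shows "f (sum g I) = (\<Sum>i\<in>I. f (g i))"
  using assms(3)
proof (induction I rule: infinite_finite_induct)
  case (insert i I)
  then show ?case
    using assms(1,2) by (simp add: clinear_on_add cvs.subspace_sum)
qed (simp_all add: clinear_on_zero[OF assms(1,2)])

section \<open>Inner products and norms\<close>

lemma cinner_add_left: "cinner (x + y) z = cinner x z + cinner y z"
  by (metis cinner_add_right cinner_commute complex_cnj_add)

lemma cinner_scaleC_left: "cinner (c *\<^sub>C x) y = cnj c * cinner x y"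
  by (metis cinner_commute cinner_scaleC_right complex_cnj_mult)

lemma cinner_zero_right [simp]: "cinner x 0 = 0"
  using cinner_scaleC_right[of x 0 0] by simp

lemma cinner_zero_left [simp]: "cinner 0 x = 0"
  using cinner_scaleC_left[of 0 0 x] by simp

lemma cinner_minus_right: "cinner x (- y) = - cinner x y"
  using cinner_scaleC_right[of x "-1" y] by simp

lemma cinner_diff_right: "cinner x (y - z) = cinner x y - cinner x z"
  using cinner_add_right[of x y "-z"] by (simp add: cinner_minus_right)

lemma cinner_sum_right: "cinner x (sum f I) = (\<Sum>i\<in>I. cinner x (f i))"
  by (induction I rule: infinite_finite_induct) (simp_all add: cinner_add_right)

lemma cinner_self: "cinner x x = of_real ((norm x)\<^sup>2)"
proof -
  have im: "Im (cinner x x) = 0"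
    using arg_cong[OF cinner_commute[of x x], of Im] by simp
  have "norm x ^ 2 = Re (cinner x x)"
    by (metis abs_norm_cancel norm_eq_sqrt_cinner real_sqrt_abs real_sqrt_eq_iff)
  with im show ?thesis by (simp add: complex_eq_iff)
qed

lemma norm_scaleC [simp]:
  fixes x :: "'h::complex_hilbert"
  shows "norm (c *\<^sub>C x) = cmod c * norm x"
proof -
  have "cinner (c *\<^sub>C x) (c *\<^sub>C x) = (c * cnj c) * cinner x x"
    by (simp add: cinner_scaleC_left cinner_scaleC_right mult_ac)
  also have "\<dots> = of_real ((cmod c * norm x)\<^sup>2)"
    by (simp only: cinner_self[of x] complex_norm_square[symmetric] of_real_mult[symmetric]
        power_mult_distrib)
  finally have "cinner (c *\<^sub>C x) (c *\<^sub>C x) = of_real ((cmod c * norm x)\<^sup>2)" .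
  then have "of_real ((norm (c *\<^sub>C x))\<^sup>2) = (of_real ((cmod c * norm x)\<^sup>2) :: complex)"
    by (simp only: cinner_self)
  then show ?thesis
    by (simp only: of_real_eq_iff) (simp add: power2_eq_iff_nonneg)
qed

lemma norm_add_sq:
  fixes x :: "'h::complex_hilbert"
  shows "(norm (x + y))\<^sup>2 = (norm x)\<^sup>2 + (norm y)\<^sup>2 + 2 * Re (cinner x y)"
proof -
  have "Re (cinner (x + y) (x + y)) = Re (cinner x x) + Re (cinner y y) + 2 * Re (cinner x y)"
    using arg_cong[OF cinner_commute[of y x], of Re] by (simp add: cinner_add_left cinner_add_right)
  then show ?thesis by (simp add: cinner_self)
qed

lemma pythagoras:
  fixes x :: "'h::complex_hilbert"
  shows "cinner x y = 0 \<Longrightarrow> (norm (x + y))\<^sup>2 = (norm x)\<^sup>2 + (norm y)\<^sup>2"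
  by (simp add: norm_add_sq)

section \<open>Finite orthonormal systems, projections and Gram-Schmidt\<close>

definition orthonormal :: "'h::complex_hilbert set \<Rightarrow> bool"
  where "orthonormal E \<longleftrightarrow> (\<forall>e\<in>E. \<forall>e'\<in>E. cinner e e' = (if e = e' then 1 else 0))"

lemma orthonormalD: "orthonormal E \<Longrightarrow> e \<in> E \<Longrightarrow> e' \<in> E \<Longrightarrow> cinner e e' = (if e = e' then 1 else 0)"
  by (auto simp: orthonormal_def)

lemma orthonormal_norm: "orthonormal E \<Longrightarrow> e \<in> E \<Longrightarrow> norm e = 1"
  by (simp add: norm_eq_sqrt_cinner orthonormalD)

definition proj :: "'h::complex_hilbert set \<Rightarrow> 'h \<Rightarrow> 'h"
  where "proj E x = (\<Sum>e\<in>E. cinner e x *\<^sub>C e)"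

lemma cinner_proj:
  assumes "finite E" "orthonormal E" "e \<in> E" shows "cinner e (proj E x) = cinner e x"
proof -
  have "cinner e (proj E x) = (\<Sum>e'\<in>E. if e = e' then cinner e' x else 0)"
    unfolding proj_def cinner_sum_right cinner_scaleC_right
    using assms by (intro sum.cong) (auto simp: orthonormalD)
  also have "\<dots> = cinner e x" using assms by simp
  finally show ?thesis .
qed

lemma proj_in_span: "proj E x \<in> cspan E"
  unfolding proj_def by (intro cvs.span_sum cvs.span_scale cvs.span_base)

lemma cinner_proj_span:
  assumes "finite E" "orthonormal E" "y \<in> cspan E" shows "cinner y (x - proj E x) = 0"
  using assms(3)
proof (induction rule: cvs.span_induct_alt)
  case (step c z y)
  then show ?case
    using assms by (simp add: cinner_add_left cinner_scaleC_left cinner_diff_right cinner_proj)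
qed simp

lemma proj_id:
  assumes "finite E" "orthonormal E" "x \<in> cspan E" shows "proj E x = x"
proof -
  have "cinner (x - proj E x) (x - proj E x) = 0"
    using cinner_proj_span[OF assms(1,2), of "x - proj E x" x] assms(3) proj_in_span[of E x]
    by (simp add: cvs.span_diff)
  then show ?thesis by (simp add: cinner_self)
qed

text \<open>Pythagoras: \<open>x - proj E x\<close> is orthogonal to
  \<open>proj E x - y\<close>.\<close>

lemma proj_best:
  assumes "finite E" "orthonormal E" "y \<in> cspan E" shows "norm (x - proj E x) \<le> norm (x - y)"
proof -
  have "proj E x - y \<in> cspan E" using assms(3) proj_in_span cvs.span_diff by blast
  then have "cinner (x - proj E x) (proj E x - y) = 0"
    using cinner_proj_span[OF assms(1,2)] cinner_commute by (metis complex_cnj_zero)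
  from pythagoras[OF this] have "(norm (x - y))\<^sup>2 = (norm (x - proj E x))\<^sup>2 + (norm (proj E x - y))\<^sup>2"
    by simp
  then have "(norm (x - proj E x))\<^sup>2 \<le> (norm (x - y))\<^sup>2" by simp
  then show ?thesis by simp
qed

lemma norm_proj_le:
  assumes "finite E" "orthonormal E" shows "norm (proj E x) \<le> norm x"
proof -
  have "cinner (proj E x) (x - proj E x) = 0"
    using cinner_proj_span[OF assms proj_in_span] .
  from pythagoras[OF this] have "(norm (proj E x))\<^sup>2 \<le> (norm x)\<^sup>2" by simp
  then show ?thesis by simp
qed

lemma norm_orthonormal_sum:
  assumes "finite E" "orthonormal E"
  shows "(norm (\<Sum>e\<in>E. c e *\<^sub>C e))\<^sup>2 = (\<Sum>e\<in>E. (cmod (c e))\<^sup>2)"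
  using assms
proof (induction E rule: finite_induct)
  case (insert e E)
  then have on: "orthonormal E" by (auto simp: orthonormal_def)
  have "cinner (c e *\<^sub>C e) (\<Sum>e\<in>E. c e *\<^sub>C e) = (\<Sum>e'\<in>E. 0)"
    unfolding cinner_sum_right using insert
    by (intro sum.cong) (auto simp: cinner_scaleC_left cinner_scaleC_right orthonormalD)
  then have "cinner (c e *\<^sub>C e) (\<Sum>e\<in>E. c e *\<^sub>C e) = 0" by simp
  from pythagoras[OF this] show ?case
    using insert on by (simp add: orthonormal_norm power_mult_distrib)
qed simp

lemma bessel:
  assumes "finite E" "orthonormal E"
  shows "(\<Sum>e\<in>E. (cmod (cinner e x))\<^sup>2) \<le> (norm x)\<^sup>2"
  using norm_proj_le[OF assms, of x] norm_orthonormal_sum[OF assms, of "\<lambda>e. cinner e x"]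
  by (simp add: proj_def[symmetric]) (metis norm_ge_zero power_mono)

text \<open>Bessel's inequality for the one-element system consisting of the normalised
  \<open>x\<close>.\<close>

lemma cauchy_schwarz: "cmod (cinner x y) \<le> norm x * norm y"
proof (cases "x = 0")
  case False
  define e where "e = inverse (of_real (norm x)) *\<^sub>C x"
  have "orthonormal {e}"
    using False by (simp add: orthonormal_def e_def cinner_scaleC_left cinner_scaleC_right cinner_self
        power2_eq_square norm_inverse)
  from bessel[OF _ this, of y] have "cmod (cinner e y) \<le> norm y" by simp
  then show ?thesis
    using False by (simp add: e_def cinner_scaleC_left norm_mult norm_inverse norm_divide field_simps)
qed simp

lemma tendsto_cinner_right:
  assumes "(f \<longlongrightarrow> l) F" shows "((\<lambda>n. cinner x (f n)) \<longlongrightarrow> cinner x l) F"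
proof -
  have "((\<lambda>n. norm x * norm (f n - l)) \<longlongrightarrow> norm x * norm (l - l)) F"
    by (intro tendsto_intros assms)
  then have "((\<lambda>n. norm x * norm (f n - l)) \<longlongrightarrow> 0) F" by simp
  then have "((\<lambda>n. cinner x (f n) - cinner x l) \<longlongrightarrow> 0) F"
    by (rule Lim_null_comparison[rotated])
      (simp add: cinner_diff_right[symmetric] cauchy_schwarz)
  then show ?thesis by (simp add: LIM_zero_iff)
qed

text \<open>One Gram-Schmidt step. If \<open>x\<close> already lies in the span, then
  \<open>E\<close> is kept, hence only an inequality for the cardinality.\<close>

lemma orthonormal_extend:
  assumes "finite E" "orthonormal E"
  obtains E' where "finite E'" "orthonormal E'" "E \<subseteq> E'" "card E' \<le> Suc (card E)"
    "cspan E' = cspan (insert x E)"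
proof (cases "x \<in> cspan E")
  case True
  then show ?thesis using that[of E] assms by (simp add: cvs.span_redundant)
next
  case False
  define y where "y = x - proj E x"
  have y0: "y \<noteq> 0" using False proj_in_span[of E x] by (auto simp: y_def)
  define e where "e = inverse (of_real (norm y)) *\<^sub>C y"
  have 1: "cinner e' e = 0" if "e' \<in> E" for e'
    using that assms by (simp add: e_def cinner_scaleC_right y_def cinner_diff_right cinner_proj)
  then have 2: "cinner e e' = 0" if "e' \<in> E" for e'
    using that by (metis cinner_commute complex_cnj_zero)
  have 3: "cinner e e = 1" using y0
    by (simp add: e_def cinner_scaleC_left cinner_scaleC_right cinner_self power2_eq_square norm_inverse)
  then have "e \<notin> E" using 1 by force
  with 1 2 3 have on: "orthonormal (insert e E)"
    using assms(2) by (auto simp: orthonormal_def)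
  have "of_real (norm y) *\<^sub>C e = y" using y0 by (simp add: e_def)
  then have x: "x = of_real (norm y) *\<^sub>C e + proj E x" by (simp add: y_def)
  have "x \<in> cspan (insert e E)"
    by (subst x) (meson cvs.span_add cvs.span_scale cvs.span_base insertI1 proj_in_span
        cvs.span_mono subset_insertI subsetD)
  moreover have "e \<in> cspan (insert x E)"
    unfolding e_def y_def
    by (meson cvs.span_diff cvs.span_scale cvs.span_base insertI1 proj_in_span
        cvs.span_mono subset_insertI subsetD)
  ultimately have "cspan (insert e E) = cspan (insert x E)"
    by (intro cvs.span_eq[THEN iffD2] conjI insert_subsetI) (auto intro: cvs.span_base)
  moreover have "card (insert e E) \<le> Suc (card E)"
    using assms(1) by (simp add: card_insert_if)
  ultimately show ?thesis
    using that[OF _ on subset_insertI] assms(1) by blast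
qed

lemma orthonormal_finite_span:
  assumes "finite B"
  obtains E where "finite E" "orthonormal E" "card E \<le> card B" "cspan E = cspan B"
  using assms
proof (induction B arbitrary: thesis rule: finite_induct)
  case empty
  then show ?case by (metis finite.emptyI le_refl orthonormal_def empty_iff)
next
  case (insert x B)
  obtain E where E: "finite E" "orthonormal E" "card E \<le> card B" "cspan E = cspan B"
    using insert.IH by blast
  obtain E' where E': "finite E'" "orthonormal E'" "card E' \<le> Suc (card E)"
    "cspan E' = cspan (insert x E)"
    using orthonormal_extend[OF E(1,2)] by metis
  have "cspan (insert x E) = cspan (insert x B)"
    using E(4) by (simp add: cvs.span_insert)
  then show ?case using insert.prems[of E'] E' E insert.hyps by simp
qed

text \<open>Gram-Schmidt along a dense sequence. A basis is needed because \<open>op_trace\<close>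
  quantifies over all orthonormal bases and would not determine a value if there were none.\<close>

lemma orthonormal_basis_exists:
  assumes "csubspace V" "closed V" "countable D" "D \<subseteq> V" "V \<subseteq> closure D"
  shows "\<exists>E. orthonormal_basis V E"
proof -
  have "D \<noteq> {}" using assms cvs.subspace_0[OF assms(1)] by auto
  then obtain d :: "nat \<Rightarrow> 'a" where d: "range d = D"
    using assms(3) by (metis range_from_nat_into)
  \<comment> \<open>Stage \<open>n + 1\<close> absorbs the vector \<open>d n\<close>, so the union
    of the increasing systems has a dense span.\<close>
  have "\<exists>A. \<forall>n. (finite (A n) \<and> orthonormal (A n) \<and> cspan (A n) \<subseteq> V) \<and>
        (A n \<subseteq> A (Suc n) \<and> d n \<in> cspan (A (Suc n)))"
  proof (rule dependent_nat_choice)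
    show "\<exists>E. finite E \<and> orthonormal E \<and> cspan E \<subseteq> V"
      using cvs.subspace_0[OF assms(1)] by (intro exI[of _ "{}"]) (auto simp: orthonormal_def)
    fix E n assume E: "finite E \<and> orthonormal E \<and> cspan E \<subseteq> V"
    then obtain E' where E': "finite E'" "orthonormal E'" "E \<subseteq> E'" "cspan E' = cspan (insert (d n) E)"
      using orthonormal_extend[of E "d n"] by metis
    moreover have "E \<subseteq> V" using E cvs.span_superset by blast
    ultimately have "cspan E' \<subseteq> V"
      using assms(1,4) d by (metis cvs.span_minimal insert_subset rangeI subsetD)
    then show "\<exists>E'. (finite E' \<and> orthonormal E' \<and> cspan E' \<subseteq> V) \<and> (E \<subseteq> E' \<and> d n \<in> cspan E')"
      using E' by (metis cvs.span_base insertI1)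
  qed
  then obtain A where A: "\<And>n. finite (A n)" "\<And>n. orthonormal (A n)" "\<And>n. cspan (A n) \<subseteq> V"
      "\<And>n. A n \<subseteq> A (Suc n)" "\<And>n. d n \<in> cspan (A (Suc n))" by metis
  define E where "E = (\<Union>n. A n)"
  have mono: "A m \<subseteq> A n" if "m \<le> n" for m n
    using lift_Suc_mono_le[of A] A(4) that by blast
  have "cinner e e' = (if e = e' then 1 else 0)" if "e \<in> E" "e' \<in> E" for e e'
  proof -
    obtain m n where "e \<in> A m" "e' \<in> A n" using \<open>e \<in> E\<close> \<open>e' \<in> E\<close> by (auto simp: E_def)
    then have "e \<in> A (max m n)" "e' \<in> A (max m n)"
      using mono[of m "max m n"] mono[of n "max m n"] by auto
    then show ?thesis using A(2) orthonormalD by blast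
  qed
  moreover have EV: "E \<subseteq> V" using A(3) cvs.span_superset by (fastforce simp: E_def)
  moreover have "closure (cspan E) = V"
  proof
    show "closure (cspan E) \<subseteq> V"
      using EV assms(1,2) by (simp add: closure_minimal cvs.span_minimal)
    have "d n \<in> cspan E" for n
      using A(5)[of n] cvs.span_mono[of "A (Suc n)" E] by (auto simp: E_def)
    then have "D \<subseteq> cspan E" using d by auto
    then show "V \<subseteq> closure (cspan E)" using assms(5) closure_mono by blast
  qed
  ultimately show ?thesis unfolding orthonormal_basis_def by blast
qed

section \<open>Bounded operators\<close>

lemma bounded_op_linear: "bounded_op V W T \<Longrightarrow> clinear_on V W T"
  by (simp add: bounded_op_def)

lemma bounded_op_mem: "bounded_op V W T \<Longrightarrow> x \<in> V \<Longrightarrow> T x \<in> W"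
  by (auto simp: bounded_op_def clinear_on_def)

lemma bounded_opE:
  assumes "bounded_op V W T"
  obtains B where "0 \<le> B" "\<And>x. x \<in> V \<Longrightarrow> norm (T x) \<le> B * norm x"
proof -
  obtain B where B: "\<And>x. x \<in> V \<Longrightarrow> norm (T x) \<le> B * norm x"
    using assms by (auto simp: bounded_op_def)
  have "norm (T x) \<le> max 0 B * norm x" if "x \<in> V" for x
    using B[OF that] by (meson max.cobounded2 mult_right_mono norm_ge_zero order_trans)
  then show ?thesis using that[of "max 0 B"] by auto
qed

lemma clinear_on_cong: "clinear_on V W f \<Longrightarrow> csubspace V \<Longrightarrow> (\<And>x. x \<in> V \<Longrightarrow> f x = g x) \<Longrightarrow> clinear_on V W g"
  by (simp add: clinear_on_def cvs.subspace_add cvs.subspace_scale)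

lemma bounded_op_cong:
  "bounded_op V W T \<Longrightarrow> csubspace V \<Longrightarrow> (\<And>x. x \<in> V \<Longrightarrow> T x = T' x) \<Longrightarrow> bounded_op V W T'"
  unfolding bounded_op_def using clinear_on_cong by (metis (no_types, lifting))

lemma bounded_op_zero: "csubspace W \<Longrightarrow> bounded_op V W (\<lambda>x. 0)"
  by (auto simp: bounded_op_def clinear_on_def cvs.subspace_0 intro: exI[of _ 0])

lemma bounded_op_add:
  assumes "bounded_op V W S" "bounded_op V W T" "csubspace W"
  shows "bounded_op V W (\<lambda>x. S x + T x)"
proof -
  obtain B B' where B: "\<And>x. x \<in> V \<Longrightarrow> norm (S x) \<le> B * norm x" "\<And>x. x \<in> V \<Longrightarrow> norm (T x) \<le> B' * norm x"
    using assms unfolding bounded_op_def by auto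
  have "norm (S x + T x) \<le> (B + B') * norm x" if "x \<in> V" for x
    using B(1)[OF that] B(2)[OF that] norm_triangle_ineq[of "S x" "T x"] by (simp add: algebra_simps)
  then show ?thesis
    using assms unfolding bounded_op_def clinear_on_def
    by (auto simp: cvs.subspace_add algebra_simps scaleC_add_right intro!: exI[of _ "B + B'"])
qed

lemma bounded_op_scale:
  assumes "bounded_op V W T" "csubspace W"
  shows "bounded_op V W (\<lambda>x. c *\<^sub>C T x)"
proof -
  obtain B where B: "\<And>x. x \<in> V \<Longrightarrow> norm (T x) \<le> B * norm x"
    using assms unfolding bounded_op_def by auto
  have "norm (c *\<^sub>C T x) \<le> (cmod c * B) * norm x" if "x \<in> V" for x
    using mult_left_mono[OF B[OF that], of "cmod c"] by (simp add: mult.assoc)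
  then show ?thesis
    using assms unfolding bounded_op_def clinear_on_def
    by (auto simp: cvs.subspace_scale mult.commute scaleC_add_right simp del: norm_scaleC
        intro!: exI[of _ "cmod c * B"])
qed

lemma bounded_op_diff:
  assumes "bounded_op V W S" "bounded_op V W T" "csubspace W"
  shows "bounded_op V W (\<lambda>x. S x - T x)"
  using bounded_op_add[OF assms(1) bounded_op_scale[OF assms(2,3), of "-1"] assms(3)] by simp

lemma bounded_op_comp:
  assumes "bounded_op V W S" "bounded_op W U T"
  shows "bounded_op V U (\<lambda>x. T (S x))"
proof -
  obtain B where B: "\<And>x. x \<in> V \<Longrightarrow> norm (S x) \<le> B * norm x"
    using assms(1) unfolding bounded_op_def by auto
  obtain B' where B': "0 \<le> B'" "\<And>x. x \<in> W \<Longrightarrow> norm (T x) \<le> B' * norm x"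
    using bounded_opE[OF assms(2)] by metis
  have "norm (T (S x)) \<le> (B' * B) * norm x" if "x \<in> V" for x
    using B'(2)[of "S x"] mult_left_mono[OF B[OF that] B'(1)] bounded_op_mem[OF assms(1) that]
    by (simp add: mult.assoc)
  then show ?thesis
    using assms unfolding bounded_op_def clinear_on_def by (auto intro!: exI[of _ "B' * B"])
qed

section \<open>Finite rank operators and approximation numbers\<close>

lemma subspace_image:
  assumes "clinear_on V W R" "csubspace V" shows "csubspace (R ` V)"
proof (rule cvs.subspaceI)
  show "0 \<in> R ` V" using clinear_on_zero[OF assms] cvs.subspace_0[OF assms(2)] by force
next
  fix x y assume "x \<in> R ` V" "y \<in> R ` V"
  then show "x + y \<in> R ` V"
    using clinear_on_add[OF assms(1)] cvs.subspace_add[OF assms(2)] by (metis (no_types, opaque_lifting) image_iff)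
next
  fix c x assume "x \<in> R ` V"
  then show "c *\<^sub>C x \<in> R ` V"
    using clinear_on_scale[OF assms(1)] cvs.subspace_scale[OF assms(2)] by (metis (no_types, opaque_lifting) image_iff)
qed

text \<open>\<open>rank_le\<close> admits a spanning set anywhere in the ambient space. Choosing it
  inside the range puts it into the target space, where further operators are linear.\<close>

lemma rank_le_basis:
  assumes "clinear_on V W R" "csubspace V" "rank_le V R n"
  obtains B where "finite B" "card B \<le> n" "B \<subseteq> R ` V" "R ` V \<subseteq> cspan B"
proof -
  obtain A where A: "finite A" "card A \<le> n" "R ` V \<subseteq> cspan A"
    using assms(3) by (auto simp: rank_le_def)
  obtain B where B: "B \<subseteq> R ` V" "cvs.independent B" "R ` V \<subseteq> cspan B"
    using cvs.basis_exists by metis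
  have "B \<subseteq> cspan A" using A B by blast
  with cvs.independent_span_bound[OF A(1) B(2)] have "finite B \<and> card B \<le> card A" by blast
  with A B that show ?thesis by auto
qed

lemma rank_le_orthonormal:
  assumes "clinear_on V W R" "csubspace V" "csubspace W" "rank_le V R n"
  obtains E where "finite E" "orthonormal E" "card E \<le> n" "E \<subseteq> W" "\<And>x. x \<in> V \<Longrightarrow> proj E (R x) = R x"
proof -
  obtain B where B: "finite B" "card B \<le> n" "B \<subseteq> R ` V" "R ` V \<subseteq> cspan B"
    using rank_le_basis[OF assms(1,2,4)] .
  obtain E where E: "finite E" "orthonormal E" "card E \<le> card B" "cspan E = cspan B"
    using orthonormal_finite_span[OF B(1)] .
  have "B \<subseteq> W" using B(3) assms(1) by (auto simp: clinear_on_def)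
  then have "cspan B \<subseteq> W" using assms(3) by (simp add: cvs.span_minimal)
  then have "E \<subseteq> W" using E(4) cvs.span_superset by blast
  moreover have "proj E (R x) = R x" if "x \<in> V" for x
    using that B(4) E by (intro proj_id) auto
  ultimately show ?thesis using that[of E] E B by auto
qed

lemma rank_le_mono: "rank_le V R m \<Longrightarrow> m \<le> n \<Longrightarrow> rank_le V R n"
  by (meson le_trans rank_le_def)

lemma rank_le_add:
  assumes "rank_le V S m" "rank_le V T n" shows "rank_le V (\<lambda>x. S x + T x) (m + n)"
proof -
  obtain A B where AB: "finite A" "card A \<le> m" "S ` V \<subseteq> cspan A" "finite B" "card B \<le> n" "T ` V \<subseteq> cspan B"
    using assms by (auto simp: rank_le_def)
  have "S x + T x \<in> cspan (A \<union> B)" if "x \<in> V" for x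
    using that AB(3,6) cvs.span_mono[of A "A \<union> B"] cvs.span_mono[of B "A \<union> B"]
    by (intro cvs.span_add) auto
  then show ?thesis unfolding rank_le_def
    using AB card_Un_le[of A B] by (intro exI[of _ "A \<union> B"]) auto
qed

lemma rank_le_scale:
  assumes "rank_le V S m" shows "rank_le V (\<lambda>x. c *\<^sub>C S x) m"
proof -
  obtain A where A: "finite A" "card A \<le> m" "S ` V \<subseteq> cspan A"
    using assms by (auto simp: rank_le_def)
  then show ?thesis unfolding rank_le_def
    by (intro exI[of _ A]) (auto intro: cvs.span_scale)
qed

lemma rank_le_diff: "rank_le V S m \<Longrightarrow> rank_le V T n \<Longrightarrow> rank_le V (\<lambda>x. S x - T x) (m + n)"
  using rank_le_add[OF _ rank_le_scale[of V T n "-1"]] by fastforce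

lemma rank_le_comp_left:
  assumes "rank_le W R n" "\<And>x. x \<in> V \<Longrightarrow> S x \<in> W" shows "rank_le V (\<lambda>x. R (S x)) n"
  using assms by (force simp: rank_le_def)

lemma rank_le_comp_right:
  assumes "clinear_on V W R" "csubspace V" "csubspace W" "rank_le V R n" "clinear_on W U S"
  shows "rank_le V (\<lambda>x. S (R x)) n"
proof -
  obtain B where B: "finite B" "card B \<le> n" "B \<subseteq> R ` V" "R ` V \<subseteq> cspan B"
    using rank_le_basis[OF assms(1,2,4)] .
  have BW: "B \<subseteq> W" using B(3) assms(1) by (auto simp: clinear_on_def)
  have "y \<in> W \<and> S y \<in> cspan (S ` B)" if "y \<in> cspan B" for y
    using that
  proof (induction rule: cvs.span_induct_alt)
    case base
    then show ?case
      using clinear_on_zero[OF assms(5,3)] by (simp add: cvs.subspace_0[OF assms(3)] cvs.span_zero)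
  next
    case (step c x y)
    then have "x \<in> W" "c *\<^sub>C x \<in> W" using BW cvs.subspace_scale[OF assms(3)] by auto
    with step show ?case
      using clinear_on_add[OF assms(5)] clinear_on_scale[OF assms(5)]
      by (simp add: cvs.subspace_add[OF assms(3)] cvs.span_add cvs.span_scale cvs.span_base)
  qed
  then have "(\<lambda>x. S (R x)) ` V \<subseteq> cspan (S ` B)" using B(4) by auto
  then show ?thesis unfolding rank_le_def
    using B card_image_le[OF B(1), of S] by (intro exI[of _ "S ` B"]) auto
qed

text \<open>The \<open>n\<close>-th approximation number is at most \<open>t\<close>, with the
  approximant as a witness. The pointwise estimate keeps suprema and infima out of the calculus of
  Schatten ideals.\<close>

definition approx :: "'h::complex_hilbert set \<Rightarrow> 'h set \<Rightarrow> ('h \<Rightarrow> 'h) \<Rightarrow> nat \<Rightarrow> real \<Rightarrow> bool"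
  where "approx V W T n t \<longleftrightarrow>
    (\<exists>R. bounded_op V W R \<and> rank_le V R n \<and> (\<forall>x\<in>V. norm (T x - R x) \<le> t * norm x))"

lemma approx_mono:
  assumes "approx V W T n t" "n \<le> n'" "t \<le> t'" shows "approx V W T n' t'"
  using assms unfolding approx_def
  by (meson mult_right_mono norm_ge_zero order_trans rank_le_mono)

lemma approx_cong: "approx V W T n t \<Longrightarrow> (\<And>x. x \<in> V \<Longrightarrow> T x = T' x) \<Longrightarrow> approx V W T' n t"
  by (simp add: approx_def)

lemma approx_norm:
  assumes "csubspace W" "\<And>x. x \<in> V \<Longrightarrow> norm (T x) \<le> t * norm x" shows "approx V W T n t"
  unfolding approx_def
  by (rule exI[of _ "\<lambda>x. 0"]) (use assms in \<open>auto simp: bounded_op_zero rank_le_def intro!: exI[of _ "{}"]\<close>)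

lemma approx_add:
  assumes "approx V W S m s" "approx V W T n t" "csubspace W"
  shows "approx V W (\<lambda>x. S x + T x) (m + n) (s + t)"
proof -
  obtain P Q where P: "bounded_op V W P" "rank_le V P m" "\<And>x. x \<in> V \<Longrightarrow> norm (S x - P x) \<le> s * norm x"
    and Q: "bounded_op V W Q" "rank_le V Q n" "\<And>x. x \<in> V \<Longrightarrow> norm (T x - Q x) \<le> t * norm x"
    using assms(1,2) by (auto simp: approx_def)
  have "norm (S x + T x - (P x + Q x)) \<le> (s + t) * norm x" if "x \<in> V" for x
    using P(3)[OF that] Q(3)[OF that] norm_triangle_ineq[of "S x - P x" "T x - Q x"]
    by (simp add: algebra_simps)
  then show ?thesis unfolding approx_def
    using bounded_op_add[OF P(1) Q(1) assms(3)] rank_le_add[OF P(2) Q(2)] by blast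
qed

lemma approx_scale:
  assumes "approx V W T n t" "csubspace W" shows "approx V W (\<lambda>x. c *\<^sub>C T x) n (cmod c * t)"
proof -
  obtain Q where Q: "bounded_op V W Q" "rank_le V Q n" "\<And>x. x \<in> V \<Longrightarrow> norm (T x - Q x) \<le> t * norm x"
    using assms(1) by (auto simp: approx_def)
  have "norm (c *\<^sub>C T x - c *\<^sub>C Q x) \<le> (cmod c * t) * norm x" if "x \<in> V" for x
    using mult_left_mono[OF Q(3)[OF that], of "cmod c"]
    by (simp add: cvs.scale_right_diff_distrib[symmetric] mult.assoc)
  then show ?thesis unfolding approx_def
    using bounded_op_scale[OF Q(1) assms(2)] rank_le_scale[OF Q(2)] by blast
qed

text \<open>\<open>T S - (Q (S - P) + T P) = (T - Q) (S - P)\<close>.\<close>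

lemma approx_comp:
  assumes S: "bounded_op V W S" "approx V W S m s" and T: "bounded_op W U T" "approx W U T n t"
    and "csubspace V" "csubspace W" "csubspace U" "0 \<le> t"
  shows "approx V U (\<lambda>x. T (S x)) (n + m) (t * s)"
proof -
  obtain P Q where P: "bounded_op V W P" "rank_le V P m" "\<And>x. x \<in> V \<Longrightarrow> norm (S x - P x) \<le> s * norm x"
    and Q: "bounded_op W U Q" "rank_le W Q n" "\<And>x. x \<in> W \<Longrightarrow> norm (T x - Q x) \<le> t * norm x"
    using S(2) T(2) by (auto simp: approx_def)
  have SP: "bounded_op V W (\<lambda>x. S x - P x)" using bounded_op_diff[OF S(1) P(1)] assms by simp
  have "norm (T (S x) - (Q (S x - P x) + T (P x))) \<le> (t * s) * norm x" if x: "x \<in> V" for x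
  proof -
    have mem: "S x \<in> W" "P x \<in> W" "S x - P x \<in> W"
      using S(1) P(1) SP x by (auto dest: bounded_op_mem)
    have "T (S x) = T (S x - P x) + T (P x)"
      using clinear_on_diff[OF bounded_op_linear[OF T(1)] \<open>csubspace W\<close>] mem by simp
    then have "norm (T (S x) - (Q (S x - P x) + T (P x))) \<le> t * norm (S x - P x)"
      using Q(3)[OF mem(3)] by simp
    also have "\<dots> \<le> t * (s * norm x)" using P(3)[OF x] assms(8) by (rule mult_left_mono)
    finally show ?thesis by (simp add: mult.assoc)
  qed
  moreover have "bounded_op V U (\<lambda>x. Q (S x - P x) + T (P x))"
    using bounded_op_add[OF bounded_op_comp[OF SP Q(1)] bounded_op_comp[OF P(1) T(1)]] assms by simp
  moreover have "rank_le V (\<lambda>x. Q (S x - P x) + T (P x)) (n + m)"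
    by (rule rank_le_add[OF rank_le_comp_left[OF Q(2) bounded_op_mem[OF SP]]
          rank_le_comp_right[OF bounded_op_linear[OF P(1)] _ _ P(2) bounded_op_linear[OF T(1)]]])
      (use assms in simp_all)
  ultimately show ?thesis unfolding approx_def by blast
qed

section \<open>Nuclear operators and the trace\<close>

text \<open>Closedness of \<open>V\<close> is implied, since \<open>orthonormal_basis\<close> makes
  \<open>V\<close> the closure of a span. The basis is kept in the definition because it gives
  \<open>op_trace\<close> at most one value.\<close>

definition hilbert_space :: "'h::complex_hilbert set \<Rightarrow> bool"
  where "hilbert_space V \<longleftrightarrow> csubspace V \<and> (\<exists>E. orthonormal_basis V E)"

section \<open>Expansions in an orthonormal basis\<close>

lemma orthonormal_subset: "orthonormal E \<Longrightarrow> F \<subseteq> E \<Longrightarrow> orthonormal F"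
  unfolding orthonormal_def by blast

lemma orthonormal_basis_orthonormal: "orthonormal_basis V E \<Longrightarrow> orthonormal E"
  by (simp add: orthonormal_basis_def orthonormal_def)

text \<open>A projection \<open>proj F u\<close> approximates at least as well as any element of the
  span of \<open>F\<close>, and the span of \<open>E\<close> is dense in \<open>V\<close>.\<close>

lemma proj_tendsto:
  assumes E: "orthonormal_basis V E" and u: "u \<in> V"
  shows "((\<lambda>F. proj F u) \<longlongrightarrow> u) (finite_subsets_at_top E)"
proof (rule tendstoI)
  fix r :: real assume "0 < r"
  have "u \<in> closure (cspan E)" using assms by (simp add: orthonormal_basis_def)
  then obtain y where y: "y \<in> cspan E" "dist y u < r"
    using \<open>0 < r\<close> by (auto simp: closure_approachable)
  obtain F0 c where F0: "finite F0" "F0 \<subseteq> E" "y = (\<Sum>a\<in>F0. c a *\<^sub>C a)"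
    using y(1) by (auto simp: cvs.span_explicit)
  have "dist (proj F u) u < r" if F: "finite F" "F0 \<subseteq> F" "F \<subseteq> E" for F
  proof -
    have "y \<in> cspan F" unfolding F0(3)
      using F by (intro cvs.span_sum cvs.span_scale cvs.span_base) auto
    from proj_best[OF F(1) orthonormal_subset[OF orthonormal_basis_orthonormal[OF E] F(3)] this, of u]
    show ?thesis using y(2) by (simp add: dist_norm norm_minus_commute)
  qed
  then show "\<forall>\<^sub>F F in finite_subsets_at_top E. dist (proj F u) u < r"
    using F0(1,2) by (auto simp: eventually_finite_subsets_at_top)
qed

text \<open>This takes the place of the Riesz representation: a bounded functional is continuous
  along the projections \<open>proj F u\<close>, which converge to \<open>u\<close>.\<close>

lemma functional_expansion:
  assumes E: "orthonormal_basis V E" and u: "u \<in> V" and V: "csubspace V"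
    and f: "clinear_on V UNIV f" "\<And>x. x \<in> V \<Longrightarrow> cmod (f x) \<le> a * norm x"
  shows "((\<lambda>e. f e * cinner e u) has_sum f u) E"
proof -
  have EV: "E \<subseteq> V" using E by (simp add: orthonormal_basis_def)
  have pV: "proj F u \<in> V" if "F \<subseteq> E" for F
    unfolding proj_def using that EV V by (intro cvs.subspace_sum cvs.subspace_scale) auto
  have fp: "f (proj F u) = (\<Sum>e\<in>F. f e * cinner e u)" if "F \<subseteq> E" for F
  proof -
    have "f (proj F u) = (\<Sum>e\<in>F. f (cinner e u *\<^sub>C e))"
      unfolding proj_def using that EV V by (intro clinear_on_sum[OF f(1) V]) (auto simp: cvs.subspace_scale)
    also have "\<dots> = (\<Sum>e\<in>F. f e * cinner e u)"
      using that EV clinear_on_scale[OF f(1)] by (intro sum.cong) (auto simp: scaleC_complex_def)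
    finally show ?thesis .
  qed
  have "((\<lambda>F. f (proj F u) - f u) \<longlongrightarrow> 0) (finite_subsets_at_top E)"
  proof (rule Lim_null_comparison)
    have "((\<lambda>F. a * norm (proj F u - u)) \<longlongrightarrow> a * norm (u - u)) (finite_subsets_at_top E)"
      by (intro tendsto_intros proj_tendsto[OF E u])
    then show "((\<lambda>F. a * norm (proj F u - u)) \<longlongrightarrow> 0) (finite_subsets_at_top E)" by simp
    have "norm (f (proj F u) - f u) \<le> a * norm (proj F u - u)" if "F \<subseteq> E" for F
      using f(2)[of "proj F u - u"] clinear_on_diff[OF f(1) V pV[OF that] u] pV[OF that] u V
      by (simp add: cvs.subspace_diff)
    then show "\<forall>\<^sub>F F in finite_subsets_at_top E. norm (f (proj F u) - f u) \<le> a * norm (proj F u - u)"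
      by (auto intro!: eventually_finite_subsets_at_top_weakI)
  qed
  then have "((\<lambda>F. f (proj F u)) \<longlongrightarrow> f u) (finite_subsets_at_top E)" by (simp add: LIM_zero_iff)
  then show ?thesis unfolding has_sum_def
    by (rule Lim_transform_eventually) (auto intro!: eventually_finite_subsets_at_top_weakI simp: fp)
qed

text \<open>Let S be the left-hand side. Testing \<open>f\<close> against the vector
  \<open>x\<close> with coefficients \<open>cnj (f e)\<close> gives \<open>f x = S\<^sup>2\<close>
  and \<open>norm x = S\<close>, hence \<open>S\<^sup>2 \<le> a * S\<close>.\<close>

lemma functional_bessel:
  assumes F: "finite F" "orthonormal F" "F \<subseteq> V" and V: "csubspace V"
    and f: "clinear_on V UNIV f" "\<And>x. x \<in> V \<Longrightarrow> cmod (f x) \<le> a * norm x" "0 \<le> a"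
  shows "L2_set (\<lambda>e. cmod (f e)) F \<le> a"
proof -
  define S where "S = L2_set (\<lambda>e. cmod (f e)) F"
  define x where "x = (\<Sum>e\<in>F. cnj (f e) *\<^sub>C e)"
  have xV: "x \<in> V" unfolding x_def using F V by (intro cvs.subspace_sum cvs.subspace_scale) auto
  have "norm x ^ 2 = (\<Sum>e\<in>F. (cmod (f e))\<^sup>2)"
    unfolding x_def norm_orthonormal_sum[OF F(1,2)] by simp
  then have nx: "norm x = S"
    unfolding S_def L2_set_def by (metis abs_norm_cancel real_sqrt_abs)
  have "f x = (\<Sum>e\<in>F. f (cnj (f e) *\<^sub>C e))"
    unfolding x_def using F V by (intro clinear_on_sum[OF f(1) V]) (auto simp: cvs.subspace_scale)
  also have "\<dots> = (\<Sum>e\<in>F. of_real ((cmod (f e))\<^sup>2))"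
  proof (rule sum.cong)
    fix e assume "e \<in> F"
    then have "f (cnj (f e) *\<^sub>C e) = f e * cnj (f e)"
      using F(3) clinear_on_scale[OF f(1)] by (auto simp: scaleC_complex_def)
    then show "f (cnj (f e) *\<^sub>C e) = of_real ((cmod (f e))\<^sup>2)"
      by (simp only: complex_norm_square)
  qed simp
  also have "\<dots> = of_real (S\<^sup>2)"
    unfolding S_def L2_set_def by (simp add: sum_nonneg)
  finally have "f x = of_real (S\<^sup>2)" .
  then have "S\<^sup>2 \<le> a * S" using f(2)[OF xV] nx by (simp add: norm_power)
  moreover have "0 \<le> S" by (simp add: S_def)
  ultimately have "S \<le> a" using f(3)
    by (cases "S = 0") (auto simp: power2_eq_square)
  then show ?thesis by (simp add: S_def)
qed

text \<open>\<open>T = \<Sum>\<^sub>j f\<^sub>j(\<cdot>) u\<^sub>j\<close> with \<open>\<Sum>\<^sub>j \<parallel>f\<^sub>j\<parallel> \<parallel>u\<^sub>j\<parallel> < \<infinity>\<close>. Using functionals \<open>f\<^sub>j\<close> instead of vectors makes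
  adjoints superfluous.\<close>

definition nuclear_rep :: "'h::complex_hilbert set \<Rightarrow> 'h set \<Rightarrow> ('h \<Rightarrow> 'h) \<Rightarrow> 'j set
    \<Rightarrow> ('j \<Rightarrow> 'h \<Rightarrow> complex) \<Rightarrow> ('j \<Rightarrow> 'h) \<Rightarrow> ('j \<Rightarrow> real) \<Rightarrow> bool"
  where "nuclear_rep V W T J f u a \<longleftrightarrow>
    (\<forall>j\<in>J. clinear_on V UNIV (f j) \<and> u j \<in> W \<and> norm (u j) \<le> 1 \<and> 0 \<le> a j \<and>
      (\<forall>x\<in>V. cmod (f j x) \<le> a j * norm x)) \<and>
    a summable_on J \<and> (\<forall>x\<in>V. ((\<lambda>j. f j x *\<^sub>C u j) has_sum T x) J)"

lemma nuclear_repD: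
  assumes "nuclear_rep V W T J f u a"
  shows "j \<in> J \<Longrightarrow> clinear_on V UNIV (f j)" "j \<in> J \<Longrightarrow> u j \<in> W" "j \<in> J \<Longrightarrow> norm (u j) \<le> 1"
    "j \<in> J \<Longrightarrow> 0 \<le> a j" "j \<in> J \<Longrightarrow> x \<in> V \<Longrightarrow> cmod (f j x) \<le> a j * norm x"
    "a summable_on J" "x \<in> V \<Longrightarrow> ((\<lambda>j. f j x *\<^sub>C u j) has_sum T x) J"
  using assms unfolding nuclear_rep_def by blast+

lemma nuclear_repI:
  assumes "\<And>j. j \<in> J \<Longrightarrow> clinear_on V UNIV (f j)" "\<And>j. j \<in> J \<Longrightarrow> u j \<in> W" "\<And>j. j \<in> J \<Longrightarrow> norm (u j) \<le> 1"
    "\<And>j. j \<in> J \<Longrightarrow> 0 \<le> a j" "\<And>j x. j \<in> J \<Longrightarrow> x \<in> V \<Longrightarrow> cmod (f j x) \<le> a j * norm x"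
    "a summable_on J" "\<And>x. x \<in> V \<Longrightarrow> ((\<lambda>j. f j x *\<^sub>C u j) has_sum T x) J"
  shows "nuclear_rep V W T J f u a"
  using assms unfolding nuclear_rep_def by blast

section \<open>Traces of nuclear operators\<close>

definition has_trace :: "'h::complex_hilbert set \<Rightarrow> ('h \<Rightarrow> 'h) \<Rightarrow> complex \<Rightarrow> bool"
  where "has_trace V T t \<longleftrightarrow> (\<forall>E. orthonormal_basis V E \<longrightarrow> ((\<lambda>e. cinner e (T e)) has_sum t) E)"

lemma op_trace_eq:
  assumes "hilbert_space V" "has_trace V T t" shows "op_trace V T = t"
proof -
  obtain E where "orthonormal_basis V E" using assms(1) by (auto simp: hilbert_space_def)
  then show ?thesis
    using assms(2) unfolding op_trace_def has_trace_def
    by (intro the_equality) (auto dest: has_sum_unique)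
qed

lemma has_sum_diag_cong:
  assumes "orthonormal_basis V E" "\<And>x. x \<in> V \<Longrightarrow> T x = T' x"
  shows "((\<lambda>e. cinner e (T e)) has_sum t) E \<longleftrightarrow> ((\<lambda>e. cinner e (T' e)) has_sum t) E"
proof (rule has_sum_cong)
  fix e assume "e \<in> E"
  then have "e \<in> V" using assms(1) by (auto simp: orthonormal_basis_def)
  then show "cinner e (T e) = cinner e (T' e)" using assms(2) by simp
qed

lemma has_trace_cong:
  assumes "has_trace V T t" "\<And>x. x \<in> V \<Longrightarrow> T x = T' x"
  shows "has_trace V T' t"
  using assms(1) has_sum_diag_cong[of V _ T T', OF _ assms(2)] unfolding has_trace_def by blast

lemma has_trace_add: "has_trace V S s \<Longrightarrow> has_trace V T t \<Longrightarrow> has_trace V (\<lambda>x. S x + T x) (s + t)"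
  by (auto simp: has_trace_def cinner_add_right intro: has_sum_add)

lemma has_trace_scale: "has_trace V T t \<Longrightarrow> has_trace V (\<lambda>x. c *\<^sub>C T x) (c * t)"
  by (auto simp: has_trace_def cinner_scaleC_right intro: has_sum_cmult_right)

text \<open>No convergence is involved: the two definite descriptions have the same
  predicate.\<close>

lemma op_trace_cong:
  assumes "\<And>x. x \<in> V \<Longrightarrow> T x = T' x" shows "op_trace V T = op_trace V T'"
proof -
  have "(\<forall>E. orthonormal_basis V E \<longrightarrow> ((\<lambda>e. cinner e (T e)) has_sum t) E) \<longleftrightarrow>
      (\<forall>E. orthonormal_basis V E \<longrightarrow> ((\<lambda>e. cinner e (T' e)) has_sum t) E)" for t
    using has_sum_diag_cong[of V _ T T', OF _ assms] by blast
  then show ?thesis unfolding op_trace_def by simp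
qed

text \<open>Fubini for the family \<open>f j e * cinner e (u j)\<close>. By Cauchy-Schwarz and the
  two Bessel inequalities its absolute sum over \<open>e\<close> is at most \<open>a j\<close>, so
  the double sum converges absolutely. Summing over \<open>e\<close> first gives
  \<open>f j (u j)\<close>, summing over \<open>j\<close> first gives the diagonal entry of
  \<open>T\<close>. The resulting value does not mention the basis.\<close>

lemma nuclear_has_trace:
  assumes N: "nuclear_rep V V T J f u a" and V: "csubspace V"
  shows "has_trace V T (\<Sum>\<^sub>\<infinity>j\<in>J. f j (u j))"
  unfolding has_trace_def
proof (intro allI impI)
  fix E assume E: "orthonormal_basis V E"
  have EV: "E \<subseteq> V" using E by (simp add: orthonormal_basis_def)
  note f = nuclear_repD[OF N]
  define g where "g j e = f j e * cinner e (u j)" for j e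
  have fin: "(\<Sum>e\<in>F. norm (g j e)) \<le> a j" if j: "j \<in> J" and F: "finite F" "F \<subseteq> E" for j F
  proof -
    have on: "orthonormal F" using orthonormal_subset orthonormal_basis_orthonormal[OF E] F by blast
    have "(\<Sum>e\<in>F. norm (g j e)) = (\<Sum>e\<in>F. \<bar>cmod (f j e)\<bar> * \<bar>cmod (cinner e (u j))\<bar>)"
      by (simp add: g_def norm_mult)
    also have "\<dots> \<le> L2_set (\<lambda>e. cmod (f j e)) F * L2_set (\<lambda>e. cmod (cinner e (u j))) F"
      by (rule L2_set_mult_ineq)
    also have "\<dots> \<le> a j * 1"
    proof (rule mult_mono)
      show "L2_set (\<lambda>e. cmod (f j e)) F \<le> a j"
        using F(2) EV by (intro functional_bessel[OF F(1) on _ V f(1)[OF j] f(5)[OF j] f(4)[OF j]]) auto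
      have "(\<Sum>e\<in>F. (cmod (cinner e (u j)))\<^sup>2) \<le> 1"
        using bessel[OF F(1) on, of "u j"] power_le_one[OF norm_ge_zero f(3)[OF j], of 2] by linarith
      then show "L2_set (\<lambda>e. cmod (cinner e (u j))) F \<le> 1"
        by (simp add: L2_set_def)
    qed (use f(4)[OF j] in auto)
    finally show ?thesis by simp
  qed
  have s1: "(\<lambda>e. norm (g j e)) summable_on E" if "j \<in> J" for j
  proof (rule nonneg_bdd_above_summable_on)
    show "bdd_above (sum (\<lambda>e. norm (g j e)) ` {F. F \<subseteq> E \<and> finite F})"
    proof (rule bdd_aboveI)
      fix y assume "y \<in> sum (\<lambda>e. norm (g j e)) ` {F. F \<subseteq> E \<and> finite F}"
      then show "y \<le> a j" using fin[OF that] by blast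
    qed
  qed simp
  have le: "infsum (\<lambda>e. norm (g j e)) E \<le> a j" if "j \<in> J" for j
    using s1[OF that] fin[OF that] by (rule infsum_le_finite_sums)
  have "(\<lambda>j. norm (infsum (\<lambda>e. norm (g j e)) E)) summable_on J"
  proof (rule Infinite_Sum.abs_summable_on_comparison_test'[OF f(6)])
    show "norm (infsum (\<lambda>e. norm (g j e)) E) \<le> a j" if "j \<in> J" for j
      using le[OF that] f(4)[OF that] by (simp add: infsum_nonneg)
  qed
  then have s2: "(\<lambda>x. norm (case x of (j, e) \<Rightarrow> g j e)) summable_on (SIGMA j:J. E)"
    using s1 by (subst Infinite_Sum.abs_summable_on_Sigma_iff) auto
  then have s3: "(\<lambda>(j, e). g j e) summable_on (J \<times> E)" by (rule abs_summable_summable)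
  define S where "S = infsum (\<lambda>(j, e). g j e) (J \<times> E)"
  have S: "((\<lambda>(j, e). g j e) has_sum S) (J \<times> E)" using s3 by (simp add: S_def)
  have "((\<lambda>j. f j (u j)) has_sum S) J"
  proof (rule has_sum_SigmaD[OF S])
    fix j assume j: "j \<in> J"
    have "((\<lambda>e. f j e * cinner e (u j)) has_sum f j (u j)) E"
      by (rule functional_expansion[OF E f(2)[OF j] V f(1)[OF j] f(5)[OF j]])
    then show "((\<lambda>e. case (j, e) of (j, e) \<Rightarrow> g j e) has_sum f j (u j)) E" by (simp add: g_def)
  qed
  then have "S = (\<Sum>\<^sub>\<infinity>j\<in>J. f j (u j))" by (simp add: infsumI)
  moreover have "((\<lambda>(e, j). g j e) has_sum S) (E \<times> J)"
    by (rule iffD1[OF has_sum_reindex_bij_witness[of _ prod.swap prod.swap] S]) auto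
  then have "((\<lambda>e. cinner e (T e)) has_sum S) E"
  proof (rule has_sum_SigmaD)
    fix e assume "e \<in> E"
    then have e: "((\<lambda>j. f j e *\<^sub>C u j) has_sum T e) J" using f(7) EV by blast
    have "((\<lambda>F. cinner e (\<Sum>j\<in>F. f j e *\<^sub>C u j)) \<longlongrightarrow> cinner e (T e)) (finite_subsets_at_top J)"
      using e unfolding has_sum_def by (rule tendsto_cinner_right)
    then show "((\<lambda>j. case (e, j) of (e, j) \<Rightarrow> g j e) has_sum cinner e (T e)) J"
      unfolding has_sum_def by (simp add: cinner_sum_right cinner_scaleC_right g_def)
  qed
  ultimately show "((\<lambda>e. cinner e (T e)) has_sum (\<Sum>\<^sub>\<infinity>j\<in>J. f j (u j))) E" by simp
qed

lemma nuclear_rep_precomp: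
  assumes "nuclear_rep V W A J f u a" "bounded_op U V B"
  obtains a' where "nuclear_rep U W (\<lambda>x. A (B x)) J (\<lambda>j x. f j (B x)) u a'"
proof -
  obtain b where b: "0 \<le> b" "\<And>x. x \<in> U \<Longrightarrow> norm (B x) \<le> b * norm x" using bounded_opE[OF assms(2)] by metis
  have "cmod (f j (B x)) \<le> (a j * b) * norm x" if "j \<in> J" "x \<in> U" for j x
  proof -
    have "cmod (f j (B x)) \<le> a j * norm (B x)" "0 \<le> a j"
      using nuclear_repD(4,5)[OF assms(1)] that bounded_op_mem[OF assms(2)] by blast+
    moreover from this(2) have "a j * norm (B x) \<le> a j * (b * norm x)"
      using b that by (intro mult_left_mono) auto
    ultimately show ?thesis by (simp add: mult.assoc)
  qed
  moreover have "clinear_on U UNIV (\<lambda>x. f j (B x))" if "j \<in> J" for j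
    using nuclear_repD(1)[OF assms(1) that] assms(2) by (auto simp: bounded_op_def clinear_on_def)
  ultimately have "nuclear_rep U W (\<lambda>x. A (B x)) J (\<lambda>j x. f j (B x)) u (\<lambda>j. a j * b)"
    using nuclear_repD[OF assms(1)] b(1) bounded_op_mem[OF assms(2)]
    by (intro nuclear_repI summable_on_cmult_left) auto
  then show ?thesis by (rule that)
qed

lemma has_sum_bounded_op:
  assumes g: "(g has_sum s) J" "\<And>j. j \<in> J \<Longrightarrow> g j \<in> W" "s \<in> W"
    and B: "bounded_op W U B" and W: "csubspace W"
  shows "((\<lambda>j. B (g j)) has_sum B s) J"
proof -
  obtain b where b: "0 \<le> b" "\<And>x. x \<in> W \<Longrightarrow> norm (B x) \<le> b * norm x" using bounded_opE[OF B] by metis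
  have sW: "sum g F \<in> W" if "F \<subseteq> J" for F using that g(2) W by (intro cvs.subspace_sum) auto
  have Bs: "B (sum g F) = (\<Sum>j\<in>F. B (g j))" if "F \<subseteq> J" for F
    using that g(2) by (intro clinear_on_sum[OF bounded_op_linear[OF B] W]) auto
  have "((\<lambda>F. B (sum g F) - B s) \<longlongrightarrow> 0) (finite_subsets_at_top J)"
  proof (rule Lim_null_comparison)
    have "((\<lambda>F. b * norm (sum g F - s)) \<longlongrightarrow> b * norm (s - s)) (finite_subsets_at_top J)"
      by (intro tendsto_intros g(1)[unfolded has_sum_def])
    then show "((\<lambda>F. b * norm (sum g F - s)) \<longlongrightarrow> 0) (finite_subsets_at_top J)" by simp
    have "norm (B (sum g F) - B s) \<le> b * norm (sum g F - s)" if "F \<subseteq> J" for F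
      using b(2)[of "sum g F - s"] clinear_on_diff[OF bounded_op_linear[OF B] W sW[OF that] g(3)]
        sW[OF that] g(3) W by (simp add: cvs.subspace_diff)
    then show "\<forall>\<^sub>F F in finite_subsets_at_top J. norm (B (sum g F) - B s) \<le> b * norm (sum g F - s)"
      by (auto intro!: eventually_finite_subsets_at_top_weakI)
  qed
  then have "((\<lambda>F. B (sum g F)) \<longlongrightarrow> B s) (finite_subsets_at_top J)" by (simp add: LIM_zero_iff)
  then show ?thesis unfolding has_sum_def
    by (rule Lim_transform_eventually) (auto intro!: eventually_finite_subsets_at_top_weakI simp: Bs)
qed

text \<open>Postcomposition rescales by a bound \<open>b\<close> of \<open>B\<close>, to keep the vectors in the unit ball.\<close>

lemma nuclear_rep_postcomp:
  assumes "nuclear_rep V W A J f u a" "bounded_op W U B" "csubspace U" "bounded_op V W A" "csubspace W"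
  obtains a' b where "b \<noteq> 0"
    "nuclear_rep V U (\<lambda>x. B (A x)) J (\<lambda>j x. b * f j x) (\<lambda>j. inverse b *\<^sub>C B (u j)) a'"
proof -
  obtain b' where b': "0 \<le> b'" "\<And>x. x \<in> W \<Longrightarrow> norm (B x) \<le> b' * norm x" using bounded_opE[OF assms(2)] by metis
  \<comment> \<open>Adding 1 makes the bound positive, so that it can be divided out.\<close>
  define b where "b = b' + 1"
  have b: "0 < b" "norm (B x) \<le> b * norm x" if "x \<in> W" for x
    using b'(1) b'(2)[OF that] by (auto simp: b_def distrib_right intro: add_increasing2)
  have b0: "0 < b" using b' by (simp add: b_def)
  note N = nuclear_repD[OF assms(1)]
  have "norm (inverse (of_real b) *\<^sub>C B (u j)) \<le> 1" if "j \<in> J" for j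
  proof -
    have "norm (B (u j)) \<le> b * 1"
      using b(2)[OF N(2)[OF that]] mult_left_mono[OF N(3)[OF that], of b] b0 by linarith
    then show ?thesis using b0 by (simp add: norm_inverse norm_divide field_simps)
  qed
  moreover have "cmod (of_real b * f j x) \<le> (b * a j) * norm x" if "j \<in> J" "x \<in> V" for j x
    using N(5)[OF that] b0 by (simp add: norm_mult)
  moreover have "((\<lambda>j. (of_real b * f j x) *\<^sub>C inverse (of_real b) *\<^sub>C B (u j)) has_sum B (A x)) J"
    if x: "x \<in> V" for x
  proof -
    have h: "((\<lambda>j. f j x *\<^sub>C u j) has_sum A x) J" using N(7) x .
    have "((\<lambda>j. B (f j x *\<^sub>C u j)) has_sum B (A x)) J"
      using N(2) x assms by (intro has_sum_bounded_op[OF h _ _ assms(2,5)])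
        (auto simp: cvs.subspace_scale bounded_op_mem[OF assms(4)])
    then show ?thesis
      using N clinear_on_scale[OF bounded_op_linear[OF assms(2)]] b0
      by (subst has_sum_cong[where g = "\<lambda>j. B (f j x *\<^sub>C u j)"]) auto
  qed
  moreover have "clinear_on V UNIV (\<lambda>x. of_real b * f j x)" if "j \<in> J" for j
    using N(1)[OF that] by (auto simp: clinear_on_def scaleC_complex_def algebra_simps)
  moreover have "inverse (of_real b) *\<^sub>C B (u j) \<in> U" if "j \<in> J" for j
    using N(2)[OF that] assms bounded_op_mem cvs.subspace_scale by blast
  ultimately have "nuclear_rep V U (\<lambda>x. B (A x)) J (\<lambda>j x. of_real b * f j x)
      (\<lambda>j. inverse (of_real b) *\<^sub>C B (u j)) (\<lambda>j. b * a j)"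
    using b0 N by (intro nuclear_repI summable_on_cmult_right) auto
  then show ?thesis using that[of "of_real b"] b0 by simp
qed

text \<open>Both traces are the sum of the numbers \<open>f j (B (u j))\<close>: in one product
  \<open>B\<close> is absorbed by the functionals, in the other by the vectors, where the
  normalising factor \<open>b\<close> cancels.\<close>

lemma trace_rotate_nuclear:
  assumes N: "nuclear_rep V W A J f u a" and A: "bounded_op V W A" and B: "bounded_op W V B"
    and V: "csubspace V" and W: "csubspace W"
  shows "\<exists>t. has_trace W (\<lambda>x. A (B x)) t \<and> has_trace V (\<lambda>x. B (A x)) t"
proof -
  obtain a1 where "nuclear_rep W W (\<lambda>x. A (B x)) J (\<lambda>j x. f j (B x)) u a1"
    using nuclear_rep_precomp[OF N B] .
  then have 1: "has_trace W (\<lambda>x. A (B x)) (\<Sum>\<^sub>\<infinity>j\<in>J. f j (B (u j)))"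
    using W by (rule nuclear_has_trace)
  obtain a2 b where b: "b \<noteq> 0"
    and N2: "nuclear_rep V V (\<lambda>x. B (A x)) J (\<lambda>j x. b * f j x) (\<lambda>j. inverse b *\<^sub>C B (u j)) a2"
    using nuclear_rep_postcomp[OF N B V A W] .
  have "b * f j (inverse b *\<^sub>C B (u j)) = f j (B (u j))" if "j \<in> J" for j
    using b clinear_on_scale[OF nuclear_repD(1)[OF N that] bounded_op_mem[OF B nuclear_repD(2)[OF N that]]]
    by (simp add: scaleC_complex_def)
  then have "(\<Sum>\<^sub>\<infinity>j\<in>J. b * f j (inverse b *\<^sub>C B (u j))) = (\<Sum>\<^sub>\<infinity>j\<in>J. f j (B (u j)))"
    by (rule infsum_cong)
  with nuclear_has_trace[OF N2 V] 1 show ?thesis by auto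
qed

lemma nuclear_trace_bound:
  assumes N: "nuclear_rep V V T J f u a" and V: "hilbert_space V"
  shows "cmod (op_trace V T) \<le> infsum a J"
proof -
  have j: "cmod (f j (u j)) \<le> a j" if "j \<in> J" for j
  proof -
    have "cmod (f j (u j)) \<le> a j * norm (u j)" "0 \<le> a j" "norm (u j) \<le> 1"
      using nuclear_repD[OF N] that by blast+
    then show ?thesis using mult_left_mono[of "norm (u j)" 1 "a j"] by linarith
  qed
  have "op_trace V T = (\<Sum>\<^sub>\<infinity>j\<in>J. f j (u j))"
    using op_trace_eq[OF V nuclear_has_trace[OF N]] V by (simp add: hilbert_space_def)
  moreover have "cmod (\<Sum>\<^sub>\<infinity>j\<in>J. f j (u j)) \<le> infsum a J"
  proof (rule norm_infsum_le)
    have a: "a summable_on J" using nuclear_repD(6)[OF N] .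
    then show "(a has_sum infsum a J) J" by simp
    have "(\<lambda>j. norm (f j (u j))) summable_on J"
      by (rule Infinite_Sum.abs_summable_on_comparison_test'[OF a j])
    then show "((\<lambda>j. f j (u j)) has_sum (\<Sum>\<^sub>\<infinity>j\<in>J. f j (u j))) J"
      by (rule has_sum_infsum[OF abs_summable_summable])
  qed (rule j)
  ultimately show ?thesis by simp
qed

section \<open>Schatten ideals\<close>

text \<open>The weight \<open>w k\<close> will bound rank times norm of the \<open>k\<close>-th
  telescoping difference. The difference between levels k and k + 1 has rank at most q 2^(k+1) + q
  2^k = 3 q 2^k. In terms of g k = 2^k c k it contributes 3 q g k + (3/2) q g (k+1); rounding 3/2 up
  to 3 leads to the factor 6.\<close>

lemma geometric_weight_bound:
  fixes c :: "nat \<Rightarrow> real" and q :: nat and N :: real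
  assumes c: "\<And>k. 0 \<le> c k" and s: "summable (\<lambda>k. 2 ^ k * c k)" and "0 \<le> N"
  defines "w \<equiv> (\<lambda>k. case k of 0 \<Rightarrow> real q * (N + c 0) | Suc k \<Rightarrow> real (3 * q * 2 ^ k) * (c k + c (Suc k)))"
  shows "summable w" "suminf w \<le> q * N + 6 * q * (\<Sum>k. 2 ^ k * c k)"
proof -
  define g where "g k = 2 ^ k * c k" for k
  have g: "g sums suminf g" using summable_sums[OF s] by (simp add: g_def[abs_def])
  have g0: "0 \<le> g k" for k using c by (simp add: g_def)
  define v where "v k = (case k of 0 \<Rightarrow> q * N | Suc k \<Rightarrow> 3 * q * g k) + 3 * q * g k" for k
  have "(\<lambda>k. 3 * q * g k) sums (3 * q * suminf g)" using g by (rule sums_mult)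
  moreover from this have "(\<lambda>k. case k of 0 \<Rightarrow> q * N | Suc k \<Rightarrow> 3 * q * g k) sums (3 * q * suminf g + q * N)"
    using sums_Suc_iff[of "\<lambda>k. case k of 0 \<Rightarrow> q * N | Suc k \<Rightarrow> 3 * q * g k"] by simp
  ultimately have v: "v sums (3 * q * suminf g + q * N + 3 * q * suminf g)"
    unfolding v_def by (rule sums_add[rotated])
  have w0: "0 \<le> w k" for k using c \<open>0 \<le> N\<close> by (auto simp: w_def split: nat.split)
  have wv: "w k \<le> v k" for k
  proof (cases k)
    case 0
    then show ?thesis using c[of 0] by (simp add: w_def v_def g_def algebra_simps)
  next
    case (Suc l)
    have "w k = 3 * q * g l + (3 / 2) * q * g (Suc l)" by (simp add: w_def g_def Suc algebra_simps)
    also have "\<dots> \<le> 3 * q * g l + 3 * q * g (Suc l)"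
      using g0[of "Suc l"] by (intro add_left_mono mult_right_mono) auto
    finally show ?thesis by (simp add: v_def Suc)
  qed
  show "summable w"
    by (rule summable_comparison_test'[OF sums_summable[OF v]]) (use w0 wv in auto)
  then have "suminf w \<le> suminf v" using wv v by (intro suminf_le) (auto simp: sums_iff)
  also have "\<dots> = q * N + 6 * q * suminf g" using v by (simp add: sums_iff)
  finally show "suminf w \<le> q * N + 6 * q * (\<Sum>k. 2 ^ k * c k)" unfolding g_def[abs_def] .
qed

text \<open>\<open>T\<close> is the telescoping sum of the differences of its approximants, of rank \<open>O(2\<^sup>k)\<close>; each of them
  is expanded in an orthonormal basis of its range.\<close>

lemma nuclear_from_approx:
  fixes T :: "'h::complex_hilbert \<Rightarrow> 'h"
  assumes T: "bounded_op V W T" "\<And>x. x \<in> V \<Longrightarrow> norm (T x) \<le> N * norm x" "0 \<le> N"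
    and V: "csubspace V" and W: "csubspace W"
    and c: "\<And>k. 0 \<le> c k" "\<And>k. approx V W T (q * 2 ^ k) (c k)" "summable (\<lambda>k. 2 ^ k * c k)"
  obtains J :: "(nat \<times> 'h) set" and f u a
  where "nuclear_rep V W T J f u a" "infsum a J \<le> q * N + 6 * q * (\<Sum>k. 2 ^ k * c k)"
proof -
  have "\<exists>R. \<forall>k. bounded_op V W (R k) \<and> rank_le V (R k) (q * 2 ^ k) \<and>
      (\<forall>x\<in>V. norm (T x - R k x) \<le> c k * norm x)"
    by (rule choice) (use c(2) in \<open>simp add: approx_def\<close>)
  then obtain R where R: "\<And>k. bounded_op V W (R k)" "\<And>k. rank_le V (R k) (q * 2 ^ k)"
      "\<And>k x. x \<in> V \<Longrightarrow> norm (T x - R k x) \<le> c k * norm x"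
    by blast
  define D where "D k x = (case k of 0 \<Rightarrow> R 0 x | Suc k \<Rightarrow> R (Suc k) x - R k x)" for k x
  define r where "r k = (case k of 0 \<Rightarrow> q | Suc k \<Rightarrow> 3 * q * 2 ^ k)" for k
  define \<delta> where "\<delta> k = (case k of 0 \<Rightarrow> N + c 0 | Suc k \<Rightarrow> c k + c (Suc k))" for k
  have \<delta>0: "0 \<le> \<delta> k" for k using c(1) T(3) by (auto simp: \<delta>_def split: nat.split)
  have D0: "D 0 = R 0" and DS: "D (Suc l) = (\<lambda>x. R (Suc l) x - R l x)" for l
    by (simp_all add: D_def fun_eq_iff)
  have D: "bounded_op V W (D k)" for k
    by (cases k) (simp_all add: D0 DS R(1) bounded_op_diff[OF R(1) R(1) W])
  have Dr: "rank_le V (D k) (r k)" for k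
  proof (cases k)
    case 0
    then show ?thesis using R(2)[of 0] by (simp add: D0 r_def)
  next
    case (Suc l)
    have "q * 2 ^ Suc l + q * 2 ^ l = 3 * q * 2 ^ l" by simp
    with rank_le_diff[OF R(2)[of "Suc l"] R(2)[of l]] show ?thesis
      unfolding Suc DS r_def by (simp only: nat.case)
  qed
  have Dn: "norm (D k x) \<le> \<delta> k * norm x" if x: "x \<in> V" for k x
  proof (cases k)
    case 0
    have "norm (R 0 x) \<le> norm (T x) + norm (T x - R 0 x)"
      by (metis norm_minus_commute norm_triangle_sub)
    then show ?thesis using T(2)[OF x] R(3)[OF x, of 0] 0 by (simp add: D_def \<delta>_def distrib_right)
  next
    case (Suc l)
    have "norm (R (Suc l) x - R l x) \<le> norm (T x - R l x) + norm (T x - R (Suc l) x)"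
      using norm_triangle_ineq4[of "T x - R l x" "T x - R (Suc l) x"] by simp
    then show ?thesis using R(3)[OF x, of l] R(3)[OF x, of "Suc l"] Suc
      by (simp add: D_def \<delta>_def distrib_right)
  qed
  have "\<exists>E. finite E \<and> orthonormal E \<and> card E \<le> r k \<and> E \<subseteq> W \<and> (\<forall>x\<in>V. proj E (D k x) = D k x)" for k
    by (rule rank_le_orthonormal[OF bounded_op_linear[OF D[of k]] V W Dr[of k]], intro exI conjI ballI)
  then have "\<forall>k. \<exists>E. finite E \<and> orthonormal E \<and> card E \<le> r k \<and> E \<subseteq> W \<and> (\<forall>x\<in>V. proj E (D k x) = D k x)"
    by blast
  then have "\<exists>E. \<forall>k. finite (E k) \<and> orthonormal (E k) \<and> card (E k) \<le> r k \<and> E k \<subseteq> W \<and>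
      (\<forall>x\<in>V. proj (E k) (D k x) = D k x)"
    by (rule choice)
  then obtain E where E: "\<And>k. finite (E k)" "\<And>k. orthonormal (E k)" "\<And>k. card (E k) \<le> r k"
      "\<And>k. E k \<subseteq> W" "\<And>k x. x \<in> V \<Longrightarrow> proj (E k) (D k x) = D k x" by blast
  define J where "J = (SIGMA k:UNIV. E k)"
  define f where "f j x = cinner (snd j) (D (fst j) x)" for j :: "nat \<times> 'h" and x
  define a where "a j = \<delta> (fst j)" for j :: "nat \<times> 'h"
  define w where "w k = real (r k) * \<delta> k" for k
  have w_eq: "w = (\<lambda>k. case k of 0 \<Rightarrow> real q * (N + c 0) | Suc k \<Rightarrow> real (3 * q * 2 ^ k) * (c k + c (Suc k)))"
    by (auto simp: w_def r_def \<delta>_def fun_eq_iff split: nat.split)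
  have w: "summable w" "suminf w \<le> q * N + 6 * q * (\<Sum>k. 2 ^ k * c k)"
    unfolding w_eq by (rule geometric_weight_bound[OF c(1) c(3) T(3), of q])+
  have w_on: "w summable_on UNIV"
    by (rule summable_nonneg_imp_summable_on[OF w(1)]) (simp add: w_def \<delta>0)
  have inner: "infsum (\<lambda>e. a (k, e)) (E k) = card (E k) * \<delta> k" for k
    using E(1) by (simp add: a_def)
  have le_w: "card (E k) * \<delta> k \<le> w k" for k
    unfolding w_def using E(3)[of k] \<delta>0[of k] by (intro mult_right_mono) auto
  have cs: "(\<lambda>k. card (E k) * \<delta> k) summable_on UNIV"
    using Infinite_Sum.abs_summable_on_comparison_test'[OF w_on, of "\<lambda>k. card (E k) * \<delta> k"] le_w \<delta>0
    by simp
  have "(\<lambda>j. norm (a j)) summable_on J"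
    unfolding J_def
  proof (subst Infinite_Sum.abs_summable_on_Sigma_iff, intro conjI ballI)
    show "(\<lambda>k. norm (\<Sum>\<^sub>\<infinity>e\<in>E k. norm (a (k, e)))) summable_on UNIV"
      using cs inner \<delta>0 E(1) by (simp add: a_def)
  qed (simp add: E(1))
  then have a_sum: "a summable_on J" by (rule abs_summable_summable)
  have "infsum a J = (\<Sum>\<^sub>\<infinity>k. card (E k) * \<delta> k)"
    using infsum_Sigma_banach[of a UNIV E] a_sum inner unfolding J_def by simp
  also have "\<dots> \<le> infsum w UNIV" by (rule infsum_mono[OF cs w_on le_w])
  also have "\<dots> = suminf w"
    by (intro infsumI sums_nonneg_imp_has_sum summable_sums w(1)) (simp add: w_def \<delta>0)
  finally have bound: "infsum a J \<le> q * N + 6 * q * (\<Sum>k. 2 ^ k * c k)" using w(2) by simp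
  have fa: "cmod (f j x) \<le> a j * norm x" if "j \<in> J" "x \<in> V" for j x
  proof -
    have "norm (snd j) = 1" using that(1) orthonormal_norm[OF E(2)] by (auto simp: J_def)
    then show ?thesis
      using cauchy_schwarz[of "snd j" "D (fst j) x"] Dn[OF that(2), of "fst j"] by (simp add: f_def a_def)
  qed
  have hs: "((\<lambda>j. f j x *\<^sub>C snd j) has_sum T x) J" if x: "x \<in> V" for x
  proof -
    have "(\<lambda>j. norm (f j x *\<^sub>C snd j)) summable_on J"
    proof (rule Infinite_Sum.abs_summable_on_comparison_test')
      show "(\<lambda>j. a j * norm x) summable_on J" using a_sum by (rule summable_on_cmult_left)
      show "norm (f j x *\<^sub>C snd j) \<le> a j * norm x" if "j \<in> J" for j
      proof -
        have "norm (snd j) = 1" using that orthonormal_norm[OF E(2)] by (auto simp: J_def)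
        then show ?thesis using fa[OF that x] by simp
      qed
    qed
    then have "(\<lambda>j. f j x *\<^sub>C snd j) summable_on J" by (rule abs_summable_summable)
    then obtain S where S: "((\<lambda>j. f j x *\<^sub>C snd j) has_sum S) J" by (auto simp: summable_on_def)
    \<comment> \<open>Absolute summability only provides some sum \<open>S\<close>. Summing within
      each level first turns it into the telescoping series of the \<open>D k x\<close>, whose
      partial sums \<open>R n x\<close> tend to \<open>T x\<close>.\<close>
    have "((\<lambda>k. D k x) has_sum S) UNIV"
    proof (rule has_sum_SigmaD[OF S[unfolded J_def]])
      fix k
      have "(\<Sum>e\<in>E k. f (k, e) x *\<^sub>C e) = D k x"
        using E(5)[OF x, of k] by (simp add: proj_def f_def)
      then show "((\<lambda>e. f (k, e) x *\<^sub>C snd (k, e)) has_sum D k x) (E k)"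
        using E(1) by (intro has_sum_finiteI) auto
    qed
    then have "(\<lambda>k. D k x) sums S" by (rule has_sum_imp_sums)
    moreover have "(\<lambda>k. D k x) sums T x"
    proof -
      have part: "(\<Sum>k<Suc n. D k x) = R n x" for n
        by (induction n) (simp_all add: D_def)
      have "c \<longlonglongrightarrow> 0"
      proof (rule Lim_null_comparison)
        show "(\<lambda>k. 2 ^ k * c k) \<longlonglongrightarrow> 0" using c(3) by (rule summable_LIMSEQ_zero)
        have "1 * c k \<le> 2 ^ k * c k" for k using c(1) by (intro mult_right_mono) auto
        then show "\<forall>\<^sub>F k in sequentially. norm (c k) \<le> 2 ^ k * c k" using c(1) by simp
      qed
      from tendsto_mult_left_zero[OF this, of "norm x"] have "(\<lambda>n. R n x - T x) \<longlonglongrightarrow> 0"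
        by (rule Lim_null_comparison[rotated]) (use R(3)[OF x] in \<open>simp add: norm_minus_commute\<close>)
      then have "(\<lambda>n. \<Sum>k<Suc n. D k x) \<longlonglongrightarrow> T x" unfolding part by (simp add: LIM_zero_iff)
      then show ?thesis unfolding sums_def by (rule LIMSEQ_imp_Suc)
    qed
    ultimately have "S = T x" by (rule sums_unique2)
    then show ?thesis using S by simp
  qed
  have fl: "clinear_on V UNIV (f j)" for j
    using bounded_op_linear[OF D[of "fst j"]] unfolding f_def clinear_on_def
    by (simp add: cinner_add_right cinner_scaleC_right scaleC_complex_def)
  have u: "snd j \<in> W" "norm (snd j) \<le> 1" if "j \<in> J" for j
    using that subsetD[OF E(4)] orthonormal_norm[OF E(2)] by (auto simp: J_def)
  have "nuclear_rep V W T J f snd a"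
    using fl u fa a_sum hs \<delta>0 by (intro nuclear_repI) (simp_all add: a_def)
  then show ?thesis using bound that by blast
qed

text \<open>\<open>sch p n\<close> is an ideal with the multiplicative properties of the Schatten class of exponent \<open>p / n\<close>
  (bounded operators for \<open>n = 0\<close>), stated by means of dyadic approximation numbers.\<close>

definition sch :: "real \<Rightarrow> nat \<Rightarrow> 'h::complex_hilbert set \<Rightarrow> 'h set \<Rightarrow> ('h \<Rightarrow> 'h) \<Rightarrow> bool"
  where "sch p n V W T \<longleftrightarrow> bounded_op V W T \<and> (\<exists>q C \<alpha>. decseq \<alpha> \<and> (\<forall>k. 0 \<le> \<alpha> k) \<and> 0 \<le> C \<and>
    summable (\<lambda>k. 2 ^ k * \<alpha> k powr p) \<and> (\<forall>k. approx V W T (q * 2 ^ k) (C * \<alpha> k ^ n)))"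

lemma schE:
  assumes "sch p n V W T"
  obtains q C \<alpha> where "decseq \<alpha>" "\<And>k. 0 \<le> \<alpha> k" "0 \<le> C" "summable (\<lambda>k. 2 ^ k * \<alpha> k powr p)"
    "\<And>k. approx V W T (q * 2 ^ k) (C * \<alpha> k ^ n)"
  using assms unfolding sch_def by blast

section \<open>Ideal properties of the Schatten-type classes\<close>

lemma sch_bounded_op: "sch p n V W T \<Longrightarrow> bounded_op V W T"
  by (simp add: sch_def)

lemma sch_cong:
  assumes "sch p n V W T" "csubspace V" "\<And>x. x \<in> V \<Longrightarrow> T x = T' x" shows "sch p n V W T'"
  using assms(1) bounded_op_cong[of V W T T', OF _ assms(2,3)]
    approx_cong[of V W T _ _ T', OF _ assms(3)] unfolding sch_def by blast

text \<open>Degree 0 demands no decay: even for the sequence \<alpha> = 0 the bound is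
  \<open>B * 0 ^ 0\<close>, which is \<open>B\<close>.\<close>

lemma sch_bounded:
  assumes "bounded_op V W T" "csubspace W" shows "sch p 0 V W T"
proof -
  obtain B where B: "0 \<le> B" "\<And>x. x \<in> V \<Longrightarrow> norm (T x) \<le> B * norm x"
    using bounded_opE[OF assms(1)] by metis
  then have "approx V W T (0 * 2 ^ k) (B * 0 ^ 0)" for k
    using approx_norm[OF assms(2), of V T B] by simp
  then show ?thesis unfolding sch_def using assms(1) B(1)
    by (intro conjI exI[of _ 0] exI[of _ B] exI[of _ "\<lambda>k. 0"]) (auto simp: decseq_def)
qed

lemma summable_powr_add:
  fixes \<alpha> \<beta> :: "nat \<Rightarrow> real"
  assumes "\<And>k. 0 \<le> \<alpha> k" "\<And>k. 0 \<le> \<beta> k" "0 \<le> p"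
    "summable (\<lambda>k. 2 ^ k * \<alpha> k powr p)" "summable (\<lambda>k. 2 ^ k * \<beta> k powr p)"
  shows "summable (\<lambda>k. 2 ^ k * (\<alpha> k + \<beta> k) powr p)"
proof (rule summable_comparison_test')
  show "summable (\<lambda>k. 2 powr p * (2 ^ k * \<alpha> k powr p + 2 ^ k * \<beta> k powr p))"
    using assms by (intro summable_mult summable_add)
  fix k
  have "(\<alpha> k + \<beta> k) powr p \<le> (2 * max (\<alpha> k) (\<beta> k)) powr p"
    using assms(1,2)[of k] assms(3) by (intro powr_mono2) auto
  also have "\<dots> = 2 powr p * max (\<alpha> k) (\<beta> k) powr p"
    using assms(1,2)[of k] by (simp add: powr_mult)
  also have "\<dots> \<le> 2 powr p * (\<alpha> k powr p + \<beta> k powr p)"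
    by (intro mult_left_mono) (auto simp: max_def)
  finally have "(\<alpha> k + \<beta> k) powr p \<le> 2 powr p * (\<alpha> k powr p + \<beta> k powr p)" .
  from mult_left_mono[OF this, of "2 ^ k"]
  show "norm (2 ^ k * (\<alpha> k + \<beta> k) powr p) \<le> 2 powr p * (2 ^ k * \<alpha> k powr p + 2 ^ k * \<beta> k powr p)"
    by (simp add: algebra_simps)
qed

lemma decseq_add:
  fixes \<alpha> \<beta> :: "nat \<Rightarrow> real"
  shows "decseq \<alpha> \<Longrightarrow> decseq \<beta> \<Longrightarrow> decseq (\<lambda>k. \<alpha> k + \<beta> k)"
  by (simp add: decseq_def add_mono)

text \<open>The sequence \<alpha> + \<beta> majorises both given ones and is again decreasing and
  p-summable with dyadic weights. Ranks add, which the constant in front of 2^k absorbs.\<close>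

lemma sch_add:
  assumes S: "sch p n V W S" and T: "sch p n V W T" and W: "csubspace W" and p: "0 \<le> p"
  shows "sch p n V W (\<lambda>x. S x + T x)"
proof -
  obtain q C \<alpha> where S1: "decseq \<alpha>" "\<And>k. 0 \<le> \<alpha> k" "0 \<le> C" "summable (\<lambda>k. 2 ^ k * \<alpha> k powr p)"
    "\<And>k. approx V W S (q * 2 ^ k) (C * \<alpha> k ^ n)" by (rule schE[OF S], rule that)
  obtain q' C' \<beta> where T1: "decseq \<beta>" "\<And>k. 0 \<le> \<beta> k" "0 \<le> C'" "summable (\<lambda>k. 2 ^ k * \<beta> k powr p)"
    "\<And>k. approx V W T (q' * 2 ^ k) (C' * \<beta> k ^ n)" by (rule schE[OF T], rule that)
  have "approx V W (\<lambda>x. S x + T x) ((q + q') * 2 ^ k) ((C + C') * (\<alpha> k + \<beta> k) ^ n)" for k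
  proof (rule approx_mono[OF approx_add[OF S1(5)[of k] T1(5)[of k] W]])
    have "\<alpha> k ^ n \<le> (\<alpha> k + \<beta> k) ^ n" "\<beta> k ^ n \<le> (\<alpha> k + \<beta> k) ^ n"
      using S1(2)[of k] T1(2)[of k] by (auto intro!: power_mono)
    then show "C * \<alpha> k ^ n + C' * \<beta> k ^ n \<le> (C + C') * (\<alpha> k + \<beta> k) ^ n"
      using S1(3) T1(3) by (simp add: distrib_right add_mono mult_left_mono)
  qed (simp add: distrib_right)
  then show ?thesis unfolding sch_def
    using bounded_op_add[OF sch_bounded_op[OF S] sch_bounded_op[OF T] W] decseq_add[OF S1(1) T1(1)]
      summable_powr_add[OF S1(2) T1(2) p S1(4) T1(4)] S1(2,3) T1(2,3)
    by (intro conjI exI[of _ "q + q'"] exI[of _ "C + C'"] exI[of _ "\<lambda>k. \<alpha> k + \<beta> k"]) auto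
qed

lemma sch_scale:
  assumes S: "sch p n V W S" and W: "csubspace W" shows "sch p n V W (\<lambda>x. c *\<^sub>C S x)"
proof -
  obtain q C \<alpha> where S1: "decseq \<alpha>" "\<And>k. 0 \<le> \<alpha> k" "0 \<le> C" "summable (\<lambda>k. 2 ^ k * \<alpha> k powr p)"
    "\<And>k. approx V W S (q * 2 ^ k) (C * \<alpha> k ^ n)" by (rule schE[OF S], rule that)
  have "approx V W (\<lambda>x. c *\<^sub>C S x) (q * 2 ^ k) (cmod c * C * \<alpha> k ^ n)" for k
    using approx_scale[OF S1(5)[of k] W, of c] by (simp add: mult.assoc)
  then show ?thesis unfolding sch_def
    using bounded_op_scale[OF sch_bounded_op[OF S] W] S1
    by (intro conjI exI[of _ q] exI[of _ "cmod c * C"] exI[of _ \<alpha>]) auto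
qed

text \<open>Hoelder's inequality in this encoding: \<beta>^j \<alpha>^i is at most (\<alpha> +
  \<beta>)^(i + j). This is the reason for bounding by powers of one p-summable sequence instead of
  working with the exponent p / n.\<close>

lemma sch_comp:
  assumes S: "sch p i V W S" and T: "sch p j W U T"
    and sub: "csubspace V" "csubspace W" "csubspace U" and p: "0 \<le> p"
  shows "sch p (i + j) V U (\<lambda>x. T (S x))"
proof -
  obtain q C \<alpha> where S1: "decseq \<alpha>" "\<And>k. 0 \<le> \<alpha> k" "0 \<le> C" "summable (\<lambda>k. 2 ^ k * \<alpha> k powr p)"
    "\<And>k. approx V W S (q * 2 ^ k) (C * \<alpha> k ^ i)" by (rule schE[OF S], rule that)
  obtain q' C' \<beta> where T1: "decseq \<beta>" "\<And>k. 0 \<le> \<beta> k" "0 \<le> C'" "summable (\<lambda>k. 2 ^ k * \<beta> k powr p)"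
    "\<And>k. approx W U T (q' * 2 ^ k) (C' * \<beta> k ^ j)" by (rule schE[OF T], rule that)
  have "approx V U (\<lambda>x. T (S x)) ((q' + q) * 2 ^ k) ((C' * C) * (\<alpha> k + \<beta> k) ^ (i + j))" for k
  proof (rule approx_mono)
    show "approx V U (\<lambda>x. T (S x)) (q' * 2 ^ k + q * 2 ^ k) ((C' * \<beta> k ^ j) * (C * \<alpha> k ^ i))"
      using T1(2,3) by (intro approx_comp[OF sch_bounded_op[OF S] S1(5) sch_bounded_op[OF T] T1(5) sub]) simp
    have "\<beta> k ^ j * \<alpha> k ^ i \<le> (\<alpha> k + \<beta> k) ^ j * (\<alpha> k + \<beta> k) ^ i"
      using S1(2)[of k] T1(2)[of k] by (intro mult_mono power_mono) auto
    from mult_left_mono[OF this, of "C' * C"]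
    show "(C' * \<beta> k ^ j) * (C * \<alpha> k ^ i) \<le> (C' * C) * (\<alpha> k + \<beta> k) ^ (i + j)"
      using S1(3) T1(3) by (simp add: power_add mult_ac)
  qed (simp add: distrib_right)
  then show ?thesis unfolding sch_def
    using bounded_op_comp[OF sch_bounded_op[OF S] sch_bounded_op[OF T]] decseq_add[OF S1(1) T1(1)]
      summable_powr_add[OF S1(2) T1(2) p S1(4) T1(4)] S1(2,3) T1(2,3)
    by (intro conjI exI[of _ "q' + q"] exI[of _ "C' * C"] exI[of _ "\<lambda>k. \<alpha> k + \<beta> k"]) auto
qed

text \<open>A decreasing sequence stays below its first term, so the surplus factor
  \<open>\<alpha> k powr (n - p)\<close> is bounded by
  \<open>\<alpha> 0 powr (n - p)\<close>.\<close>

lemma summable_dyadic_power: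
  fixes \<alpha> :: "nat \<Rightarrow> real"
  assumes "decseq \<alpha>" "\<And>k. 0 \<le> \<alpha> k" "1 \<le> p" "p \<le> real n" "summable (\<lambda>k. 2 ^ k * \<alpha> k powr p)"
  shows "summable (\<lambda>k. 2 ^ k * \<alpha> k ^ n)"
proof (rule summable_comparison_test')
  show "summable (\<lambda>k. \<alpha> 0 powr (n - p) * (2 ^ k * \<alpha> k powr p))"
    using assms(5) by (rule summable_mult)
  fix k
  have "\<alpha> k ^ n \<le> \<alpha> 0 powr (n - p) * \<alpha> k powr p"
  proof (cases "\<alpha> k = 0")
    case True
    have "0 < real n" using assms(3,4) by linarith
    then show ?thesis by (simp add: True zero_power)
  next
    case False
    then have pos: "0 < \<alpha> k" using assms(2)[of k] by simp
    have "\<alpha> k ^ n = \<alpha> k powr ((n - p) + p)" using pos by (simp add: powr_realpow)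
    also have "\<dots> = \<alpha> k powr (n - p) * \<alpha> k powr p" by (rule powr_add)
    also have "\<dots> \<le> \<alpha> 0 powr (n - p) * \<alpha> k powr p"
      using decseqD[OF assms(1), of 0 k] assms(2,4) by (intro mult_right_mono powr_mono2) auto
    finally show ?thesis .
  qed
  from mult_left_mono[OF this, of "2 ^ k"]
  show "norm (2 ^ k * \<alpha> k ^ n) \<le> \<alpha> 0 powr (n - p) * (2 ^ k * \<alpha> k powr p)"
    using assms(2)[of k] by (simp add: mult_ac)
qed

lemma sch_nuclear:
  fixes T :: "'h::complex_hilbert \<Rightarrow> 'h"
  assumes T: "sch p n V W T" and "1 \<le> p" "p \<le> real n" and V: "csubspace V" and W: "csubspace W"
  obtains J :: "(nat \<times> 'h) set" and f u a where "nuclear_rep V W T J f u a"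
proof -
  obtain q C \<alpha> where S1: "decseq \<alpha>" "\<And>k. 0 \<le> \<alpha> k" "0 \<le> C" "summable (\<lambda>k. 2 ^ k * \<alpha> k powr p)"
    "\<And>k. approx V W T (q * 2 ^ k) (C * \<alpha> k ^ n)" by (rule schE[OF T], rule that)
  obtain B where B: "0 \<le> B" "\<And>x. x \<in> V \<Longrightarrow> norm (T x) \<le> B * norm x"
    using bounded_opE[OF sch_bounded_op[OF T]] by metis
  have "summable (\<lambda>k. C * (2 ^ k * \<alpha> k ^ n))"
    using summable_dyadic_power[OF S1(1,2) assms(2,3) S1(4)] by (rule summable_mult)
  then have s: "summable (\<lambda>k. 2 ^ k * (C * \<alpha> k ^ n))" by (simp add: mult_ac)
  have c0: "0 \<le> C * \<alpha> k ^ n" for k using S1(2,3) by simp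
  show ?thesis
    using nuclear_from_approx[OF sch_bounded_op[OF T] B(2,1) V W c0 S1(5) s] that by metis
qed

text \<open>The norm bound \<open>N\<close> enters separately from the approximation bounds
  \<open>c\<close>, so that both can be made small for the remainders in the rotation
  argument.\<close>

lemma nuclear_trace_le:
  fixes T :: "'h::complex_hilbert \<Rightarrow> 'h"
  assumes T: "bounded_op V V T" "\<And>x. x \<in> V \<Longrightarrow> norm (T x) \<le> N * norm x" "0 \<le> N"
    and V: "hilbert_space V"
    and c: "\<And>k. 0 \<le> c k" "\<And>k. approx V V T (q * 2 ^ k) (c k)" "summable (\<lambda>k. 2 ^ k * c k)"
    and t: "has_trace V T t"
  shows "cmod t \<le> q * N + 6 * q * (\<Sum>k. 2 ^ k * c k)"
proof -
  have sV: "csubspace V" using V by (simp add: hilbert_space_def)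
  obtain J :: "(nat \<times> 'h) set" and f u a
    where "nuclear_rep V V T J f u a" "infsum a J \<le> q * N + 6 * q * (\<Sum>k. 2 ^ k * c k)"
    by (rule nuclear_from_approx[OF T sV sV c], assumption, rule that)
  then show ?thesis using nuclear_trace_bound[OF _ V] op_trace_eq[OF V t] by fastforce
qed

text \<open>A finite rank operator is its own approximant, so the error 0 is admissible at every
  level.\<close>

lemma finite_rank_nuclear:
  fixes R :: "'h::complex_hilbert \<Rightarrow> 'h"
  assumes R: "bounded_op V W R" "rank_le V R n" and V: "csubspace V" and W: "csubspace W"
  obtains J :: "(nat \<times> 'h) set" and f u a where "nuclear_rep V W R J f u a"
proof -
  obtain B where B: "0 \<le> B" "\<And>x. x \<in> V \<Longrightarrow> norm (R x) \<le> B * norm x"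
    by (rule bounded_opE[OF R(1)], rule that)
  have "rank_le V R (n * 2 ^ k)" for k
    by (rule rank_le_mono[OF R(2)]) simp
  then have ap: "approx V W R (n * 2 ^ k) 0" for k
    using R(1) unfolding approx_def by (intro exI[of _ R]) simp
  show ?thesis
    by (rule nuclear_from_approx[where c = "\<lambda>k. 0" and q = n, OF R(1) B(2,1) V W]) (simp_all add: ap that)
qed

section \<open>Cyclicity of the trace\<close>

lemma has_trace_diff: "has_trace V S s \<Longrightarrow> has_trace V T t \<Longrightarrow> has_trace V (\<lambda>x. S x - T x) (s - t)"
  using has_trace_add[OF _ has_trace_scale[of V T t "-1"]] by fastforce

text \<open>The numbers \<open>\<alpha> (max k N)\<close> will bound the approximation errors of the
  remainder after the \<open>N\<close>-th approximant: constant up to level \<open>N\<close>,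
  unchanged beyond it. Tannery's theorem applies with \<open>\<alpha> k * \<beta> k\<close> as
  dominating series.\<close>

lemma tail_sum_tendsto_0:
  fixes \<alpha> \<beta> :: "nat \<Rightarrow> real"
  assumes \<alpha>: "decseq \<alpha>" "\<And>k. 0 \<le> \<alpha> k" "\<alpha> \<longlonglongrightarrow> 0" and \<beta>: "\<And>k. 0 \<le> \<beta> k"
    and s: "summable (\<lambda>k. \<alpha> k * \<beta> k)"
  shows "summable (\<lambda>k. \<alpha> (max k N) * \<beta> k)" "(\<lambda>N. \<Sum>k. \<alpha> (max k N) * \<beta> k) \<longlonglongrightarrow> 0"
proof -
  have le: "norm (\<alpha> (max k N) * \<beta> k) \<le> \<alpha> k * \<beta> k" for k N
    using decseqD[OF \<alpha>(1), of k "max k N"] \<alpha>(2) \<beta> by (simp add: abs_mult mult_right_mono)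
  show "summable (\<lambda>k. \<alpha> (max k N) * \<beta> k)"
    by (rule summable_comparison_test'[OF s]) (rule le)
  have lim: "(\<lambda>N. \<alpha> (max k N) * \<beta> k) \<longlonglongrightarrow> 0" for k
  proof (rule tendsto_mult_left_zero, rule Lim_transform_eventually[OF \<alpha>(3)])
    show "\<forall>\<^sub>F N in sequentially. \<alpha> N = \<alpha> (max k N)"
      by (rule eventually_sequentiallyI[of k]) (simp add: max_def)
  qed
  have ev: "\<forall>\<^sub>F (k, N) in sequentially \<times>\<^sub>F sequentially. norm (\<alpha> (max k N) * \<beta> k) \<le> \<alpha> k * \<beta> k"
    using le by (intro always_eventually) auto
  have "(\<lambda>N. \<Sum>k. \<alpha> (max k N) * \<beta> k) \<longlonglongrightarrow> (\<Sum>k. 0)"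
    using tannerys_theorem[where a = "\<lambda>k N. \<alpha> (max k N) * \<beta> k" and b = "\<lambda>k. 0" and M = "\<lambda>k. \<alpha> k * \<beta> k"
        and F = sequentially, OF lim ev s] by simp
  then show "(\<lambda>N. \<Sum>k. \<alpha> (max k N) * \<beta> k) \<longlonglongrightarrow> 0" by simp
qed

lemma dyadic_null:
  fixes \<alpha> :: "nat \<Rightarrow> real"
  assumes "\<And>k. 0 \<le> \<alpha> k" "0 < p" "summable (\<lambda>k. 2 ^ k * \<alpha> k powr p)"
  shows "\<alpha> \<longlonglongrightarrow> 0"
proof -
  have "(\<lambda>k. \<alpha> k powr p) \<longlonglongrightarrow> 0"
  proof (rule Lim_null_comparison)
    show "(\<lambda>k. 2 ^ k * \<alpha> k powr p) \<longlonglongrightarrow> 0" using assms(3) by (rule summable_LIMSEQ_zero)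
    have "1 * \<alpha> k powr p \<le> 2 ^ k * \<alpha> k powr p" for k by (intro mult_right_mono) auto
    then show "\<forall>\<^sub>F k in sequentially. norm (\<alpha> k powr p) \<le> 2 ^ k * \<alpha> k powr p" by simp
  qed
  then have "(\<lambda>k. (\<alpha> k powr p) powr (1 / p)) \<longlonglongrightarrow> 0 powr (1 / p)"
    using assms(2) by (intro tendsto_powr') auto
  then show ?thesis using assms(1,2) by (simp add: powr_powr)
qed

text \<open>\<open>A = R\<^sub>N + D\<^sub>N\<close> with \<open>R\<^sub>N\<close> of finite rank, and the traces of \<open>D\<^sub>N B\<close> and \<open>B D\<^sub>N\<close> tend to \<open>0\<close>.\<close>

lemma sch_trace_rotate:
  fixes A B :: "'h::complex_hilbert \<Rightarrow> 'h"
  assumes A: "sch p i V W A" and B: "sch p j W V B" and p: "1 \<le> p" "p \<le> real (i + j)"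
    and V: "hilbert_space V" and W: "hilbert_space W"
  shows "\<exists>t. has_trace W (\<lambda>x. A (B x)) t \<and> has_trace V (\<lambda>x. B (A x)) t"
proof (cases "i = 0")
  \<comment> \<open>For \<open>i = 0\<close> the operator \<open>A\<close> is merely bounded and its
    approximants need not converge to it; but then \<open>p \<le> real j\<close> makes
    \<open>B\<close> nuclear.\<close>
  case True
  have sV: "csubspace V" and sW: "csubspace W" using V W by (simp_all add: hilbert_space_def)
  have pj: "p \<le> real j" using p(2) True by simp
  obtain J :: "(nat \<times> 'h) set" and f u a where "nuclear_rep W V B J f u a"
    by (rule sch_nuclear[OF B p(1) pj sW sV], rule that)
  from trace_rotate_nuclear[OF this sch_bounded_op[OF B] sch_bounded_op[OF A] sW sV]
  show ?thesis by blast
next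
  case False
  have sV: "csubspace V" and sW: "csubspace W" using V W by (simp_all add: hilbert_space_def)
  note bA = sch_bounded_op[OF A] and bB = sch_bounded_op[OF B]
  obtain q C \<alpha> where A1: "decseq \<alpha>" "\<And>k. 0 \<le> \<alpha> k" "0 \<le> C" "summable (\<lambda>k. 2 ^ k * \<alpha> k powr p)"
    "\<And>k. approx V W A (q * 2 ^ k) (C * \<alpha> k ^ i)" by (rule schE[OF A], rule that)
  obtain q' C' \<beta> where B1: "decseq \<beta>" "\<And>k. 0 \<le> \<beta> k" "0 \<le> C'" "summable (\<lambda>k. 2 ^ k * \<beta> k powr p)"
    "\<And>k. approx W V B (q' * 2 ^ k) (C' * \<beta> k ^ j)" by (rule schE[OF B], rule that)
  obtain b where b: "0 \<le> b" "\<And>x. x \<in> W \<Longrightarrow> norm (B x) \<le> b * norm x"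
    by (rule bounded_opE[OF bB], rule that)
  have "\<exists>R. \<forall>k. bounded_op V W (R k) \<and> rank_le V (R k) (q * 2 ^ k) \<and>
      (\<forall>x\<in>V. norm (A x - R k x) \<le> (C * \<alpha> k ^ i) * norm x)"
    by (rule choice) (use A1(5) in \<open>simp add: approx_def\<close>)
  then obtain R where R: "\<And>k. bounded_op V W (R k)" "\<And>k. rank_le V (R k) (q * 2 ^ k)"
      "\<And>k x. x \<in> V \<Longrightarrow> norm (A x - R k x) \<le> (C * \<alpha> k ^ i) * norm x"
    by blast
  have AB: "sch p (i + j) W W (\<lambda>x. A (B x))"
    using sch_comp[OF B A sW sV sW] p by (simp add: add.commute)
  obtain J1 :: "(nat \<times> 'h) set" and f1 u1 a1 where "nuclear_rep W W (\<lambda>x. A (B x)) J1 f1 u1 a1"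
    by (rule sch_nuclear[OF AB p sW sW], rule that)
  then obtain t1 where t1: "has_trace W (\<lambda>x. A (B x)) t1" using nuclear_has_trace[OF _ sW] by blast
  have BA: "sch p (i + j) V V (\<lambda>x. B (A x))" using sch_comp[OF A B sV sW sV] p by simp
  obtain J2 :: "(nat \<times> 'h) set" and f2 u2 a2 where "nuclear_rep V V (\<lambda>x. B (A x)) J2 f2 u2 a2"
    by (rule sch_nuclear[OF BA p sV sV], rule that)
  then obtain t2 where t2: "has_trace V (\<lambda>x. B (A x)) t2" using nuclear_has_trace[OF _ sV] by blast
  define \<gamma> where "\<gamma> k = C * \<alpha> k ^ i" for k
  define \<eta> where "\<eta> k = C' * \<beta> k ^ j" for k
  have \<gamma>: "decseq \<gamma>" "\<And>k. 0 \<le> \<gamma> k" and \<eta>: "\<And>k. 0 \<le> \<eta> k"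
    using A1(1-3) B1(2,3) by (auto simp: \<gamma>_def \<eta>_def decseq_def intro!: mult_left_mono power_mono)
  have "(\<lambda>k. C * \<alpha> k ^ i) \<longlonglongrightarrow> C * 0 ^ i"
    using dyadic_null[OF A1(2) _ A1(4)] p(1) by (intro tendsto_intros) auto
  then have \<gamma>0: "\<gamma> \<longlonglongrightarrow> 0" using False by (simp add: \<gamma>_def[abs_def] zero_power)
  have "summable (\<lambda>k. (C * C') * (2 ^ k * (\<alpha> k + \<beta> k) ^ (i + j)))"
    using A1(2) B1(2) p(1)
    by (intro summable_mult summable_dyadic_power[OF decseq_add[OF A1(1) B1(1)] _ p]
        summable_powr_add[OF A1(2) B1(2) _ A1(4) B1(4)]) auto
  then have s: "summable (\<lambda>k. \<gamma> k * (2 ^ k * \<eta> k))"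
  proof (rule summable_comparison_test')
    fix k
    have "\<alpha> k ^ i * \<beta> k ^ j \<le> (\<alpha> k + \<beta> k) ^ i * (\<alpha> k + \<beta> k) ^ j"
      using A1(2)[of k] B1(2)[of k] by (intro mult_mono power_mono) auto
    from mult_left_mono[OF this, of "(C * C') * 2 ^ k"]
    show "norm (\<gamma> k * (2 ^ k * \<eta> k)) \<le> (C * C') * (2 ^ k * (\<alpha> k + \<beta> k) ^ (i + j))"
      using A1(2,3) B1(2,3) by (simp add: \<gamma>_def \<eta>_def power_add mult_ac)
  qed
  \<comment> \<open>The remainder of \<open>A\<close> has approximants of rank at most
    \<open>2 * q * 2 ^ k\<close>, those of \<open>B\<close> have rank at most
    \<open>q' * 2 ^ k\<close>, and the ranks add in a product.\<close>
  define q2 where "q2 = 2 * q + q'"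
  define K where "K N = q2 * (\<gamma> N * b) + 6 * real q2 * (\<Sum>k. \<gamma> (max k N) * (2 ^ k * \<eta> k))" for N
  note tail = tail_sum_tendsto_0[OF \<gamma> \<gamma>0 _ s]
  have tail': "summable (\<lambda>k. 2 ^ k * (\<gamma> (max k N) * \<eta> k))"
    "(\<Sum>k. 2 ^ k * (\<gamma> (max k N) * \<eta> k)) = (\<Sum>k. \<gamma> (max k N) * (2 ^ k * \<eta> k))" for N
    using tail(1)[of N] \<eta> by (simp_all add: mult_ac)
  have "K \<longlonglongrightarrow> real q2 * (0 * b) + 6 * real q2 * 0"
    unfolding K_def[abs_def]
    by (intro tendsto_add tendsto_mult tendsto_const \<gamma>0 tail(2)) (simp add: \<eta>)
  then have K0: "K \<longlonglongrightarrow> 0" by simp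
  have main: "cmod (t1 - t2) \<le> 2 * K N" for N
  proof -
    define D where "D x = A x - R N x" for x
    have bD: "bounded_op V W D" unfolding D_def by (rule bounded_op_diff[OF bA R(1) sW])
    have nD: "norm (D x) \<le> \<gamma> N * norm x" if "x \<in> V" for x
      using R(3)[OF that] by (simp add: D_def \<gamma>_def)
    \<comment> \<open>Up to level \<open>N\<close> the approximant 0 suffices because
      \<open>D\<close> has norm at most \<open>\<gamma> N\<close>. Beyond it,
      \<open>R k - R N\<close> approximates \<open>D\<close> exactly as well as \<open>R k\<close>
      approximates \<open>A\<close>.\<close>
    have aD: "approx V W D (2 * q * 2 ^ k) (\<gamma> (max k N))" for k
    proof (cases "k \<le> N")
      case True
      then show ?thesis
        using approx_norm[OF sW, of V D "\<gamma> N"] nD by (auto intro: approx_mono simp: max_def)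
    next
      case False
      then have "q * 2 ^ N \<le> q * 2 ^ k" by simp
      then have "rank_le V (\<lambda>x. R k x - R N x) (2 * q * 2 ^ k)"
        by (intro rank_le_mono[OF rank_le_diff[OF R(2)[of k] R(2)[of N]]]) linarith
      moreover have "max k N = k" using False by simp
      ultimately show ?thesis unfolding approx_def
        using bounded_op_diff[OF R(1)[of k] R(1)[of N] sW] R(3)[of _ k]
        by (intro exI[of _ "\<lambda>x. R k x - R N x"]) (simp add: D_def \<gamma>_def)
    qed
    \<comment> \<open>The finite rank part has one trace \<open>s\<close> in both orders, so
      \<open>t1 - t2\<close> is controlled by the traces of the two products of \<open>D\<close> and
      \<open>B\<close>.\<close>
    obtain J :: "(nat \<times> 'h) set" and f u a where "nuclear_rep V W (R N) J f u a"
      by (rule finite_rank_nuclear[OF R(1)[of N] R(2)[of N] sV sW], rule that)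
    from trace_rotate_nuclear[OF this R(1) bB sV sW] obtain s
      where s: "has_trace W (\<lambda>x. R N (B x)) s" "has_trace V (\<lambda>x. B (R N x)) s" by blast
    have c0: "0 \<le> \<gamma> (max k N) * \<eta> k" for k using \<gamma>(2) \<eta> by simp
    have 1: "cmod (t1 - s) \<le> K N"
      unfolding K_def tail'(2)[symmetric]
    proof (rule nuclear_trace_le[where T = "\<lambda>x. D (B x)" and V = W and c = "\<lambda>k. \<gamma> (max k N) * \<eta> k"])
      show "hilbert_space W" by fact
      show "0 \<le> \<gamma> (max k N) * \<eta> k" for k by (rule c0)
      show "summable (\<lambda>k. 2 ^ k * (\<gamma> (max k N) * \<eta> k))" by (rule tail'(1))
      show "bounded_op W W (\<lambda>x. D (B x))" by (rule bounded_op_comp[OF bB bD])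
      show "norm (D (B x)) \<le> \<gamma> N * b * norm x" if "x \<in> W" for x
        using nD[OF bounded_op_mem[OF bB that]] mult_left_mono[OF b(2)[OF that] \<gamma>(2)[of N]]
        by (simp add: mult.assoc)
      show "0 \<le> \<gamma> N * b" using \<gamma>(2) b(1) by simp
      show "approx W W (\<lambda>x. D (B x)) (q2 * 2 ^ k) (\<gamma> (max k N) * \<eta> k)" for k
        using approx_comp[OF bB B1(5)[of k] bD aD[of k] sW sV sW \<gamma>(2)]
        by (simp add: q2_def \<eta>_def distrib_right)
      show "has_trace W (\<lambda>x. D (B x)) (t1 - s)"
        unfolding D_def by (rule has_trace_diff[OF t1 s(1)])
    qed
    have 2: "cmod (t2 - s) \<le> K N"
      unfolding K_def tail'(2)[symmetric]
    proof (rule nuclear_trace_le[where T = "\<lambda>x. B (D x)" and V = V and c = "\<lambda>k. \<gamma> (max k N) * \<eta> k"])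
      show "hilbert_space V" by fact
      show "0 \<le> \<gamma> (max k N) * \<eta> k" for k by (rule c0)
      show "summable (\<lambda>k. 2 ^ k * (\<gamma> (max k N) * \<eta> k))" by (rule tail'(1))
      show "bounded_op V V (\<lambda>x. B (D x))" by (rule bounded_op_comp[OF bD bB])
      show "norm (B (D x)) \<le> \<gamma> N * b * norm x" if "x \<in> V" for x
        using b(2)[OF bounded_op_mem[OF bD that]] mult_left_mono[OF nD[OF that] b(1)]
        by (simp add: mult_ac)
      show "0 \<le> \<gamma> N * b" using \<gamma>(2) b(1) by simp
      have "0 \<le> C' * \<beta> k ^ j" for k using \<eta> by (simp add: \<eta>_def)
      then show "approx V V (\<lambda>x. B (D x)) (q2 * 2 ^ k) (\<gamma> (max k N) * \<eta> k)" for k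
        using approx_comp[OF bD aD[of k] bB B1(5)[of k] sV sW sV]
        by (simp add: q2_def \<eta>_def algebra_simps)
      have "has_trace V (\<lambda>x. B (A x) - B (R N x)) (t2 - s)" by (rule has_trace_diff[OF t2 s(2)])
      then show "has_trace V (\<lambda>x. B (D x)) (t2 - s)"
        by (rule has_trace_cong)
          (simp add: D_def clinear_on_diff[OF bounded_op_linear[OF bB] sW] bounded_op_mem[OF bA]
            bounded_op_mem[OF R(1)])
    qed
    have "cmod (t1 - t2) \<le> cmod (t1 - s) + cmod (t2 - s)"
      using norm_triangle_ineq4[of "t1 - s" "t2 - s"] by simp
    with 1 2 show ?thesis by linarith
  qed
  have "(\<lambda>N. 2 * K N) \<longlonglongrightarrow> 2 * 0" by (intro tendsto_intros K0)
  then have "cmod (t1 - t2) \<le> 2 * 0" by (rule LIMSEQ_le_const) (use main in blast)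
  then show ?thesis using t1 t2 by auto
qed

section \<open>Singular values and the Schatten class\<close>

lemma op_norm_le:
  assumes T: "bounded_op V W T" and V: "csubspace V" and x: "x \<in> V"
  shows "norm (T x) \<le> op_norm V T * norm x"
proof (cases "x = 0")
  case True
  then show ?thesis using clinear_on_zero[OF bounded_op_linear[OF T] V] by simp
next
  case False
  obtain B where B: "0 \<le> B" "\<And>x. x \<in> V \<Longrightarrow> norm (T x) \<le> B * norm x"
    by (rule bounded_opE[OF T], rule that)
  have bdd: "bdd_above ((\<lambda>x. norm (T x)) ` {x \<in> V. norm x \<le> 1})"
  proof (rule bdd_aboveI2)
    fix x assume "x \<in> {x \<in> V. norm x \<le> 1}"
    then show "norm (T x) \<le> B" using B(2)[of x] mult_left_mono[of "norm x" 1 B] B(1) by auto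
  qed
  define y where "y = inverse (of_real (norm x)) *\<^sub>C x"
  have y: "y \<in> V" "norm y \<le> 1" using V x False by (auto simp: y_def cvs.subspace_scale norm_inverse norm_divide)
  then have "norm (T y) \<le> op_norm V T"
    unfolding op_norm_def using bdd by (intro cSUP_upper) auto
  moreover have "norm (T y) = norm (T x) / norm x"
    unfolding y_def clinear_on_scale[OF bounded_op_linear[OF T] x]
    by (simp add: norm_inverse norm_divide divide_inverse mult.commute)
  ultimately show ?thesis using False by (simp add: divide_le_eq)
qed

lemma op_norm_nonneg:
  assumes T: "bounded_op V W T" and V: "csubspace V" shows "0 \<le> op_norm V T"
proof -
  obtain B where B: "0 \<le> B" "\<And>x. x \<in> V \<Longrightarrow> norm (T x) \<le> B * norm x"
    by (rule bounded_opE[OF T], rule that)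
  have bdd: "bdd_above ((\<lambda>x. norm (T x)) ` {x \<in> V. norm x \<le> 1})"
  proof (rule bdd_aboveI2)
    fix x assume "x \<in> {x \<in> V. norm x \<le> 1}"
    then show "norm (T x) \<le> B" using B(2)[of x] mult_left_mono[of "norm x" 1 B] B(1) by auto
  qed
  have "norm (T 0) \<le> op_norm V T"
    unfolding op_norm_def using bdd V by (intro cSUP_upper) (auto simp: cvs.subspace_0)
  then show ?thesis using norm_ge_zero order_trans by blast
qed

text \<open>The last fact asks for a strict inequality because the infimum over finite rank
  operators only provides approximants for every larger bound.\<close>

lemma singular_value_facts:
  assumes T: "bounded_op V W T" and V: "csubspace V" and W: "csubspace W"
  shows singular_value_nonneg: "0 \<le> singular_value V W T n"
    and singular_value_antimono: "m \<le> n \<Longrightarrow> singular_value V W T n \<le> singular_value V W T m"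
    and approx_singular_value: "singular_value V W T n < t \<Longrightarrow> approx V W T n t"
proof -
  define A where "A n = {op_norm V (\<lambda>x. T x - R x) | R. bounded_op V W R \<and> rank_le V R n}" for n
  have sv: "singular_value V W T n = Inf (A n)" for n by (simp add: singular_value_def A_def)
  have pos: "0 \<le> a" if "a \<in> A n" for a n
    using that op_norm_nonneg[OF bounded_op_diff[OF T _ W] V] by (auto simp: A_def)
  have ne: "A n \<noteq> {}" for n
    using bounded_op_zero[OF W, of V] by (auto simp: A_def rank_le_def intro!: exI[of _ "\<lambda>x. 0"] exI[of _ "{}"])
  have bdd: "bdd_below (A n)" for n by (rule bdd_belowI[of _ 0]) (rule pos)
  show "0 \<le> singular_value V W T n" unfolding sv by (rule cInf_greatest[OF ne pos])
  show "singular_value V W T n \<le> singular_value V W T m" if "m \<le> n"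
    unfolding sv using rank_le_mono[OF _ that]
    by (intro cInf_superset_mono ne bdd) (auto simp: A_def)
  show "approx V W T n t" if lt: "singular_value V W T n < t"
  proof -
    obtain a where "a \<in> A n" "a < t" using cInf_lessD[OF ne lt[unfolded sv]] by blast
    then obtain R where R: "bounded_op V W R" "rank_le V R n" "op_norm V (\<lambda>x. T x - R x) < t"
      by (auto simp: A_def)
    have "norm (T x - R x) \<le> t * norm x" if "x \<in> V" for x
    proof -
      have "norm (T x - R x) \<le> op_norm V (\<lambda>x. T x - R x) * norm x"
        using op_norm_le[OF bounded_op_diff[OF T R(1) W] V that] .
      also have "\<dots> \<le> t * norm x" using R(3) by (intro mult_right_mono) auto
      finally show ?thesis .
    qed
    then show ?thesis unfolding approx_def using R by blast
  qed
qed

text \<open>Cauchy condensation: the singular values decrease, so p-summability passes to the values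
  at \<open>2 ^ n\<close> with weight \<open>2 ^ n\<close>.\<close>

lemma schatten_class_sch:
  assumes T: "T \<in> schatten_class p V W" and V: "csubspace V" and W: "csubspace W" and p: "1 \<le> p"
  shows "sch p 1 V W T"
proof -
  have bT: "bounded_op V W T" and s: "summable (\<lambda>n. singular_value V W T n powr p)"
    using T by (auto simp: schatten_class_def)
  define \<sigma> where "\<sigma> n = singular_value V W T n" for n
  note facts = singular_value_facts[OF bT V W, folded \<sigma>_def]
  have "summable (\<lambda>n. 2 ^ n * \<sigma> (2 ^ n) powr p)"
  proof (subst condensation_test[symmetric, where f = "\<lambda>n. \<sigma> n powr p"])
    show "summable (\<lambda>n. \<sigma> n powr p)" using s by (simp add: \<sigma>_def)
  qed (use facts(1) facts(2)[OF le_SucI[OF order_refl]] p in \<open>auto intro!: powr_mono2\<close>)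
  \<comment> \<open>Adding \<open>(1/4) ^ n\<close> lifts the bound strictly above the singular
    value, as \<open>approx_singular_value\<close> requires. The ratio 1/4 still beats the weight
    \<open>2 ^ n\<close> since p is at least 1.\<close>
  moreover have "summable (\<lambda>n. 2 ^ n * ((1/4) ^ n) powr p)"
  proof (rule summable_comparison_test')
    show "summable (\<lambda>n. (1/2::real) ^ n)" by (rule summable_geometric) simp
    fix n
    have "((1/4::real) ^ n) powr p \<le> (1/4) ^ n"
      using powr_mono_both'[of 1 p "(1/4::real) ^ n" "(1/4) ^ n"] p by (simp add: power_le_one)
    from mult_left_mono[OF this, of "2 ^ n"]
    show "norm (2 ^ n * ((1/4::real) ^ n) powr p) \<le> (1/2) ^ n"
      by (simp add: power_mult_distrib[symmetric])
  qed
  ultimately have "summable (\<lambda>n. 2 ^ n * (\<sigma> (2 ^ n) + (1/4) ^ n) powr p)"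
    using facts(1) p by (intro summable_powr_add) auto
  moreover have "approx V W T (1 * 2 ^ k) (1 * (\<sigma> (2 ^ k) + (1/4) ^ k) ^ 1)" for k
    using facts(3)[of "2 ^ k"] by simp
  moreover have "decseq (\<lambda>k. \<sigma> (2 ^ k) + (1/4) ^ k)"
    by (rule decseq_add) (auto simp: decseq_def intro!: facts(2) power_decreasing power_increasing)
  moreover have "0 \<le> \<sigma> (2 ^ k) + (1/4) ^ k" for k using facts(1) by simp
  ultimately show ?thesis unfolding sch_def using bT
    by (intro conjI exI[of _ 1] exI[of _ "\<lambda>k. \<sigma> (2 ^ k) + (1/4) ^ k"]) auto
qed

section \<open>Faces and cyclic permutations of chains\<close>

text \<open>Unlike \<open>mor\<close> this reads the index cyclically, as \<open>obj\<close> does,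
  so that rotating a chain becomes a shift of the index.\<close>

definition fmor :: "('o, 'a) chain \<Rightarrow> nat \<Rightarrow> 'a"
  where "fmor l i = snd (l ! (i mod length l))"

lemma mor_eq_fmor: "i < length l \<Longrightarrow> mor l i = fmor l i"
  by (simp add: mor_def fmor_def)

lemma obj_mod: "obj l (i mod length l) = obj l i"
  by (simp add: obj_def)

lemma fmor_mod: "fmor l (i mod length l) = fmor l i"
  by (simp add: fmor_def)

lemma obj_add_length: "obj l (i + length l) = obj l i" "obj l (length l + i) = obj l i"
  by (simp_all add: obj_def)

lemma fmor_add_length: "fmor l (i + length l) = fmor l i" "fmor l (length l + i) = fmor l i"
  by (simp_all add: fmor_def)

lemma nth_obj_fmor: "i < length l \<Longrightarrow> l ! i = (obj l i, fmor l i)"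
  by (simp add: obj_def fmor_def)

lemma chains_length: "l \<in> chains C n \<Longrightarrow> length l = n + 1"
  by (simp add: chains_def)

text \<open>By periodicity the conditions at the indices up to \<open>n\<close> hold at all indices,
  which frees the later arguments from range conditions.\<close>

lemma chains_iff:
  "l \<in> chains C n \<longleftrightarrow> length l = n + 1 \<and>
    (\<forall>i. obj l i \<in> ob C \<and> fmor l i \<in> hom C (obj l (i + 1)) (obj l i))"
  (is "_ \<longleftrightarrow> ?len \<and> ?R")
proof (cases ?len)
  case True
  have w: "obj l (i mod length l + 1) = obj l (i + 1)" for i
    unfolding obj_def by (simp add: mod_simps)
  have le: "i mod length l \<le> n" for i
    using True by (simp add: less_Suc_eq_le[symmetric])
  have red: "P (obj l i) (fmor l i) (obj l (i + 1))"
    if "\<And>i. i \<le> n \<Longrightarrow> P (obj l i) (fmor l i) (obj l (i + 1))" for P i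
    using that[OF le[of i]] by (simp only: w obj_mod fmor_mod)
  have "l \<in> chains C n \<longleftrightarrow> (\<forall>i\<le>n. obj l i \<in> ob C \<and> fmor l i \<in> hom C (obj l (i + 1)) (obj l i))"
    unfolding chains_def using True by (auto simp: mor_eq_fmor)
  also have "\<dots> \<longleftrightarrow> ?R"
    using red[of "\<lambda>X f Y. X \<in> ob C \<and> f \<in> hom C Y X"] by blast
  finally show ?thesis using True by simp
qed (auto simp: chains_def)

lemma chains_obj: "l \<in> chains C n \<Longrightarrow> obj l i \<in> ob C"
  and chains_fmor: "l \<in> chains C n \<Longrightarrow> fmor l i \<in> hom C (obj l (i + 1)) (obj l i)"
  by (simp_all add: chains_iff)

lemma chains_wrap:
  assumes "l \<in> chains C n"
  shows "obj l (i + (n + 1)) = obj l i" "obj l (n + 1) = obj l 0"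
    "fmor l (i + (n + 1)) = fmor l i" "fmor l (n + 1) = fmor l 0"
  using obj_add_length[of l] fmor_add_length[of l] chains_length[OF assms]
  by (auto simp: obj_def fmor_def)

lemma chain_eqI:
  assumes "length l = length l'" "\<And>i. i < length l \<Longrightarrow> obj l i = obj l' i"
    "\<And>i. i < length l \<Longrightarrow> fmor l i = fmor l' i"
  shows "l = l'"
  using assms by (intro nth_equalityI) (simp_all add: nth_obj_fmor)

lemma obj_rotate: "l \<noteq> [] \<Longrightarrow> obj (rotate k l) i = obj l (i + k)"
  by (simp add: obj_def nth_rotate mod_simps add.commute)

lemma fmor_rotate: "l \<noteq> [] \<Longrightarrow> fmor (rotate k l) i = fmor l (i + k)"
  by (simp add: fmor_def nth_rotate mod_simps add.commute)

lemma obj_rotate1: "l \<noteq> [] \<Longrightarrow> obj (rotate1 l) i = obj l (i + 1)"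
  using obj_rotate[of l 1 i] by simp

lemma fmor_rotate1: "l \<noteq> [] \<Longrightarrow> fmor (rotate1 l) i = fmor l (i + 1)"
  using fmor_rotate[of l 1 i] by simp

lemma chains_not_Nil: "l \<in> chains C n \<Longrightarrow> l \<noteq> []"
  by (auto simp: chains_def)

lemma rotate_chains:
  assumes "l \<in> chains C n" shows "rotate k l \<in> chains C n"
  using assms chains_not_Nil[OF assms] by (simp add: chains_iff obj_rotate fmor_rotate)

lemma rotate_Suc_n: "length l = n + 1 \<Longrightarrow> rotate (n + 1) l = l"
  by (metis rotate_length01 rotate_id mod_self)

lemma comp_mem:
  assumes "linear_category C" "X \<in> ob C" "Y \<in> ob C" "Z \<in> ob C" "g \<in> hom C Y Z" "f \<in> hom C X Y"
  shows "comp C X Y Z g f \<in> hom C X Z"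
  using assms by (auto simp: linear_category_def cbilinear_on_def clinear_on_def)

section \<open>Faces and their behaviour under rotation\<close>

lemma length_face: "i + 1 < length l \<Longrightarrow> length (face C i l) = length l - 1"
  by (simp add: face_def)

lemma face_nth:
  assumes "i + 1 < length l" "j < length l - 1"
  shows "face C i l ! j = (if j < i then l ! j else if j = i
    then (obj l i, comp C (obj l (i + 2)) (obj l (i + 1)) (obj l i) (fmor l i) (fmor l (i + 1)))
    else l ! (j + 1))"
proof -
  have [simp]: "mor l i = fmor l i" "mor l (Suc i) = fmor l (Suc i)" using assms by (simp_all add: mor_eq_fmor)
  consider "j < i" | "j = i" | "j > i" by linarith
  then show ?thesis
  proof cases
    case 3
    then obtain k where "j = i + 1 + k" by (metis add.commute less_iff_Suc_add Suc_eq_plus1_left add.assoc)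
    then show ?thesis using assms by (simp add: face_def nth_append)
  qed (use assms in \<open>simp_all add: face_def nth_append\<close>)
qed

text \<open>The range for objects includes \<open>j = n + 1\<close>, one past the last entry, where
  both sides wrap around to the object of index 0. The source of the last morphism can then be
  treated like all others.\<close>

lemma
  assumes l: "l \<in> chains C (n + 1)" and i: "i \<le> n"
  shows obj_face: "j \<le> n + 1 \<Longrightarrow> obj (face C i l) j = obj l (if j \<le> i then j else j + 1)"
    and fmor_face: "j \<le> n \<Longrightarrow> fmor (face C i l) j = (if j < i then fmor l j else if j = i
      then comp C (obj l (i + 2)) (obj l (i + 1)) (obj l i) (fmor l i) (fmor l (i + 1)) else fmor l (j + 1))"
proof -
  have len: "length l = n + 2" using chains_length[OF l] by simp
  have lenf: "length (face C i l) = n + 1" using len i by (simp add: length_face)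
  note nth = face_nth[of i l _ C, unfolded len]
  have o: "obj (face C i l) j = obj l (if j \<le> i then j else j + 1)" if "j \<le> n" for j
    using that nth[of j] i lenf by (simp add: obj_def len)
  show "obj (face C i l) j = obj l (if j \<le> i then j else j + 1)" if "j \<le> n + 1"
  proof (cases "j \<le> n")
    case False
    then have "j = n + 1" using that by simp
    then have "obj (face C i l) j = obj (face C i l) 0" using lenf by (simp add: obj_def)
    also have "\<dots> = obj l 0" using o[of 0] by simp
    also have "\<dots> = obj l (j + 1)" using \<open>j = n + 1\<close> len by (simp add: obj_def)
    finally show ?thesis using \<open>j = n + 1\<close> i by simp
  qed (rule o)
  show "fmor (face C i l) j = (if j < i then fmor l j else if j = i
      then comp C (obj l (i + 2)) (obj l (i + 1)) (obj l i) (fmor l i) (fmor l (i + 1)) else fmor l (j + 1))"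
    if "j \<le> n"
    using that nth[of j] i lenf by (simp add: fmor_def len)
qed

lemma face_chains:
  assumes C: "linear_category C" and l: "l \<in> chains C (n + 1)" and i: "i \<le> n"
  shows "face C i l \<in> chains C n"
proof -
  have len: "length (face C i l) = n + 1" using chains_length[OF l] i by (simp add: length_face)
  have "obj (face C i l) j \<in> ob C \<and> fmor (face C i l) j \<in> hom C (obj (face C i l) (j + 1)) (obj (face C i l) j)"
    if j: "j \<le> n" for j
    using chains_obj[OF l] chains_fmor[OF l] j comp_mem[OF C] i
    by (auto simp: obj_face[OF l i] fmor_face[OF l i] numeral_eq_Suc)
  then show ?thesis unfolding chains_def using len by (auto simp: mor_eq_fmor)
qed

text \<open>On a list of length \<open>n + 2\<close>, \<open>rotate (n + 1)\<close> moves the last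
  entry to the front, where the face of index 0 merges it with the former first entry.\<close>

lemma last_face_eq:
  assumes "l \<in> chains C (n + 1)"
  shows "last_face C l = face C 0 (rotate (n + 1) l)"
proof -
  have len: "length l = n + 2" using chains_length[OF assms] by simp
  then obtain x l' y where l: "l = x # l' @ [y]" "length l' = n"
    by (metis (no_types, lifting) Suc_eq_plus1 add_2_eq_Suc' append_butlast_last_id length_Suc_conv
        length_append_singleton list.size(3) nat.simps(3) nat.inject)
  have "rotate (n + 1) l = y # x # l'"
    using rotate_append[of "x # l'" "[y]"] l by simp
  then show ?thesis
    using l len by (simp add: last_face_def face_def Let_def obj_def mor_def nth_append)
qed

lemma face_rotate1:
  assumes l: "l \<in> chains C (n + 1)" and i: "i < n"
  shows "face C i (rotate 1 l) = rotate 1 (face C (i + 1) l)"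
proof -
  have r: "rotate 1 l \<in> chains C (n + 1)" using l by (rule rotate_chains)
  have len: "length (face C i (rotate 1 l)) = n + 1" "length (face C (i + 1) l) = n + 1"
    using chains_length[OF l] i by (simp_all add: length_face)
  have [simp]: "l \<noteq> []" "face C (i + 1) l \<noteq> []" using chains_not_Nil[OF l] len by auto
  show ?thesis
  proof (rule chain_eqI)
    fix j assume "j < length (face C i (rotate 1 l))"
    then have j: "j \<le> n" using len by simp
    show "obj (face C i (rotate 1 l)) j = obj (rotate 1 (face C (i + 1) l)) j"
      unfolding obj_rotate[OF \<open>face C (i + 1) l \<noteq> []\<close>] using j i by (simp only: obj_face[OF r] obj_face[OF l]) (simp add: obj_rotate obj_rotate1)
    show "fmor (face C i (rotate 1 l)) j = fmor (rotate 1 (face C (i + 1) l)) j"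
    proof (cases "j < n")
      case True
      then show ?thesis
        unfolding fmor_rotate[OF \<open>face C (i + 1) l \<noteq> []\<close>] using j i
        by (simp only: fmor_face[OF r] fmor_face[OF l]) (simp add: obj_rotate fmor_rotate obj_rotate1 fmor_rotate1)
    next
      case False
      then have [simp]: "j = n" using j by simp
      have "fmor (rotate 1 (face C (i + 1) l)) n = fmor (face C (i + 1) l) 0"
        using len(2) unfolding fmor_rotate[OF \<open>face C (i + 1) l \<noteq> []\<close>] by (simp add: fmor_def)
      also have "\<dots> = fmor l 0" using fmor_face[OF l, of "i + 1" 0] i by simp
      also have "\<dots> = fmor l (n + 2)" using chains_wrap(4)[OF l] by simp
      also have "\<dots> = fmor (face C i (rotate 1 l)) n"
        using fmor_face[OF r, of i n] i by (simp add: fmor_rotate fmor_rotate1)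
      finally show ?thesis by simp
    qed
  qed (use len in simp)
qed

text \<open>After one rotation the last two entries are the last and the first entry of
  \<open>l\<close>, the pair merged by \<open>last_face\<close>.\<close>

lemma face_last_rotate1:
  assumes l: "l \<in> chains C (n + 1)"
  shows "face C n (rotate 1 l) = rotate 1 (last_face C l)"
proof -
  have r: "rotate 1 l \<in> chains C (n + 1)" and r': "rotate (n + 1) l \<in> chains C (n + 1)"
    using l by (simp_all only: rotate_chains)
  have len: "length (face C n (rotate 1 l)) = n + 1" "length (face C 0 (rotate (n + 1) l)) = n + 1"
    using chains_length[OF l] by (simp_all add: length_face)
  have [simp]: "l \<noteq> []" using chains_not_Nil[OF l] .
  have ne: "face C 0 (rotate (n + 1) l) \<noteq> []" using len by auto
  have w: "obj l (i + (n + 2)) = obj l i" "fmor l (i + (n + 2)) = fmor l i" for i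
    using chains_wrap(1,3)[OF l, of i] by simp_all
  show ?thesis unfolding last_face_eq[OF l]
  proof (rule chain_eqI)
    fix j assume "j < length (face C n (rotate 1 l))"
    then have j: "j \<le> n" using len by simp
    show "obj (face C n (rotate 1 l)) j = obj (rotate 1 (face C 0 (rotate (n + 1) l))) j"
      unfolding obj_rotate[OF ne] using j w(1)[of "j + 1"]
      by (simp only: obj_face[OF r] obj_face[OF r']) (simp add: obj_rotate obj_rotate1 add_ac)
    show "fmor (face C n (rotate 1 l)) j = fmor (rotate 1 (face C 0 (rotate (n + 1) l))) j"
    proof (cases "j < n")
      case True
      then show ?thesis
        unfolding fmor_rotate[OF ne] using j w(2)[of "j + 1"]
        by (simp only: fmor_face[OF r] fmor_face[OF r']) (simp add: fmor_rotate fmor_rotate1 obj_rotate obj_rotate1 add_ac)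
    next
      case False
      then have [simp]: "j = n" using j by simp
      have "fmor (rotate 1 (face C 0 (rotate (n + 1) l))) n = fmor (face C 0 (rotate (n + 1) l)) 0"
        using len(2) unfolding fmor_rotate[OF ne] by (simp add: fmor_def)
      also have "\<dots> = fmor (face C n (rotate 1 l)) n"
        using fmor_face[OF r', of 0 0] fmor_face[OF r, of n n] w[of 0] w[of 1]
        by (simp add: fmor_rotate obj_rotate obj_rotate1 fmor_rotate1 add_ac numeral_eq_Suc)
      finally show ?thesis by simp
    qed
  qed (use len in simp)
qed

lemma last_face_rotate1:
  assumes l: "l \<in> chains C (n + 1)"
  shows "last_face C (rotate 1 l) = face C 0 l"
proof -
  have "rotate (n + 1) (rotate 1 l) = l"
    using rotate_Suc_n[of l "n + 1"] chains_length[OF l] by (simp only: rotate_rotate)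
  then show ?thesis using last_face_eq[OF rotate_chains[OF l]] by metis
qed

text \<open>All n + 2 cyclic faces under one index, so that b becomes a single alternating
  sum.\<close>

definition cface :: "('o, 'a) lin_cat \<Rightarrow> nat \<Rightarrow> nat \<Rightarrow> ('o, 'a) chain \<Rightarrow> ('o, 'a) chain"
  where "cface C n i l = (if i \<le> n then face C i l else last_face C l)"

lemma cface_chains:
  assumes "linear_category C" "l \<in> chains C (n + 1)" shows "cface C n i l \<in> chains C n"
  using assms face_chains[OF assms(1) rotate_chains[OF assms(2)], of 0] face_chains[OF assms]
  by (simp add: cface_def last_face_eq del: rotate_Suc)

lemma cface_rotate1:
  assumes l: "l \<in> chains C (n + 1)" and "i \<le> n"
  shows "cface C n i (rotate 1 l) = rotate 1 (cface C n (i + 1) l)"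
  using assms face_rotate1[OF l, of i] face_last_rotate1[OF l] by (cases "i = n") (auto simp: cface_def)

lemma cface_rotate:
  assumes l: "l \<in> chains C (n + 1)"
  shows "i + j \<le> n + 1 \<Longrightarrow> cface C n i (rotate j l) = rotate j (cface C n (i + j) l)"
proof (induction j arbitrary: i)
  case (Suc j)
  have "cface C n i (rotate 1 (rotate j l)) = rotate 1 (cface C n (i + 1) (rotate j l))"
    using Suc.prems by (intro cface_rotate1 rotate_chains l) simp
  then show ?case using Suc.IH[of "i + 1"] Suc.prems by (simp add: rotate_rotate)
qed simp

text \<open>Merging shortens the list by one. When the position \<open>i + j\<close> passes the end,
  one of the \<open>j\<close> rotations is used up in turning the last face into the face of index
  0.\<close>

lemma cface_rotate_wrap:
  assumes C: "linear_category C" and l: "l \<in> chains C (n + 1)" and "i \<le> n" "j \<le> n + 1" "n + 2 \<le> i + j"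
  shows "cface C n i (rotate j l) = rotate (j - 1) (cface C n (i + j - (n + 2)) l)"
proof -
  define s where "s = n + 1 - i"
  define r where "r = i + j - (n + 2)"
  have j: "j = s + (1 + r)" and "i + s = n + 1" using assms by (auto simp: s_def r_def)
  have "cface C n i (rotate s (rotate (1 + r) l)) = rotate s (cface C n (n + 1) (rotate (1 + r) l))"
    using cface_rotate[OF rotate_chains[OF l], of i s "1 + r"] \<open>i + s = n + 1\<close> by simp
  also have "cface C n (n + 1) (rotate (1 + r) l) = cface C n 0 (rotate r l)"
    using last_face_rotate1[OF rotate_chains[OF l], of r] by (simp add: cface_def rotate_rotate)
  also have "\<dots> = rotate r (cface C n r l)"
    using cface_rotate[OF l, of 0 r] assms by (simp add: r_def)
  also have "rotate s (rotate r (cface C n r l)) = rotate (j - 1) (cface C n r l)"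
    unfolding rotate_rotate j by simp
  also have "rotate s (rotate (1 + r) l) = rotate j l"
    unfolding rotate_rotate j ..
  finally show ?thesis unfolding r_def .
qed

lemma hochschild_b_cface:
  assumes "l \<in> chains C (n + 1)"
  shows "hochschild_b C n \<phi> l = (\<Sum>i\<le>n + 1. (-1) ^ i * \<phi> (cface C n i l))"
proof -
  have "(\<Sum>i\<le>n + 1. (-1) ^ i * \<phi> (cface C n i l)) =
      (\<Sum>i\<le>n. (-1) ^ i * \<phi> (cface C n i l)) + (-1) ^ (n + 1) * \<phi> (cface C n (n + 1) l)"
    using sum.atMost_Suc[of "\<lambda>i. (-1) ^ i * \<phi> (cface C n i l)" n] by (simp only: Suc_eq_plus1)
  also have "(\<Sum>i\<le>n. (-1) ^ i * \<phi> (cface C n i l)) = (\<Sum>i\<le>n. (-1) ^ i * \<phi> (face C i l))"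
    by (intro sum.cong) (auto simp: cface_def)
  also have "cface C n (n + 1) l = last_face C l" by (simp add: cface_def)
  finally show ?thesis using assms by (simp only: hochschild_b_def if_True)
qed

definition bprime :: "('o, 'a) lin_cat \<Rightarrow> nat \<Rightarrow> (('o, 'a) chain \<Rightarrow> complex) \<Rightarrow> ('o, 'a) chain \<Rightarrow> complex"
  where "bprime C n \<phi> l = (if l \<in> chains C (n + 1) then \<Sum>i\<le>n. (-1) ^ i * \<phi> (face C i l) else 0)"

text \<open>The norm operator N. The operator \<lambda> rotates in the opposite direction, but the
  sum extends over the whole cyclic group of order n + 1, in which \<lambda> and its inverse have
  the same powers.\<close>

definition cyclic_sum :: "('o, 'a) lin_cat \<Rightarrow> nat \<Rightarrow> (('o, 'a) chain \<Rightarrow> complex) \<Rightarrow> ('o, 'a) chain \<Rightarrow> complex"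
  where "cyclic_sum C n \<phi> l = (if l \<in> chains C n then \<Sum>j\<le>n. (-1) ^ (n * j) * \<phi> (rotate j l) else 0)"

text \<open>The standard identity \<open>b N = N b'\<close>. The pair \<open>(k, j)\<close> on the left (merge at \<open>k\<close>, then rotate by \<open>j\<close>)
  corresponds to \<open>(j, k - j)\<close> or \<open>(j + 1, k + n + 1 - j)\<close> on the right (rotate first).\<close>

lemma hochschild_b_cyclic_sum:
  assumes C: "linear_category C"
  shows "hochschild_b C n (cyclic_sum C n \<phi>) = cyclic_sum C (n + 1) (bprime C n \<phi>)"
proof
  fix l
  show "hochschild_b C n (cyclic_sum C n \<phi>) l = cyclic_sum C (n + 1) (bprime C n \<phi>) l"
  proof (cases "l \<in> chains C (n + 1)")
    case l: True
    define L where "L = (\<lambda>(k, j). (-1) ^ k * ((-1) ^ (n * j) * \<phi> (rotate j (cface C n k l))))"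
    define R where "R = (\<lambda>(j, i). (-1) ^ ((n + 1) * j) * ((-1) ^ i * \<phi> (cface C n i (rotate j l))))"
    have "hochschild_b C n (cyclic_sum C n \<phi>) l = (\<Sum>k\<le>n + 1. \<Sum>j\<le>n. L (k, j))"
      unfolding hochschild_b_cface[OF l] L_def
      by (simp only: cyclic_sum_def cface_chains[OF C l] if_True sum_distrib_left case_prod_conv)
    also have "\<dots> = sum L ({..n + 1} \<times> {..n})"
      by (simp add: sum.cartesian_product)
    also have "\<dots> = sum R ({..n + 1} \<times> {..n})"
    \<comment> \<open>The pair \<open>(n + 1, 0)\<close> is exceptional: its partner would be
      \<open>(0, n + 1)\<close>, but b' has no face of index \<open>n + 1\<close>. It is sent to
      itself instead, because face 0 after \<open>n + 1\<close> rotations is the last face up to a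
      full turn.\<close>
    proof (rule sum.reindex_bij_witness[
          where j = "\<lambda>(k, j). if k = n + 1 \<and> j = 0 then (n + 1, 0) else if j \<le> k then (j, k - j) else (j + 1, k + n + 1 - j)"
          and i = "\<lambda>(j, i). if j = n + 1 \<and> i = 0 then (n + 1, 0) else if i + j \<le> n + 1 then (i + j, j) else (i + j - (n + 2), j - 1)"])
      fix a assume a: "a \<in> {..n + 1} \<times> {..n}"
      obtain k j where [simp]: "a = (k, j)" and kj: "k \<le> n + 1" "j \<le> n" using a by auto
      consider "k = n + 1 \<and> j = 0" | "j \<le> k" "\<not> (k = n + 1 \<and> j = 0)" | "k < j" by linarith
      then show "R (case a of (k, j) \<Rightarrow> if k = n + 1 \<and> j = 0 then (n + 1, 0) else if j \<le> k then (j, k - j) else (j + 1, k + n + 1 - j)) = L a"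
      proof cases
        case 1
        have "cface C n 0 (rotate (n + 1) l) = rotate (n + 1) (cface C n (n + 1) l)"
          using cface_rotate[OF l, of 0 "n + 1"] by simp
        also have "\<dots> = cface C n (n + 1) l"
          using chains_length[OF cface_chains[OF C l]] by (intro rotate_Suc_n)
        moreover have "(-1::complex) ^ ((n + 1) * (n + 1)) = (-1) ^ (n + 1)"
          by (simp add: minus_one_power_iff)
        ultimately show ?thesis using 1 by (simp add: L_def R_def del: mult_Suc mult_Suc_right power_Suc)
      next
        case 2
        have "(-1::complex) ^ ((n + 1) * j) * (-1) ^ (k - j) = (-1) ^ k * (-1) ^ (n * j)"
        proof -
          have "(n + 1) * j + (k - j) = k + n * j" using 2 by (simp add: algebra_simps)
          then show ?thesis by (simp only: power_add[symmetric])
        qed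
        then show ?thesis
          using 2 kj cface_rotate[OF l, of "k - j" j]
          by (auto simp: L_def R_def mult.assoc[symmetric] simp del: mult_Suc power_Suc)
      next
        case 3
        have "(-1::complex) ^ ((n + 1) * (j + 1)) * (-1) ^ (k + n + 1 - j) = (-1) ^ k * (-1) ^ (n * j)"
        proof -
          have "(n + 1) * (j + 1) + (k + n + 1 - j) = k + n * j + 2 * (n + 1)" using 3 kj by (simp add: algebra_simps)
          then have "(-1::complex) ^ ((n + 1) * (j + 1)) * (-1) ^ (k + n + 1 - j) = (-1) ^ (k + n * j + 2 * (n + 1))"
            by (simp only: power_add[symmetric])
          also have "\<dots> = (-1) ^ (k + n * j)" by (simp only: power_add power_mult) simp
          finally show ?thesis by (simp only: power_add)
        qed
        then show ?thesis
          using 3 kj cface_rotate_wrap[OF C l, of "k + n + 1 - j" "j + 1"]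
          by (simp add: L_def R_def mult.assoc[symmetric] del: mult_Suc power_Suc)
      qed
    qed (auto split: if_splits)
    also have "\<dots> = cyclic_sum C (n + 1) (bprime C n \<phi>) l"
      unfolding cyclic_sum_def R_def using l rotate_chains[OF l]
      by (simp add: sum.cartesian_product[symmetric] bprime_def cface_def sum_distrib_left)
    finally show ?thesis .
  qed (simp add: hochschild_b_def cyclic_sum_def)
qed

text \<open>The simplicial identity. Associativity enters exactly for \<open>i = j\<close>, where
  three consecutive morphisms are merged.\<close>

lemma face_face:
  assumes C: "linear_category C" and l: "l \<in> chains C (n + 2)" and ji: "j \<le> i" "i \<le> n"
  shows "face C j (face C (Suc i) l) = face C i (face C j l)"
proof -
  have l': "l \<in> chains C (Suc n + 1)" using l by simp
  have i': "Suc i \<le> Suc n" and j': "j \<le> Suc n" and j: "j \<le> n" using ji by simp_all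
  have fi: "face C (Suc i) l \<in> chains C (n + 1)" and fj: "face C j l \<in> chains C (n + 1)"
    using face_chains[OF C l' i'] face_chains[OF C l' j'] by simp_all
  note oi = obj_face[OF l' i'] and oj = obj_face[OF l' j']
  note mi = fmor_face[OF l' i'] and mj = fmor_face[OF l' j']
  note simps = fmor_face[OF fi j] fmor_face[OF fj ji(2)] mi mj oi oj numeral_eq_Suc
  show ?thesis
  proof (rule chain_eqI)
    show "length (face C j (face C (Suc i) l)) = length (face C i (face C j l))"
      using chains_length[OF face_chains[OF C fi j]] chains_length[OF face_chains[OF C fj ji(2)]] by simp
    fix k assume "k < length (face C j (face C (Suc i) l))"
    then have k: "k \<le> n" using chains_length[OF face_chains[OF C fi j]] by simp
    show "obj (face C j (face C (Suc i) l)) k = obj (face C i (face C j l)) k"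
      using k ji by (auto simp: obj_face[OF fi j] obj_face[OF fj ji(2)] oi oj)
    have assoc: "comp C W Y Z h (comp C W X Y g f) = comp C W X Z (comp C X Y Z h g) f"
      if "W \<in> ob C" "X \<in> ob C" "Y \<in> ob C" "Z \<in> ob C" "h \<in> hom C Y Z" "g \<in> hom C X Y" "f \<in> hom C W X"
      for W X Y Z h g f
      using C that by (simp add: linear_category_def)
    note m = chains_fmor[OF l, of j] chains_fmor[OF l, of "Suc j"] chains_fmor[OF l, of "Suc (Suc j)"]
    consider "k < j" | "k = j" "i = j" | "k = j" "i > j" | "k > j" "k < i" | "k > j" "k = i" | "k > i"
      using ji by linarith
    then show "fmor (face C j (face C (Suc i) l)) k = fmor (face C i (face C j l)) k"
    proof cases
      case 2
      then show ?thesis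
        using k ji chains_obj[OF l] m by (simp add: simps[unfolded 2(2)]) (rule assoc; simp)
    qed (use k ji in \<open>simp_all add: simps\<close>)
  qed
qed

text \<open>The simplicial identity matches the pairs with \<open>j < i\<close> and those with
  \<open>i \<le> j\<close>, with opposite signs.\<close>

lemma bprime_bprime:
  assumes C: "linear_category C"
  shows "bprime C (n + 1) (bprime C n \<phi>) = (\<lambda>l. 0)"
proof
  fix l
  show "bprime C (n + 1) (bprime C n \<phi>) l = 0"
  proof (cases "l \<in> chains C (n + 2)")
    case l: True
    then have l': "l \<in> chains C (Suc n + 1)" by simp
    define g where "g = (\<lambda>(i, j). (-1) ^ i * ((-1) ^ j * \<phi> (face C j (face C i l))))"
    define A where "A = {(i, j) \<in> {..n + 1} \<times> {..n}. j < i}"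
    define B where "B = {(i, j) \<in> {..n + 1} \<times> {..n}. i \<le> j}"
    have fin: "finite A" "finite B" "A \<inter> B = {}" "A \<union> B = {..n + 1} \<times> {..n}"
      by (auto simp: A_def B_def intro: finite_subset[of _ "{..n + 1} \<times> {..n}"])
    have "bprime C (n + 1) (bprime C n \<phi>) l = (\<Sum>i\<le>n + 1. \<Sum>j\<le>n. g (i, j))"
      unfolding bprime_def[of C "n + 1"] g_def using l face_chains[OF C l']
      by (simp add: bprime_def sum_distrib_left)
    also have "\<dots> = sum g (A \<union> B)" by (simp add: fin sum.cartesian_product)
    also have "\<dots> = sum g A + sum g B" using fin by (intro sum.union_disjoint)
    also have "sum g A = (\<Sum>x\<in>B. - g x)"
    proof (rule sum.reindex_bij_witness[where j = "\<lambda>(i, j). (j, i - 1)" and i = "\<lambda>(i, j). (j + 1, i)"])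
      fix a assume "a \<in> A"
      then obtain i j where [simp]: "a = (i, j)" and ij: "j < i" "i \<le> n + 1" by (auto simp: A_def)
      obtain i0 where i0: "i = Suc i0" using ij(1) by (cases i) auto
      then show "- g (case a of (i, j) \<Rightarrow> (j, i - 1)) = g a"
        using face_face[OF C l, of j i0] ij by (simp add: g_def)
    qed (auto simp: A_def B_def)
    finally show ?thesis by (simp add: sum_negf)
  qed (simp add: bprime_def)
qed

section \<open>Multilinearity of cochains under faces and rotations\<close>

lemma scaleC_fun_apply: "(c *\<^sub>C f) x = c *\<^sub>C f x"
  by (simp add: scaleC_fun_def)

lemma sum_fun_apply: "sum F A x = (\<Sum>a\<in>A. F a x)"
  by (induction A rule: infinite_finite_induct) auto

lemma clinear_on_compose: "clinear_on V W f \<Longrightarrow> clinear_on W U g \<Longrightarrow> clinear_on V U (\<lambda>x. g (f x))"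
  by (auto simp: clinear_on_def)

lemma clinear_on_congr:
  assumes "clinear_on V W f" "csubspace V" "\<And>x. x \<in> V \<Longrightarrow> g x = f x" shows "clinear_on V W g"
  by (rule clinear_on_cong[OF assms(1,2)]) (simp add: assms(3))

lemma clinear_on_id: "clinear_on V V (\<lambda>x. x)"
  by (simp add: clinear_on_def)

lemma lin_cat_hom: "linear_category C \<Longrightarrow> X \<in> ob C \<Longrightarrow> Y \<in> ob C \<Longrightarrow> csubspace (hom C X Y)"
  by (simp add: linear_category_def)

lemma
  assumes "linear_category C" "X \<in> ob C" "Y \<in> ob C" "Z \<in> ob C"
  shows comp_linear_right: "g \<in> hom C Y Z \<Longrightarrow> clinear_on (hom C X Y) (hom C X Z) (\<lambda>f. comp C X Y Z g f)"
    and comp_linear_left: "f \<in> hom C X Y \<Longrightarrow> clinear_on (hom C Y Z) (hom C X Z) (\<lambda>g. comp C X Y Z g f)"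
  using assms by (simp_all add: linear_category_def cbilinear_on_def)

definition slot :: "('o, 'a) chain \<Rightarrow> nat \<Rightarrow> 'a \<Rightarrow> ('o, 'a) chain"
  where "slot l i f = l[i := (obj l i, f)]"

lemma cochains_iff:
  "\<phi> \<in> cochains C n \<longleftrightarrow> (\<forall>l. l \<notin> chains C n \<longrightarrow> \<phi> l = 0) \<and>
    (\<forall>l\<in>chains C n. \<forall>i\<le>n. clinear_on (hom C (obj l (i + 1)) (obj l i)) UNIV (\<lambda>f. \<phi> (slot l i f)))"
  by (simp add: cochains_def slot_def)

lemma length_slot [simp]: "length (slot l i f) = length l"
  by (simp add: slot_def)

lemma obj_slot [simp]: "obj (slot l i f) j = obj l j"
  by (cases "i < length l") (auto simp: slot_def obj_def nth_list_update list_update_beyond)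

lemma fmor_slot: "i < length l \<Longrightarrow> fmor (slot l i f) j = (if j mod length l = i then f else fmor l j)"
  by (cases "l = []") (auto simp: slot_def fmor_def nth_list_update)

lemma slot_chains:
  assumes l: "l \<in> chains C n" and i: "i \<le> n" and f: "f \<in> hom C (obj l (i + 1)) (obj l i)"
  shows "slot l i f \<in> chains C n"
proof -
  have "fmor (slot l i f) j \<in> hom C (obj l (j + 1)) (obj l j)" if "j \<le> n" for j
    using that i f chains_fmor[OF l, of j] chains_length[OF l] by (simp add: fmor_slot)
  then show ?thesis
    using chains_length[OF l] chains_obj[OF l] by (simp add: chains_def mor_eq_fmor)
qed

lemma cochains_subspace: "csubspace (cochains C n)"
proof (rule cvs.subspaceI)
  show "0 \<in> cochains C n" by (auto simp: cochains_def clinear_on_def)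
next
  fix \<phi> \<psi> assume "\<phi> \<in> cochains C n" "\<psi> \<in> cochains C n"
  then show "\<phi> + \<psi> \<in> cochains C n"
    unfolding cochains_iff clinear_on_def by (auto simp: scaleC_complex_def algebra_simps)
next
  fix c \<phi> assume "\<phi> \<in> cochains C n"
  then show "c *\<^sub>C \<phi> \<in> cochains C n"
    unfolding cochains_iff clinear_on_def by (auto simp: scaleC_fun_def scaleC_complex_def algebra_simps)
qed

text \<open>The index \<open>i'\<close> is i - j modulo n + 1; adding \<open>n + 1\<close> first
  keeps the subtraction of natural numbers from truncating.\<close>

lemma rotate_slot:
  assumes l: "l \<in> chains C n" and i: "i \<le> n" and j: "j \<le> n"
  defines "i' \<equiv> (i + (n + 1) - j) mod (n + 1)"
  shows "rotate j (slot l i f) = slot (rotate j l) i' f" "obj (rotate j l) i' = obj l i"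
    "obj (rotate j l) (i' + 1) = obj l (i + 1)"
proof -
  have len: "length l = n + 1" and ne: "l \<noteq> []" "slot l i f \<noteq> []"
    using chains_length[OF l] by (auto simp flip: length_0_conv)
  have eq: "(k + j) mod (n + 1) = i \<longleftrightarrow> k = i'" if "k \<le> n" for k
    using that i j unfolding i'_def by (cases "j \<le> i") (auto simp: mod_if)
  have i': "i' \<le> n" "(i' + j) mod (n + 1) = i" using eq[of i'] by (auto simp: i'_def less_Suc_eq_le[symmetric])
  have "obj l (i' + j) = obj l i" using i'(2) i len obj_mod[of l "i' + j"] by simp
  then show "obj (rotate j l) i' = obj l i" by (simp add: obj_rotate ne)
  have "(i' + j + 1) mod (n + 1) = (i + 1) mod (n + 1)" using i'(2) by (metis mod_add_left_eq)
  then have "obj l (i' + j + 1) = obj l (i + 1)" using len unfolding obj_def by simp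
  then show "obj (rotate j l) (i' + 1) = obj l (i + 1)" by (simp add: obj_rotate ne)
  show "rotate j (slot l i f) = slot (rotate j l) i' f"
  proof (rule chain_eqI)
    fix k assume "k < length (rotate j (slot l i f))"
    then have k: "k \<le> n" using len by simp
    show "obj (rotate j (slot l i f)) k = obj (slot (rotate j l) i' f) k" by (simp add: obj_rotate ne)
    show "fmor (rotate j (slot l i f)) k = fmor (slot (rotate j l) i' f) k"
      using k i i'(1) len eq[OF k] by (simp add: fmor_rotate fmor_slot ne)
  qed simp
qed

lemma cochains_rotate:
  assumes C: "linear_category C" and \<phi>: "\<phi> \<in> cochains C n" and j: "j \<le> n"
  shows "(\<lambda>l. if l \<in> chains C n then \<phi> (rotate j l) else 0) \<in> cochains C n"
  unfolding cochains_iff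
proof (intro conjI ballI allI impI)
  fix l i assume l: "l \<in> chains C n" and i: "i \<le> n"
  define i' where "i' = (i + (n + 1) - j) mod (n + 1)"
  note r = rotate_slot[OF l i j, folded i'_def]
  have i': "i' \<le> n" by (simp add: i'_def less_Suc_eq_le[symmetric])
  have "clinear_on (hom C (obj l (i + 1)) (obj l i)) UNIV (\<lambda>f. \<phi> (slot (rotate j l) i' f))"
    using \<phi> rotate_chains[OF l, of j] i' r(2,3) unfolding cochains_iff by metis
  then show "clinear_on (hom C (obj l (i + 1)) (obj l i)) UNIV
      (\<lambda>f. if slot l i f \<in> chains C n then \<phi> (rotate j (slot l i f)) else 0)"
    by (rule clinear_on_congr) (simp_all add: lin_cat_hom[OF C] chains_obj[OF l] slot_chains[OF l i] r(1))
qed simp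

text \<open>A face sends the varied entry through a linear map \<open>g\<close>: composition with
  its neighbour if the entry is merged, the identity otherwise. Hence multilinearity pulls back
  along faces.\<close>

lemma face_slot:
  assumes C: "linear_category C" and l: "l \<in> chains C (n + 1)" and k: "k \<le> n + 1" and i: "i \<le> n"
  obtains k' g where "k' \<le> n"
    "clinear_on (hom C (obj l (k + 1)) (obj l k)) (hom C (obj (face C i l) (k' + 1)) (obj (face C i l) k')) g"
    "\<And>f. f \<in> hom C (obj l (k + 1)) (obj l k) \<Longrightarrow> face C i (slot l k f) = slot (face C i l) k' (g f)"
proof -
  define k' where "k' = (if k \<le> i then k else k - 1)"
  define g where "g f = (if k = i then comp C (obj l (i + 2)) (obj l (i + 1)) (obj l i) f (fmor l (i + 1))
      else if k = i + 1 then comp C (obj l (i + 2)) (obj l (i + 1)) (obj l i) (fmor l i) f else f)" for f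
  have k': "k' \<le> n" using k i by (auto simp: k'_def)
  have fl: "face C i l \<in> chains C n" by (rule face_chains[OF C l i])
  have eq: "face C i (slot l k f) = slot (face C i l) k' (g f)"
    if f: "f \<in> hom C (obj l (k + 1)) (obj l k)" for f
  proof (rule chain_eqI)
    have s: "slot l k f \<in> chains C (n + 1)" by (rule slot_chains[OF l k f])
    have len: "length (face C i (slot l k f)) = n + 1" "length (face C i l) = n + 1"
      using chains_length[OF face_chains[OF C s i]] chains_length[OF fl] by simp_all
    then show "length (face C i (slot l k f)) = length (slot (face C i l) k' (g f))" by simp
    fix j assume "j < length (face C i (slot l k f))"
    then have j: "j \<le> n" using len by simp
    show "obj (face C i (slot l k f)) j = obj (slot (face C i l) k' (g f)) j"
      using j by (simp add: obj_face[OF s i] obj_face[OF l i])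
    have w: "fmor (slot l k f) j = (if j = k then f else fmor l j)" if "j \<le> n + 1" for j
      using that k chains_length[OF l] by (simp add: fmor_slot)
    show "fmor (face C i (slot l k f)) j = fmor (slot (face C i l) k' (g f)) j"
      using j i k k' len(2) w[of j] w[of i] w[of "i + 1"] w[of "j + 1"]
      by (auto simp: fmor_face[OF s i] fmor_face[OF l i] fmor_slot k'_def g_def)
  qed
  have o: "obj (face C i l) j = obj l (if j \<le> i then j else j + 1)" if "j \<le> n + 1" for j
    using obj_face[OF l i that] .
  have "clinear_on (hom C (obj l (k + 1)) (obj l k)) (hom C (obj (face C i l) (k' + 1)) (obj (face C i l) k')) g"
  proof -
    consider "k = i" | "k = i + 1" | "k < i" | "k > i + 1" by linarith
    then show ?thesis
    proof cases
      case 1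
      then have "obj (face C i l) (k' + 1) = obj l (i + 2)" "obj (face C i l) k' = obj l i"
        using o i by (auto simp: k'_def)
      moreover have "g = (\<lambda>f. comp C (obj l (i + 2)) (obj l (i + 1)) (obj l i) f (fmor l (i + 1)))"
        using 1 by (auto simp: g_def)
      ultimately show ?thesis
        using comp_linear_left[OF C chains_obj[OF l] chains_obj[OF l] chains_obj[OF l] chains_fmor[OF l, of "i + 1"]] 1
        by (simp add: numeral_eq_Suc)
    next
      case 2
      then have "obj (face C i l) (k' + 1) = obj l (i + 2)" "obj (face C i l) k' = obj l i"
        using o i by (auto simp: k'_def)
      moreover have "g = (\<lambda>f. comp C (obj l (i + 2)) (obj l (i + 1)) (obj l i) (fmor l i) f)"
        using 2 by (auto simp: g_def)
      ultimately show ?thesis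
        using comp_linear_right[OF C chains_obj[OF l] chains_obj[OF l] chains_obj[OF l] chains_fmor[OF l, of i]] 2
        by (simp add: numeral_eq_Suc)
    next
      case 3
      then have "obj (face C i l) (k' + 1) = obj l (k + 1)" "obj (face C i l) k' = obj l k"
        using o i by (auto simp: k'_def)
      moreover have "g = (\<lambda>f. f)" using 3 by (auto simp: g_def)
      ultimately show ?thesis by (simp add: clinear_on_id)
    next
      case 4
      then have "obj (face C i l) (k' + 1) = obj l (k + 1)" "obj (face C i l) k' = obj l k"
        using o[of "k' + 1"] o[of k'] i k by (auto simp: k'_def)
      moreover have "g = (\<lambda>f. f)" using 4 by (auto simp: g_def)
      ultimately show ?thesis by (simp add: clinear_on_id)
    qed
  qed
  with k' eq that show ?thesis by blast
qed

lemma cochains_face: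
  assumes C: "linear_category C" and \<phi>: "\<phi> \<in> cochains C n" and i: "i \<le> n"
  shows "(\<lambda>l. if l \<in> chains C (n + 1) then \<phi> (face C i l) else 0) \<in> cochains C (n + 1)"
  unfolding cochains_iff
proof (intro conjI ballI allI impI)
  fix l k assume l: "l \<in> chains C (n + 1)" and k: "k \<le> n + 1"
  obtain k' g where r: "k' \<le> n"
    "clinear_on (hom C (obj l (k + 1)) (obj l k)) (hom C (obj (face C i l) (k' + 1)) (obj (face C i l) k')) g"
    "\<And>f. f \<in> hom C (obj l (k + 1)) (obj l k) \<Longrightarrow> face C i (slot l k f) = slot (face C i l) k' (g f)"
    by (rule face_slot[OF C l k i], rule that)
  have "clinear_on (hom C (obj (face C i l) (k' + 1)) (obj (face C i l) k')) UNIV (\<lambda>f. \<phi> (slot (face C i l) k' f))"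
    using \<phi> face_chains[OF C l i] r(1) unfolding cochains_iff by blast
  from clinear_on_compose[OF r(2) this]
  show "clinear_on (hom C (obj l (k + 1)) (obj l k)) UNIV
      (\<lambda>f. if slot l k f \<in> chains C (n + 1) then \<phi> (face C i (slot l k f)) else 0)"
    by (rule clinear_on_congr) (simp_all add: lin_cat_hom[OF C] chains_obj[OF l] slot_chains[OF l k, simplified] r(3))
qed simp

lemma cochains_bprime:
  assumes C: "linear_category C" and \<phi>: "\<phi> \<in> cochains C n" shows "bprime C n \<phi> \<in> cochains C (n + 1)"
proof -
  have "bprime C n \<phi> = (\<Sum>i\<le>n. (-1) ^ i *\<^sub>C (\<lambda>l. if l \<in> chains C (n + 1) then \<phi> (face C i l) else 0))"
    by (auto simp: fun_eq_iff bprime_def sum_fun_apply scaleC_fun_def scaleC_complex_def)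
  also have "\<dots> \<in> cochains C (n + 1)"
    using cochains_face[OF C \<phi>] by (intro cvs.subspace_sum cvs.subspace_scale cochains_subspace) auto
  finally show ?thesis .
qed

section \<open>Cyclic cochains, cocycles and coboundaries\<close>

lemma cyclic_op_rotate: "l \<in> chains C n \<Longrightarrow> cyclic_op C n \<phi> l = (-1) ^ n * \<phi> (rotate n l)"
proof -
  assume l: "l \<in> chains C n"
  then have "l \<noteq> []" "length l = n + 1" using chains_length[OF l] by auto
  then have "rotate n l = last l # butlast l"
    using rotate_append[of "butlast l" "[last l]"] by simp
  then show ?thesis using l by (simp add: cyclic_op_def)
qed

lemma cyclic_cochains_iff:
  "\<phi> \<in> cyclic_cochains C n \<longleftrightarrow> \<phi> \<in> cochains C n \<and> (\<forall>l\<in>chains C n. \<phi> l = (-1) ^ n * \<phi> (rotate n l))"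
proof -
  have "\<phi> - cyclic_op C n \<phi> = 0 \<longleftrightarrow> (\<forall>l\<in>chains C n. \<phi> l = (-1) ^ n * \<phi> (rotate n l))" if "\<phi> \<in> cochains C n"
  proof -
    have "\<phi> - cyclic_op C n \<phi> = 0 \<longleftrightarrow> (\<forall>l. \<phi> l = cyclic_op C n \<phi> l)" by (auto simp: fun_eq_iff)
    also have "\<dots> \<longleftrightarrow> (\<forall>l\<in>chains C n. \<phi> l = cyclic_op C n \<phi> l)"
      using that by (auto simp: cochains_iff cyclic_op_def)
    finally show ?thesis by (simp add: cyclic_op_rotate)
  qed
  then show ?thesis by (auto simp: cyclic_cochains_def)
qed

text \<open>Rotating the chain permutes the summands. The signs match because (-1)^(n n) = (-1)^n
  for the summand that wraps around, and n + n (j + 1) = n j + 2n for the others.\<close>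

lemma cyclic_sum_cyclic:
  assumes C: "linear_category C" and \<phi>: "\<phi> \<in> cochains C n" shows "cyclic_sum C n \<phi> \<in> cyclic_cochains C n"
proof -
  have "cyclic_sum C n \<phi> = (\<Sum>j\<le>n. (-1) ^ (n * j) *\<^sub>C (\<lambda>l. if l \<in> chains C n then \<phi> (rotate j l) else 0))"
    by (auto simp: fun_eq_iff cyclic_sum_def sum_fun_apply scaleC_fun_def scaleC_complex_def)
  also have "\<dots> \<in> cochains C n"
    using cochains_rotate[OF C \<phi>] by (intro cvs.subspace_sum cvs.subspace_scale cochains_subspace) auto
  finally have "cyclic_sum C n \<phi> \<in> cochains C n" .
  moreover have "cyclic_sum C n \<phi> l = (-1) ^ n * cyclic_sum C n \<phi> (rotate n l)" if l: "l \<in> chains C n" for l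
  proof -
    have "(\<Sum>j\<le>n. (-1) ^ (n * j) * \<phi> (rotate j l)) = (\<Sum>j\<le>n. (-1) ^ n * ((-1) ^ (n * j) * \<phi> (rotate (j + n) l)))"
    proof (rule sum.reindex_bij_witness[where j = "\<lambda>j. if j = n then 0 else j + 1"
          and i = "\<lambda>j. if j = 0 then n else j - 1"])
      fix j assume "j \<in> {..n}"
      show "(-1) ^ n * ((-1) ^ (n * (if j = n then 0 else j + 1)) * \<phi> (rotate ((if j = n then 0 else j + 1) + n) l)) =
          (-1) ^ (n * j) * \<phi> (rotate j l)"
      proof (cases "j = n")
        case True
        have "(-1::complex) ^ (n * n) = (-1) ^ n" by (simp add: minus_one_power_iff)
        then show ?thesis using True by simp
      next
        case False
        have "rotate ((j + 1) + n) l = rotate j (rotate (n + 1) l)" by (simp only: rotate_rotate ac_simps)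
        also have "rotate (n + 1) l = l" using rotate_Suc_n chains_length[OF l] by blast
        finally have "rotate ((j + 1) + n) l = rotate j l" .
        moreover have "(-1::complex) ^ n * (-1) ^ (n * (j + 1)) = (-1) ^ (n * j)"
        proof -
          have "n + n * (j + 1) = n * j + 2 * n" by simp
          then have "(-1::complex) ^ n * (-1) ^ (n * (j + 1)) = (-1) ^ (n * j + 2 * n)"
            by (simp only: power_add[symmetric])
          then show ?thesis by (simp add: power_add power_mult)
        qed
        ultimately show ?thesis using False by (simp only: if_False mult.assoc[symmetric])
      qed
    qed auto
    also have "\<dots> = (-1) ^ n * (\<Sum>j\<le>n. (-1) ^ (n * j) * \<phi> (rotate j (rotate n l)))"
      by (simp only: sum_distrib_left rotate_rotate)
    finally show ?thesis using l rotate_chains[OF l, of n] by (simp only: cyclic_sum_def if_True)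
  qed
  ultimately show ?thesis by (simp add: cyclic_cochains_iff)
qed

text \<open>\<open>b b N = b N b' = N b' b' = 0\<close>.\<close>

lemma hochschild_b_cyclic_sum_cocycle:
  assumes C: "linear_category C" and \<phi>: "\<phi> \<in> cochains C n"
  shows "hochschild_b C n (cyclic_sum C n \<phi>) \<in> cyclic_cocycles C (n + 1)"
proof -
  have "hochschild_b C (n + 1) (hochschild_b C n (cyclic_sum C n \<phi>)) = cyclic_sum C (n + 1 + 1) (\<lambda>l. 0)"
    by (simp only: hochschild_b_cyclic_sum[OF C] bprime_bprime[OF C])
  also have "\<dots> = 0" by (simp add: cyclic_sum_def fun_eq_iff)
  finally show ?thesis
    unfolding cyclic_cocycles_def
    using cyclic_sum_cyclic[OF C cochains_bprime[OF C \<phi>]] hochschild_b_cyclic_sum[OF C, of n \<phi>] by auto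
qed

lemma cyclic_cochains_subspace: "csubspace (cyclic_cochains C n)"
  by (rule cvs.subspaceI)
    (auto simp: cyclic_cochains_iff cvs.subspace_0[OF cochains_subspace] cvs.subspace_add[OF cochains_subspace]
      cvs.subspace_scale[OF cochains_subspace] algebra_simps scaleC_fun_apply scaleC_complex_def)

lemma hochschild_b_add: "hochschild_b C n (\<phi> + \<psi>) = hochschild_b C n \<phi> + hochschild_b C n \<psi>"
  by (auto simp: hochschild_b_def fun_eq_iff algebra_simps sum.distrib)

lemma hochschild_b_scale: "hochschild_b C n (c *\<^sub>C \<phi>) = c *\<^sub>C hochschild_b C n \<phi>"
  by (auto simp: hochschild_b_def fun_eq_iff algebra_simps sum_distrib_left scaleC_fun_apply scaleC_complex_def)

lemma cyclic_cocycles_subspace: "csubspace (cyclic_cocycles C n)"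
  using cvs.subspace_0[OF cyclic_cochains_subspace] cvs.subspace_add[OF cyclic_cochains_subspace]
    cvs.subspace_scale[OF cyclic_cochains_subspace] hochschild_b_scale[of C n 0 0]
  by (intro cvs.subspaceI) (auto simp: cyclic_cocycles_def hochschild_b_add hochschild_b_scale)

section \<open>Forms over a DG-semicategory\<close>

text \<open>A cycle without its trace and dimension: functionals in several degrees, traces or not,
  will be studied on one and the same DG-semicategory.\<close>

locale dg_words =
  fixes C :: "('o, 'a::complex_vector) lin_cat" and c :: "('o, 'a, 's, 'x::complex_vector) cyc"
  assumes C: "linear_category C"
    and S: "dg_semicategory (cyc_dg c)"
    and ob: "X \<in> ob C \<Longrightarrow> cyc_ob c X \<in> dg_ob (cyc_dg c)"
    and rho_linear: "X \<in> ob C \<Longrightarrow> Y \<in> ob C \<Longrightarrow>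
      clinear_on (hom C X Y) (dg_hom (cyc_dg c) 0 (cyc_ob c X) (cyc_ob c Y)) (cyc_mor c X Y)"
    and rho_comp: "X \<in> ob C \<Longrightarrow> Y \<in> ob C \<Longrightarrow> Z \<in> ob C \<Longrightarrow> g \<in> hom C Y Z \<Longrightarrow> f \<in> hom C X Y \<Longrightarrow>
      cyc_mor c X Z (comp C X Y Z g f) =
      dg_comp (cyc_dg c) 0 0 (cyc_ob c X) (cyc_ob c Y) (cyc_ob c Z) (cyc_mor c Y Z g) (cyc_mor c X Y f)"
begin

definition H :: "nat \<Rightarrow> 'o \<Rightarrow> 'o \<Rightarrow> 'x set"
  where "H n X Y = dg_hom (cyc_dg c) n (cyc_ob c X) (cyc_ob c Y)"

definition cmp :: "nat \<Rightarrow> nat \<Rightarrow> 'o \<Rightarrow> 'o \<Rightarrow> 'o \<Rightarrow> 'x \<Rightarrow> 'x \<Rightarrow> 'x"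
  where "cmp i j X Y Z = dg_comp (cyc_dg c) i j (cyc_ob c X) (cyc_ob c Y) (cyc_ob c Z)"

definition dd :: "nat \<Rightarrow> 'o \<Rightarrow> 'o \<Rightarrow> 'x \<Rightarrow> 'x"
  where "dd n X Y = dg_d (cyc_dg c) n (cyc_ob c X) (cyc_ob c Y)"

abbreviation rho :: "'o \<Rightarrow> 'o \<Rightarrow> 'a \<Rightarrow> 'x"
  where "rho X Y \<equiv> cyc_mor c X Y"

lemma H_subspace: "X \<in> ob C \<Longrightarrow> Y \<in> ob C \<Longrightarrow> csubspace (H n X Y)"
  using S ob by (simp add: dg_semicategory_def H_def)

lemma cmp_bilinear: "X \<in> ob C \<Longrightarrow> Y \<in> ob C \<Longrightarrow> Z \<in> ob C \<Longrightarrow>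
    cbilinear_on (H i Y Z) (H j X Y) (H (i + j) X Z) (cmp i j X Y Z)"
  using S ob by (simp add: dg_semicategory_def H_def cmp_def)

lemma cmp_left: "X \<in> ob C \<Longrightarrow> Y \<in> ob C \<Longrightarrow> Z \<in> ob C \<Longrightarrow> f \<in> H j X Y \<Longrightarrow>
    clinear_on (H i Y Z) (H (i + j) X Z) (\<lambda>g. cmp i j X Y Z g f)"
  using cmp_bilinear[of X Y Z i j] by (simp add: cbilinear_on_def)

lemma cmp_right: "X \<in> ob C \<Longrightarrow> Y \<in> ob C \<Longrightarrow> Z \<in> ob C \<Longrightarrow> g \<in> H i Y Z \<Longrightarrow>
    clinear_on (H j X Y) (H (i + j) X Z) (cmp i j X Y Z g)"
  using cmp_bilinear[of X Y Z i j] by (simp add: cbilinear_on_def)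

lemma cmp_mem: "X \<in> ob C \<Longrightarrow> Y \<in> ob C \<Longrightarrow> Z \<in> ob C \<Longrightarrow> g \<in> H i Y Z \<Longrightarrow> f \<in> H j X Y \<Longrightarrow>
    cmp i j X Y Z g f \<in> H (i + j) X Z"
  using cmp_right clinear_on_mem by blast

lemma cmp_assoc: "W \<in> ob C \<Longrightarrow> X \<in> ob C \<Longrightarrow> Y \<in> ob C \<Longrightarrow> Z \<in> ob C \<Longrightarrow>
    h \<in> H i Y Z \<Longrightarrow> g \<in> H j X Y \<Longrightarrow> f \<in> H k W X \<Longrightarrow>
    cmp i (j + k) W Y Z h (cmp j k W X Y g f) = cmp (i + j) k W X Z (cmp i j X Y Z h g) f"
  using S ob by (simp add: dg_semicategory_def H_def cmp_def)

lemma dd_linear: "X \<in> ob C \<Longrightarrow> Y \<in> ob C \<Longrightarrow> clinear_on (H n X Y) (H (n + 1) X Y) (dd n X Y)"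
  using S ob by (simp add: dg_semicategory_def H_def dd_def)

lemma dd_mem: "X \<in> ob C \<Longrightarrow> Y \<in> ob C \<Longrightarrow> f \<in> H n X Y \<Longrightarrow> dd n X Y f \<in> H (n + 1) X Y"
  using dd_linear clinear_on_mem by blast

lemma dd_dd: "X \<in> ob C \<Longrightarrow> Y \<in> ob C \<Longrightarrow> f \<in> H n X Y \<Longrightarrow> dd (n + 1) X Y (dd n X Y f) = 0"
  using S ob by (simp add: dg_semicategory_def H_def dd_def)

lemma leibniz: "X \<in> ob C \<Longrightarrow> Y \<in> ob C \<Longrightarrow> Z \<in> ob C \<Longrightarrow> g \<in> H i Y Z \<Longrightarrow> f \<in> H j X Y \<Longrightarrow>
    dd (i + j) X Z (cmp i j X Y Z g f) =
    cmp (i + 1) j X Y Z (dd i Y Z g) f + (-1) ^ i *\<^sub>C cmp i (j + 1) X Y Z g (dd j X Y f)"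
  using S ob by (simp add: dg_semicategory_def H_def dd_def cmp_def)

lemma rho_lin: "X \<in> ob C \<Longrightarrow> Y \<in> ob C \<Longrightarrow> clinear_on (hom C X Y) (H 0 X Y) (rho X Y)"
  using rho_linear by (simp add: H_def)

lemma rho_mem: "X \<in> ob C \<Longrightarrow> Y \<in> ob C \<Longrightarrow> f \<in> hom C X Y \<Longrightarrow> rho X Y f \<in> H 0 X Y"
  using rho_lin clinear_on_mem by blast

lemma rho_cmp: "X \<in> ob C \<Longrightarrow> Y \<in> ob C \<Longrightarrow> Z \<in> ob C \<Longrightarrow> g \<in> hom C Y Z \<Longrightarrow> f \<in> hom C X Y \<Longrightarrow>
    rho X Z (comp C X Y Z g f) = cmp 0 0 X Y Z (rho Y Z g) (rho X Y f)"
  using rho_comp by (simp add: cmp_def)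

definition df :: "('o, 'a) chain \<Rightarrow> nat \<Rightarrow> 'x"
  where "df l k = dd 0 (obj l (k + 1)) (obj l k) (rho (obj l (k + 1)) (obj l k) (fmor l k))"

text \<open>\<open>ext l Y w \<omega> k j\<close> is \<open>\<omega> df\<^sup>k \<dots> df\<^bsup>k+j-1\<^esup>\<close>, for \<open>\<omega>\<close> of degree \<open>w\<close> from \<open>X\<^sub>k\<close> to \<open>Y\<close>.\<close>

primrec ext :: "('o, 'a) chain \<Rightarrow> 'o \<Rightarrow> nat \<Rightarrow> 'x \<Rightarrow> nat \<Rightarrow> nat \<Rightarrow> 'x"
  where
    "ext l Y w \<omega> k 0 = \<omega>"
  | "ext l Y w \<omega> k (Suc j) =
      cmp (w + j) 1 (obj l (k + j + 1)) (obj l (k + j)) Y (ext l Y w \<omega> k j) (df l (k + j))"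

text \<open>The form f^0 df^1 ... df^j. It agrees with \<open>cycle_word\<close>, but being a case
  of \<open>ext\<close> it can be split at any place.\<close>

definition word :: "('o, 'a) chain \<Rightarrow> nat \<Rightarrow> 'x"
  where "word l j = ext l (obj l 0) 0 (rho (obj l 1) (obj l 0) (fmor l 0)) 1 j"

lemma word_Suc: "word l (Suc j) = cmp j 1 (obj l (j + 2)) (obj l (j + 1)) (obj l 0) (word l j) (df l (j + 1))"
  by (simp add: word_def numeral_eq_Suc)

lemma cycle_word_eq: "j < length l \<Longrightarrow> cycle_word c l j = word l j"
proof (induction j)
  case 0
  then show ?case by (simp add: word_def mor_eq_fmor)
next
  case (Suc j)
  then show ?case by (simp add: word_Suc cmp_def df_def dd_def mor_eq_fmor numeral_eq_Suc)
qed

text \<open>This is how words of faces and of rotated chains are compared with words of the original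
  chain: they share long stretches of entries at shifted positions.\<close>

lemma ext_cong:
  assumes "\<And>i. i \<le> j \<Longrightarrow> obj l' (k' + i) = obj l (k + i)" "\<And>i. i < j \<Longrightarrow> fmor l' (k' + i) = fmor l (k + i)"
  shows "ext l' Y w \<omega> k' j = ext l Y w \<omega> k j"
  using assms
proof (induction j)
  case (Suc j)
  have "df l' (k' + j) = df l (k + j)"
    using Suc.prems(1)[of j] Suc.prems(1)[of "Suc j"] Suc.prems(2)[of j] by (simp add: df_def)
  then show ?case using Suc.prems(1)[of j] Suc.prems(1)[of "Suc j"] Suc by simp
qed simp

lemma ext_ext: "ext l Y w \<omega> k (i + j) = ext l Y (w + i) (ext l Y w \<omega> k i) (k + i) j"
  by (induction j) (simp_all add: add.assoc)

context
  fixes l n assumes l: "l \<in> chains C n"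
begin

lemmas objs = chains_obj[OF l]

lemma rho_f: "rho (obj l (k + 1)) (obj l k) (fmor l k) \<in> H 0 (obj l (k + 1)) (obj l k)"
  by (rule rho_mem[OF objs objs chains_fmor[OF l]])

lemma df_mem: "df l k \<in> H 1 (obj l (k + 1)) (obj l k)"
  unfolding df_def using dd_mem[OF objs objs rho_f] by simp

lemma dd_df: "dd 1 (obj l (k + 1)) (obj l k) (df l k) = 0"
  unfolding df_def using dd_dd[OF objs objs rho_f, of k] by simp

lemma ext_linear:
  assumes "Y \<in> ob C"
  shows "clinear_on (H w (obj l k) Y) (H (w + j) (obj l (k + j)) Y) (\<lambda>\<omega>. ext l Y w \<omega> k j)"
proof (induction j)
  case (Suc j)
  from clinear_on_compose[OF Suc cmp_left[OF objs objs assms df_mem[of "k + j"]]] show ?case by simp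
qed (simp add: clinear_on_id)

lemma ext_mem: "Y \<in> ob C \<Longrightarrow> \<omega> \<in> H w (obj l k) Y \<Longrightarrow> ext l Y w \<omega> k j \<in> H (w + j) (obj l (k + j)) Y"
  using ext_linear clinear_on_mem by blast

lemma ext_add: "Y \<in> ob C \<Longrightarrow> \<omega> \<in> H w (obj l k) Y \<Longrightarrow> \<omega>' \<in> H w (obj l k) Y \<Longrightarrow>
    ext l Y w (\<omega> + \<omega>') k j = ext l Y w \<omega> k j + ext l Y w \<omega>' k j"
  using clinear_on_add[OF ext_linear] by blast

lemma cmp_ext:
  assumes Y: "Y \<in> ob C" and Z: "Z \<in> ob C" and g: "g \<in> H i Y Z" and \<omega>: "\<omega> \<in> H w (obj l k) Y"
  shows "cmp i (w + j) (obj l (k + j)) Y Z g (ext l Y w \<omega> k j) = ext l Z (i + w) (cmp i w (obj l k) Y Z g \<omega>) k j"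
proof (induction j)
  case (Suc j)
  from cmp_assoc[OF objs objs Y Z g ext_mem[OF Y \<omega>] df_mem[of "k + j"]] Suc
  show ?case by (simp add: add.assoc)
qed simp

text \<open>As d(df) = 0, the Leibniz rule differentiates only the initial form, which produces no
  sign.\<close>

lemma dd_ext:
  assumes Y: "Y \<in> ob C" and \<omega>: "\<omega> \<in> H w (obj l k) Y"
  shows "dd (w + j) (obj l (k + j)) Y (ext l Y w \<omega> k j) = ext l Y (w + 1) (dd w (obj l k) Y \<omega>) k j"
proof (induction j)
  case (Suc j)
  have "cmp (w + j) 2 (obj l (k + j + 1)) (obj l (k + j)) Y (ext l Y w \<omega> k j) 0 = 0"
    by (rule clinear_on_zero[OF cmp_right[OF objs objs Y ext_mem[OF Y \<omega>]] H_subspace[OF objs objs]])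
  moreover from leibniz[OF objs objs Y ext_mem[OF Y \<omega>] df_mem[of "k + j"]]
  have "dd (w + j + 1) (obj l (k + j + 1)) Y (ext l Y w \<omega> k (Suc j)) =
      cmp (w + j + 1) 1 (obj l (k + j + 1)) (obj l (k + j)) Y (dd (w + j) (obj l (k + j)) Y (ext l Y w \<omega> k j)) (df l (k + j)) +
      (-1) ^ (w + j) *\<^sub>C cmp (w + j) (1 + 1) (obj l (k + j + 1)) (obj l (k + j)) Y (ext l Y w \<omega> k j)
        (dd 1 (obj l (k + j + 1)) (obj l (k + j)) (df l (k + j)))"
    by simp
  ultimately show ?case using Suc dd_df[of "k + j"] by (simp add: numeral_eq_Suc)
qed simp

lemma word_mem: "word l j \<in> H j (obj l (j + 1)) (obj l 0)"
  unfolding word_def using ext_mem[OF objs[of 0], of _ 0 1 j] rho_f[of 0] by simp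

text \<open>\<open>wpre l i\<close> is \<open>f\<^sup>0 df\<^sup>1 \<dots> df\<^sup>i f\<^bsup>i+1\<^esup>\<close>.\<close>

definition wpre :: "nat \<Rightarrow> 'x"
  where "wpre i = cmp i 0 (obj l (i + 2)) (obj l (i + 1)) (obj l 0) (word l i)
    (rho (obj l (i + 2)) (obj l (i + 1)) (fmor l (i + 1)))"

lemma wpre_mem: "wpre i \<in> H i (obj l (i + 2)) (obj l 0)"
  unfolding wpre_def using cmp_mem[OF objs objs objs word_mem rho_f[of "i + 1"]] by (simp add: numeral_eq_Suc)

end

section \<open>Words of the faces of a chain\<close>

lemma word_face_0:
  assumes l: "l \<in> chains C (n + 1)"
  shows "word (face C 0 l) n = ext l (obj l 0) 0 (wpre l 0) 2 n"
proof -
  have z: "0 \<le> n" by simp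
  note o = obj_face[OF l z] and m = fmor_face[OF l z]
  have F: "fmor l 0 \<in> hom C (obj l 1) (obj l 0)" "fmor l 1 \<in> hom C (obj l 2) (obj l 1)"
    using chains_fmor[OF l, of 0] chains_fmor[OF l, of 1] by (simp_all add: numeral_eq_Suc)
  have "rho (obj (face C 0 l) 1) (obj (face C 0 l) 0) (fmor (face C 0 l) 0) = wpre l 0"
    using o[of 0] o[of 1] m[of 0] rho_cmp[OF chains_obj[OF l] chains_obj[OF l] chains_obj[OF l] F]
    by (simp add: wpre_def[OF l] word_def numeral_eq_Suc)
  then show ?thesis unfolding word_def using o[of 0]
    by simp (rule ext_cong; use o m in \<open>simp add: numeral_eq_Suc\<close>)
qed

text \<open>By d(fg) = df g + f dg, merging two differentiated entries gives two forms whose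
  undifferentiated factors sit in adjacent places.\<close>

lemma word_face_Suc:
  assumes l: "l \<in> chains C (n + 1)" and i: "Suc i \<le> n"
  shows "word (face C (Suc i) l) n = ext l (obj l 0) (Suc i) (wpre l (Suc i)) (i + 3) (n - Suc i) +
    ext l (obj l 0) i (wpre l i) (i + 2) (n - i)"
proof -
  note o = obj_face[OF l i] and m = fmor_face[OF l i]
  note O = chains_obj[OF l]
  have F: "fmor l (i + 1) \<in> hom C (obj l (i + 2)) (obj l (i + 1))"
    "fmor l (i + 2) \<in> hom C (obj l (i + 3)) (obj l (i + 2))"
    using chains_fmor[OF l, of "i + 1"] chains_fmor[OF l, of "i + 2"] by (simp_all add: numeral_eq_Suc)
  let ?l = "face C (Suc i) l" and ?Y = "obj l 0"
  have fl: "?l \<in> chains C n" using face_chains[OF C l i] .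
  have o0: "obj ?l 0 = ?Y" using o[of 0] by simp
  have w: "word ?l i = word l i"
    unfolding word_def using o[of 0] o[of 1] m[of 0] i
    by simp (rule ext_cong; use o m i in simp)
  define A where "A = rho (obj l (i + 2)) (obj l (i + 1)) (fmor l (i + 1))"
  define B where "B = rho (obj l (i + 3)) (obj l (i + 2)) (fmor l (i + 2))"
  have A: "A \<in> H 0 (obj l (i + 2)) (obj l (i + 1))" and B: "B \<in> H 0 (obj l (i + 3)) (obj l (i + 2))"
    using rho_f[OF l, of "i + 1"] rho_f[OF l, of "i + 2"] by (simp_all add: A_def B_def numeral_eq_Suc)
  have dA: "dd 0 (obj l (i + 2)) (obj l (i + 1)) A = df l (i + 1)"
    and dB: "dd 0 (obj l (i + 3)) (obj l (i + 2)) B = df l (i + 2)"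
    by (simp_all add: df_def A_def B_def numeral_eq_Suc)
  have "df ?l (i + 1) = dd 0 (obj l (i + 3)) (obj l (i + 1)) (cmp 0 0 (obj l (i + 3)) (obj l (i + 2)) (obj l (i + 1)) A B)"
    unfolding df_def using o[of "i + 1"] o[of "i + 2"] m[of "i + 1"] i
      rho_cmp[OF O O O F]
    by (simp add: A_def B_def numeral_eq_Suc)
  also have "\<dots> = cmp 1 0 (obj l (i + 3)) (obj l (i + 2)) (obj l (i + 1)) (df l (i + 1)) B +
      cmp 0 1 (obj l (i + 3)) (obj l (i + 2)) (obj l (i + 1)) A (df l (i + 2))"
    using leibniz[OF O O O A B, unfolded dA dB] by simp
  finally have df: "df ?l (i + 1) = \<dots>" .
  have mem1: "df l (i + 1) \<in> H 1 (obj l (i + 2)) (obj l (i + 1))"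
    and mem2: "df l (i + 2) \<in> H 1 (obj l (i + 3)) (obj l (i + 2))"
    using df_mem[OF l, of "i + 1"] df_mem[OF l, of "i + 2"] by (simp_all add: numeral_eq_Suc)
  note W = word_mem[OF l, of i]
  have "word ?l (Suc i) = cmp i 1 (obj l (i + 3)) (obj l (i + 1)) ?Y (word l i) (df ?l (i + 1))"
    unfolding word_Suc w using o[of 0] o[of "i + 1"] o[of "i + 2"] i by (simp add: numeral_eq_Suc)
  also have "\<dots> = cmp i 1 (obj l (i + 3)) (obj l (i + 1)) ?Y (word l i)
        (cmp 1 0 (obj l (i + 3)) (obj l (i + 2)) (obj l (i + 1)) (df l (i + 1)) B) +
      cmp i 1 (obj l (i + 3)) (obj l (i + 1)) ?Y (word l i)
        (cmp 0 1 (obj l (i + 3)) (obj l (i + 2)) (obj l (i + 1)) A (df l (i + 2)))"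
    unfolding df using cmp_mem[OF O O O mem1 B] cmp_mem[OF O O O A mem2]
    by (intro clinear_on_add[OF cmp_right[OF O O O W]]) simp_all
  also have "cmp i 1 (obj l (i + 3)) (obj l (i + 1)) ?Y (word l i)
        (cmp 1 0 (obj l (i + 3)) (obj l (i + 2)) (obj l (i + 1)) (df l (i + 1)) B) = wpre l (Suc i)"
    using cmp_assoc[OF O O O O W mem1 B] by (simp add: wpre_def[OF l] word_Suc B_def numeral_eq_Suc)
  also have "cmp i 1 (obj l (i + 3)) (obj l (i + 1)) ?Y (word l i)
        (cmp 0 1 (obj l (i + 3)) (obj l (i + 2)) (obj l (i + 1)) A (df l (i + 2))) =
      ext l ?Y i (wpre l i) (i + 2) 1"
    using cmp_assoc[OF O O O O W A mem2] by (simp add: wpre_def[OF l] A_def numeral_eq_Suc)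
  finally have eq: "word ?l (Suc i) = wpre l (Suc i) + ext l ?Y i (wpre l i) (i + 2) 1" .
  have m1: "wpre l (Suc i) \<in> H (Suc i) (obj l (i + 3)) ?Y"
    using wpre_mem[OF l, of "Suc i"] by (simp add: numeral_eq_Suc)
  have m2: "ext l ?Y i (wpre l i) (i + 2) 1 \<in> H (Suc i) (obj l (i + 3)) ?Y"
    using ext_mem[OF l O wpre_mem[OF l, of i], where j = 1] by (simp add: numeral_eq_Suc)
  have n: "n = Suc i + (n - Suc i)" "n - i = 1 + (n - Suc i)" using i by simp_all
  have "word ?l n = ext ?l ?Y (Suc i) (word ?l (Suc i)) (i + 2) (n - Suc i)"
    using ext_ext[of ?l ?Y 0 _ 1 "Suc i" "n - Suc i"] n(1) by (simp add: word_def o0 numeral_eq_Suc)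
  also have "\<dots> = ext l ?Y (Suc i) (word ?l (Suc i)) (i + 3) (n - Suc i)"
    by (rule ext_cong; use o m i in \<open>simp add: numeral_eq_Suc\<close>)
  also have "\<dots> = ext l ?Y (Suc i) (wpre l (Suc i)) (i + 3) (n - Suc i) +
      ext l ?Y (Suc i) (ext l ?Y i (wpre l i) (i + 2) 1) (i + 3) (n - Suc i)"
    unfolding eq by (rule ext_add[OF l O m1 m2])
  also have "ext l ?Y (Suc i) (ext l ?Y i (wpre l i) (i + 2) 1) (i + 3) (n - Suc i) = ext l ?Y i (wpre l i) (i + 2) (n - i)"
    unfolding n(2) ext_ext by (simp add: numeral_eq_Suc)
  finally show ?thesis .
qed

lemma ext_wpre_mem:
  assumes l: "l \<in> chains C (n + 1)" and i: "i \<le> n"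
  shows "ext l (obj l 0) i (wpre l i) (i + 2) (n - i) \<in> H n (obj l 0) (obj l 0)"
  using ext_mem[OF l chains_obj[OF l] wpre_mem[OF l, of i], where j = "n - i"] i chains_wrap(2)[OF l]
  by simp

lemma word_mem': "l \<in> chains C n \<Longrightarrow> word l n \<in> H n (obj l 0) (obj l 0)"
  using word_mem[of l n n] chains_wrap(2)[of l C n] by simp

text \<open>Let A(i) be the form with undifferentiated factor f^(i+1). The word of face 0 is A(0),
  that of face i + 1 is A(i+1) + A(i); solving this recursion for A(i) yields the alternating
  sum.\<close>

lemma functional_ext_wpre:
  fixes \<theta> :: "'o \<Rightarrow> 'x \<Rightarrow> complex"
  assumes \<theta>: "\<And>X. X \<in> ob C \<Longrightarrow> clinear_on (H n X X) UNIV (\<theta> X)"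
    and l: "l \<in> chains C (n + 1)"
  shows "i \<le> n \<Longrightarrow> \<theta> (obj l 0) (ext l (obj l 0) i (wpre l i) (i + 2) (n - i)) =
    (\<Sum>k\<le>i. (-1) ^ (i + k) * \<theta> (obj l 0) (word (face C k l) n))"
proof (induction i)
  case 0
  then show ?case using word_face_0[OF l] by (simp add: numeral_eq_Suc)
next
  case (Suc i)
  have "\<theta> (obj l 0) (word (face C (Suc i) l) n) =
      \<theta> (obj l 0) (ext l (obj l 0) (Suc i) (wpre l (Suc i)) (i + 3) (n - Suc i)) +
      \<theta> (obj l 0) (ext l (obj l 0) i (wpre l i) (i + 2) (n - i))"
    unfolding word_face_Suc[OF l Suc.prems]
    using ext_wpre_mem[OF l Suc.prems] ext_wpre_mem[OF l, of i] Suc.prems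
    by (intro clinear_on_add[OF \<theta>[OF chains_obj[OF l]]]) (simp_all add: numeral_eq_Suc)
  moreover have "(\<Sum>k\<le>i. (-1) ^ (Suc i + k) * \<theta> (obj l 0) (word (face C k l) n)) =
      - (\<Sum>k\<le>i. (-1) ^ (i + k) * \<theta> (obj l 0) (word (face C k l) n))"
    by (simp add: sum_negf[symmetric])
  moreover have "(-1::complex) ^ (Suc i + Suc i) = 1" by (simp add: power_add[symmetric] flip: mult_2)
  ultimately show ?case using Suc by (simp add: numeral_eq_Suc)
qed

text \<open>For a closed graded trace this is the character; for a mere linear functional such as
  \<theta> it is still a cochain.\<close>

definition wfun :: "nat \<Rightarrow> ('o \<Rightarrow> 'x \<Rightarrow> complex) \<Rightarrow> ('o, 'a) chain \<Rightarrow> complex"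
  where "wfun n \<theta> l = (if l \<in> chains C n then \<theta> (obj l 0) (word l n) else 0)"

lemma wfun_cochain:
  assumes \<theta>: "\<And>X. X \<in> ob C \<Longrightarrow> clinear_on (H n X X) UNIV (\<theta> X)"
  shows "wfun n \<theta> \<in> cochains C n"
  unfolding cochains_iff
proof (intro conjI ballI allI impI)
  fix l i assume l: "l \<in> chains C n" and i: "i \<le> n"
  note O = chains_obj[OF l]
  let ?Y = "obj l 0" and ?H = "hom C (obj l (i + 1)) (obj l i)"
  have len: "length l = n + 1" using chains_length[OF l] .
  have m: "fmor (slot l i f) j = (if j = i then f else fmor l j)" if "j \<le> n" for j f
    using that i len by (simp add: fmor_slot)
  \<comment> \<open>Past the varied slot the word is an extension of a form that depends linearly on
    the entry: \<rho>(f) in slot 0, the preceding word times d\<rho>(f) in the other slots.\<close>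
  have "\<exists>A. clinear_on ?H (H i (obj l (i + 1)) ?Y) A \<and> (\<forall>f. word (slot l i f) n = ext l ?Y i (A f) (i + 1) (n - i))"
  proof (cases i)
    case 0
    have "word (slot l i f) n = ext l ?Y i (rho (obj l 1) ?Y f) (i + 1) (n - i)" for f
      unfolding word_def using m[of 0 f] 0
      by simp (rule ext_cong; use m 0 in simp)
    then show ?thesis using 0 rho_lin[OF O O, of 1 0] by auto
  next
    case (Suc k)
    have w: "word (slot l i f) k = word l k" for f
      unfolding word_def using m[of 0 f] Suc i
      by simp (rule ext_cong; use m Suc i in simp)
    define A where "A f = cmp k 1 (obj l (i + 1)) (obj l i) ?Y (word l k) (dd 0 (obj l (i + 1)) (obj l i) (rho (obj l (i + 1)) (obj l i) f))" for f
    have W: "word l k \<in> H k (obj l i) ?Y" using word_mem[OF l, of k] Suc by simp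
    have "clinear_on ?H (H i (obj l (i + 1)) ?Y) A"
      unfolding A_def using clinear_on_compose[OF clinear_on_compose[OF rho_lin[OF O O] dd_linear[OF O O]]
          cmp_right[OF O O O W, where j = "0 + 1"], of "i + 1"] Suc by simp
    moreover have "word (slot l i f) n = ext l ?Y i (A f) (i + 1) (n - i)" for f
    proof -
      have "word (slot l i f) i = A f"
        unfolding Suc word_Suc w[unfolded Suc] using m[of i f] Suc i
        by (simp add: A_def df_def numeral_eq_Suc)
      moreover have "word (slot l i f) n = ext (slot l i f) ?Y i (word (slot l i f) i) (i + 1) (n - i)"
        using ext_ext[of "slot l i f" ?Y 0 _ 1 i "n - i"] i by (simp add: word_def)
      moreover have "ext (slot l i f) ?Y i (A f) (i + 1) (n - i) = ext l ?Y i (A f) (i + 1) (n - i)"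
        by (rule ext_cong) (use m i in simp_all)
      ultimately show ?thesis by simp
    qed
    ultimately show ?thesis by blast
  qed
  then obtain A where A: "clinear_on ?H (H i (obj l (i + 1)) ?Y) A"
    "\<And>f. word (slot l i f) n = ext l ?Y i (A f) (i + 1) (n - i)" by blast
  have "i + (n - i) = n" "obj l (i + 1 + (n - i)) = ?Y" using i chains_wrap(2)[OF l] by simp_all
  then have "clinear_on (H i (obj l (i + 1)) ?Y) (H n ?Y ?Y) (\<lambda>\<omega>. ext l ?Y i \<omega> (i + 1) (n - i))"
    using ext_linear[OF l O[of 0], of i "i + 1" "n - i"] by simp
  from clinear_on_compose[OF clinear_on_compose[OF A(1) this] \<theta>[OF O]]
  show "clinear_on ?H UNIV (\<lambda>f. wfun n \<theta> (slot l i f))"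
    by (rule clinear_on_congr) (simp_all add: lin_cat_hom[OF C] O wfun_def slot_chains[OF l i, simplified] A(2))
qed (simp add: wfun_def)

end

context dg_words
begin

definition graded_trace :: "nat \<Rightarrow> ('o \<Rightarrow> 'x \<Rightarrow> complex) \<Rightarrow> bool"
  where "graded_trace n T \<longleftrightarrow>
    (\<forall>X\<in>ob C. clinear_on (H n X X) UNIV (T X)) \<and>
    (\<forall>k. n = k + 1 \<longrightarrow> (\<forall>X\<in>ob C. \<forall>f\<in>H k X X. T X (dd k X X f) = 0)) \<and>
    (\<forall>i j. i + j = n \<longrightarrow> (\<forall>X\<in>ob C. \<forall>Y\<in>ob C. \<forall>g\<in>H i Y X. \<forall>g'\<in>H j X Y.
      T X (cmp i j X Y X g g') = (-1) ^ (i * j) * T Y (cmp j i Y X Y g' g)))"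

section \<open>Closed graded traces and cyclic cocycles\<close>

lemma graded_trace_linear: "graded_trace n T \<Longrightarrow> X \<in> ob C \<Longrightarrow> clinear_on (H n X X) UNIV (T X)"
  by (simp add: graded_trace_def)

lemma graded_trace_closed: "graded_trace (k + 1) T \<Longrightarrow> X \<in> ob C \<Longrightarrow> f \<in> H k X X \<Longrightarrow> T X (dd k X X f) = 0"
  by (simp add: graded_trace_def)

lemma graded_trace_comm: "graded_trace (i + j) T \<Longrightarrow> X \<in> ob C \<Longrightarrow> Y \<in> ob C \<Longrightarrow> g \<in> H i Y X \<Longrightarrow> g' \<in> H j X Y \<Longrightarrow>
    T X (cmp i j X Y X g g') = (-1) ^ (i * j) * T Y (cmp j i Y X Y g' g)"
  unfolding graded_trace_def by blast

lemma rho_word_last_face: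
  assumes l: "l \<in> chains C (n + 1)"
  shows "cmp 0 n (obj l (n + 1)) (obj l 0) (obj l (n + 1))
      (rho (obj l 0) (obj l (n + 1)) (fmor l (n + 1))) (word l n) = word (last_face C l) n"
proof -
  define r where "r = rotate (n + 1) l"
  have r: "r \<in> chains C (n + 1)" unfolding r_def by (rule rotate_chains[OF l])
  have o: "obj r i = obj l (i + (n + 1))" and m: "fmor r i = fmor l (i + (n + 1))" for i
    using chains_not_Nil[OF l] by (simp_all add: r_def obj_rotate fmor_rotate del: rotate_Suc)
  have w: "obj l (i + (n + 2)) = obj l i" "fmor l (i + (n + 2)) = fmor l i" for i
    using chains_wrap(1,3)[OF l, of i] by simp_all
  have o1: "obj r 1 = obj l 0" "obj r 2 = obj l 1" "obj r 0 = obj l (n + 1)"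
    and m1: "fmor r 1 = fmor l 0" "fmor r 0 = fmor l (n + 1)"
    using o[of 0] o[of 1] o[of 2] m[of 0] m[of 1] w[of 0] w[of 1] by (simp_all add: numeral_eq_Suc)
  have f: "rho (obj l 0) (obj l (n + 1)) (fmor l (n + 1)) \<in> H 0 (obj l 0) (obj l (n + 1))"
    using rho_f[OF l, of "n + 1"] w(1)[of 0] by (simp add: numeral_eq_Suc)
  have f0: "rho (obj l 1) (obj l 0) (fmor l 0) \<in> H 0 (obj l 1) (obj l 0)"
    using rho_f[OF l, of 0] by simp
  have pre: "wpre r 0 = cmp 0 0 (obj l 1) (obj l 0) (obj l (n + 1)) (rho (obj l 0) (obj l (n + 1)) (fmor l (n + 1)))
      (rho (obj l 1) (obj l 0) (fmor l 0))"
    using o1 m1 by (simp add: wpre_def[OF r] word_def numeral_eq_Suc)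
  have "cmp 0 n (obj l (n + 1)) (obj l 0) (obj l (n + 1)) (rho (obj l 0) (obj l (n + 1)) (fmor l (n + 1))) (word l n)
      = ext l (obj l (n + 1)) 0 (wpre r 0) 1 n"
    using cmp_ext[OF l chains_obj[OF l] chains_obj[OF l] f f0, of n]
    by (simp add: word_def[of l n] pre)
  also have "\<dots> = ext r (obj r 0) 0 (wpre r 0) 2 n"
    unfolding o1(3) by (rule ext_cong; use o m w(1)[of "_ + 1"] w(2)[of "_ + 1"] in \<open>simp add: numeral_eq_Suc add_ac\<close>)
  also have "\<dots> = word (last_face C l) n"
    unfolding last_face_eq[OF l] r_def[symmetric] by (rule word_face_0[OF r, symmetric])
  finally show ?thesis .
qed

lemma dd_word:
  assumes l: "l \<in> chains C n"
  shows "dd j (obj l (j + 1)) (obj l 0) (word l j) = ext l (obj l 0) 1 (df l 0) 1 j"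
  using dd_ext[OF l chains_obj[OF l] rho_f[OF l, of 0], of j] by (simp add: word_def df_def)

text \<open>The second factor is d(f^0 df^1 ... df^(i-1)) = df^0 ... df^(i-1); multiplied by f^i
  df^(i+1) ... df^n from the left it completes the rotated word.\<close>

lemma word_rotate:
  assumes l: "l \<in> chains C n" and i: "1 \<le> i" "i \<le> n"
  shows "cmp (n - i) i (obj l i) (obj l 0) (obj l i) (word (rotate i l) (n - i))
      (dd (i - 1) (obj l i) (obj l 0) (word l (i - 1))) = word (rotate i l) n"
proof -
  define r where "r = rotate i l"
  have r: "r \<in> chains C n" unfolding r_def by (rule rotate_chains[OF l])
  have o: "obj r j = obj l (j + i)" and m: "fmor r j = fmor l (j + i)" for j
    using chains_not_Nil[OF l] by (simp_all add: r_def obj_rotate fmor_rotate del: rotate_Suc)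
  have w: "obj l (j + (n + 1)) = obj l j" "fmor l (j + (n + 1)) = fmor l j" for j
    using chains_wrap(1,3)[OF l, of j] by simp_all
  have o1: "obj r (n - i + 1 + j) = obj l j" and m1: "fmor r (n - i + 1 + j) = fmor l j" for j
    using o[of "n - i + 1 + j"] m[of "n - i + 1 + j"] w[of j] i by (simp_all add: add_ac)
  have o0: "obj r 0 = obj l i" using o[of 0] by simp
  have d: "df r (n - i + 1) = df l 0"
    unfolding df_def using o1[of 0] o1[of 1] m1[of 0] by simp
  have v: "word r (n - i) \<in> H (n - i) (obj l 0) (obj l i)"
    using word_mem[OF r, of "n - i"] o1[of 0] o0 by simp
  have d0: "df l 0 \<in> H 1 (obj l 1) (obj l 0)" using df_mem[OF l, of 0] by simp
  have "cmp (n - i) i (obj l i) (obj l 0) (obj l i) (word r (n - i)) (dd (i - 1) (obj l i) (obj l 0) (word l (i - 1)))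
      = ext l (obj l i) (n - i + 1) (cmp (n - i) 1 (obj l 1) (obj l 0) (obj l i) (word r (n - i)) (df l 0)) 1 (i - 1)"
    using cmp_ext[OF l chains_obj[OF l] chains_obj[OF l] v d0, of "i - 1"] dd_word[OF l, of "i - 1"] i by simp
  also have "cmp (n - i) 1 (obj l 1) (obj l 0) (obj l i) (word r (n - i)) (df l 0) = word r (n - i + 1)"
    using word_Suc[of r "n - i"] d o1[of 0] o1[of 1] o0 by simp
  also have "ext l (obj l i) (n - i + 1) (word r (n - i + 1)) 1 (i - 1) = ext r (obj l i) (n - i + 1) (word r (n - i + 1)) (n - i + 2) (i - 1)"
    by (rule ext_cong; use o1[of "Suc _"] m1[of "Suc _"] in \<open>simp add: numeral_eq_Suc\<close>)
  also have "\<dots> = word r n"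
    using ext_ext[of r "obj l i" 0 _ 1 "n - i + 1" "i - 1"] i by (simp add: word_def[of r] o0 numeral_eq_Suc)
  finally show ?thesis by (simp add: r_def)
qed

text \<open>Closedness for f^n f^0 df^1 ... df^(n-1) exchanges df^n f^0 df^1 ... df^(n-1) for minus
  f^n df^0 ... df^(n-1), and graded commutativity moves df^n from the end of the word to its
  front.\<close>

lemma wfun_cyclic:
  assumes T: "graded_trace n T" and l: "l \<in> chains C n"
  shows "wfun n T l = (-1) ^ n * wfun n T (rotate n l)"
proof (cases n)
  case (Suc k)
  note O = chains_obj[OF l]
  have r: "rotate n l \<in> chains C n" by (rule rotate_chains[OF l])
  have X: "obj l (n + 1) = obj l 0" using chains_wrap(2)[OF l] .
  let ?X = "obj l 0" and ?Y = "obj l n"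
  define f where "f = rho ?X ?Y (fmor l n)"
  have f: "f \<in> H 0 ?X ?Y" using rho_f[OF l, of n] X by (simp add: f_def)
  have df: "df l n = dd 0 ?X ?Y f" "df l n \<in> H 1 ?X ?Y"
    using df_mem[OF l, of n] X by (simp_all add: df_def f_def)
  have w: "word l k \<in> H k ?Y ?X" using word_mem[OF l, of k] Suc by simp
  have wn: "word l n = cmp k 1 ?X ?Y ?X (word l k) (df l n)"
    using word_Suc[of l k] X Suc by (simp add: numeral_eq_Suc)
  have T1: "graded_trace (k + 1) T" using T Suc by simp
  have "0 = T ?Y (dd k ?Y ?Y (cmp 0 k ?Y ?X ?Y f (word l k)))"
    using graded_trace_closed[OF T1 O, of "cmp 0 k ?Y ?X ?Y f (word l k)" n] cmp_mem[OF O O O f w] by simp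
  also have "\<dots> = T ?Y (cmp 1 k ?Y ?X ?Y (df l n) (word l k) + cmp 0 (k + 1) ?Y ?X ?Y f (dd k ?Y ?X (word l k)))"
    using leibniz[OF O O O f w] df(1) by simp
  also have "\<dots> = T ?Y (cmp 1 k ?Y ?X ?Y (df l n) (word l k)) + T ?Y (cmp 0 (k + 1) ?Y ?X ?Y f (dd k ?Y ?X (word l k)))"
    using cmp_mem[OF O O O df(2) w] cmp_mem[OF O O O f dd_mem[OF O O w]]
    by (intro clinear_on_add[OF graded_trace_linear[OF T1 O]]) simp_all
  also have "cmp 0 (k + 1) ?Y ?X ?Y f (dd k ?Y ?X (word l k)) = word (rotate n l) n"
  proof -
    have "word (rotate n l) 0 = f"
      using chains_not_Nil[OF l] X by (simp add: word_def obj_rotate fmor_rotate f_def add.commute)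
    then show ?thesis using word_rotate[OF l, of n] Suc by (simp del: rotate_Suc)
  qed
  finally have 1: "T ?Y (cmp 1 k ?Y ?X ?Y (df l n) (word l k)) = - T ?Y (word (rotate n l) n)"
    by (simp add: eq_neg_iff_add_eq_0)
  have "T ?X (word l n) = (-1) ^ (k * 1) * T ?Y (cmp 1 k ?Y ?X ?Y (df l n) (word l k))"
    unfolding wn by (rule graded_trace_comm[OF T1 O O w df(2)])
  also have "\<dots> = (-1) ^ n * T ?Y (word (rotate n l) n)" unfolding 1 by (simp add: Suc)
  finally show ?thesis
    using l r chains_not_Nil[OF l] by (simp add: wfun_def obj_rotate del: rotate_Suc)
qed simp

lemma wpre_last:
  assumes l: "l \<in> chains C (n + 1)"
  defines "Y \<equiv> obj l (n + 1)" and "f \<equiv> rho (obj l 0) (obj l (n + 1)) (fmor l (n + 1))"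
  shows "wpre l n = cmp n 0 (obj l 0) Y (obj l 0) (word l n) f" "f \<in> H 0 (obj l 0) Y"
    "word l n \<in> H n Y (obj l 0)" "df l (n + 1) = dd 0 (obj l 0) Y f"
    "word l (n + 1) = cmp n 1 (obj l 0) Y (obj l 0) (word l n) (df l (n + 1))"
    "obj (last_face C l) 0 = Y"
proof -
  have X: "obj l (n + 2) = obj l 0" using chains_wrap(2)[OF l] by simp
  show "wpre l n = cmp n 0 (obj l 0) Y (obj l 0) (word l n) f" using X by (simp add: wpre_def[OF l] Y_def f_def)
  show "f \<in> H 0 (obj l 0) Y" using rho_f[OF l, of "n + 1"] X by (simp add: Y_def f_def numeral_eq_Suc)
  show "word l n \<in> H n Y (obj l 0)" using word_mem[OF l, of n] by (simp add: Y_def)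
  show "df l (n + 1) = dd 0 (obj l 0) Y f" using X by (simp add: df_def Y_def f_def numeral_eq_Suc)
  show "word l (n + 1) = cmp n 1 (obj l 0) Y (obj l 0) (word l n) (df l (n + 1))"
    using word_Suc[of l n] X by (simp add: Y_def numeral_eq_Suc)
  have r: "rotate (n + 1) l \<in> chains C (n + 1)" by (rule rotate_chains[OF l])
  show "obj (last_face C l) 0 = Y"
    unfolding last_face_eq[OF l] using obj_face[OF r, of 0 0] chains_not_Nil[OF l]
    by (simp add: Y_def obj_rotate del: rotate_Suc)
qed

text \<open>The alternating sum over the faces telescopes to the form f^0 df^1 ... df^n f^(n+1),
  whose undifferentiated factor has been pushed to the end.\<close>

lemma bprime_wfun:
  assumes \<theta>: "\<And>X. X \<in> ob C \<Longrightarrow> clinear_on (H n X X) UNIV (\<theta> X)" and l: "l \<in> chains C (n + 1)"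
  shows "bprime C n (wfun n \<theta>) l = (-1) ^ n * \<theta> (obj l 0) (wpre l n)"
proof -
  have "\<theta> (obj l 0) (wpre l n) = (\<Sum>k\<le>n. (-1) ^ (n + k) * \<theta> (obj l 0) (word (face C k l) n))"
    using functional_ext_wpre[OF \<theta> l, of n] by simp
  also have "\<dots> = (-1) ^ n * (\<Sum>k\<le>n. (-1) ^ k * \<theta> (obj l 0) (word (face C k l) n))"
    by (simp add: sum_distrib_left power_add mult.assoc)
  also have "(\<Sum>k\<le>n. (-1) ^ k * \<theta> (obj l 0) (word (face C k l) n)) = bprime C n (wfun n \<theta>) l"
    unfolding bprime_def using l face_chains[OF C l]
    by (simp add: wfun_def obj_face[OF l])
  finally have "\<theta> (obj l 0) (wpre l n) = (-1) ^ n * bprime C n (wfun n \<theta>) l" .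
  moreover have "(-1::complex) ^ n * (-1) ^ n = 1" by (simp add: power_mult_distrib[symmetric])
  ultimately show ?thesis by (simp add: mult.assoc[symmetric])
qed

text \<open>With \<omega> = f^0 df^1 ... df^n, the inner faces amount to T(\<omega> f^(n+1)) and the
  last face to T(f^(n+1) \<omega>), with opposite signs.\<close>

lemma wfun_cocycle:
  assumes T: "graded_trace n T" shows "wfun n T \<in> cyclic_cocycles C n"
proof -
  note lin = graded_trace_linear[OF T]
  have "hochschild_b C n (wfun n T) l = 0" for l
  proof (cases "l \<in> chains C (n + 1)")
    case l: True
    note w = wpre_last[OF l] and O = chains_obj[OF l]
    have "T (obj l 0) (wpre l n) = T (obj l (n + 1)) (word (last_face C l) n)"
      unfolding w(1) rho_word_last_face[OF l, symmetric]
      using graded_trace_comm[of n 0 T, OF _ O O w(3,2)] T by simp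
    also have "\<dots> = wfun n T (last_face C l)"
      using cface_chains[OF C l, of "n + 1"] w(6) by (simp add: wfun_def cface_def)
    finally have "bprime C n (wfun n T) l = (-1) ^ n * wfun n T (last_face C l)"
      using bprime_wfun[of n T, OF lin l] by simp
    then show ?thesis using l by (simp add: hochschild_b_def bprime_def)
  qed (simp add: hochschild_b_def)
  then show ?thesis
    using wfun_cochain[of n T, OF lin] wfun_cyclic[OF T]
    by (simp add: cyclic_cocycles_def cyclic_cochains_iff fun_eq_iff)
qed

text \<open>\<open>S \<phi>\<close>, for the character \<open>\<phi>\<close> of the closed graded trace \<open>T\<close>, is the sum of
  \<open>T(f\<^sup>0 df\<^sup>1 \<dots> df\<^bsup>i-1\<^esup> f\<^sup>i f\<^bsup>i+1\<^esup> df\<^bsup>i+2\<^esup> \<dots> df\<^bsup>r+2\<^esup>)\<close> over \<open>1 \<le> i \<le> r + 1\<close>.\<close>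

definition Sfun :: "nat \<Rightarrow> ('o \<Rightarrow> 'x \<Rightarrow> complex) \<Rightarrow> ('o, 'a) chain \<Rightarrow> complex"
  where "Sfun r T l = (if l \<in> chains C (r + 2) then \<Sum>k\<le>r. T (obj l 0)
    (ext (face C (Suc k) l) (obj l 0) k (wpre (face C (Suc k) l) k) (k + 2) (r - k)) else 0)"

text \<open>A linear functional \<open>\<theta>\<close> on the forms of odd degree \<open>N\<close> that is a trace up to \<open>T'(dg g')\<close> gives rise
  to the closed graded trace \<open>T = \<theta> d / 2\<close>.\<close>

context
  fixes N m :: nat and \<theta> T' T :: "'o \<Rightarrow> 'x \<Rightarrow> complex"
  assumes N: "N = 2 * m + 1"
    and \<theta>: "\<And>X. X \<in> ob C \<Longrightarrow> clinear_on (H N X X) UNIV (\<theta> X)"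
    and T': "graded_trace (N + 1) T'"
    and comm: "\<And>i j X Y g g'. i + j = N \<Longrightarrow> X \<in> ob C \<Longrightarrow> Y \<in> ob C \<Longrightarrow> g \<in> H i Y X \<Longrightarrow> g' \<in> H j X Y \<Longrightarrow>
      \<theta> X (cmp i j X Y X g g') = \<theta> Y (cmp j i Y X Y g' g) + T' X (cmp (i + 1) j X Y X (dd i Y X g) g')"
    and T: "\<And>X \<omega>. X \<in> ob C \<Longrightarrow> \<omega> \<in> H (2 * m) X X \<Longrightarrow> T X \<omega> = 1 / 2 * \<theta> X (dd (2 * m) X X \<omega>)"
begin

text \<open>The differential of f^0 df^1 ... df^k f^(k+1) df^(k+2) ... df^N is df^0 ... df^k f^(k+1)
  df^(k+2) ... df^N plus (-1)^k times the full word. In the first term the factor df^0 ... df^k can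
  be moved to the end under \<theta>, which gives the word of the rotated chain.\<close>

lemma Sfun_term:
  assumes l: "l \<in> chains C N" and k: "k \<le> 2 * m"
  shows "T (obj l 0) (ext l (obj l 0) k (wpre l k) (k + 2) (2 * m - k)) =
    1 / 2 * (wfun N \<theta> (rotate (Suc k) l) + (-1) ^ k * wfun N \<theta> l)"
proof -
  let ?X = "obj l 0" and ?i = "Suc k" and ?j = "2 * m - k"
  let ?Y = "obj l ?i"
  note O = chains_obj[OF l]
  have l1: "l \<in> chains C (2 * m + 1)" using l N by simp
  have X: "obj l (N + 1) = ?X" using chains_wrap(2)[OF l] .
  define f where "f = rho (obj l (k + 2)) ?Y (fmor l ?i)"
  have f: "f \<in> H 0 (obj l (k + 2)) ?Y" using rho_f[OF l, of ?i] by (simp add: f_def numeral_eq_Suc)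
  have w: "word l k \<in> H k ?Y ?X" using word_mem[OF l, of k] by simp
  have dw: "dd k ?Y ?X (word l k) \<in> H (k + 1) ?Y ?X" by (rule dd_mem[OF O O w])
  have df: "df l ?i = dd 0 (obj l (k + 2)) ?Y f" "df l ?i \<in> H 1 (obj l (k + 2)) ?Y"
    using df_mem[OF l, of ?i] by (simp_all add: df_def f_def numeral_eq_Suc)
  have pre: "wpre l k = cmp k 0 (obj l (k + 2)) ?Y ?X (word l k) f"
    by (simp add: wpre_def[OF l] f_def)
  have "dd k (obj l (k + 2)) ?X (wpre l k) = cmp (k + 1) 0 (obj l (k + 2)) ?Y ?X (dd k ?Y ?X (word l k)) f +
      (-1) ^ k *\<^sub>C word l ?i"
    using leibniz[OF O O O w f, folded df(1)] by (simp add: pre word_Suc)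
  moreover have m1: "cmp (k + 1) 0 (obj l (k + 2)) ?Y ?X (dd k ?Y ?X (word l k)) f \<in> H (k + 1) (obj l (k + 2)) ?X"
    using cmp_mem[OF O O O dw f] by simp
  moreover have m2: "word l ?i \<in> H (k + 1) (obj l (k + 2)) ?X"
    using word_mem[OF l, of ?i] by (simp add: numeral_eq_Suc)
  moreover have m3: "(-1) ^ k *\<^sub>C word l ?i \<in> H (k + 1) (obj l (k + 2)) ?X"
    using m2 by (intro cvs.subspace_scale H_subspace O)
  ultimately have "dd (2 * m) ?X ?X (ext l ?X k (wpre l k) (k + 2) ?j) =
      ext l ?X (k + 1) (cmp (k + 1) 0 (obj l (k + 2)) ?Y ?X (dd k ?Y ?X (word l k)) f) (k + 2) ?j +
      (-1) ^ k *\<^sub>C ext l ?X (k + 1) (word l ?i) (k + 2) ?j"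
    using dd_ext[OF l O wpre_mem[OF l, of k], of ?j] k X N ext_add[OF l O m1 m3, of ?j]
      clinear_on_scale[OF ext_linear[OF l O[of 0], where w = "k + 1" and k = "k + 2" and j = ?j] m2, of "(-1) ^ k"]
    by (simp add: numeral_eq_Suc)
  also have "ext l ?X (k + 1) (word l ?i) (k + 2) ?j = word l N"
    using ext_ext[of l ?X 0 _ 1 ?i ?j] k N by (simp add: word_def numeral_eq_Suc)
  also have "ext l ?X (k + 1) (cmp (k + 1) 0 (obj l (k + 2)) ?Y ?X (dd k ?Y ?X (word l k)) f) (k + 2) ?j =
      cmp ?i ?j ?X ?Y ?X (dd k ?Y ?X (word l k)) (word (rotate ?i l) ?j)"
  proof -
    have ne: "l \<noteq> []" using chains_not_Nil[OF l] .
    have "word (rotate ?i l) ?j = ext l ?Y 0 f (k + 2) ?j"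
      unfolding word_def using ne
      by (simp add: obj_rotate fmor_rotate f_def numeral_eq_Suc del: rotate_Suc)
        (rule ext_cong; use ne in \<open>simp add: obj_rotate fmor_rotate add_ac del: rotate_Suc\<close>)
    then show ?thesis
      using cmp_ext[OF l O O dw f, of ?j] X k N by (simp add: numeral_eq_Suc)
  qed
  finally have d: "dd (2 * m) ?X ?X (ext l ?X k (wpre l k) (k + 2) ?j) =
      cmp ?i ?j ?X ?Y ?X (dd k ?Y ?X (word l k)) (word (rotate ?i l) ?j) + (-1) ^ k *\<^sub>C word l N" .
  have dw': "dd k ?Y ?X (word l k) \<in> H ?i ?Y ?X" using dw by simp
  have v: "word (rotate ?i l) ?j \<in> H ?j ?X ?Y"
    using word_mem[OF rotate_chains[OF l], of ?i ?j] chains_not_Nil[OF l] X k N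
    by (simp add: obj_rotate del: rotate_Suc)
  have ij: "?i + ?j = N" using k N by simp
  have je: "N - ?i = ?j" and Sk: "?i \<le> N" and S1: "1 \<le> ?i" using k N by simp_all
  note wr = word_rotate[OF l S1 Sk, unfolded je diff_Suc_1]
  have r: "rotate ?i l \<in> chains C N" by (rule rotate_chains[OF l])
  have ro: "obj (rotate ?i l) 0 = ?Y" using chains_not_Nil[OF l] by (simp add: obj_rotate del: rotate_Suc)
  \<comment> \<open>The error term of the trace property vanishes here because the left factor is
    closed.\<close>
  have "cmp (?i + 1) ?j ?X ?Y ?X (dd ?i ?Y ?X (dd k ?Y ?X (word l k))) (word (rotate ?i l) ?j) = 0"
    using dd_dd[OF O O w] clinear_on_zero[OF cmp_left[OF O O O v] H_subspace[OF O O]] by simp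
  then have "\<theta> ?X (cmp ?i ?j ?X ?Y ?X (dd k ?Y ?X (word l k)) (word (rotate ?i l) ?j)) =
      \<theta> ?Y (cmp ?j ?i ?Y ?X ?Y (word (rotate ?i l) ?j) (dd k ?Y ?X (word l k)))"
    using comm[OF ij O O dw' v] clinear_on_zero[OF graded_trace_linear[OF T' O] H_subspace[OF O O]] by simp
  also have "\<dots> = wfun N \<theta> (rotate ?i l)"
    unfolding wr wfun_def using r ro by (simp del: rotate_Suc)
  finally have 1: "\<theta> ?X (cmp ?i ?j ?X ?Y ?X (dd k ?Y ?X (word l k)) (word (rotate ?i l) ?j)) = wfun N \<theta> (rotate ?i l)" .
  have wN: "word l N \<in> H N ?X ?X" by (rule word_mem'[OF l])
  have "cmp ?i ?j ?X ?Y ?X (dd k ?Y ?X (word l k)) (word (rotate ?i l) ?j) \<in> H N ?X ?X"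
    using cmp_mem[OF O O O dw' v] ij by simp
  then have "\<theta> ?X (dd (2 * m) ?X ?X (ext l ?X k (wpre l k) (k + 2) ?j)) =
      wfun N \<theta> (rotate ?i l) + (-1) ^ k * wfun N \<theta> l"
    unfolding d 1[symmetric] using wN l
    by (simp add: clinear_on_add[OF \<theta>[OF O]] clinear_on_scale[OF \<theta>[OF O]] cvs.subspace_scale[OF H_subspace[OF O O]]
        scaleC_complex_def wfun_def)
  then show ?thesis using T[OF O ext_wpre_mem[OF l1 k]] by simp
qed

text \<open>With \<omega> = f^0 df^1 ... df^N, moving f = f^(N+1) to the front of \<omega> f costs
  T'(d\<omega> f). As T' is closed and N is odd, d(\<omega> f) = d\<omega> f - \<omega> df shows
  that this cost is T'(\<omega> df), the value of the cochain of T'.\<close>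

lemma bprime_theta:
  assumes l: "l \<in> chains C (N + 1)"
  shows "bprime C N (wfun N \<theta>) l = - (wfun N \<theta> (face C 0 (rotate (N + 1) l)) + wfun (N + 1) T' l)"
proof -
  note w = wpre_last[OF l] and O = chains_obj[OF l]
  let ?X = "obj l 0" and ?Y = "obj l (N + 1)"
  let ?f = "rho ?X ?Y (fmor l (N + 1))"
  have odd: "odd N" using N by simp
  have "\<theta> ?X (wpre l N) = \<theta> ?Y (word (last_face C l) N) + T' ?X (cmp (N + 1) 0 ?X ?Y ?X (dd N ?Y ?X (word l N)) ?f)"
    unfolding w(1) rho_word_last_face[OF l, symmetric] by (rule comm[OF _ O O w(3,2)]) simp
  moreover have "\<theta> ?Y (word (last_face C l) N) = wfun N \<theta> (face C 0 (rotate (N + 1) l))"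
    using cface_chains[OF C l, of "N + 1"] w(6) unfolding last_face_eq[OF l, symmetric]
    by (simp add: wfun_def cface_def)
  moreover have "T' ?X (cmp (N + 1) 0 ?X ?Y ?X (dd N ?Y ?X (word l N)) ?f) = wfun (N + 1) T' l"
  proof -
    have d: "dd 0 ?X ?Y ?f \<in> H 1 ?X ?Y" using dd_mem[OF O O w(2)] by simp
    have m1: "cmp (N + 1) 0 ?X ?Y ?X (dd N ?Y ?X (word l N)) ?f \<in> H (N + 1) ?X ?X"
      using cmp_mem[OF O O O dd_mem[OF O O w(3)] w(2)] by simp
    have m2: "word l (N + 1) \<in> H (N + 1) ?X ?X" by (rule word_mem'[OF l])
    have "dd N ?X ?X (cmp N 0 ?X ?Y ?X (word l N) ?f) =
        cmp (N + 1) 0 ?X ?Y ?X (dd N ?Y ?X (word l N)) ?f + (-1) *\<^sub>C word l (N + 1)"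
      unfolding w(5) using leibniz[OF O O O w(3,2), folded w(4)] odd by (simp del: cvs.scale_minus_left)
    moreover have "T' ?X (dd N ?X ?X (cmp N 0 ?X ?Y ?X (word l N) ?f)) = 0"
      using graded_trace_closed[OF T' O] cmp_mem[OF O O O w(3,2)] by simp
    ultimately have "T' ?X (cmp (N + 1) 0 ?X ?Y ?X (dd N ?Y ?X (word l N)) ?f) + (-1) *\<^sub>C T' ?X (word l (N + 1)) = 0"
      using clinear_on_add[OF graded_trace_linear[OF T' O] m1 cvs.subspace_scale[OF H_subspace[OF O O] m2]]
        clinear_on_scale[OF graded_trace_linear[OF T' O] m2] by metis
    then show ?thesis using l by (simp add: wfun_def scaleC_complex_def)
  qed
  ultimately show ?thesis
    using bprime_wfun[of N \<theta>, OF \<theta> l] odd by simp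
qed

lemma wfun_rotate_even:
  assumes l: "l \<in> chains C (N + 1)" shows "wfun (N + 1) T' (rotate j l) = wfun (N + 1) T' l"
proof (induction j)
  case (Suc j)
  have r: "rotate (Suc j) l \<in> chains C (N + 1)" by (rule rotate_chains[OF l])
  have "rotate (N + 1) (rotate (Suc j) l) = rotate j (rotate (N + 1 + 1) l)"
    by (simp only: rotate_rotate) (simp add: add_ac del: rotate_Suc)
  also have "rotate (N + 1 + 1) l = l" using rotate_Suc_n[of l "N + 1"] chains_length[OF l] by simp
  finally show ?case using wfun_cyclic[OF T' r] Suc N by (simp del: rotate_Suc)
qed simp

text \<open>Both S \<phi> and b N \<xi> are expressed by the numbers \<open>x i\<close>, the values
  of \<xi> on face 0 of the rotated chains. They enter only through their sum over a full turn,
  which can thus be eliminated.\<close>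

theorem Sfun_eq:
  assumes l: "l \<in> chains C (N + 1)"
  shows "Sfun (2 * m) T l = - 1 / 2 * hochschild_b C N (cyclic_sum C N (wfun N \<theta>)) l - of_nat (m + 1) * wfun (N + 1) T' l"
proof -
  define \<xi> where "\<xi> = wfun N \<theta>"
  define x where "x i = \<xi> (face C 0 (rotate i l))" for i
  define t where "t = wfun (N + 1) T' l"
  have l2: "l \<in> chains C (2 * m + 2)" using l N by simp
  have bp: "bprime C N \<xi> l = - (x (N + 1) + t)"
    using bprime_theta[OF l] by (simp add: \<xi>_def x_def t_def del: rotate_Suc)
  have "Sfun (2 * m) T l = (\<Sum>k\<le>2 * m. 1 / 2 * (x (Suc k) + (-1) ^ k * \<xi> (face C (Suc k) l)))"
    unfolding Sfun_def using l2
  proof (simp only: if_True, intro sum.cong refl)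
    fix k assume "k \<in> {..2 * m}"
    then have k: "k \<le> 2 * m" by simp
    then have Sk: "Suc k \<le> N" using N by simp
    have f: "face C (Suc k) l \<in> chains C N" by (rule face_chains[OF C l Sk])
    have o: "obj (face C (Suc k) l) 0 = obj l 0" using obj_face[OF l Sk, of 0] by simp
    have "rotate (Suc k) (face C (Suc k) l) = face C 0 (rotate (Suc k) l)"
      using cface_rotate[OF l, of 0 "Suc k"] Sk by (simp add: cface_def del: rotate_Suc)
    then show "T (obj l 0) (ext (face C (Suc k) l) (obj l 0) k (wpre (face C (Suc k) l) k) (k + 2) (2 * m - k)) =
        1 / 2 * (x (Suc k) + (-1) ^ k * \<xi> (face C (Suc k) l))"
      using Sfun_term[OF f k] by (simp add: o x_def \<xi>_def del: rotate_Suc)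
  qed
  also have "\<dots> = 1 / 2 * ((\<Sum>k\<le>2 * m. x (Suc k)) + (\<Sum>k\<le>2 * m. (-1) ^ k * \<xi> (face C (Suc k) l)))"
    by (simp only: sum_distrib_left sum.distrib distrib_left)
  \<comment> \<open>Up to sign, the faces of index \<open>k + 1\<close> are those of b' \<xi> except
    face 0. The missing one reappears as \<open>x 0\<close> and completes the sum over the
    rotations.\<close>
  also have "(\<Sum>k\<le>2 * m. (-1) ^ k * \<xi> (face C (Suc k) l)) = x 0 - bprime C N \<xi> l"
  proof -
    have "bprime C N \<xi> l = (\<Sum>k\<le>Suc (2 * m). (-1) ^ k * \<xi> (face C k l))"
      using l N by (simp add: bprime_def)
    also have "\<dots> = \<xi> (face C 0 l) + (\<Sum>k\<le>2 * m. (-1) ^ Suc k * \<xi> (face C (Suc k) l))"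
      by (subst sum.atMost_Suc_shift) simp
    also have "(\<Sum>k\<le>2 * m. (-1) ^ Suc k * \<xi> (face C (Suc k) l)) = - (\<Sum>k\<le>2 * m. (-1) ^ k * \<xi> (face C (Suc k) l))"
      by (simp add: sum_negf)
    finally show ?thesis by (simp add: x_def)
  qed
  also have "(\<Sum>k\<le>2 * m. x (Suc k)) + (x 0 - bprime C N \<xi> l) = (\<Sum>i\<le>N + 1. x i) + t"
  proof -
    have "(\<Sum>i\<le>N + 1. x i) = (\<Sum>i\<le>Suc (2 * m). x i) + x (N + 1)" using N by simp
    also have "(\<Sum>i\<le>Suc (2 * m). x i) = x 0 + (\<Sum>k\<le>2 * m. x (Suc k))" by (rule sum.atMost_Suc_shift)
    finally show ?thesis by (simp add: bp)
  qed
  finally have S: "Sfun (2 * m) T l = 1 / 2 * ((\<Sum>i\<le>N + 1. x i) + t)" .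
  have "hochschild_b C N (cyclic_sum C N \<xi>) l = cyclic_sum C (N + 1) (bprime C N \<xi>) l"
    by (simp only: hochschild_b_cyclic_sum[OF C])
  \<comment> \<open>All signs of the cyclic sum are +1 because \<open>N + 1\<close> is even.\<close>
  also have "\<dots> = (\<Sum>j\<le>N + 1. bprime C N \<xi> (rotate j l))"
    using l N by (simp add: cyclic_sum_def minus_one_power_iff)
  also have "\<dots> = (\<Sum>j\<le>N + 1. - (x (N + 1 + j) + t))"
  proof (intro sum.cong refl)
    fix j
    have "bprime C N \<xi> (rotate j l) = - (\<xi> (face C 0 (rotate (N + 1) (rotate j l))) + wfun (N + 1) T' (rotate j l))"
      using bprime_theta[OF rotate_chains[OF l, of j]] unfolding \<xi>_def .
    then show "bprime C N \<xi> (rotate j l) = - (x (N + 1 + j) + t)"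
      unfolding wfun_rotate_even[OF l] rotate_rotate x_def t_def .
  qed
  also have "\<dots> = - ((\<Sum>j\<le>N + 1. x (N + 1 + j)) + of_nat (N + 2) * t)"
    by (simp only: sum_negf sum.distrib sum_constant card_atMost) simp
  also have "(\<Sum>j\<le>N + 1. x (N + 1 + j)) = (\<Sum>i\<le>N + 1. x i)"
  proof (rule sum.reindex_bij_witness[where j = "\<lambda>j. if j = 0 then N + 1 else j - 1" and i = "\<lambda>i. if i = N + 1 then 0 else i + 1"])
    fix j assume "j \<in> {..N + 1}"
    show "x (if j = 0 then N + 1 else j - 1) = x (N + 1 + j)"
    proof (cases j)
      case (Suc i)
      have "rotate (N + 1 + j) l = rotate i (rotate (N + 1 + 1) l)"
        unfolding rotate_rotate Suc by (simp add: add_ac del: rotate_Suc)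
      also have "rotate (N + 1 + 1) l = l" using rotate_Suc_n[of l "N + 1"] chains_length[OF l] by simp
      finally show ?thesis using Suc by (simp add: x_def del: rotate_Suc)
    qed simp
  qed auto
  finally have "hochschild_b C N (cyclic_sum C N \<xi>) l = - ((\<Sum>i\<le>N + 1. x i) + of_nat (N + 2) * t)" .
  moreover have "of_nat (N + 2) = 2 * of_nat (m + 1) + (1 :: complex)" using N by simp
  moreover have "1 / 2 * (X + t) = - 1 / 2 * A - k * t" if "A = - (X + (2 * k + 1) * t)" for A X k t :: complex
    unfolding that by (simp add: field_simps)
  ultimately show ?thesis unfolding \<xi>_def[symmetric] t_def[symmetric] S by metis
qed

end

end

section \<open>The periodicity operator on characters\<close>

lemma complex_cat_linear: "linear_category complex_cat"
  by (auto simp: linear_category_def complex_cat_def cbilinear_on_def clinear_on_def scaleC_complex_def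
      algebra_simps)

lemma complex_cat_simps [simp]:
  "ob complex_cat = UNIV" "hom complex_cat X Y = UNIV" "comp complex_cat X Y Z g f = g * f"
  by (simp_all add: complex_cat_def)

lemma cycle_over_dg_words: "linear_category C \<Longrightarrow> cycle_over C n c \<Longrightarrow> dg_words C c"
  unfolding cycle_over_def by unfold_locales auto

lemma cycle_over_graded_trace:
  assumes C: "linear_category C" and c: "cycle_over C n c"
  shows "dg_words.graded_trace C c n (\<lambda>X. cyc_tr c (cyc_ob c X))"
proof -
  interpret dg_words C c using assms by (rule cycle_over_dg_words)
  have "closed_graded_trace (cyc_dg c) n (cyc_tr c)" using c by (simp add: cycle_over_def)
  note t = this[unfolded closed_graded_trace_def]
  show ?thesis
    unfolding graded_trace_def H_def cmp_def dd_def
  proof (intro conjI ballI allI impI)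
    fix X assume X: "X \<in> ob C"
    show "clinear_on (dg_hom (cyc_dg c) n (cyc_ob c X) (cyc_ob c X)) UNIV (cyc_tr c (cyc_ob c X))"
      using t ob[OF X] by (elim conjE) blast
    show "cyc_tr c (cyc_ob c X) (dg_d (cyc_dg c) k (cyc_ob c X) (cyc_ob c X) f) = 0"
      if "n = k + 1" "f \<in> dg_hom (cyc_dg c) k (cyc_ob c X) (cyc_ob c X)" for k f
      using t ob[OF X] that by (elim conjE) blast
    fix Y assume Y: "Y \<in> ob C"
    show "cyc_tr c (cyc_ob c X) (dg_comp (cyc_dg c) i j (cyc_ob c X) (cyc_ob c Y) (cyc_ob c X) g g') =
        (-1) ^ (i * j) * cyc_tr c (cyc_ob c Y) (dg_comp (cyc_dg c) j i (cyc_ob c Y) (cyc_ob c X) (cyc_ob c Y) g' g)"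
      if "i + j = n" "g \<in> dg_hom (cyc_dg c) i (cyc_ob c Y) (cyc_ob c X)" "g' \<in> dg_hom (cyc_dg c) j (cyc_ob c X) (cyc_ob c Y)"
      for i j g g'
      using t ob[OF X] ob[OF Y] that by (elim conjE) blast
  qed
qed

lemma (in dg_words) cycle_character_wfun:
  "cycle_character C n c = wfun n (\<lambda>X. cyc_tr c (cyc_ob c X))"
  by (auto simp: fun_eq_iff cycle_character_def wfun_def cycle_word_eq chains_length)

text \<open>The right-hand side involves only the character and the chain, so S \<phi> does not
  depend on the cycle chosen to represent \<phi>.\<close>

lemma (in dg_words) Sfun_wfun:
  assumes T: "\<And>X. X \<in> ob C \<Longrightarrow> clinear_on (H r X X) UNIV (T X)" and l: "l \<in> chains C (r + 2)"
  shows "Sfun r T l = (\<Sum>k\<le>r. \<Sum>j\<le>k. (-1) ^ (k + j) * wfun r T (face C j (face C (Suc k) l)))"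
proof -
  have l1: "l \<in> chains C (r + 1 + 1)" using l by simp
  have "T (obj l 0) (ext (face C (Suc k) l) (obj l 0) k (wpre (face C (Suc k) l) k) (k + 2) (r - k)) =
      (\<Sum>j\<le>k. (-1) ^ (k + j) * wfun r T (face C j (face C (Suc k) l)))" if k: "k \<le> r" for k
  proof -
    have Sk: "Suc k \<le> r + 1" using k by simp
    have f: "face C (Suc k) l \<in> chains C (r + 1)" by (rule face_chains[OF C l1 Sk])
    have o: "obj (face C (Suc k) l) 0 = obj l 0" using obj_face[OF l1 Sk, of 0] by simp
    have "wfun r T (face C j (face C (Suc k) l)) = T (obj l 0) (word (face C j (face C (Suc k) l)) r)"
      if "j \<le> k" for j
      using face_chains[OF C f, of j] obj_face[OF f, of j 0] that k o by (simp add: wfun_def)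
    then show ?thesis using functional_ext_wpre[of r T, OF T f k] o by simp
  qed
  then show ?thesis using l by (simp add: Sfun_def)
qed

section \<open>Evaluation of tensor lifts on pure tensors\<close>

lemma cbilinear_on_congr:
  assumes f: "cbilinear_on V W U f" and V: "csubspace V" and W: "csubspace W"
    and eq: "\<And>v w. v \<in> V \<Longrightarrow> w \<in> W \<Longrightarrow> g v w = f v w"
  shows "cbilinear_on V W U g"
  unfolding cbilinear_on_def
proof (intro conjI ballI)
  fix v assume v: "v \<in> V"
  then have "clinear_on W U (f v)" using f by (simp add: cbilinear_on_def)
  then show "clinear_on W U (g v)" by (rule clinear_on_congr[OF _ W]) (rule eq[OF v])
next
  fix w assume w: "w \<in> W"
  then have "clinear_on V U (\<lambda>v. f v w)" using f by (simp add: cbilinear_on_def)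
  then show "clinear_on V U (\<lambda>v. g v w)" by (rule clinear_on_congr[OF _ V]) (rule eq[OF _ w])
qed

lemma cbilinear_on_compose:
  assumes f: "cbilinear_on A B U f" and p: "clinear_on V A p" and q: "clinear_on W B q"
  shows "cbilinear_on V W U (\<lambda>v w. f (p v) (q w))"
  unfolding cbilinear_on_def
proof (intro conjI ballI)
  fix v assume "v \<in> V"
  then have "clinear_on B U (f (p v))" using f clinear_on_mem[OF p] by (simp add: cbilinear_on_def)
  from clinear_on_compose[OF q this] show "clinear_on W U (\<lambda>w. f (p v) (q w))" .
next
  fix w assume "w \<in> W"
  then have "clinear_on A U (\<lambda>x. f x (q w))" using f clinear_on_mem[OF q] by (simp add: cbilinear_on_def)
  from clinear_on_compose[OF p this] show "clinear_on V U (\<lambda>v. f (p v) (q w))" .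
qed

lemma tensor_lift_map:
  assumes "clinear_on V A p" "clinear_on W B q"
  shows "tensor_lift (\<lambda>v w. pure_tensor A B (p v) (q w)) (pure_tensor V W v w) = pure_tensor A B (p v) (q w)"
  by (rule tensor_lift_pure[OF cbilinear_on_compose[OF cbilinear_on_pure_tensor assms]])

text \<open>The inner lift is evaluated first, for arguments in the given subspaces only; this
  suffices for the outer kernel to be bilinear there.\<close>

lemma tensor_lift_comp:
  assumes p: "cbilinear_on V1 V2 A p" and q: "cbilinear_on W1 W2 B q" and V1: "csubspace V1" and W1: "csubspace W1"
    and m: "g \<in> V1" "g' \<in> W1" "f \<in> V2" "f' \<in> W2"
  shows "tensor_lift (\<lambda>g g'. tensor_lift (\<lambda>f f'. pure_tensor A B (p g f) (q g' f')) (pure_tensor V2 W2 f f'))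
    (pure_tensor V1 W1 g g') = pure_tensor A B (p g f) (q g' f')"
proof -
  have inner: "tensor_lift (\<lambda>f f'. pure_tensor A B (p g f) (q g' f')) (pure_tensor V2 W2 f f') = pure_tensor A B (p g f) (q g' f')"
    if "g \<in> V1" "g' \<in> W1" for g g'
    using that p q by (intro tensor_lift_map) (auto simp: cbilinear_on_def)
  have "clinear_on V1 A (\<lambda>g. p g f)" "clinear_on W1 B (\<lambda>g'. q g' f')"
    using p q m by (auto simp: cbilinear_on_def)
  from cbilinear_on_compose[OF cbilinear_on_pure_tensor this]
  have "cbilinear_on V1 W1 UNIV (\<lambda>g g'. tensor_lift (\<lambda>f f'. pure_tensor A B (p g f) (q g' f')) (pure_tensor V2 W2 f f'))"
    by (rule cbilinear_on_congr[OF _ V1 W1]) (rule inner)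
  from tensor_lift_pure[OF this] show ?thesis using inner m by simp
qed

lemma pure_tensor_zero_right: "csubspace B \<Longrightarrow> a \<in> A \<Longrightarrow> pure_tensor A B a 0 = 0"
  using cbilinear_on_pure_tensor[of A B] clinear_on_zero[of B UNIV "pure_tensor A B a"]
  by (simp add: cbilinear_on_def)

lemma pure_tensor_add_left: "b \<in> B \<Longrightarrow> a \<in> A \<Longrightarrow> a' \<in> A \<Longrightarrow>
    pure_tensor A B (a + a') b = pure_tensor A B a b + pure_tensor A B a' b"
  using cbilinear_on_pure_tensor[of A B] clinear_on_add[of A UNIV "\<lambda>a. pure_tensor A B a b"]
  by (simp add: cbilinear_on_def)

text \<open>The tensors v \<otimes> z and (z v) \<otimes> 1 agree, so the pure tensors with second
  factor 1 already form a subspace.\<close>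

lemma tensor_space_unit:
  assumes V: "csubspace V"
  shows "tensor_space V (UNIV :: complex set) = {pure_tensor V UNIV v 1 | v. v \<in> V}"
proof
  let ?P = "{pure_tensor V (UNIV :: complex set) v 1 | v. v \<in> V}"
  have lin: "clinear_on V UNIV (\<lambda>v. pure_tensor V (UNIV :: complex set) v 1)"
    using cbilinear_on_pure_tensor[of V "UNIV :: complex set"] by (simp add: cbilinear_on_def)
  have P: "?P = (\<lambda>v. pure_tensor V UNIV v 1) ` V" by auto
  have "csubspace ?P" unfolding P by (rule subspace_image[OF lin V])
  moreover have "pure_tensor V UNIV v z \<in> ?P" if "v \<in> V" for v and z :: complex
  proof -
    have "clinear_on UNIV UNIV (pure_tensor V (UNIV :: complex set) v)"
      using cbilinear_on_pure_tensor[of V "UNIV :: complex set"] that by (simp add: cbilinear_on_def)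
    then have "pure_tensor V UNIV v (z *\<^sub>C (1 :: complex)) = z *\<^sub>C pure_tensor V UNIV v 1"
      by (rule clinear_on_scale) simp
    also have "\<dots> = pure_tensor V UNIV (z *\<^sub>C v) 1" using clinear_on_scale[OF lin that] by simp
    finally show ?thesis using that cvs.subspace_scale[OF V] by (auto simp: scaleC_complex_def)
  qed
  ultimately show "tensor_space V UNIV \<subseteq> ?P"
    unfolding tensor_space_def by (intro cvs.span_minimal) auto
  show "?P \<subseteq> tensor_space V UNIV"
    unfolding tensor_space_def by (auto intro!: cvs.span_base)
qed

section \<open>Chains over the tensor product with the one-object category\<close>

lemma obj_unit_chain: "l \<noteq> [] \<Longrightarrow> obj (unit_chain C l) i = (obj l i, ())"
  by (simp add: unit_chain_def obj_def)

lemma length_unit_chain [simp]: "length (unit_chain C l) = length l"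
  by (simp add: unit_chain_def)

lemma mor_unit_chain: "i < length l \<Longrightarrow>
    mor (unit_chain C l) i = pure_tensor (hom C (obj l (i + 1)) (obj l i)) UNIV (fmor l i) 1"
  by (simp add: unit_chain_def mor_def fmor_def)

lemma unit_chain_chains:
  assumes C: "linear_category C" and l: "l \<in> chains C n"
  shows "unit_chain C l \<in> chains (tensor_cat C complex_cat) n"
proof -
  have "pure_tensor (hom C (obj l (i + 1)) (obj l i)) UNIV (fmor l i) 1 \<in>
      tensor_space (hom C (obj l (i + 1)) (obj l i)) (UNIV :: complex set)" for i
    using chains_fmor[OF l, of i] tensor_space_unit[OF lin_cat_hom[OF C chains_obj[OF l] chains_obj[OF l]]] by blast
  then show ?thesis
    using chains_length[OF l] chains_obj[OF l] chains_not_Nil[OF l]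
    by (simp add: chains_def obj_unit_chain mor_unit_chain tensor_cat_def)
qed

text \<open>The uniqueness required by \<open>sharp\<close> is about functions on all chains over
  the tensor product; this reduces it to chains of the form \<open>unit_chain C l\<close>.\<close>

lemma tensor_cat_chains:
  assumes C: "linear_category C" and L: "L \<in> chains (tensor_cat C complex_cat) n"
  obtains l where "l \<in> chains C n" "L = unit_chain C l"
proof -
  have len: "length L = n + 1" using chains_length[OF L] .
  define X where "X i = fst (obj L i)" for i
  have oX: "obj L i = (X i, ())" for i by (simp add: X_def prod_eq_iff)
  have X: "X i \<in> ob C" for i using chains_obj[OF L, of i] oX[of i] by (simp add: tensor_cat_def)
  have "fmor L i \<in> tensor_space (hom C (X (i + 1)) (X i)) UNIV" for i
    using chains_fmor[OF L, of i] oX[of i] oX[of "i + 1"] by (simp add: tensor_cat_def)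
  then have "\<forall>i. \<exists>v. v \<in> hom C (X (i + 1)) (X i) \<and> fmor L i = pure_tensor (hom C (X (i + 1)) (X i)) UNIV v 1"
    using tensor_space_unit[OF lin_cat_hom[OF C X X]] by blast
  from choice[OF this] obtain v where v: "\<And>i. v i \<in> hom C (X (i + 1)) (X i)"
    "\<And>i. fmor L i = pure_tensor (hom C (X (i + 1)) (X i)) UNIV (v i) 1" by blast
  define l where "l = map (\<lambda>i. (X i, v i)) [0..<n + 1]"
  have lenl: "length l = n + 1" by (simp add: l_def)
  have o: "obj l i = X i" for i
  proof -
    have "X (i mod (n + 1)) = X i" using obj_mod[of L i] len by (simp add: X_def)
    then show ?thesis by (simp add: obj_def l_def del: upt_Suc)
  qed
  have m: "fmor l i = v i" if "i \<le> n" for i using that by (simp add: fmor_def l_def del: upt_Suc)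
  have "l \<in> chains C n"
    using lenl X v(1) m o by (simp add: chains_def mor_eq_fmor)
  moreover have "L = unit_chain C l"
  proof (rule chain_eqI)
    show "length L = length (unit_chain C l)" using len lenl by simp
    fix i assume i: "i < length L"
    show "obj L i = obj (unit_chain C l) i" using lenl by (subst obj_unit_chain) (auto simp: oX o)
    have "fmor (unit_chain C l) i = mor (unit_chain C l) i" using i len lenl by (simp add: mor_eq_fmor)
    then show "fmor L i = fmor (unit_chain C l) i"
      using i len lenl v(2)[of i] m[of i] by (simp add: mor_unit_chain o)
  qed
  ultimately show ?thesis by (rule that)
qed

locale tensor_words = W: dg_words C c + V: dg_words complex_cat c'
  for C :: "('o, 'a::complex_vector) lin_cat" and c :: "('o, 'a, 's, 'x::complex_vector) cyc"
    and c' :: "(unit, complex, 't, 'y::complex_vector) cyc" +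
  fixes r :: nat and l :: "('o, 'a) chain"
  assumes l: "l \<in> chains C (r + 2)"
begin

text \<open>The image of 1 is an idempotent but need not act as an identity, as the cycle lives over
  a semicategory. All relations used below follow from e e = e and the Leibniz rule.\<close>

definition e :: 'y where "e = V.rho () () 1"
definition de :: 'y where "de = V.dd 0 () () e"
definition e1 :: 'y where "e1 = V.cmp 0 1 () () () e de"
definition e2 :: 'y where "e2 = V.cmp 1 1 () () () e1 de"

section \<open>Relations for the idempotent and its differential\<close>

lemma e_mem: "e \<in> V.H 0 () ()" unfolding e_def by (rule V.rho_mem) simp_all
lemma de_mem: "de \<in> V.H 1 () ()" unfolding de_def using V.dd_mem[OF _ _ e_mem] by simp
lemma e1_mem: "e1 \<in> V.H 1 () ()" unfolding e1_def using V.cmp_mem[OF _ _ _ e_mem de_mem] by simp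
lemma e2_mem: "e2 \<in> V.H 2 () ()" unfolding e2_def using V.cmp_mem[OF _ _ _ e1_mem de_mem] by (simp add: numeral_eq_Suc)

lemma e_e: "V.cmp 0 0 () () () e e = e"
  using V.rho_cmp[of "()" "()" "()" 1 1] by (simp add: e_def)

lemma de_split: "V.cmp 1 0 () () () de e + e1 = de"
  using V.leibniz[OF _ _ _ e_mem e_mem] by (simp add: e_e de_def[symmetric] e1_def)

lemma de_e_mem: "V.cmp 1 0 () () () de e \<in> V.H 1 () ()"
  using V.cmp_mem[OF _ _ _ de_mem e_mem] by simp

text \<open>Multiplying de = de e + e de by e from the left gives e de = e de e + e de.\<close>

lemma e1_e: "V.cmp 1 0 () () () e1 e = 0"
proof -
  have "e1 = V.cmp 0 1 () () () e (V.cmp 1 0 () () () de e + e1)"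
    unfolding de_split by (rule e1_def)
  also have "\<dots> = V.cmp 0 1 () () () e (V.cmp 1 0 () () () de e) + V.cmp 0 1 () () () e e1"
    by (rule clinear_on_add[OF V.cmp_right[OF _ _ _ e_mem] de_e_mem e1_mem]) simp_all
  also have "V.cmp 0 1 () () () e (V.cmp 1 0 () () () de e) = V.cmp 1 0 () () () e1 e"
    using V.cmp_assoc[OF _ _ _ _ e_mem de_mem e_mem] by (simp add: e1_def)
  also have "V.cmp 0 1 () () () e e1 = e1"
    using V.cmp_assoc[OF _ _ _ _ e_mem e_mem de_mem] by (simp add: e1_def e_e)
  finally show ?thesis by simp
qed

text \<open>Substituting de = de e + e de for the last factor of e de de leaves e de de e plus (e de
  e) de, and the latter is 0.\<close>

lemma e2_e: "V.cmp 2 0 () () () e2 e = e2"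
proof -
  have "e2 = V.cmp 1 1 () () () e1 (V.cmp 1 0 () () () de e + e1)"
    unfolding de_split by (rule e2_def)
  also have "\<dots> = V.cmp 1 1 () () () e1 (V.cmp 1 0 () () () de e) + V.cmp 1 1 () () () e1 e1"
    by (rule clinear_on_add[OF V.cmp_right[OF _ _ _ e1_mem] de_e_mem e1_mem]) simp_all
  also have "V.cmp 1 1 () () () e1 (V.cmp 1 0 () () () de e) = V.cmp 2 0 () () () e2 e"
    using V.cmp_assoc[OF _ _ _ _ e1_mem de_mem e_mem] by (simp add: e2_def numeral_eq_Suc)
  also have "V.cmp 1 1 () () () e1 e1 = V.cmp 1 1 () () () (V.cmp 1 0 () () () e1 e) de"
    using V.cmp_assoc[OF _ _ _ _ e1_mem e_mem de_mem, folded e1_def] by simp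
  also have "\<dots> = 0"
    unfolding e1_e by (rule clinear_on_zero[OF V.cmp_left[OF _ _ _ de_mem] V.H_subspace]) simp_all
  finally show ?thesis by simp
qed

section \<open>Bidegree components of words in the tensor product\<close>

abbreviation P :: "nat \<Rightarrow> 'o \<Rightarrow> 'o \<Rightarrow> nat \<Rightarrow> 'x \<Rightarrow> 'y \<Rightarrow> ('x, 'y) tensor"
  where "P i X Y j \<equiv> pure_tensor (W.H i X Y) (V.H j () ())"

lemma tcomp:
  assumes "X \<in> ob C" "Y \<in> ob C" "Z \<in> ob C" "g \<in> W.H i Y Z" "g' \<in> V.H i' () ()" "f \<in> W.H j X Y" "f' \<in> V.H j' () ()"
  shows "tensor_lift (\<lambda>g g'. tensor_lift (\<lambda>f f'. P (i + j) X Z (i' + j') (W.cmp i j X Y Z g f)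
      (V.cmp i' j' () () () g' f')) (P j X Y j' f f')) (P i Y Z i' g g') =
    P (i + j) X Z (i' + j') (W.cmp i j X Y Z g f) (V.cmp i' j' () () () g' f')"
  using assms by (intro tensor_lift_comp W.cmp_bilinear V.cmp_bilinear W.H_subspace V.H_subspace) simp_all

definition cw :: "nat \<Rightarrow> nat \<Rightarrow> ('x, 'y) tensor"
  where "cw = cycle_word (tensor_cycle C complex_cat r c c') (unit_chain C l)"

lemmas O = chains_obj[OF l]

text \<open>The components of d(f \<otimes> e): f \<otimes> de in bidegree (0, 1) and df \<otimes> e
  in bidegree (1, 0).\<close>

definition gen :: "nat \<Rightarrow> nat \<Rightarrow> ('x, 'y) tensor"
  where "gen k b = (if b = 0 then P 0 (obj l (k + 1)) (obj l k) 1 (W.rho (obj l (k + 1)) (obj l k) (fmor l k)) de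
    else P 1 (obj l (k + 1)) (obj l k) 0 (W.df l k) e)"

lemma cyc_mor_tensor:
  assumes k: "k \<le> r + 2"
  shows "cyc_mor (tensor_cycle C complex_cat r c c') (obj l (k + 1), ()) (obj l k, ()) (mor (unit_chain C l) k) 0 =
    P 0 (obj l (k + 1)) (obj l k) 0 (W.rho (obj l (k + 1)) (obj l k) (fmor l k)) e"
proof -
  have "k < length l" using k chains_length[OF l] by simp
  then show ?thesis
    using tensor_lift_map[OF W.rho_lin[OF O O] V.rho_lin, of "()" "()" "k + 1" k "fmor l k" 1]
    by (simp add: mor_unit_chain tensor_cycle_def W.H_def V.H_def e_def)
qed

lemma dg_d_tensor:
  assumes k: "k \<le> r + 2" and b: "b \<le> 1"
  shows "dg_d (cyc_dg (tensor_cycle C complex_cat r c c')) 0 (cyc_ob c (obj l (k + 1)), cyc_ob c' ()) (cyc_ob c (obj l k), cyc_ob c' ())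
    (cyc_mor (tensor_cycle C complex_cat r c c') (obj l (k + 1), ()) (obj l k, ()) (mor (unit_chain C l) k)) b = gen k b"
proof (cases "b = 0")
  case True
  have "tensor_lift (\<lambda>f g. P 0 (obj l (k + 1)) (obj l k) 1 f (V.dd 0 () () g))
      (P 0 (obj l (k + 1)) (obj l k) 0 (W.rho (obj l (k + 1)) (obj l k) (fmor l k)) e) = gen k 0"
    using tensor_lift_map[OF clinear_on_id V.dd_linear[of "()" "()" 0], of "W.H 0 (obj l (k + 1)) (obj l k)"]
    by (simp add: gen_def de_def)
  then show ?thesis
    using True cyc_mor_tensor[OF k] by (simp add: tensor_cycle_def tensor_dg_def W.H_def V.H_def V.dd_def)
next
  case False
  then have "b = 1" using b by simp
  have "tensor_lift (\<lambda>f g. P 1 (obj l (k + 1)) (obj l k) 0 (W.dd 0 (obj l (k + 1)) (obj l k) f) g)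
      (P 0 (obj l (k + 1)) (obj l k) 0 (W.rho (obj l (k + 1)) (obj l k) (fmor l k)) e) = gen k 1"
    using tensor_lift_map[OF W.dd_linear[OF O[of "k + 1"] O[of k], of 0] clinear_on_id, of "V.H 0 () ()"]
    by (simp add: gen_def W.df_def)
  then show ?thesis
    using \<open>b = 1\<close> cyc_mor_tensor[OF k] by (simp add: tensor_cycle_def tensor_dg_def W.H_def V.H_def W.dd_def)
qed

lemma cw_0: "cw 0 0 = P 0 (obj l 1) (obj l 0) 0 (W.word l 0) e"
  using cyc_mor_tensor[of 0] chains_not_Nil[OF l] by (simp add: cw_def obj_unit_chain W.word_def)

lemma cw_Suc:
  assumes i: "Suc i \<le> r + 2"
  shows "cw (Suc i) k = (\<Sum>(a, b)\<in>{(a, b). a \<le> i \<and> b \<le> 1 \<and> a + b = k}.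
    (-1) ^ ((i - a) * b) *\<^sub>C tensor_lift (\<lambda>g g'. tensor_lift (\<lambda>f f'.
      P (a + b) (obj l (i + 2)) (obj l 0) ((i - a) + (1 - b))
        (W.cmp a b (obj l (i + 2)) (obj l (i + 1)) (obj l 0) g f) (V.cmp (i - a) (1 - b) () () () g' f'))
      (gen (i + 1) b)) (cw i a))"
proof -
  let ?D = "dg_d (cyc_dg (tensor_cycle C complex_cat r c c')) 0 (cyc_ob c (obj l (i + 2)), cyc_ob c' ()) (cyc_ob c (obj l (i + 1)), cyc_ob c' ())
    (cyc_mor (tensor_cycle C complex_cat r c c') (obj l (i + 2), ()) (obj l (i + 1), ()) (mor (unit_chain C l) (i + 1)))"
  have D: "?D b = gen (i + 1) b" if "b \<le> 1" for b
    using dg_d_tensor[of "i + 1" b] i that by (simp add: numeral_eq_Suc)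
  have "cw (Suc i) k = dg_comp (tensor_dg (cyc_dg c) (cyc_dg c')) i 1 (cyc_ob c (obj l (i + 2)), cyc_ob c' ())
      (cyc_ob c (obj l (i + 1)), cyc_ob c' ()) (cyc_ob c (obj l 0), cyc_ob c' ()) (cw i) ?D k"
    unfolding cw_def using chains_not_Nil[OF l]
    by (simp add: obj_unit_chain tensor_cycle_def)
  also have "\<dots> = (\<Sum>(a, b)\<in>{(a, b). a \<le> i \<and> b \<le> 1 \<and> a + b = k}.
    (-1) ^ ((i - a) * b) *\<^sub>C tensor_lift (\<lambda>g g'. tensor_lift (\<lambda>f f'.
      P (a + b) (obj l (i + 2)) (obj l 0) ((i - a) + (1 - b))
        (W.cmp a b (obj l (i + 2)) (obj l (i + 1)) (obj l 0) g f) (V.cmp (i - a) (1 - b) () () () g' f'))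
      (?D b)) (cw i a))"
    by (simp add: tensor_dg_def W.H_def V.H_def W.cmp_def V.cmp_def)
  also have "\<dots> = (\<Sum>(a, b)\<in>{(a, b). a \<le> i \<and> b \<le> 1 \<and> a + b = k}.
    (-1) ^ ((i - a) * b) *\<^sub>C tensor_lift (\<lambda>g g'. tensor_lift (\<lambda>f f'.
      P (a + b) (obj l (i + 2)) (obj l 0) ((i - a) + (1 - b))
        (W.cmp a b (obj l (i + 2)) (obj l (i + 1)) (obj l 0) g f) (V.cmp (i - a) (1 - b) () () () g' f'))
      (gen (i + 1) b)) (cw i a))"
    by (rule sum.cong[OF refl]) (auto simp only: D mem_Collect_eq split: prod.splits)
  finally show ?thesis .
qed

text \<open>The new factor of a word has total degree 1, so each component receives at most two
  contributions.\<close>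

lemma index_set:
  "{(a, b). a \<le> i \<and> b \<le> 1 \<and> a + b = Suc i} = {(i, 1::nat)}"
  "{(a, b). a \<le> i \<and> b \<le> 1 \<and> a + b = (0::nat)} = {(0, 0::nat)}"
  "k < i \<Longrightarrow> {(a, b). a \<le> i \<and> b \<le> 1 \<and> a + b = Suc k} = {(Suc k, 0), (k, 1::nat)}"
  by auto

definition summand :: "nat \<Rightarrow> nat \<Rightarrow> nat \<Rightarrow> ('x, 'y) tensor"
  where "summand i a b = (-1) ^ ((i - a) * b) *\<^sub>C tensor_lift (\<lambda>g g'. tensor_lift (\<lambda>f f'.
      P (a + b) (obj l (i + 2)) (obj l 0) ((i - a) + (1 - b))
        (W.cmp a b (obj l (i + 2)) (obj l (i + 1)) (obj l 0) g f) (V.cmp (i - a) (1 - b) () () () g' f'))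
      (gen (i + 1) b)) (cw i a)"

lemma cw_Suc': "Suc i \<le> r + 2 \<Longrightarrow> cw (Suc i) k = (\<Sum>(a, b)\<in>{(a, b). a \<le> i \<and> b \<le> 1 \<and> a + b = k}. summand i a b)"
  unfolding summand_def by (rule cw_Suc)

lemma summand_0:
  assumes x: "cw i a = P a (obj l (i + 1)) (obj l 0) (i - a) x y" "x \<in> W.H a (obj l (i + 1)) (obj l 0)" "y \<in> V.H (i - a) () ()"
  shows "summand i a 0 = P a (obj l (i + 2)) (obj l 0) (i - a + 1)
    (W.cmp a 0 (obj l (i + 2)) (obj l (i + 1)) (obj l 0) x (W.rho (obj l (i + 2)) (obj l (i + 1)) (fmor l (i + 1))))
    (V.cmp (i - a) 1 () () () y de)"
proof -
  have f: "W.rho (obj l (i + 2)) (obj l (i + 1)) (fmor l (i + 1)) \<in> W.H 0 (obj l (i + 2)) (obj l (i + 1))"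
    using W.rho_f[OF l, of "i + 1"] by (simp add: numeral_eq_Suc)
  show ?thesis
    using tcomp[OF O O O x(2,3) f de_mem] unfolding summand_def x(1) gen_def by (simp add: numeral_eq_Suc)
qed

lemma summand_1:
  assumes x: "cw i a = P a (obj l (i + 1)) (obj l 0) (i - a) x y" "x \<in> W.H a (obj l (i + 1)) (obj l 0)" "y \<in> V.H (i - a) () ()"
  shows "summand i a 1 = (-1) ^ (i - a) *\<^sub>C P (a + 1) (obj l (i + 2)) (obj l 0) (i - a)
    (W.cmp a 1 (obj l (i + 2)) (obj l (i + 1)) (obj l 0) x (W.df l (i + 1))) (V.cmp (i - a) 0 () () () y e)"
proof -
  have f: "W.df l (i + 1) \<in> W.H 1 (obj l (i + 2)) (obj l (i + 1))"
    using W.df_mem[OF l, of "i + 1"] by (simp add: numeral_eq_Suc)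
  show ?thesis
    using tcomp[OF O O O x(2,3) f e_mem] unfolding summand_def x(1) gen_def by (simp add: numeral_eq_Suc)
qed

lemma cw_word: "i \<le> r + 2 \<Longrightarrow> cw i i = P i (obj l (i + 1)) (obj l 0) 0 (W.word l i) e"
proof (induction i)
  case 0
  then show ?case using cw_0 by simp
next
  case (Suc i)
  then have "cw i i = P i (obj l (i + 1)) (obj l 0) (i - i) (W.word l i) e" by simp
  from summand_1[OF this W.word_mem[OF l]] e_mem
  have "summand i i 1 = P (Suc i) (obj l (i + 2)) (obj l 0) 0 (W.word l (Suc i)) e"
    by (simp add: W.word_Suc e_e numeral_eq_Suc)
  then show ?case using cw_Suc'[OF Suc.prems, of "Suc i"] unfolding index_set(1) by (simp add: numeral_eq_Suc)
qed

text \<open>Exactly one de has been used, and it must belong to the factor just appended: any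
  further df \<otimes> e would multiply the second component by e, and e de e = 0.\<close>

lemma cw_wpre: "Suc i \<le> r + 2 \<Longrightarrow> cw (Suc i) i = P i (obj l (i + 2)) (obj l 0) 1 (W.wpre l i) e1"
proof (induction i)
  case 0
  have "cw 0 0 = P 0 (obj l (0 + 1)) (obj l 0) (0 - 0) (W.word l 0) e" using cw_0 by simp
  from summand_0[OF this W.word_mem[OF l]] e_mem
  have "summand 0 0 0 = P 0 (obj l 2) (obj l 0) 1 (W.wpre l 0) e1"
    by (simp add: W.wpre_def[OF l] e1_def numeral_eq_Suc)
  then show ?case using cw_Suc'[OF 0, of 0] unfolding index_set(2) by (simp add: numeral_eq_Suc)
next
  case (Suc k)
  have "cw (Suc k) (Suc k) = P (Suc k) (obj l (Suc k + 1)) (obj l 0) (Suc k - Suc k) (W.word l (Suc k)) e"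
    using cw_word[of "Suc k"] Suc.prems by simp
  from summand_0[OF this W.word_mem[OF l]] e_mem
  have 1: "summand (Suc k) (Suc k) 0 = P (Suc k) (obj l (k + 3)) (obj l 0) 1 (W.wpre l (Suc k)) e1"
    by (simp add: W.wpre_def[OF l] e1_def numeral_eq_Suc)
  have w: "W.wpre l k \<in> W.H k (obj l (Suc k + 1)) (obj l 0)" using W.wpre_mem[OF l, of k] by (simp add: numeral_eq_Suc)
  have d: "W.df l (k + 2) \<in> W.H 1 (obj l (k + 3)) (obj l (k + 2))"
    using W.df_mem[OF l, of "k + 2"] by (simp add: numeral_eq_Suc)
  have m: "W.cmp k 1 (obj l (k + 3)) (obj l (k + 2)) (obj l 0) (W.wpre l k) (W.df l (k + 2)) \<in> W.H (k + 1) (obj l (k + 3)) (obj l 0)"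
    using W.cmp_mem[OF O O O W.wpre_mem[OF l] d] by simp
  have "cw (Suc k) k = P k (obj l (Suc k + 1)) (obj l 0) (Suc k - k) (W.wpre l k) e1"
    using Suc by (simp add: numeral_eq_Suc Suc_diff_le)
  from summand_1[OF this w] e1_mem
  have "summand (Suc k) k 1 = - P (k + 1) (obj l (k + 3)) (obj l 0) 1
      (W.cmp k 1 (obj l (k + 3)) (obj l (k + 2)) (obj l 0) (W.wpre l k) (W.df l (k + 2))) 0"
    using e1_e by (simp add: numeral_eq_Suc Suc_diff_le)
  also have "\<dots> = 0" using pure_tensor_zero_right[OF V.H_subspace m] by simp
  finally have 2: "summand (Suc k) k 1 = 0" .
  show ?case
    using cw_Suc'[OF Suc.prems, of "Suc k"] 1 2 unfolding index_set(3)[OF lessI[of k]] by (simp add: numeral_eq_Suc)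
qed

text \<open>The form f^0 df^1 ... df^k f^(k+1) f^(k+2): by the previous lemma the two
  undifferentiated factors are adjacent.\<close>

definition pp :: "nat \<Rightarrow> 'x"
  where "pp k = W.cmp k 0 (obj l (k + 3)) (obj l (k + 2)) (obj l 0) (W.wpre l k) (W.rho (obj l (k + 3)) (obj l (k + 2)) (fmor l (k + 2)))"

definition bb :: "nat \<Rightarrow> 'x"
  where "bb n = (\<Sum>k\<le>n. W.ext l (obj l 0) k (pp k) (k + 3) (n - k))"

lemma pp_mem: "pp k \<in> W.H k (obj l (k + 3)) (obj l 0)"
proof -
  have f: "W.rho (obj l (k + 3)) (obj l (k + 2)) (fmor l (k + 2)) \<in> W.H 0 (obj l (k + 3)) (obj l (k + 2))"
    using W.rho_f[OF l, of "k + 2"] by (simp add: numeral_eq_Suc)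
  show ?thesis unfolding pp_def using W.cmp_mem[OF O O O W.wpre_mem[OF l] f] by simp
qed

lemma ext_pp_mem: "k \<le> n \<Longrightarrow> W.ext l (obj l 0) k (pp k) (k + 3) (n - k) \<in> W.H n (obj l (n + 3)) (obj l 0)"
  using W.ext_mem[OF l O pp_mem, of k "n - k"] by (simp add: add.commute)

lemma bb_mem: "bb n \<in> W.H n (obj l (n + 3)) (obj l 0)"
  unfolding bb_def using ext_pp_mem by (intro cvs.subspace_sum W.H_subspace O) simp

lemma bb_Suc: "bb (Suc n) = W.cmp n 1 (obj l (n + 4)) (obj l (n + 3)) (obj l 0) (bb n) (W.df l (n + 3)) + pp (Suc n)"
proof -
  have d: "W.df l (n + 3) \<in> W.H 1 (obj l (n + 4)) (obj l (n + 3))"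
    using W.df_mem[OF l, of "n + 3"] by (simp add: numeral_eq_Suc)
  have "W.cmp n 1 (obj l (n + 4)) (obj l (n + 3)) (obj l 0) (bb n) (W.df l (n + 3)) =
      (\<Sum>k\<le>n. W.cmp n 1 (obj l (n + 4)) (obj l (n + 3)) (obj l 0) (W.ext l (obj l 0) k (pp k) (k + 3) (n - k)) (W.df l (n + 3)))"
    unfolding bb_def using ext_pp_mem by (intro clinear_on_sum[OF W.cmp_left[OF O O O d] W.H_subspace[OF O O]]) simp
  also have "\<dots> = (\<Sum>k\<le>n. W.ext l (obj l 0) k (pp k) (k + 3) (Suc n - k))"
    by (intro sum.cong refl) (simp add: Suc_diff_le numeral_eq_Suc)
  finally show ?thesis by (simp add: bb_def)
qed

text \<open>Once both de have been used, appending df \<otimes> e changes nothing in the second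
  component, since e de de e = e de de, and the sign is that of an even degree. So the first
  components accumulate a sum over the place where the two factors occurred.\<close>

lemma cw_bb: "i \<le> r \<Longrightarrow> cw (Suc (Suc i)) i = P i (obj l (i + 3)) (obj l 0) 2 (bb i) e2"
proof -
  have A: "summand (Suc i) i 0 = P i (obj l (i + 3)) (obj l 0) 2 (pp i) e2" if i: "i \<le> r" for i
  proof -
    have w: "W.wpre l i \<in> W.H i (obj l (Suc i + 1)) (obj l 0)" using W.wpre_mem[OF l, of i] by (simp add: numeral_eq_Suc)
    have "cw (Suc i) i = P i (obj l (Suc i + 1)) (obj l 0) (Suc i - i) (W.wpre l i) e1"
      using cw_wpre[of i] i by (simp add: numeral_eq_Suc Suc_diff_le)
    from summand_0[OF this w] e1_mem show ?thesis by (simp add: pp_def e2_def numeral_eq_Suc Suc_diff_le)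
  qed
  show "i \<le> r \<Longrightarrow> cw (Suc (Suc i)) i = P i (obj l (i + 3)) (obj l 0) 2 (bb i) e2"
  proof (induction i)
    case 0
    then show ?case using cw_Suc'[of 1 0] A[of 0] index_set(2)[of 1] by (simp add: bb_def numeral_eq_Suc)
  next
    case (Suc k)
    have b: "bb k \<in> W.H k (obj l (Suc (Suc k) + 1)) (obj l 0)" using bb_mem[of k] by (simp add: numeral_eq_Suc)
    have "cw (Suc (Suc k)) k = P k (obj l (Suc (Suc k) + 1)) (obj l 0) (Suc (Suc k) - k) (bb k) e2"
      using Suc by (simp add: numeral_eq_Suc Suc_diff_le)
    from summand_1[OF this b] e2_mem
    have B: "summand (Suc (Suc k)) k 1 = P (Suc k) (obj l (k + 4)) (obj l 0) 2
        (W.cmp k 1 (obj l (k + 4)) (obj l (k + 3)) (obj l 0) (bb k) (W.df l (k + 3))) e2"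
      using e2_e by (simp add: numeral_eq_Suc Suc_diff_le)
    have d: "W.df l (k + 3) \<in> W.H 1 (obj l (k + 4)) (obj l (k + 3))"
      using W.df_mem[OF l, of "k + 3"] by (simp add: numeral_eq_Suc)
    have m1: "W.cmp k 1 (obj l (k + 4)) (obj l (k + 3)) (obj l 0) (bb k) (W.df l (k + 3)) \<in> W.H (Suc k) (obj l (k + 4)) (obj l 0)"
      using W.cmp_mem[OF O O O bb_mem d] by simp
    have m2: "pp (Suc k) \<in> W.H (Suc k) (obj l (k + 4)) (obj l 0)" using pp_mem[of "Suc k"] by (simp add: numeral_eq_Suc)
    have le: "Suc (Suc (Suc k)) \<le> r + 2" using Suc.prems by simp
    have lt: "k < Suc (Suc k)" by simp
    have "cw (Suc (Suc (Suc k))) (Suc k) = summand (Suc (Suc k)) (Suc k) 0 + summand (Suc (Suc k)) k 1"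
      using cw_Suc'[OF le, of "Suc k"] unfolding index_set(3)[OF lt] by simp
    also have "\<dots> = P (Suc k) (obj l (k + 4)) (obj l 0) 2 (bb (Suc k)) e2"
      using A[OF Suc.prems] B pure_tensor_add_left[OF e2_mem m1 m2] bb_Suc[of k] by (simp add: numeral_eq_Suc add.commute)
    finally show ?case by (simp add: numeral_eq_Suc)
  qed
qed

lemma ext_pp_face:
  assumes k: "k \<le> r"
  shows "W.ext (face C (Suc k) l) (obj l 0) k (W.wpre (face C (Suc k) l) k) (k + 2) (r - k) =
    W.ext l (obj l 0) k (pp k) (k + 3) (r - k)"
proof -
  have l1: "l \<in> chains C (r + 1 + 1)" and Sk: "Suc k \<le> r + 1" using l k by simp_all
  let ?f = "face C (Suc k) l"
  note o = obj_face[OF l1 Sk] and m = fmor_face[OF l1 Sk]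
  have f: "?f \<in> chains C (r + 1)" by (rule face_chains[OF W.C l1 Sk])
  have w: "W.word ?f k = W.word l k"
    unfolding W.word_def using o[of 0] o[of 1] m[of 0] k
    by simp (rule W.ext_cong; use o m k in simp)
  have h: "fmor l (Suc k) \<in> hom C (obj l (k + 2)) (obj l (k + 1))" "fmor l (k + 2) \<in> hom C (obj l (k + 3)) (obj l (k + 2))"
    using chains_fmor[OF l, of "Suc k"] chains_fmor[OF l, of "k + 2"] by (simp_all add: numeral_eq_Suc)
  have r: "W.rho (obj l (k + 2)) (obj l (k + 1)) (fmor l (Suc k)) \<in> W.H 0 (obj l (k + 2)) (obj l (k + 1))"
    "W.rho (obj l (k + 3)) (obj l (k + 2)) (fmor l (k + 2)) \<in> W.H 0 (obj l (k + 3)) (obj l (k + 2))"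
    using W.rho_mem[OF O O h(1)] W.rho_mem[OF O O h(2)] .
  have "W.wpre ?f k = W.cmp k 0 (obj l (k + 3)) (obj l (k + 1)) (obj l 0) (W.word l k)
      (W.rho (obj l (k + 3)) (obj l (k + 1)) (comp C (obj l (k + 3)) (obj l (k + 2)) (obj l (k + 1)) (fmor l (Suc k)) (fmor l (k + 2))))"
    unfolding W.wpre_def[OF f] w using o[of 0] o[of "k + 1"] o[of "k + 2"] m[of "k + 1"] k by (simp add: numeral_eq_Suc)
  also have "\<dots> = pp k"
    unfolding pp_def W.wpre_def[OF l] W.rho_cmp[OF O O O h]
    using W.cmp_assoc[OF O O O O W.word_mem[OF l] r] by simp
  finally have "W.wpre ?f k = pp k" .
  then show ?thesis using k
    by simp (rule W.ext_cong; use o m in \<open>simp add: numeral_eq_Suc\<close>)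
qed

text \<open>Only bidegree (r, 2) is seen by the trace. There the word is a pure tensor with second
  factor e de de, on which the trace of \<open>c'\<close> takes the value of \<open>psi2\<close> at
  1 \<otimes> 1 \<otimes> 1, namely 1.\<close>

lemma tensor_character:
  assumes T: "\<And>X. X \<in> ob C \<Longrightarrow> clinear_on (W.H r X X) UNIV (cyc_tr c (cyc_ob c X))"
    and T': "clinear_on (V.H 2 () ()) UNIV (cyc_tr c' (cyc_ob c' ()))"
    and \<psi>: "cycle_character complex_cat 2 c' = psi2"
  shows "cycle_character (tensor_cat C complex_cat) (r + 2) (tensor_cycle C complex_cat r c c') (unit_chain C l) =
    W.Sfun r (\<lambda>X. cyc_tr c (cyc_ob c X)) l"
proof -
  let ?T = "cyc_tr c (cyc_ob c (obj l 0))" and ?T' = "cyc_tr c' (cyc_ob c' ())"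
  have X: "obj l (r + 3) = obj l 0" using chains_wrap(2)[OF l] by (simp add: numeral_eq_Suc)
  let ?o = "[((), 1), ((), 1), ((), 1)] :: (unit, complex) chain"
  have o: "?o \<in> chains complex_cat 2" by (simp add: chains_def complex_cat_def)
  have "cycle_word c' ?o (Suc (Suc 0)) = e2"
    by (simp add: mor_def e2_def e1_def de_def e_def V.cmp_def V.dd_def)
  then have "?T' e2 = cycle_character complex_cat 2 c' ?o"
    using o unfolding cycle_character_def by (simp add: numeral_2_eq_2)
  then have e2: "?T' e2 = 1" unfolding \<psi> by (simp add: psi2_unit)
  have "cbilinear_on (W.H r (obj l 0) (obj l 0)) (V.H 2 () ()) UNIV (\<lambda>f f'. ?T f * ?T' f')"
    using T[OF O[of 0]] T' by (simp add: cbilinear_on_def clinear_on_def scaleC_complex_def algebra_simps)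
  from tensor_form_pure[OF this, of "bb r" e2]
  have 1: "tensor_form (\<lambda>f f'. ?T f * ?T' f') (cw (r + 2) r) = ?T (bb r)"
    using cw_bb[of r] X e2 by simp
  have "?T (bb r) = (\<Sum>k\<le>r. ?T (W.ext l (obj l 0) k (pp k) (k + 3) (r - k)))"
    unfolding bb_def using ext_pp_mem[of _ r] X by (intro clinear_on_sum[OF T[OF O] W.H_subspace[OF O O]]) simp
  also have "\<dots> = W.Sfun r (\<lambda>X. cyc_tr c (cyc_ob c X)) l"
    unfolding W.Sfun_def using l ext_pp_face by simp
  finally have 2: "?T (bb r) = W.Sfun r (\<lambda>X. cyc_tr c (cyc_ob c X)) l" .
  have "cycle_character (tensor_cat C complex_cat) (r + 2) (tensor_cycle C complex_cat r c c') (unit_chain C l) =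
      tensor_form (\<lambda>f f'. ?T f * ?T' f') (cw (r + 2) r)"
    using unit_chain_chains[OF W.C l] chains_not_Nil[OF l]
    by (simp only: cycle_character_def if_True cw_def[symmetric]) (simp add: tensor_cycle_def obj_unit_chain chains_length[OF l])
  then show ?thesis using 1 2 by simp
qed

end

text \<open>Discharges the description in \<open>sharp\<close>: the pair \<open>c0\<close>,
  \<open>c0'\<close> gives existence, and every other pair gives the same formula in terms of
  \<phi>.\<close>

lemma periodicity_formula:
  fixes C :: "('o, 'a::complex_vector) lin_cat" and c0 :: "('o, 'a) std_cyc" and c0' :: "(unit, complex) std_cyc"
  assumes C: "linear_category C" and c0: "cycle_over C r c0" "cycle_character C r c0 = \<phi>"
    and c0': "cycle_over complex_cat 2 c0'" "cycle_character complex_cat 2 c0' = psi2"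
    and l: "l \<in> chains C (r + 2)"
  shows "periodicity C r \<phi> l = (\<Sum>k\<le>r. \<Sum>j\<le>k. (-1) ^ (k + j) * \<phi> (face C j (face C (Suc k) l)))"
proof -
  define F where "F l = (\<Sum>k\<le>r. \<Sum>j\<le>k. (-1) ^ (k + j) * \<phi> (face C j (face C (Suc k) l)))" for l
  have F: "cycle_character (tensor_cat C complex_cat) (r + 2) (tensor_cycle C complex_cat r c c') (unit_chain C l) = F l"
    if c: "cycle_over C r c" "cycle_character C r c = \<phi>" and c': "cycle_over complex_cat 2 c'" "cycle_character complex_cat 2 c' = psi2"
      and l: "l \<in> chains C (r + 2)" for l and c :: "('o, 'a) std_cyc" and c' :: "(unit, complex) std_cyc"
  proof -
    interpret W: dg_words C c by (rule cycle_over_dg_words[OF C c(1)])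
    interpret V: dg_words complex_cat c' by (rule cycle_over_dg_words[OF complex_cat_linear c'(1)])
    interpret tensor_words C c c' r l by unfold_locales (rule l)
    note t = W.graded_trace_linear[OF cycle_over_graded_trace[OF C c(1)]]
    have "cycle_character (tensor_cat C complex_cat) (r + 2) (tensor_cycle C complex_cat r c c') (unit_chain C l) =
        W.Sfun r (\<lambda>X. cyc_tr c (cyc_ob c X)) l"
      by (rule tensor_character[OF t V.graded_trace_linear[OF cycle_over_graded_trace[OF complex_cat_linear c'(1)]] c'(2)]) simp_all
    also have "\<dots> = (\<Sum>k\<le>r. \<Sum>j\<le>k. (-1) ^ (k + j) * W.wfun r (\<lambda>X. cyc_tr c (cyc_ob c X)) (face C j (face C (Suc k) l)))"
      by (rule W.Sfun_wfun[OF t l])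
    also have "\<dots> = F l"
      by (simp only: F_def W.cycle_character_wfun[symmetric] c(2))
    finally show ?thesis .
  qed
  have eq: "cycle_character (tensor_cat C complex_cat) (r + 2) (tensor_cycle C complex_cat r c c') =
      cycle_character (tensor_cat C complex_cat) (r + 2) (tensor_cycle C complex_cat r c0 c0')"
    if c: "cycle_over C r c" "cycle_character C r c = \<phi>" and c': "cycle_over complex_cat 2 c'" "cycle_character complex_cat 2 c' = psi2"
    for c :: "('o, 'a) std_cyc" and c' :: "(unit, complex) std_cyc"
  proof
    fix L
    show "cycle_character (tensor_cat C complex_cat) (r + 2) (tensor_cycle C complex_cat r c c') L =
      cycle_character (tensor_cat C complex_cat) (r + 2) (tensor_cycle C complex_cat r c0 c0') L"
    proof (cases "L \<in> chains (tensor_cat C complex_cat) (r + 2)")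
      case True
      then obtain l where "l \<in> chains C (r + 2)" "L = unit_chain C l" by (rule tensor_cat_chains[OF C])
      then show ?thesis using F[OF c c'] F[OF c0 c0'] by simp
    qed (simp add: cycle_character_def)
  qed
  have "sharp C complex_cat r 2 \<phi> psi2 = cycle_character (tensor_cat C complex_cat) (r + 2) (tensor_cycle C complex_cat r c0 c0')"
    unfolding sharp_def
    by (rule the_equality) (use c0 c0' eq in blast)+
  then show ?thesis using F[OF c0 c0' l] l by (simp add: periodicity_def F_def)
qed

section \<open>Realisation of unital cycles by standard cycles\<close>

lemma span_image_mem:
  assumes f: "clinear_on V U f" and V: "csubspace V" and B: "B \<subseteq> V" and N: "csubspace N"
    and b: "\<And>b. b \<in> B \<Longrightarrow> f b \<in> N" and x: "x \<in> cspan B"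
  shows "f x \<in> N"
proof -
  have "x \<in> V \<and> f x \<in> N"
    using x
  proof (induction rule: cvs.span_induct_alt)
    case base
    then show ?case using clinear_on_zero[OF f V] cvs.subspace_0[OF V] cvs.subspace_0[OF N] by simp
  next
    case (step c y z)
    then have "y \<in> V" "c *\<^sub>C y \<in> V" using B cvs.subspace_scale[OF V] by auto
    with step show ?case
      using b cvs.subspace_add[OF V] cvs.subspace_add[OF N] cvs.subspace_scale[OF N]
      by (simp add: clinear_on_add[OF f] clinear_on_scale[OF f])
  qed
  then show ?thesis ..
qed

text \<open>Quotient of the forms of a unital cycle by the radical of the trace pairing, realised inside the type of
  the standard cycles: a form \<open>\<omega>\<close> is represented by the values of the trace on the products of \<open>\<omega>\<close> with words.\<close>

locale unital_cycle = dg_words C c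
  for C :: "('o, 'a::complex_vector) lin_cat" and c :: "('o, 'a, 's, 'x::complex_vector) cyc" +
  fixes r :: nat and T :: "'o \<Rightarrow> 'x \<Rightarrow> complex"
  assumes T: "graded_trace r T"
    and unit_left: "X \<in> ob C \<Longrightarrow> Y \<in> ob C \<Longrightarrow> \<omega> \<in> H n X Y \<Longrightarrow> cmp 0 n X Y Y (rho Y Y (ident C Y)) \<omega> = \<omega>"
    and unit_right: "X \<in> ob C \<Longrightarrow> Y \<in> ob C \<Longrightarrow> \<omega> \<in> H n X Y \<Longrightarrow> cmp n 0 X X Y \<omega> (rho X X (ident C X)) = \<omega>"
begin

text \<open>The list describes the word from its right end: the head holds the last factor together
  with its target object. In the base case the target is \<open>Y\<close>.\<close>

primrec wd :: "nat \<Rightarrow> 'o \<Rightarrow> 'o \<Rightarrow> ('o, 'a) chain \<Rightarrow> 'x"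
  where
    "wd 0 X Y l = rho X Y (snd (hd l))"
  | "wd (Suc n) X Y l = cmp n 1 X (fst (hd l)) Y (wd n (fst (hd l)) Y (tl l)) (dd 0 X (fst (hd l)) (rho X (fst (hd l)) (snd (hd l))))"

primrec valid :: "nat \<Rightarrow> 'o \<Rightarrow> 'o \<Rightarrow> ('o, 'a) chain \<Rightarrow> bool"
  where
    "valid 0 X Y l \<longleftrightarrow> snd (hd l) \<in> hom C X Y"
  | "valid (Suc n) X Y l \<longleftrightarrow> fst (hd l) \<in> ob C \<and> snd (hd l) \<in> hom C X (fst (hd l)) \<and> valid n (fst (hd l)) Y (tl l)"

definition words :: "nat \<Rightarrow> 'o \<Rightarrow> 'o \<Rightarrow> 'x set"
  where "words n X Y = wd n X Y ` Collect (valid n X Y)"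

text \<open>The forms generated by the image of \<open>C\<close>. The radical is tested on words,
  and its ideal property is proved among these forms.\<close>

definition Ns :: "nat \<Rightarrow> 'o \<Rightarrow> 'o \<Rightarrow> 'x set"
  where "Ns n X Y = cspan (words n X Y)"

section \<open>The DG-semicategory spanned by words\<close>

lemma words_0: "words 0 X Y = rho X Y ` hom C X Y"
proof
  show "rho X Y ` hom C X Y \<subseteq> words 0 X Y"
  proof
    fix \<omega> assume "\<omega> \<in> rho X Y ` hom C X Y"
    then obtain f where "f \<in> hom C X Y" "\<omega> = rho X Y f" by blast
    then have "valid 0 X Y [(X, f)]" "\<omega> = wd 0 X Y [(X, f)]" by simp_all
    then show "\<omega> \<in> words 0 X Y" unfolding words_def by blast
  qed
qed (auto simp: words_def)

lemma words_Suc_I: "Z \<in> ob C \<Longrightarrow> w \<in> words n Z Y \<Longrightarrow> f \<in> hom C X Z \<Longrightarrow>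
    cmp n 1 X Z Y w (dd 0 X Z (rho X Z f)) \<in> words (Suc n) X Y"
proof -
  assume a: "Z \<in> ob C" "w \<in> words n Z Y" "f \<in> hom C X Z"
  then obtain l where "valid n Z Y l" "w = wd n Z Y l" by (auto simp: words_def)
  then have "valid (Suc n) X Y ((Z, f) # l)" "cmp n 1 X Z Y w (dd 0 X Z (rho X Z f)) = wd (Suc n) X Y ((Z, f) # l)"
    using a by simp_all
  then show ?thesis unfolding words_def by blast
qed

lemma words_Suc_E:
  assumes "\<omega> \<in> words (Suc n) X Y"
  obtains Z w f where "Z \<in> ob C" "w \<in> words n Z Y" "f \<in> hom C X Z" "\<omega> = cmp n 1 X Z Y w (dd 0 X Z (rho X Z f))"
proof -
  obtain l where l: "valid (Suc n) X Y l" "\<omega> = wd (Suc n) X Y l" using assms unfolding words_def by blast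
  show ?thesis
    by (rule that[of "fst (hd l)" "wd n (fst (hd l)) Y (tl l)" "snd (hd l)"]) (use l in \<open>simp_all add: words_def\<close>)
qed

lemma d_rho_mem: "X \<in> ob C \<Longrightarrow> Y \<in> ob C \<Longrightarrow> f \<in> hom C X Y \<Longrightarrow> dd 0 X Y (rho X Y f) \<in> H 1 X Y"
  using dd_mem[OF _ _ rho_mem] by simp

lemma words_H: "X \<in> ob C \<Longrightarrow> Y \<in> ob C \<Longrightarrow> words n X Y \<subseteq> H n X Y"
proof (induction n arbitrary: X)
  case 0
  then show ?case using rho_mem by (auto simp: words_0)
next
  case (Suc n)
  show ?case
  proof
    fix \<omega> assume "\<omega> \<in> words (Suc n) X Y"
    then obtain Z w f where w: "Z \<in> ob C" "w \<in> words n Z Y" "f \<in> hom C X Z" "\<omega> = cmp n 1 X Z Y w (dd 0 X Z (rho X Z f))"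
      by (rule words_Suc_E)
    then have "w \<in> H n Z Y" using Suc by blast
    from cmp_mem[OF Suc.prems(1) w(1) Suc.prems(2) this d_rho_mem[OF Suc.prems(1) w(1,3)]]
    show "\<omega> \<in> H (Suc n) X Y" using w by simp
  qed
qed

lemma Ns_H: "X \<in> ob C \<Longrightarrow> Y \<in> ob C \<Longrightarrow> \<omega> \<in> Ns n X Y \<Longrightarrow> \<omega> \<in> H n X Y"
  unfolding Ns_def using cvs.span_minimal[OF words_H H_subspace] by blast

lemma Ns_subspace: "csubspace (Ns n X Y)"
  unfolding Ns_def by (rule cvs.subspace_span)

lemma words_Ns: "\<omega> \<in> words n X Y \<Longrightarrow> \<omega> \<in> Ns n X Y"
  unfolding Ns_def by (rule cvs.span_base)

lemma Ns_map:
  assumes "X \<in> ob C" "Y \<in> ob C" "clinear_on (H n X Y) U f" "csubspace N" "\<And>w. w \<in> words n X Y \<Longrightarrow> f w \<in> N" "\<omega> \<in> Ns n X Y"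
  shows "f \<omega> \<in> N"
  using span_image_mem[OF assms(3) H_subspace[OF assms(1,2)] words_H[OF assms(1,2)] assms(4,5)] assms(6)
  unfolding Ns_def by blast

lemma Ns_d_rho:
  assumes "X \<in> ob C" "Y \<in> ob C" "Z \<in> ob C" "\<omega> \<in> Ns n Y Z" "f \<in> hom C X Y"
  shows "cmp n 1 X Y Z \<omega> (dd 0 X Y (rho X Y f)) \<in> Ns (Suc n) X Z"
  by (rule Ns_map[OF assms(2,3) cmp_left[OF assms(1-3) d_rho_mem[OF assms(1,2,5)]] Ns_subspace _ assms(4)])
    (rule words_Ns[OF words_Suc_I[OF assms(2) _ assms(5)]])

text \<open>An undifferentiated factor on the right is moved inwards by dh f = d(hf) - h df; the
  second term is covered by the induction on the degree.\<close>

lemma Ns_rho: "X \<in> ob C \<Longrightarrow> Y \<in> ob C \<Longrightarrow> Z \<in> ob C \<Longrightarrow> \<omega> \<in> Ns n Y Z \<Longrightarrow> f \<in> hom C X Y \<Longrightarrow>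
    cmp n 0 X Y Z \<omega> (rho X Y f) \<in> Ns n X Z"
proof (induction n arbitrary: X Y f \<omega>)
  case 0
  show ?case
  proof (rule Ns_map[OF 0(2,3) cmp_left[OF 0(1-3) rho_mem[OF 0(1,2,5)]] Ns_subspace _ 0(4)])
    fix w assume "w \<in> words 0 Y Z"
    then obtain g where g: "g \<in> hom C Y Z" "w = rho Y Z g" by (auto simp: words_0)
    then have "cmp 0 0 X Y Z w (rho X Y f) = rho X Z (comp C X Y Z g f)" using rho_cmp 0 by simp
    then show "cmp 0 0 X Y Z w (rho X Y f) \<in> Ns 0 X Z"
      using comp_mem[OF C 0(1-3) g(1) 0(5)] by (auto simp: words_0 intro!: words_Ns)
  qed
next
  case (Suc n)
  note p = Suc.prems
  show ?case
  proof (rule Ns_map[OF p(2,3) cmp_left[OF p(1-3) rho_mem[OF p(1,2,5)]] Ns_subspace _ p(4)])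
    fix w assume "w \<in> words (Suc n) Y Z"
    then obtain V u h where u: "V \<in> ob C" "u \<in> words n V Z" "h \<in> hom C Y V" "w = cmp n 1 Y V Z u (dd 0 Y V (rho Y V h))"
      by (rule words_Suc_E)
    define dh where "dh = dd 0 Y V (rho Y V h)"
    define \<rho>f where "\<rho>f = rho X Y f"
    define \<rho>h where "\<rho>h = rho Y V h"
    define df' where "df' = dd 0 X Y \<rho>f"
    have m: "u \<in> H n V Z" "dh \<in> H 1 Y V" "\<rho>f \<in> H 0 X Y" "\<rho>h \<in> H 0 Y V" "df' \<in> H 1 X Y"
      using u words_H[OF u(1) p(3)] d_rho_mem[OF p(2) u(1,3)] d_rho_mem[OF p(1,2,5)] rho_mem[OF p(1,2,5)] rho_mem[OF p(2) u(1,3)]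
      by (auto simp: dh_def \<rho>f_def \<rho>h_def df'_def)
    have hf: "comp C X Y V h f \<in> hom C X V" by (rule comp_mem[OF C p(1,2) u(1,3) p(5)])
    have "dd 0 X V (rho X V (comp C X Y V h f)) = cmp 1 0 X Y V dh \<rho>f + cmp 0 1 X Y V \<rho>h df'"
      using rho_cmp[OF p(1,2) u(1,3) p(5)] leibniz[OF p(1,2) u(1) m(4,3)]
      by (simp add: dh_def \<rho>f_def \<rho>h_def df'_def)
    then have s: "cmp 1 0 X Y V dh \<rho>f = dd 0 X V (rho X V (comp C X Y V h f)) - cmp 0 1 X Y V \<rho>h df'" by simp
    have "cmp (Suc n) 0 X Y Z w \<rho>f = cmp n 1 X V Z u (cmp 1 0 X Y V dh \<rho>f)"
      using cmp_assoc[OF p(1,2) u(1) p(3) m(1,2,3)] u(4) by (simp add: dh_def)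
    also have "\<dots> = cmp n 1 X V Z u (dd 0 X V (rho X V (comp C X Y V h f))) - cmp n 1 X V Z u (cmp 0 1 X Y V \<rho>h df')"
      unfolding s using cmp_mem[OF p(1,2) u(1) m(4,5)] d_rho_mem[OF p(1) u(1) hf]
      by (intro clinear_on_diff[OF cmp_right[OF p(1) u(1) p(3) m(1)] H_subspace[OF p(1) u(1)]]) simp_all
    also have "cmp n 1 X V Z u (cmp 0 1 X Y V \<rho>h df') = cmp n 1 X Y Z (cmp n 0 Y V Z u \<rho>h) df'"
      using cmp_assoc[OF p(1,2) u(1) p(3) m(1,4,5)] by simp
    also have "cmp n 1 X V Z u (dd 0 X V (rho X V (comp C X Y V h f))) - \<dots> \<in> Ns (Suc n) X Z"
      using Suc.IH[OF p(2) u(1) p(3) words_Ns[OF u(2)] u(3)]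
      unfolding df'_def \<rho>f_def \<rho>h_def
      by (intro cvs.subspace_diff[OF Ns_subspace] Ns_d_rho words_Ns[OF words_Suc_I] p u hf)
    finally show "cmp (Suc n) 0 X Y Z w (rho X Y f) \<in> Ns (Suc n) X Z" by (simp add: \<rho>f_def)
  qed
qed

lemma Ns_cmp: "X \<in> ob C \<Longrightarrow> Y \<in> ob C \<Longrightarrow> Z \<in> ob C \<Longrightarrow> \<omega> \<in> Ns i Y Z \<Longrightarrow> \<eta> \<in> Ns j X Y \<Longrightarrow>
    cmp i j X Y Z \<omega> \<eta> \<in> Ns (i + j) X Z"
proof (induction j arbitrary: X \<eta>)
  case 0
  show ?case
    by (rule Ns_map[OF 0(1,2) cmp_right[OF 0(1-3) Ns_H[OF 0(2,3,4)]] Ns_subspace _ 0(5)])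
      (use Ns_rho[OF 0(1-4)] in \<open>auto simp: words_0\<close>)
next
  case (Suc j)
  note p = Suc.prems
  show ?case
  proof (rule Ns_map[OF p(1,2) cmp_right[OF p(1-3) Ns_H[OF p(2,3,4)]] Ns_subspace _ p(5)])
    fix w assume "w \<in> words (Suc j) X Y"
    then obtain V u f where u: "V \<in> ob C" "u \<in> words j V Y" "f \<in> hom C X V" "w = cmp j 1 X V Y u (dd 0 X V (rho X V f))"
      by (rule words_Suc_E)
    have "cmp i (Suc j) X Y Z \<omega> w = cmp (i + j) 1 X V Z (cmp i j V Y Z \<omega> u) (dd 0 X V (rho X V f))"
      using cmp_assoc[OF p(1) u(1) p(2,3) Ns_H[OF p(2,3,4)] Ns_H[OF u(1) p(2) words_Ns[OF u(2)]] d_rho_mem[OF p(1) u(1,3)]] u(4)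
      by simp
    then show "cmp i (Suc j) X Y Z \<omega> w \<in> Ns (i + Suc j) X Z"
      using Ns_d_rho[OF p(1) u(1) p(3) Suc.IH[OF u(1) p(2,3,4) words_Ns[OF u(2)]] u(3)] by simp
  qed
qed

lemma Ns_rho_mem: "f \<in> hom C X Y \<Longrightarrow> rho X Y f \<in> Ns 0 X Y"
  by (rule words_Ns) (simp add: words_0)

lemma ident_mem: "X \<in> ob C \<Longrightarrow> ident C X \<in> hom C X X"
  using C by (simp add: linear_category_def)

text \<open>This is where the unit enters: df = \<rho>(id) df is a word, so the words with an
  undifferentiated first factor span a space closed under d.\<close>

lemma Ns_d_rho_mem:
  assumes "X \<in> ob C" "Y \<in> ob C" "f \<in> hom C X Y" shows "dd 0 X Y (rho X Y f) \<in> Ns 1 X Y"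
  using Ns_d_rho[OF assms(1,2,2) Ns_rho_mem[OF ident_mem[OF assms(2)]] assms(3)]
    unit_left[OF assms(1,2) d_rho_mem[OF assms]] by simp

lemma Ns_dd: "X \<in> ob C \<Longrightarrow> Y \<in> ob C \<Longrightarrow> \<omega> \<in> Ns n X Y \<Longrightarrow> dd n X Y \<omega> \<in> Ns (n + 1) X Y"
proof (induction n arbitrary: X \<omega>)
  case 0
  show ?case
    by (rule Ns_map[OF 0(1,2) dd_linear[OF 0(1,2)] Ns_subspace _ 0(3)])
      (use Ns_d_rho_mem[OF 0(1,2)] in \<open>auto simp: words_0\<close>)
next
  case (Suc n)
  note p = Suc.prems
  show ?case
  proof (rule Ns_map[OF p(1,2) dd_linear[OF p(1,2)] Ns_subspace _ p(3)])
    fix w assume "w \<in> words (Suc n) X Y"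
    then obtain V u f where u: "V \<in> ob C" "u \<in> words n V Y" "f \<in> hom C X V" "w = cmp n 1 X V Y u (dd 0 X V (rho X V f))"
      by (rule words_Suc_E)
    note uH = Ns_H[OF u(1) p(2) words_Ns[OF u(2)]] and dH = d_rho_mem[OF p(1) u(1,3)]
    have "dd 1 X V (dd 0 X V (rho X V f)) = 0" using dd_dd[OF p(1) u(1) rho_mem[OF p(1) u(1,3)]] by simp
    moreover have "cmp n 2 X V Y u 0 = 0"
      by (rule clinear_on_zero[OF cmp_right[OF p(1) u(1) p(2) uH] H_subspace[OF p(1) u(1)]])
    ultimately have "dd (Suc n) X Y w = cmp (Suc n) 1 X V Y (dd n V Y u) (dd 0 X V (rho X V f))"
      using leibniz[OF p(1) u(1) p(2) uH dH] u(4) by (simp add: numeral_eq_Suc)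
    also have "\<dots> \<in> Ns (Suc (Suc n)) X Y"
      using Ns_d_rho[OF p(1) u(1) p(2) _ u(3), of "dd n V Y u" "Suc n"] Suc.IH[OF u(1) p(2) words_Ns[OF u(2)]] by simp
    finally show "dd (Suc n) X Y w \<in> Ns (Suc n + 1) X Y" by simp
  qed
qed

text \<open>The pairing of \<open>\<omega>\<close> with the words, indexed by chains through the functions \<open>delta\<close>.\<close>

definition delta :: "('o, 'a) chain \<Rightarrow> ('o, 'a) chain \<Rightarrow> complex"
  where "delta l l' = (if l' = l then 1 else 0)"

lemma delta_inj: "delta l = delta l' \<Longrightarrow> l = l'"
  by (metis delta_def zero_neq_one)

text \<open>A word is complementary to \<omega> if the degrees add up to r. In degrees above r there
  is no such word and the class is 0.\<close>

definition J :: "nat \<Rightarrow> 'o \<Rightarrow> 'o \<Rightarrow> 'x \<Rightarrow> (('o, 'a) chain \<Rightarrow> complex) \<Rightarrow> complex"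
  where "J n X Y \<omega> G = (if n \<le> r \<and> (\<exists>l. G = delta l \<and> valid (r - n) Y X l)
    then T Y (cmp n (r - n) Y X Y \<omega> (wd (r - n) Y X (THE l. G = delta l))) else 0)"

lemma J_delta: "n \<le> r \<Longrightarrow> valid (r - n) Y X l \<Longrightarrow> J n X Y \<omega> (delta l) = T Y (cmp n (r - n) Y X Y \<omega> (wd (r - n) Y X l))"
proof -
  assume a: "n \<le> r" "valid (r - n) Y X l"
  have "(THE l'. delta l = delta l') = l" by (rule the_equality) (auto dest: delta_inj)
  then show ?thesis using a by (auto simp: J_def)
qed

section \<open>The radical of the trace pairing\<close>

lemma pair_linear:
  assumes "X \<in> ob C" "Y \<in> ob C" "n \<le> r" "x \<in> H (r - n) Y X"
  shows "clinear_on (H n X Y) UNIV (\<lambda>\<omega>. T Y (cmp n (r - n) Y X Y \<omega> x))"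
  using clinear_on_compose[OF cmp_left[OF assms(2,1,2,4), of n] graded_trace_linear[OF _ assms(2), of "n + (r - n)"]] T assms(3)
  by simp

lemma wd_H: "X \<in> ob C \<Longrightarrow> Y \<in> ob C \<Longrightarrow> valid n X Y l \<Longrightarrow> wd n X Y l \<in> H n X Y"
  using words_H by (force simp: words_def)

lemma J_linear:
  assumes XY: "X \<in> ob C" "Y \<in> ob C"
  shows "clinear_on (H n X Y) UNIV (J n X Y)"
proof -
  have "J n X Y (\<omega> + \<eta>) G = J n X Y \<omega> G + J n X Y \<eta> G \<and> J n X Y (a *\<^sub>C \<omega>) G = a * J n X Y \<omega> G"
    if "\<omega> \<in> H n X Y" "\<eta> \<in> H n X Y" for \<omega> \<eta> a G
  proof (cases "n \<le> r \<and> (\<exists>l. G = delta l \<and> valid (r - n) Y X l)")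
    case True
    then obtain l where l: "n \<le> r" "G = delta l" "valid (r - n) Y X l" by blast
    note lin = pair_linear[OF XY l(1) wd_H[OF XY(2,1) l(3)]]
    show ?thesis unfolding l(2) J_delta[OF l(1,3)]
      using clinear_on_add[OF lin that] clinear_on_scale[OF lin that(1), of a] by (simp add: scaleC_complex_def)
  qed (auto simp: J_def)
  then show ?thesis by (auto simp: clinear_on_def fun_eq_iff scaleC_fun_apply scaleC_complex_def)
qed

lemma J_eqD:
  assumes XY: "X \<in> ob C" "Y \<in> ob C" and \<omega>: "\<omega> \<in> H n X Y" "\<omega>' \<in> H n X Y" and eq: "J n X Y \<omega> = J n X Y \<omega>'"
    and n: "n \<le> r" and x: "x \<in> Ns (r - n) Y X"
  shows "T Y (cmp n (r - n) Y X Y \<omega> x) = T Y (cmp n (r - n) Y X Y \<omega>' x)"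
proof -
  define f where "f x = T Y (cmp n (r - n) Y X Y \<omega> x) - T Y (cmp n (r - n) Y X Y \<omega>' x)" for x
  have lin: "clinear_on (H (r - n) Y X) UNIV (\<lambda>x. T Y (cmp n (r - n) Y X Y \<omega> x))" if "\<omega> \<in> H n X Y" for \<omega>
    using clinear_on_compose[OF cmp_right[OF XY(2,1,2) that, of "r - n"] graded_trace_linear[OF _ XY(2), of "n + (r - n)"]] T n by simp
  have "clinear_on (H (r - n) Y X) UNIV f"
    using lin[OF \<omega>(1)] lin[OF \<omega>(2)] by (auto simp: f_def clinear_on_def scaleC_complex_def algebra_simps)
  moreover have "f w \<in> {0}" if w: "w \<in> words (r - n) Y X" for w
  proof -
    obtain l where "valid (r - n) Y X l" "w = wd (r - n) Y X l" using w by (auto simp: words_def)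
    then show ?thesis using J_delta[OF n, of Y X l \<omega>] J_delta[OF n, of Y X l \<omega>'] eq by (simp add: f_def)
  qed
  ultimately have "f x \<in> {0}" using Ns_map[OF XY(2,1) _ cvs.subspace_single_0 _ x] by blast
  then show ?thesis by (simp add: f_def)
qed

lemma J_eqI:
  assumes "\<And>x. n \<le> r \<Longrightarrow> x \<in> Ns (r - n) Y X \<Longrightarrow> T Y (cmp n (r - n) Y X Y \<omega> x) = T Y (cmp n (r - n) Y X Y \<omega>' x)"
  shows "J n X Y \<omega> = J n X Y \<omega>'"
proof
  fix G
  show "J n X Y \<omega> G = J n X Y \<omega>' G"
  proof (cases "n \<le> r \<and> (\<exists>l. G = delta l \<and> valid (r - n) Y X l)")
    case True
    then obtain l where l: "n \<le> r" "G = delta l" "valid (r - n) Y X l" by blast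
    have "wd (r - n) Y X l \<in> Ns (r - n) Y X" using l(3) by (auto simp: words_def intro!: words_Ns)
    then show ?thesis unfolding l(2) J_delta[OF l(1,3)] by (rule assms[OF l(1)])
  qed (auto simp: J_def)
qed

text \<open>The radical is a two-sided ideal: \<open>g\<close> is replaced by pairing it with the
  product of \<open>f\<close> and \<open>x\<close>, and \<open>f\<close> by pairing it, after a
  cyclic permutation under \<open>T\<close>, with the product of \<open>x\<close> and
  \<open>g'\<close>.\<close>

lemma J_cmp:
  assumes ob': "X \<in> ob C" "Y \<in> ob C" "Z \<in> ob C"
    and g: "g \<in> Ns i Y Z" "g' \<in> Ns i Y Z" "J i Y Z g = J i Y Z g'"
    and f: "f \<in> Ns j X Y" "f' \<in> Ns j X Y" "J j X Y f = J j X Y f'"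
  shows "J (i + j) X Z (cmp i j X Y Z g f) = J (i + j) X Z (cmp i j X Y Z g' f')"
proof (rule J_eqI)
  fix x assume le: "i + j \<le> r" and x: "x \<in> Ns (r - (i + j)) Z X"
  define k where "k = r - (i + j)"
  have ri: "r - i = j + k" and rj: "r - j = k + i" and ijr: "i + (j + k) = r" "j + (k + i) = r" "k = r - (i + j)"
    "i + j + k = r" "j + k + i = r"
    using le by (simp_all add: k_def)
  have i: "i \<le> r" and j: "j \<le> r" using le by simp_all
  note gH = Ns_H[OF ob'(2,3) g(1)] Ns_H[OF ob'(2,3) g(2)]
  note fH = Ns_H[OF ob'(1,2) f(1)] Ns_H[OF ob'(1,2) f(2)]
  have xN: "x \<in> Ns k Z X" using x by (simp add: k_def)
  note xH = Ns_H[OF ob'(3,1) xN]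
  have fx: "cmp j k Z X Y h x \<in> Ns (j + k) Z Y" if "h \<in> Ns j X Y" for h
    by (rule Ns_cmp[OF ob'(3,1,2) that xN])
  have xg: "cmp k i Y Z X x g' \<in> Ns (k + i) Y X" by (rule Ns_cmp[OF ob'(2,3,1) xN g(2)])
  have comm: "T Z (cmp i (j + k) Z Y Z g' (cmp j k Z X Y h x)) = (-1) ^ (i * (j + k)) * T Y (cmp j (k + i) Y X Y h (cmp k i Y Z X x g'))"
    if h: "h \<in> Ns j X Y" for h
    using graded_trace_comm[of i "j + k" T, OF _ ob'(3,2) gH(2) Ns_H[OF ob'(3,2) fx[OF h]]] T ijr
      cmp_assoc[OF ob'(2,3,1,2) Ns_H[OF ob'(1,2) h] xH gH(2)] by simp
  have "T Z (cmp (i + j) k Z X Z (cmp i j X Y Z g f) x) = T Z (cmp i (j + k) Z Y Z g (cmp j k Z X Y f x))"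
    using cmp_assoc[OF ob'(3,1,2,3) gH(1) fH(1) xH] by simp
  also have "\<dots> = T Z (cmp i (j + k) Z Y Z g' (cmp j k Z X Y f x))"
    using J_eqD[OF ob'(2,3) gH g(3) i, unfolded ri, OF fx[OF f(1)]] .
  also have "\<dots> = T Z (cmp i (j + k) Z Y Z g' (cmp j k Z X Y f' x))"
    unfolding comm[OF f(1)] comm[OF f(2)] using J_eqD[OF ob'(1,2) fH f(3) j, unfolded rj, OF xg] by simp
  also have "\<dots> = T Z (cmp (i + j) k Z X Z (cmp i j X Y Z g' f') x)"
    using cmp_assoc[OF ob'(3,1,2,3) gH(2) fH(2) xH] by simp
  finally show "T Z (cmp (i + j) (r - (i + j)) Z X Z (cmp i j X Y Z g f) x) = T Z (cmp (i + j) (r - (i + j)) Z X Z (cmp i j X Y Z g' f') x)"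
    by (simp add: k_def)
qed

text \<open>Integration by parts: closedness of T gives T(d\<omega> x) = -(-1)^n T(\<omega> dx), and
  dx is again a combination of words.\<close>

lemma J_dd:
  assumes ob': "X \<in> ob C" "Y \<in> ob C" and f: "f \<in> Ns n X Y" "f' \<in> Ns n X Y" "J n X Y f = J n X Y f'"
  shows "J (n + 1) X Y (dd n X Y f) = J (n + 1) X Y (dd n X Y f')"
proof (rule J_eqI)
  fix x assume le: "n + 1 \<le> r" and x: "x \<in> Ns (r - (n + 1)) Y X"
  define k where "k = r - (n + 1)"
  have rn: "r - n = k + 1" and r: "r = (n + k) + 1" using le by (simp_all add: k_def)
  have xN: "x \<in> Ns k Y X" using x by (simp add: k_def)
  note xH = Ns_H[OF ob'(2,1) xN]
  have key: "T Y (cmp (n + 1) k Y X Y (dd n X Y h) x) = - ((-1) ^ n * T Y (cmp n (k + 1) Y X Y h (dd k Y X x)))"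
    if h: "h \<in> Ns n X Y" for h
  proof -
    note hH = Ns_H[OF ob' h]
    have m1: "cmp (n + 1) k Y X Y (dd n X Y h) x \<in> H r Y Y"
      using cmp_mem[OF ob'(2,1,2) dd_mem[OF ob' hH] xH] r by simp
    have m2: "cmp n (k + 1) Y X Y h (dd k Y X x) \<in> H r Y Y"
      using cmp_mem[OF ob'(2,1,2) hH dd_mem[OF ob'(2,1) xH]] r by simp
    have "0 = T Y (dd (n + k) Y Y (cmp n k Y X Y h x))"
      using graded_trace_closed[OF T[unfolded r] ob'(2) cmp_mem[OF ob'(2,1,2) hH xH]] by simp
    also have "\<dots> = T Y (cmp (n + 1) k Y X Y (dd n X Y h) x) + (-1) ^ n * T Y (cmp n (k + 1) Y X Y h (dd k Y X x))"
      using leibniz[OF ob'(2,1,2) hH xH] clinear_on_add[OF graded_trace_linear[OF T ob'(2)] m1 cvs.subspace_scale[OF H_subspace[OF ob'(2,2)] m2]]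
        clinear_on_scale[OF graded_trace_linear[OF T ob'(2)] m2] by (simp add: scaleC_complex_def)
    finally show ?thesis by (simp add: eq_neg_iff_add_eq_0)
  qed
  have "n \<le> r" using le by simp
  from J_eqD[OF ob' Ns_H[OF ob' f(1)] Ns_H[OF ob' f(2)] f(3) this, unfolded rn, OF Ns_dd[OF ob'(2,1) xN]]
  have "T Y (cmp (n + 1) k Y X Y (dd n X Y f) x) = T Y (cmp (n + 1) k Y X Y (dd n X Y f') x)"
    unfolding key[OF f(1)] key[OF f(2)] by simp
  then show "T Y (cmp (n + 1) (r - (n + 1)) Y X Y (dd n X Y f) x) = T Y (cmp (n + 1) (r - (n + 1)) Y X Y (dd n X Y f') x)"
    by (simp add: k_def)
qed

text \<open>In degree r the complementary words include \<rho>(id), and pairing with it recovers the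
  trace itself.\<close>

lemma J_T:
  assumes X: "X \<in> ob C" and f: "f \<in> Ns r X X" "f' \<in> Ns r X X" "J r X X f = J r X X f'" shows "T X f = T X f'"
  using J_eqD[OF X X Ns_H[OF X X f(1)] Ns_H[OF X X f(2)] f(3), of "rho X X (ident C X)"]
    Ns_rho_mem[OF ident_mem[OF X]] unit_right[OF X X Ns_H[OF X X f(1)]] unit_right[OF X X Ns_H[OF X X f(2)]] by simp

text \<open>A choice of representatives. The three preceding lemmas make the operations below
  independent of it.\<close>

definition JI :: "nat \<Rightarrow> 'o \<Rightarrow> 'o \<Rightarrow> ((('o, 'a) chain \<Rightarrow> complex) \<Rightarrow> complex) \<Rightarrow> 'x"
  where "JI n X Y = inv_into (Ns n X Y) (J n X Y)"

section \<open>The quotient cycle and its character\<close>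

lemma JI: "f \<in> Ns n X Y \<Longrightarrow> JI n X Y (J n X Y f) \<in> Ns n X Y \<and> J n X Y (JI n X Y (J n X Y f)) = J n X Y f"
  by (simp add: JI_def f_inv_into_f inv_into_into)

definition qdg :: "('o, (('o, 'a) chain \<Rightarrow> complex) \<Rightarrow> complex) dg_semicat"
  where "qdg = \<lparr>dg_ob = ob C, dg_hom = (\<lambda>n X Y. J n X Y ` Ns n X Y),
    dg_comp = (\<lambda>i j X Y Z a b. J (i + j) X Z (cmp i j X Y Z (JI i Y Z a) (JI j X Y b))),
    dg_d = (\<lambda>n X Y a. J (n + 1) X Y (dd n X Y (JI n X Y a)))\<rparr>"

definition qcyc :: "('o, 'a) std_cyc"
  where "qcyc = \<lparr>cyc_dg = qdg, cyc_tr = (\<lambda>X a. T X (JI r X X a)), cyc_ob = (\<lambda>X. X),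
    cyc_mor = (\<lambda>X Y f. J 0 X Y (rho X Y f))\<rparr>"

lemma q_comp:
  assumes "X \<in> ob C" "Y \<in> ob C" "Z \<in> ob C" and g: "g \<in> Ns i Y Z" and f: "f \<in> Ns j X Y"
  shows "dg_comp qdg i j X Y Z (J i Y Z g) (J j X Y f) = J (i + j) X Z (cmp i j X Y Z g f)"
  using J_cmp[OF assms(1-3) conjunct1[OF JI[OF g]] g conjunct2[OF JI[OF g]] conjunct1[OF JI[OF f]] f conjunct2[OF JI[OF f]]]
  by (simp add: qdg_def)

lemma q_d:
  assumes "X \<in> ob C" "Y \<in> ob C" and f: "f \<in> Ns n X Y"
  shows "dg_d qdg n X Y (J n X Y f) = J (n + 1) X Y (dd n X Y f)"
  using J_dd[OF assms(1,2) conjunct1[OF JI[OF f]] f conjunct2[OF JI[OF f]]] by (simp add: qdg_def)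

lemma q_tr: "X \<in> ob C \<Longrightarrow> f \<in> Ns r X X \<Longrightarrow> T X (JI r X X (J r X X f)) = T X f"
  by (rule J_T[OF _ conjunct1[OF JI] _ conjunct2[OF JI]])

lemma J_Ns_linear:
  assumes "X \<in> ob C" "Y \<in> ob C" shows "clinear_on (Ns n X Y) (J n X Y ` Ns n X Y) (J n X Y)"
  using J_linear[OF assms, of n] Ns_H[OF assms] by (auto simp: clinear_on_def)

text \<open>Covers every operation defined through representatives: it is linear as soon as its
  composite with \<open>J\<close> is given by a linear map.\<close>

lemma q_linear_image:
  assumes XY: "X \<in> ob C" "Y \<in> ob C" and f: "clinear_on (H n X Y) U f"
    and g: "\<And>x. x \<in> Ns n X Y \<Longrightarrow> g (J n X Y x) = f x" and W: "\<And>x. x \<in> Ns n X Y \<Longrightarrow> f x \<in> W"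
  shows "clinear_on (J n X Y ` Ns n X Y) W g"
  unfolding clinear_on_def
proof (intro conjI ballI allI)
  note lJ = J_Ns_linear[OF XY, of n]
  fix a assume "a \<in> J n X Y ` Ns n X Y"
  then obtain x where x: "x \<in> Ns n X Y" "a = J n X Y x" by blast
  show "g a \<in> W" using x g W by simp
  show "g (k *\<^sub>C a) = k *\<^sub>C g a" for k
    using x g clinear_on_scale[OF lJ x(1), of k] clinear_on_scale[OF f Ns_H[OF XY x(1)], of k] cvs.subspace_scale[OF Ns_subspace x(1), of k]
    by (metis (no_types, lifting))
  fix b assume "b \<in> J n X Y ` Ns n X Y"
  then obtain y where y: "y \<in> Ns n X Y" "b = J n X Y y" by blast
  show "g (a + b) = g a + g b"
    using x y g clinear_on_add[OF lJ x(1) y(1)] clinear_on_add[OF f Ns_H[OF XY x(1)] Ns_H[OF XY y(1)]] cvs.subspace_add[OF Ns_subspace x(1) y(1)]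
    by (metis (no_types, lifting))
qed

lemma qdg_semicategory: "dg_semicategory qdg"
  unfolding dg_semicategory_def
proof (intro conjI allI ballI)
  have [simp]: "dg_ob qdg = ob C" "dg_hom qdg n X Y = J n X Y ` Ns n X Y" for n X Y by (simp_all add: qdg_def)
  fix X Y assume "X \<in> dg_ob qdg" "Y \<in> dg_ob qdg"
  then have XY: "X \<in> ob C" "Y \<in> ob C" by simp_all
  show "csubspace (dg_hom qdg n X Y)" for n
    using subspace_image[OF J_Ns_linear[OF XY] Ns_subspace] by simp
  show "clinear_on (dg_hom qdg n X Y) (dg_hom qdg (n + 1) X Y) (dg_d qdg n X Y)" for n
  proof -
    have "clinear_on (J n X Y ` Ns n X Y) (J (n + 1) X Y ` Ns (n + 1) X Y) (dg_d qdg n X Y)"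
      by (rule q_linear_image[OF XY clinear_on_compose[OF dd_linear[OF XY] J_linear[OF XY]]])
        (use q_d[OF XY] Ns_dd[OF XY] in auto)
    then show ?thesis by simp
  qed
  show "dg_d qdg (n + 1) X Y (dg_d qdg n X Y f) = 0" if f: "f \<in> dg_hom qdg n X Y" for n f
  proof -
    obtain x where x: "x \<in> Ns n X Y" "f = J n X Y x" using f by auto
    have "dg_d qdg (n + 1) X Y (dg_d qdg n X Y f) = J (n + 1 + 1) X Y (dd (n + 1) X Y (dd n X Y x))"
      using x q_d[OF XY x(1)] q_d[OF XY Ns_dd[OF XY x(1)]] by simp
    also have "\<dots> = 0"
      unfolding dd_dd[OF XY Ns_H[OF XY x(1)]] by (rule clinear_on_zero[OF J_linear[OF XY] H_subspace[OF XY]])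
    finally show ?thesis .
  qed
  fix Z assume "Z \<in> dg_ob qdg"
  then have Z: "Z \<in> ob C" by simp
  show "cbilinear_on (dg_hom qdg i Y Z) (dg_hom qdg j X Y) (dg_hom qdg (i + j) X Z) (dg_comp qdg i j X Y Z)" for i j
    unfolding cbilinear_on_def
  proof (intro conjI ballI)
    fix a assume "a \<in> dg_hom qdg i Y Z"
    then obtain x where x: "x \<in> Ns i Y Z" "a = J i Y Z x" by auto
    have "clinear_on (J j X Y ` Ns j X Y) (J (i + j) X Z ` Ns (i + j) X Z) (dg_comp qdg i j X Y Z a)"
      by (rule q_linear_image[OF XY clinear_on_compose[OF cmp_right[OF XY Z Ns_H[OF XY(2) Z x(1)]] J_linear[OF XY(1) Z]]])
        (use q_comp[OF XY Z x(1)] Ns_cmp[OF XY Z x(1)] x(2) in auto)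
    then show "clinear_on (dg_hom qdg j X Y) (dg_hom qdg (i + j) X Z) (dg_comp qdg i j X Y Z a)" by simp
  next
    fix b assume "b \<in> dg_hom qdg j X Y"
    then obtain x where x: "x \<in> Ns j X Y" "b = J j X Y x" by auto
    have "clinear_on (J i Y Z ` Ns i Y Z) (J (i + j) X Z ` Ns (i + j) X Z) (\<lambda>a. dg_comp qdg i j X Y Z a b)"
      by (rule q_linear_image[OF XY(2) Z clinear_on_compose[OF cmp_left[OF XY Z Ns_H[OF XY x(1)]] J_linear[OF XY(1) Z]]])
        (use q_comp[OF XY Z _ x(1)] Ns_cmp[OF XY Z _ x(1)] x(2) in auto)
    then show "clinear_on (dg_hom qdg i Y Z) (dg_hom qdg (i + j) X Z) (\<lambda>a. dg_comp qdg i j X Y Z a b)" by simp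
  qed
  show "dg_d qdg (i + j) X Z (dg_comp qdg i j X Y Z g f) = dg_comp qdg (i + 1) j X Y Z (dg_d qdg i Y Z g) f +
      (-1) ^ i *\<^sub>C dg_comp qdg i (j + 1) X Y Z g (dg_d qdg j X Y f)"
    if gf: "g \<in> dg_hom qdg i Y Z" "f \<in> dg_hom qdg j X Y" for i j g f
  proof -
    obtain x y where x: "x \<in> Ns i Y Z" "g = J i Y Z x" and y: "y \<in> Ns j X Y" "f = J j X Y y" using gf by auto
    note xH = Ns_H[OF XY(2) Z x(1)] and yH = Ns_H[OF XY y(1)]
    have m1: "cmp (i + 1) j X Y Z (dd i Y Z x) y \<in> H (i + j + 1) X Z"
      using cmp_mem[OF XY Z dd_mem[OF XY(2) Z xH] yH] by (simp add: add_ac)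
    have m2: "cmp i (j + 1) X Y Z x (dd j X Y y) \<in> H (i + j + 1) X Z"
      using cmp_mem[OF XY Z xH dd_mem[OF XY yH]] by (simp add: add_ac)
    have "dg_d qdg (i + j) X Z (dg_comp qdg i j X Y Z g f) = J (i + j + 1) X Z (dd (i + j) X Z (cmp i j X Y Z x y))"
      using q_comp[OF XY Z x(1) y(1)] q_d[OF XY(1) Z Ns_cmp[OF XY Z x(1) y(1)]] x(2) y(2) by simp
    also have "\<dots> = J (i + j + 1) X Z (cmp (i + 1) j X Y Z (dd i Y Z x) y) + (-1) ^ i *\<^sub>C J (i + j + 1) X Z (cmp i (j + 1) X Y Z x (dd j X Y y))"
      unfolding leibniz[OF XY Z xH yH]
      using clinear_on_add[OF J_linear[OF XY(1) Z] m1 cvs.subspace_scale[OF H_subspace[OF XY(1) Z] m2]]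
        clinear_on_scale[OF J_linear[OF XY(1) Z] m2] by metis
    also have "J (i + j + 1) X Z (cmp (i + 1) j X Y Z (dd i Y Z x) y) = dg_comp qdg (i + 1) j X Y Z (dg_d qdg i Y Z g) f"
      using q_comp[OF XY Z Ns_dd[OF XY(2) Z x(1)] y(1)] q_d[OF XY(2) Z x(1)] x(2) y(2) by (simp add: add_ac)
    also have "J (i + j + 1) X Z (cmp i (j + 1) X Y Z x (dd j X Y y)) = dg_comp qdg i (j + 1) X Y Z g (dg_d qdg j X Y f)"
      using q_comp[OF XY Z x(1) Ns_dd[OF XY y(1)]] q_d[OF XY y(1)] x(2) y(2) by (simp add: add_ac)
    finally show ?thesis .
  qed
  fix W assume "W \<in> dg_ob qdg"
  then have W: "W \<in> ob C" by simp
  show "dg_comp qdg i (j + k) X Z W h (dg_comp qdg j k X Y Z g f) = dg_comp qdg (i + j) k X Y W (dg_comp qdg i j Y Z W h g) f"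
    if hgf: "h \<in> dg_hom qdg i Z W" "g \<in> dg_hom qdg j Y Z" "f \<in> dg_hom qdg k X Y" for i j k h g f
  proof -
    obtain x y z where x: "x \<in> Ns i Z W" "h = J i Z W x" and y: "y \<in> Ns j Y Z" "g = J j Y Z y" and z: "z \<in> Ns k X Y" "f = J k X Y z"
      using hgf by auto
    show ?thesis
      using q_comp[OF XY Z y(1) z(1)] q_comp[OF XY(1) Z W x(1) Ns_cmp[OF XY Z y(1) z(1)]]
        q_comp[OF XY(2) Z W x(1) y(1)] q_comp[OF XY W Ns_cmp[OF XY(2) Z W x(1) y(1)] z(1)]
        cmp_assoc[OF XY Z W Ns_H[OF Z W x(1)] Ns_H[OF XY(2) Z y(1)] Ns_H[OF XY z(1)]] x(2) y(2) z(2)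
      by (simp add: add.assoc)
  qed
qed

lemma qcyc_cycle: "cycle_over C r qcyc"
proof -
  have [simp]: "dg_ob qdg = ob C" "dg_hom qdg n X Y = J n X Y ` Ns n X Y" for n X Y by (simp_all add: qdg_def)
  have "closed_graded_trace qdg r (\<lambda>X a. T X (JI r X X a))"
    unfolding closed_graded_trace_def
  proof (intro conjI ballI allI impI)
    fix X assume "X \<in> dg_ob qdg"
    then have X: "X \<in> ob C" by simp
    have "clinear_on (J r X X ` Ns r X X) UNIV (\<lambda>a. T X (JI r X X a))"
      by (rule q_linear_image[OF X X graded_trace_linear[OF T X] q_tr[OF X]]) simp_all
    then show "clinear_on (dg_hom qdg r X X) UNIV (\<lambda>a. T X (JI r X X a))" by simp
    show "T X (JI r X X (dg_d qdg k X X f)) = 0" if rk: "r = k + 1" and f: "f \<in> dg_hom qdg k X X" for k f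
    proof -
      obtain x where x: "x \<in> Ns k X X" "f = J k X X x" using f by auto
      show ?thesis
        using q_d[OF X X x(1)] x(2) q_tr[OF X, of "dd k X X x"] Ns_dd[OF X X x(1)]
          graded_trace_closed[OF T[unfolded rk] X Ns_H[OF X X x(1)]] rk by simp
    qed
    fix Y assume "Y \<in> dg_ob qdg"
    then have Y: "Y \<in> ob C" by simp
    show "T X (JI r X X (dg_comp qdg i j X Y X g g')) = (-1) ^ (i * j) * T Y (JI r Y Y (dg_comp qdg j i Y X Y g' g))"
      if ij: "i + j = r" and g: "g \<in> dg_hom qdg i Y X" "g' \<in> dg_hom qdg j X Y" for i j g g'
    proof -
      obtain x y where x: "x \<in> Ns i Y X" "g = J i Y X x" and y: "y \<in> Ns j X Y" "g' = J j X Y y" using g by auto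
      have ji: "j + i = r" using ij by simp
      show ?thesis
        using q_comp[OF X Y X x(1) y(1), unfolded ij] q_comp[OF Y X Y y(1) x(1), unfolded ji] x(2) y(2)
          q_tr[OF X Ns_cmp[OF X Y X x(1) y(1), unfolded ij]] q_tr[OF Y Ns_cmp[OF Y X Y y(1) x(1), unfolded ji]]
          graded_trace_comm[of i j T, unfolded ij, OF T X Y Ns_H[OF Y X x(1)] Ns_H[OF X Y y(1)]] by simp
    qed
  qed
  moreover have "clinear_on (hom C X Y) (J 0 X Y ` Ns 0 X Y) (\<lambda>f. J 0 X Y (rho X Y f))" if "X \<in> ob C" "Y \<in> ob C" for X Y
    using clinear_on_compose[OF rho_lin[OF that] J_linear[OF that]] Ns_rho_mem by (auto simp: clinear_on_def)
  moreover have "J 0 X Z (rho X Z (comp C X Y Z g f)) = dg_comp qdg 0 0 X Y Z (J 0 Y Z (rho Y Z g)) (J 0 X Y (rho X Y f))"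
    if "X \<in> ob C" "Y \<in> ob C" "Z \<in> ob C" "g \<in> hom C Y Z" "f \<in> hom C X Y" for X Y Z g f
    using q_comp[OF that(1-3) Ns_rho_mem[OF that(4)] Ns_rho_mem[OF that(5)]] rho_cmp[OF that] by simp
  ultimately show ?thesis
    unfolding cycle_over_def using qdg_semicategory by (simp add: qcyc_def)
qed

lemma word_Ns:
  assumes l: "l \<in> chains C n" shows "word l i \<in> Ns i (obj l (i + 1)) (obj l 0)"
proof (induction i)
  case 0
  then show ?case using Ns_rho_mem[OF chains_fmor[OF l, of 0]] by (simp add: word_def)
next
  case (Suc i)
  then show ?case
    using Ns_d_rho[OF chains_obj[OF l] chains_obj[OF l] chains_obj[OF l] Suc chains_fmor[OF l, of "i + 1"]]
    by (simp add: word_Suc df_def numeral_eq_Suc)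
qed

lemma qcyc_character: "cycle_character C r qcyc = wfun r T"
proof
  fix l
  show "cycle_character C r qcyc l = wfun r T l"
  proof (cases "l \<in> chains C r")
    case l: True
    note O = chains_obj[OF l]
    have "i < length l \<Longrightarrow> cycle_word qcyc l i = J i (obj l (i + 1)) (obj l 0) (word l i)" for i
    proof (induction i)
      case 0
      then show ?case by (simp add: qcyc_def word_def mor_eq_fmor)
    next
      case (Suc i)
      have f: "fmor l (Suc i) \<in> hom C (obj l (Suc (Suc i))) (obj l (Suc i))" using chains_fmor[OF l, of "Suc i"] by simp
      have wN: "word l i \<in> Ns i (obj l (Suc i)) (obj l 0)" using word_Ns[OF l, of i] by simp
      have "cycle_word qcyc l (Suc i) = dg_comp qdg i 1 (obj l (i + 2)) (obj l (i + 1)) (obj l 0) (J i (obj l (i + 1)) (obj l 0) (word l i))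
          (J 1 (obj l (i + 2)) (obj l (i + 1)) (df l (i + 1)))"
        using Suc q_d[OF O O Ns_rho_mem[OF f]] by (simp add: qcyc_def df_def mor_eq_fmor numeral_eq_Suc)
      also have "\<dots> = J (i + 1) (obj l (i + 2)) (obj l 0) (word l (Suc i))"
        using q_comp[OF O O O wN Ns_d_rho_mem[OF O O f]]
        by (simp add: word_Suc df_def numeral_eq_Suc)
      finally show ?case by (simp add: numeral_eq_Suc)
    qed
    from this[of r] have "cycle_word qcyc l r = J r (obj l 0) (obj l 0) (word l r)"
      using chains_length[OF l] chains_wrap(2)[OF l] by simp
    moreover have "word l r \<in> Ns r (obj l 0) (obj l 0)" using word_Ns[OF l, of r] chains_wrap(2)[OF l] by simp
    ultimately show ?thesis using l q_tr[OF O] by (simp add: cycle_character_def wfun_def qcyc_def)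
  qed (simp add: cycle_character_def wfun_def)
qed

end

section \<open>A cycle for the generator of \<open>H\<^sup>2\<^sub>\<lambda>(\<complex>)\<close>\<close>

text \<open>\<open>\<complex> \<oplus> \<complex>\<close>, realised inside the type of the standard cycles.\<close>

definition kap :: "complex \<Rightarrow> complex \<Rightarrow> ('b \<Rightarrow> complex) \<Rightarrow> complex"
  where "kap a b = (\<lambda>G. if G = (\<lambda>_. 0) then a else if G = (\<lambda>_. 1) then b else 0)"

definition kap1 :: "(('b \<Rightarrow> complex) \<Rightarrow> complex) \<Rightarrow> complex" where "kap1 x = x (\<lambda>_. 0)"
definition kap2 :: "(('b \<Rightarrow> complex) \<Rightarrow> complex) \<Rightarrow> complex" where "kap2 x = x (\<lambda>_. 1)"

lemma kap_simps [simp]: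
  "kap1 (kap a b) = a" "kap2 (kap a b) = b" "kap a b + kap a' b' = kap (a + a') (b + b')"
  "z *\<^sub>C kap a b = kap (z * a) (z * b)" "kap 0 0 = 0"
  by (auto simp: kap_def kap1_def kap2_def fun_eq_iff scaleC_fun_apply scaleC_complex_def)

lemma kap_mem [simp]: "kap a b \<in> range (\<lambda>(a, b). kap a b)"
  by (rule range_eqI[of _ _ "(a, b)"]) simp

lemma kapE:
  assumes "x \<in> range (\<lambda>(a, b). kap a b)" obtains a b where "x = kap a b"
  using assms by auto

text \<open>The algebra of \<open>2 \<times> 2\<close> matrices graded by diagonal and off-diagonal parts: \<open>kap a b\<close> stands for
  \<open>diag(a, b)\<close> in even and for \<open>diag(a, b) F\<close> in odd degrees, where \<open>F\<close> is the flip, and the differential is the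
  graded commutator with \<open>F\<close>.\<close>

definition psi_cyc :: "(unit, complex) std_cyc"
  where "psi_cyc = \<lparr>cyc_dg = \<lparr>dg_ob = UNIV, dg_hom = (\<lambda>n X Y. range (\<lambda>(a, b). kap a b)),
      dg_comp = (\<lambda>i j X Y Z x y. if even i then kap (kap1 x * kap1 y) (kap2 x * kap2 y)
        else kap (kap1 x * kap2 y) (kap2 x * kap1 y)),
      dg_d = (\<lambda>n X Y x. if even n then kap (kap2 x - kap1 x) (kap1 x - kap2 x)
        else kap (kap1 x + kap2 x) (kap1 x + kap2 x))\<rparr>,
    cyc_tr = (\<lambda>X x. kap2 x - kap1 x), cyc_ob = (\<lambda>X. X), cyc_mor = (\<lambda>X Y f. kap f 0)\<rparr>"

lemma psi_cyc_cycle: "cycle_over complex_cat 2 psi_cyc"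
proof -
  have s: "csubspace (range (\<lambda>(a, b). kap a b :: ('b \<Rightarrow> complex) \<Rightarrow> complex))"
  proof (rule cvs.subspaceI)
    show "0 \<in> range (\<lambda>(a, b). kap a b :: ('b \<Rightarrow> complex) \<Rightarrow> complex)"
      using kap_mem[of 0 0] unfolding kap_simps .
  qed (auto simp del: split_paired_All elim!: kapE)
  have "dg_semicategory (cyc_dg psi_cyc)"
    unfolding dg_semicategory_def
    by (intro conjI allI ballI)
      (auto simp: psi_cyc_def s cbilinear_on_def clinear_on_def algebra_simps elim!: kapE)
  \<comment> \<open>The trace is the difference of the diagonal entries; differentials of odd forms
    have equal entries and are annihilated.\<close>
  moreover have "closed_graded_trace (cyc_dg psi_cyc) 2 (cyc_tr psi_cyc)"
  proof -
    have "(i = 0 \<and> j = 2) \<or> (i = 1 \<and> j = 1) \<or> (i = 2 \<and> j = 0)" if "i + j = 2" for i j :: nat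
      using that by arith
    then show ?thesis
      unfolding closed_graded_trace_def
      by (intro conjI allI ballI impI)
        (fastforce simp: psi_cyc_def clinear_on_def scaleC_complex_def algebra_simps elim!: kapE)+
  qed
  ultimately show ?thesis
    by (simp add: cycle_over_def psi_cyc_def clinear_on_def scaleC_complex_def)
qed

text \<open>With \<rho>(f) = diag(f, 0) the form f^0 df^1 df^2 is diag(-f^0 f^1 f^2, 0), and the
  trace subtracts the first entry.\<close>

lemma psi_cyc_character: "cycle_character complex_cat 2 psi_cyc = psi2"
  by (auto simp: fun_eq_iff cycle_character_def psi2_def chains_def numeral_2_eq_2 psi_cyc_def)

section \<open>Fredholm modules\<close>

text \<open>Closedness is d d = 0. For the trace property, both Leibniz terms of d(g g') commute
  under \<theta>: the errors are T'(ddg g') = 0 and T'(dg dg') = T'(d(g dg')) = 0. The signs agree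
  because i and j have the same parity.\<close>

lemma (in dg_words) graded_trace_half:
  assumes N: "N = 2 * m + 1"
    and \<theta>: "\<And>X. X \<in> ob C \<Longrightarrow> clinear_on (H N X X) UNIV (\<theta> X)"
    and comm: "\<And>i j X Y g g'. i + j = N \<Longrightarrow> X \<in> ob C \<Longrightarrow> Y \<in> ob C \<Longrightarrow> g \<in> H i Y X \<Longrightarrow> g' \<in> H j X Y \<Longrightarrow>
      \<theta> X (cmp i j X Y X g g') = \<theta> Y (cmp j i Y X Y g' g) + (T' X (cmp (i + 1) j X Y X (dd i Y X g) g') :: complex)"
    and T': "\<And>X. X \<in> ob C \<Longrightarrow> T' X 0 = 0" "\<And>X \<omega>. X \<in> ob C \<Longrightarrow> \<omega> \<in> H N X X \<Longrightarrow> T' X (dd N X X \<omega>) = 0"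
  shows "graded_trace (2 * m) (\<lambda>X \<omega>. 1 / 2 * \<theta> X (dd (2 * m) X X \<omega>))"
  unfolding graded_trace_def
proof (intro conjI ballI allI impI)
  fix X assume X: "X \<in> ob C"
  have "clinear_on (H (2 * m) X X) UNIV (\<lambda>\<omega>. \<theta> X (dd (2 * m) X X \<omega>))"
    using clinear_on_compose[OF dd_linear[OF X X, of "2 * m"] \<theta>[OF X, unfolded N]] .
  then show "clinear_on (H (2 * m) X X) UNIV (\<lambda>\<omega>. 1 / 2 * \<theta> X (dd (2 * m) X X \<omega>))"
    by (simp add: clinear_on_def scaleC_complex_def field_simps)
  show "1 / 2 * \<theta> X (dd (2 * m) X X (dd k X X f)) = 0" if "2 * m = k + 1" "f \<in> H k X X" for k f
    unfolding that(1) dd_dd[OF X X that(2)] using clinear_on_zero[OF \<theta>[OF X] H_subspace[OF X X]] by simp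
  fix Y assume Y: "Y \<in> ob C"
  show "1 / 2 * \<theta> X (dd (2 * m) X X (cmp i j X Y X g g')) = (-1) ^ (i * j) * (1 / 2 * \<theta> Y (dd (2 * m) Y Y (cmp j i Y X Y g' g)))"
    if ij: "i + j = 2 * m" and g: "g \<in> H i Y X" and g': "g' \<in> H j X Y" for i j g g'
  proof -
    have n: "(i + 1) + j = N" "i + (j + 1) = N" "(j + 1) + i = N" "j + (i + 1) = N" using ij N by simp_all
    have ji: "j + i = 2 * m" using ij by simp
    note dg = dd_mem[OF Y X g] and dg' = dd_mem[OF X Y g']
    have par: "even i \<longleftrightarrow> even j" using ij by presburger
    have m1: "cmp (i + 1) j X Y X (dd i Y X g) g' \<in> H N X X" using cmp_mem[OF X Y X dg g', unfolded n] .
    have m2: "cmp i (j + 1) X Y X g (dd j X Y g') \<in> H N X X" using cmp_mem[OF X Y X g dg', unfolded n] .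
    have m3: "cmp (j + 1) i Y X Y (dd j X Y g') g \<in> H N Y Y" using cmp_mem[OF Y X Y dg' g, unfolded n] .
    have m4: "cmp j (i + 1) Y X Y g' (dd i Y X g) \<in> H N Y Y" using cmp_mem[OF Y X Y g' dg, unfolded n] .
    have lin: "\<theta> X (\<alpha> + (-1) ^ k *\<^sub>C \<beta>) = \<theta> X \<alpha> + (-1) ^ k * \<theta> X \<beta>" if "X \<in> ob C" "\<alpha> \<in> H N X X" "\<beta> \<in> H N X X" for X \<alpha> \<beta> k
      using clinear_on_add[OF \<theta>[OF that(1)] that(2) cvs.subspace_scale[OF H_subspace[OF that(1,1)] that(3)]]
        clinear_on_scale[OF \<theta>[OF that(1)] that(3)] by (simp add: scaleC_complex_def)
    have L: "\<theta> X (dd (2 * m) X X (cmp i j X Y X g g')) =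
        \<theta> X (cmp (i + 1) j X Y X (dd i Y X g) g') + (-1) ^ i * \<theta> X (cmp i (j + 1) X Y X g (dd j X Y g'))"
      using leibniz[OF X Y X g g', unfolded ij] lin[OF X m1 m2] by simp
    have R: "\<theta> Y (dd (2 * m) Y Y (cmp j i Y X Y g' g)) =
        \<theta> Y (cmp (j + 1) i Y X Y (dd j X Y g') g) + (-1) ^ j * \<theta> Y (cmp j (i + 1) Y X Y g' (dd i Y X g))"
      using leibniz[OF Y X Y g' g, unfolded ji] lin[OF Y m3 m4] by simp
    have "cmp (i + 1 + 1) j X Y X (dd (i + 1) Y X (dd i Y X g)) g' = 0"
      unfolding dd_dd[OF Y X g] by (rule clinear_on_zero[OF cmp_left[OF X Y X g'] H_subspace[OF Y X]])
    then have 1: "\<theta> X (cmp (i + 1) j X Y X (dd i Y X g) g') = \<theta> Y (cmp j (i + 1) Y X Y g' (dd i Y X g))"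
      using comm[OF n(1) X Y dg g'] T'(1)[OF X] by simp
    have "dd N X X (cmp i (j + 1) X Y X g (dd j X Y g')) = cmp (i + 1) (j + 1) X Y X (dd i Y X g) (dd j X Y g')"
      using leibniz[OF X Y X g dg', unfolded n] dd_dd[OF X Y g']
        clinear_on_zero[OF cmp_right[OF X Y X g] H_subspace[OF X Y]] by simp
    then have "T' X (cmp (i + 1) (j + 1) X Y X (dd i Y X g) (dd j X Y g')) = 0"
      using T'(2)[OF X m2] by simp
    then have 2: "\<theta> X (cmp i (j + 1) X Y X g (dd j X Y g')) = \<theta> Y (cmp (j + 1) i Y X Y (dd j X Y g') g)"
      using comm[OF n(2) X Y g dg'] by simp
    show ?thesis unfolding L R 1 2 using par by (cases "even i") (simp_all add: algebra_simps)
  qed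
qed

section \<open>Graded Hilbert spaces and homogeneous operators\<close>

lemma carrier_subspace:
  assumes "graded_hilbert K" shows "csubspace (carrier_space K)"
proof -
  have s: "csubspace (even_part K)" "csubspace (odd_part K)" using assms by (simp_all add: graded_hilbert_def)
  have "carrier_space K = {x + y | x y. x \<in> even_part K \<and> y \<in> odd_part K}" by (simp add: carrier_space_def)
  then show ?thesis using cvs.subspace_sums[OF s] by simp
qed

lemma graded_orthogonal:
  assumes "graded_hilbert K" "u \<in> even_part K" "v \<in> odd_part K" shows "cinner u v = 0"
  using assms by (simp add: graded_hilbert_def)

lemma graded_decomp_norm:
  assumes "graded_hilbert K" "u \<in> even_part K" "v \<in> odd_part K" shows "norm u \<le> norm (u + v)"
proof -
  have "(norm u)\<^sup>2 \<le> (norm (u + v))\<^sup>2" using pythagoras[OF graded_orthogonal[OF assms]] by simp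
  then show ?thesis by simp
qed

lemma grading_op_add:
  assumes K: "graded_hilbert K" and u: "u \<in> even_part K" and v: "v \<in> odd_part K"
  shows "grading_op K (u + v) = u - v"
  unfolding grading_op_def
proof (rule the_equality)
  fix z assume "\<exists>u'\<in>even_part K. \<exists>v'\<in>odd_part K. u + v = u' + v' \<and> z = u' - v'"
  then obtain u' v' where u': "u' \<in> even_part K" "v' \<in> odd_part K" "u + v = u' + v'" "z = u' - v'" by blast
  have s: "csubspace (even_part K)" "csubspace (odd_part K)" using K by (simp_all add: graded_hilbert_def)
  have "norm (u - u') \<le> norm ((u - u') + (v - v'))"
    by (intro graded_decomp_norm[OF K] cvs.subspace_diff s u v u'(1,2))
  also have "(u - u') + (v - v') = 0" using u'(3) by (simp add: algebra_simps)
  finally have "u = u'" by simp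
  with u' show "z = u - v" by simp
qed (use u v in blast)

lemma carrierE:
  assumes "x \<in> carrier_space K"
  obtains u v where "u \<in> even_part K" "v \<in> odd_part K" "x = u + v"
  using assms by (auto simp: carrier_space_def)

text \<open>By orthogonality the even component is no longer than the vector, so the even components
  of a convergent sequence are Cauchy; their limit and that of the odd components stay in the closed
  parts.\<close>

lemma carrier_closed:
  assumes K: "graded_hilbert K" shows "closed (carrier_space K)"
  unfolding closed_sequential_limits
proof (intro allI impI, elim conjE)
  fix x l assume x: "\<forall>n. x n \<in> carrier_space K" and l: "x \<longlonglongrightarrow> l"
  have s: "csubspace (even_part K)" "csubspace (odd_part K)" "closed (even_part K)" "closed (odd_part K)"
    using K by (simp_all add: graded_hilbert_def)
  have "\<forall>n. \<exists>u. u \<in> even_part K \<and> x n - u \<in> odd_part K"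
  proof
    fix n
    obtain u v where "u \<in> even_part K" "v \<in> odd_part K" "x n = u + v" using x carrierE by blast
    then show "\<exists>u. u \<in> even_part K \<and> x n - u \<in> odd_part K" by (intro exI[of _ u]) simp
  qed
  from choice[OF this] obtain u where u: "\<And>n. u n \<in> even_part K" "\<And>n. x n - u n \<in> odd_part K" by blast
  have le: "norm (u n - u k) \<le> norm (x n - x k)" for n k
  proof -
    have "norm (u n - u k) \<le> norm ((u n - u k) + ((x n - u n) - (x k - u k)))"
      by (intro graded_decomp_norm[OF K] cvs.subspace_diff s u)
    then show ?thesis by (simp add: algebra_simps)
  qed
  have "Cauchy u"
  proof (rule CauchyI)
    fix r :: real assume "0 < r"
    then obtain M where "\<forall>m\<ge>M. \<forall>n\<ge>M. norm (x m - x n) < r"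
      using CauchyD[OF LIMSEQ_imp_Cauchy[OF l]] by blast
    then show "\<exists>M. \<forall>m\<ge>M. \<forall>n\<ge>M. norm (u m - u n) < r" using le le_less_trans by blast
  qed
  then obtain a where a: "u \<longlonglongrightarrow> a" using Cauchy_convergent_iff convergent_def by blast
  have "a \<in> even_part K" using closed_sequentially[OF s(3) u(1) a] .
  moreover have "(\<lambda>n. x n - u n) \<longlonglongrightarrow> l - a" by (intro tendsto_diff l a)
  from closed_sequentially[OF s(4) u(2) this] have "l - a \<in> odd_part K" .
  ultimately show "l \<in> carrier_space K" unfolding carrier_space_def by (intro CollectI exI[of _ a] exI[of _ "l - a"]) simp
qed

lemma graded_hilbert_space:
  assumes K: "graded_hilbert K" shows "hilbert_space (carrier_space K)"
proof -
  obtain D where "countable D" "D \<subseteq> carrier_space K" "carrier_space K \<subseteq> closure D"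
    using K by (auto simp: graded_hilbert_def)
  from orthonormal_basis_exists[OF carrier_subspace[OF K] carrier_closed[OF K] this]
  show ?thesis by (simp add: hilbert_space_def carrier_subspace[OF K])
qed

definition parity :: "nat \<Rightarrow> 'h::complex_hilbert graded_space \<Rightarrow> 'h graded_space \<Rightarrow> ('h \<Rightarrow> 'h) \<Rightarrow> bool"
  where "parity n K L T \<longleftrightarrow> (if even n then degree0 K L T else degree1 K L T)"

lemma parts_carrier:
  assumes "graded_hilbert K"
  shows "u \<in> even_part K \<Longrightarrow> u \<in> carrier_space K" "v \<in> odd_part K \<Longrightarrow> v \<in> carrier_space K"
proof -
  have s: "0 \<in> even_part K" "0 \<in> odd_part K"
    using assms by (simp_all add: graded_hilbert_def cvs.subspace_0)
  show "u \<in> carrier_space K" if "u \<in> even_part K"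
    unfolding carrier_space_def using that s(2) by (intro CollectI exI[of _ u] exI[of _ 0]) simp
  show "v \<in> carrier_space K" if "v \<in> odd_part K"
    unfolding carrier_space_def using that s(1) by (intro CollectI exI[of _ 0] exI[of _ v]) simp
qed

lemma grading_op_parity:
  assumes K: "graded_hilbert K" and L: "graded_hilbert L" and T: "clinear_on (carrier_space K) W T" "parity n K L T"
    and x: "x \<in> carrier_space K"
  shows "grading_op L (T x) = (-1) ^ n *\<^sub>C T (grading_op K x)"
proof -
  obtain u v where uv: "u \<in> even_part K" "v \<in> odd_part K" "x = u + v" using x by (rule carrierE)
  note c = parts_carrier(1)[OF K uv(1)] parts_carrier(2)[OF K uv(2)]
  have Tx: "T x = T u + T v" and Td: "T (grading_op K x) = T u - T v"
    unfolding uv(3) grading_op_add[OF K uv(1,2)]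
    using clinear_on_add[OF T(1) c] clinear_on_diff[OF T(1) carrier_subspace[OF K] c] .
  show ?thesis
  proof (cases "even n")
    case True
    then have "T u \<in> even_part L" "T v \<in> odd_part L" using T(2) uv by (auto simp: parity_def degree0_def)
    then show ?thesis unfolding Tx Td using grading_op_add[OF L] True by simp
  next
    case False
    then have "T v \<in> even_part L" "T u \<in> odd_part L" using T(2) uv by (auto simp: parity_def degree1_def)
    then have "grading_op L (T v + T u) = T v - T u" by (rule grading_op_add[OF L])
    then show ?thesis unfolding Tx Td using False by (simp add: add.commute)
  qed
qed

lemma grading_bounded_op:
  assumes K: "graded_hilbert K" shows "bounded_op (carrier_space K) (carrier_space K) (grading_op K)"
proof -
  have s: "csubspace (even_part K)" "csubspace (odd_part K)" using K by (simp_all add: graded_hilbert_def)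
  have n: "norm (grading_op K x) \<le> 1 * norm x" and m: "grading_op K x \<in> carrier_space K" if x: "x \<in> carrier_space K" for x
  proof -
    obtain u v where uv: "u \<in> even_part K" "v \<in> odd_part K" "x = u + v" using x by (rule carrierE)
    have v': "- v \<in> odd_part K" using uv(2) s(2) cvs.subspace_neg by blast
    have "(norm (u + - v))\<^sup>2 = (norm (u + v))\<^sup>2"
      unfolding pythagoras[OF graded_orthogonal[OF K uv(1,2)]] pythagoras[OF graded_orthogonal[OF K uv(1) v']] by simp
    then have "norm (u - v) = norm (u + v)" by simp
    then show "norm (grading_op K x) \<le> 1 * norm x" using grading_op_add[OF K uv(1,2)] uv(3) by simp
    show "grading_op K x \<in> carrier_space K"
      using grading_op_add[OF K uv(1,2)] uv(1,3) v' unfolding carrier_space_def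
      by (intro CollectI exI[of _ u] exI[of _ "- v"]) simp
  qed
  have add: "grading_op K (x + y) = grading_op K x + grading_op K y" if x: "x \<in> carrier_space K" and y: "y \<in> carrier_space K" for x y
  proof -
    obtain u v where uv: "u \<in> even_part K" "v \<in> odd_part K" "x = u + v" using x by (rule carrierE)
    obtain a b where ab: "a \<in> even_part K" "b \<in> odd_part K" "y = a + b" using y by (rule carrierE)
    have "grading_op K ((u + a) + (v + b)) = (u + a) - (v + b)"
      by (intro grading_op_add[OF K] cvs.subspace_add s uv(1,2) ab(1,2))
    moreover have "x + y = (u + a) + (v + b)" using uv(3) ab(3) by (simp add: algebra_simps)
    moreover have "grading_op K x = u - v" "grading_op K y = a - b"
      using grading_op_add[OF K uv(1,2)] grading_op_add[OF K ab(1,2)] uv(3) ab(3) by simp_all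
    ultimately show ?thesis by (simp only:) simp
  qed
  have scale: "grading_op K (c *\<^sub>C x) = c *\<^sub>C grading_op K x" if x: "x \<in> carrier_space K" for x c
  proof -
    obtain u v where uv: "u \<in> even_part K" "v \<in> odd_part K" "x = u + v" using x by (rule carrierE)
    have "grading_op K (c *\<^sub>C u + c *\<^sub>C v) = c *\<^sub>C u - c *\<^sub>C v"
      by (intro grading_op_add[OF K] cvs.subspace_scale s uv(1,2))
    then show ?thesis using grading_op_add[OF K uv(1,2)] uv(3) by (simp add: scaleC_add_right cvs.scale_right_diff_distrib)
  qed
  show ?thesis unfolding bounded_op_def clinear_on_def using n m add scale by blast
qed

lemma sch_zero: "csubspace W \<Longrightarrow> sch p n V W (\<lambda>x. 0)"
  unfolding sch_def
  by (intro conjI exI[of _ 0] exI[of _ 0] exI[of _ "\<lambda>k. 0"])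
    (auto simp: bounded_op_zero decseq_def approx_def rank_le_def intro!: exI[of _ "\<lambda>x. 0"] exI[of _ "{}"])

lemma parity_comp:
  assumes "parity i L P g" "parity j K L f" shows "parity (i + j) K P (\<lambda>x. g (f x))"
  using assms by (auto simp: parity_def degree0_def degree1_def image_subset_iff split: if_splits)

lemma parity_lin:
  assumes "graded_hilbert L" "parity n K L S" "parity n K L T"
  shows "parity n K L (\<lambda>x. S x + T x)" "parity n K L (\<lambda>x. a *\<^sub>C S x)"
proof -
  have s: "csubspace (even_part L)" "csubspace (odd_part L)" using assms(1) by (simp_all add: graded_hilbert_def)
  show "parity n K L (\<lambda>x. S x + T x)" "parity n K L (\<lambda>x. a *\<^sub>C S x)"
    using assms(2,3) cvs.subspace_add[OF s(1)] cvs.subspace_add[OF s(2)] cvs.subspace_scale[OF s(1)] cvs.subspace_scale[OF s(2)]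
    by (auto simp: parity_def degree0_def degree1_def image_subset_iff split: if_splits)
qed

lemma parity_cong:
  assumes "graded_hilbert K" "parity n K L T" "\<And>x. x \<in> carrier_space K \<Longrightarrow> T' x = T x" shows "parity n K L T'"
  using assms(2) parts_carrier[OF assms(1)] assms(3)
  by (auto simp: parity_def degree0_def degree1_def image_subset_iff split: if_splits)

locale fredholm_module =
  fixes C :: "('o, 'a::complex_vector) lin_cat" and M :: "('o, 'a, 'h::complex_hilbert) fredholm" and p :: real
  assumes C: "linear_category C" and p: "1 \<le> p" and M: "even_fredholm_module C p M"
begin

abbreviation "Hs \<equiv> fm_space M"
abbreviation "K \<equiv> fm_graded M"
abbreviation "F \<equiv> fm_F M"
abbreviation "eps X \<equiv> grading_op (fm_graded M X)"

section \<open>The DG-semicategory of operators\<close>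

lemma K: "X \<in> ob C \<Longrightarrow> graded_hilbert (K X)"
  using M by (simp add: even_fredholm_module_def)

lemma Hs_subspace: "X \<in> ob C \<Longrightarrow> csubspace (Hs X)"
  using carrier_subspace[OF K] by (simp add: fm_space_def)

lemma Hs_hilbert: "X \<in> ob C \<Longrightarrow> hilbert_space (Hs X)"
  using graded_hilbert_space[OF K] by (simp add: fm_space_def)

lemma eps_bounded: "X \<in> ob C \<Longrightarrow> bounded_op (Hs X) (Hs X) (eps X)"
  using grading_bounded_op[OF K] by (simp add: fm_space_def)

lemma F: "X \<in> ob C \<Longrightarrow> bounded_op (Hs X) (Hs X) (F X)" "X \<in> ob C \<Longrightarrow> parity 1 (K X) (K X) (F X)"
  "X \<in> ob C \<Longrightarrow> x \<in> Hs X \<Longrightarrow> F X (F X x) = x"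
  using M by (simp_all add: even_fredholm_module_def parity_def)

lemma F_mem: "X \<in> ob C \<Longrightarrow> x \<in> Hs X \<Longrightarrow> F X x \<in> Hs X"
  using bounded_op_mem[OF F(1)] .

lemma F_lin: "X \<in> ob C \<Longrightarrow> x \<in> Hs X \<Longrightarrow> y \<in> Hs X \<Longrightarrow> F X (x + y) = F X x + F X y"
  "X \<in> ob C \<Longrightarrow> x \<in> Hs X \<Longrightarrow> F X (a *\<^sub>C x) = a *\<^sub>C F X x"
  using clinear_on_add[OF bounded_op_linear[OF F(1)]] clinear_on_scale[OF bounded_op_linear[OF F(1)]] by blast+

lemma eps_lin: "X \<in> ob C \<Longrightarrow> x \<in> Hs X \<Longrightarrow> y \<in> Hs X \<Longrightarrow> eps X (x + y) = eps X x + eps X y"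
  "X \<in> ob C \<Longrightarrow> x \<in> Hs X \<Longrightarrow> eps X (a *\<^sub>C x) = a *\<^sub>C eps X x"
  using clinear_on_add[OF bounded_op_linear[OF eps_bounded]] clinear_on_scale[OF bounded_op_linear[OF eps_bounded]] by blast+

lemma eps_diff: "X \<in> ob C \<Longrightarrow> x \<in> Hs X \<Longrightarrow> y \<in> Hs X \<Longrightarrow> eps X (x - y) = eps X x - eps X y"
  using clinear_on_diff[OF bounded_op_linear[OF eps_bounded] Hs_subspace] .

lemma F_diff: "X \<in> ob C \<Longrightarrow> x \<in> Hs X \<Longrightarrow> y \<in> Hs X \<Longrightarrow> F X (x - y) = F X x - F X y"
  using clinear_on_diff[OF bounded_op_linear[OF F(1)] Hs_subspace] .

text \<open>The value 0 outside the source space makes equality of operators an equality of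
  functions, as the laws of a DG-semicategory demand.\<close>

definition dF :: "nat \<Rightarrow> 'o \<Rightarrow> 'o \<Rightarrow> ('h \<Rightarrow> 'h) \<Rightarrow> 'h \<Rightarrow> 'h"
  where "dF n X Y T x = (if x \<in> Hs X then F Y (T x) + (- ((-1) ^ n)) *\<^sub>C T (F X x) else 0)"

text \<open>Since F is merely bounded, a commutator with F is a priori no smaller than the operator
  itself, so the gain of one degree is made a requirement. Products preserve it by the Leibniz rule,
  and \<open>dF\<close> does because its square is 0.\<close>

definition Hn :: "nat \<Rightarrow> 'o \<Rightarrow> 'o \<Rightarrow> ('h \<Rightarrow> 'h) set"
  where "Hn n X Y = {T. (\<forall>x. x \<notin> Hs X \<longrightarrow> T x = 0) \<and> parity n (K X) (K Y) T \<and> sch p n (Hs X) (Hs Y) T \<and>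
    sch p (n + 1) (Hs X) (Hs Y) (dF n X Y T)}"

lemma HnD:
  assumes "T \<in> Hn n X Y"
  shows "x \<notin> Hs X \<Longrightarrow> T x = 0" "parity n (K X) (K Y) T" "sch p n (Hs X) (Hs Y) T"
    "sch p (n + 1) (Hs X) (Hs Y) (dF n X Y T)" "x \<in> Hs X \<Longrightarrow> T x \<in> Hs Y" "clinear_on (Hs X) (Hs Y) T"
  using assms bounded_op_mem[OF sch_bounded_op] bounded_op_linear[OF sch_bounded_op] unfolding Hn_def by blast+

lemma Hn_lin:
  assumes "T \<in> Hn n X Y"
  shows "x \<in> Hs X \<Longrightarrow> y \<in> Hs X \<Longrightarrow> T (x + y) = T x + T y" "x \<in> Hs X \<Longrightarrow> T (a *\<^sub>C x) = a *\<^sub>C T x"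
  using clinear_on_add[OF HnD(6)[OF assms]] clinear_on_scale[OF HnD(6)[OF assms]] by blast+

lemma p0: "0 \<le> p" using p by simp

lemma dF_add: "X \<in> ob C \<Longrightarrow> Y \<in> ob C \<Longrightarrow> S \<in> Hn n X Y \<Longrightarrow> T \<in> Hn n X Y \<Longrightarrow> dF n X Y (S + T) = dF n X Y S + dF n X Y T"
  by (auto simp: dF_def fun_eq_iff F_lin HnD(5) scaleC_add_right algebra_simps)

lemma dF_scale: "X \<in> ob C \<Longrightarrow> Y \<in> ob C \<Longrightarrow> T \<in> Hn n X Y \<Longrightarrow> dF n X Y (a *\<^sub>C T) = a *\<^sub>C dF n X Y T"
  by (auto simp: dF_def fun_eq_iff scaleC_fun_apply F_lin HnD(5) scaleC_add_right cvs.scale_right_diff_distrib mult.commute)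

lemma Hn_subspace:
  assumes X: "X \<in> ob C" and Y: "Y \<in> ob C" shows "csubspace (Hn n X Y)"
proof (rule cvs.subspaceI)
  note W = Hs_subspace[OF Y]
  have d0: "dF n X Y 0 = (\<lambda>x. 0)"
    using clinear_on_zero[OF bounded_op_linear[OF F(1)[OF Y]] W] by (auto simp: dF_def fun_eq_iff)
  have "parity n (K X) (K Y) 0"
    using K[OF Y] by (auto simp: parity_def degree0_def degree1_def graded_hilbert_def cvs.subspace_0)
  then show "0 \<in> Hn n X Y" using sch_zero[OF W] d0 by (simp add: Hn_def zero_fun_def)
  fix S assume S: "S \<in> Hn n X Y"
  show "a *\<^sub>C S \<in> Hn n X Y" for a
    using HnD[OF S] parity_lin(2)[OF K[OF Y] HnD(2)[OF S] HnD(2)[OF S], of a]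
      sch_scale[OF HnD(3)[OF S] W, of a] sch_scale[OF HnD(4)[OF S] W, of a] dF_scale[OF X Y S, of a]
    by (simp add: Hn_def scaleC_fun_def)
  fix T assume T: "T \<in> Hn n X Y"
  show "S + T \<in> Hn n X Y"
    using HnD[OF S] HnD[OF T] parity_lin(1)[OF K[OF Y] HnD(2)[OF S] HnD(2)[OF T]]
      sch_add[OF HnD(3)[OF S] HnD(3)[OF T] W p0] sch_add[OF HnD(4)[OF S] HnD(4)[OF T] W p0] dF_add[OF X Y S T]
    by (simp add: Hn_def plus_fun_def)
qed

lemma dF_comp:
  assumes "X \<in> ob C" "Y \<in> ob C" "Z \<in> ob C" "g \<in> Hn i Y Z" "f \<in> Hn j X Y"
  shows "dF (i + j) X Z (\<lambda>x. g (f x)) = (\<lambda>x. dF i Y Z g (f x)) + (-1) ^ i *\<^sub>C (\<lambda>x. g (dF j X Y f x))"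
proof
  fix x
  show "dF (i + j) X Z (\<lambda>x. g (f x)) x = ((\<lambda>x. dF i Y Z g (f x)) + (-1) ^ i *\<^sub>C (\<lambda>x. g (dF j X Y f x))) x"
  proof (cases "x \<in> Hs X")
    case True
    have m: "f x \<in> Hs Y" "F Y (f x) \<in> Hs Y" "f (F X x) \<in> Hs Y"
      using True HnD(5)[OF assms(5)] F_mem assms by auto
    have "(-1) ^ i *\<^sub>C g (dF j X Y f x) = (-1) ^ i *\<^sub>C g (F Y (f x)) + (-1) ^ i *\<^sub>C (- ((-1) ^ j)) *\<^sub>C g (f (F X x))"
      using True m Hn_lin[OF assms(4)] cvs.subspace_scale[OF Hs_subspace[OF assms(2)]]
      by (simp add: dF_def scaleC_add_right del: cvs.scale_minus_left cvs.scale_scale)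
    then show ?thesis using True m by (simp add: dF_def scaleC_fun_apply power_add)
  next
    case False
    have z: "0 \<in> Hs Y" using cvs.subspace_0[OF Hs_subspace[OF assms(2)]] .
    have "g 0 = 0" using clinear_on_zero[OF HnD(6)[OF assms(4)] Hs_subspace[OF assms(2)]] .
    moreover have "F Y 0 = 0" "F Z 0 = 0"
      using clinear_on_zero[OF bounded_op_linear[OF F(1)[OF assms(2)]] Hs_subspace[OF assms(2)]]
        clinear_on_zero[OF bounded_op_linear[OF F(1)[OF assms(3)]] Hs_subspace[OF assms(3)]] .
    moreover from this have "dF i Y Z g 0 = 0"
      using \<open>g 0 = 0\<close> by (simp add: dF_def)
    ultimately show ?thesis using False HnD(1)[OF assms(5) False] by (simp add: dF_def scaleC_fun_apply)
  qed
qed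

lemma Hn_comp:
  assumes "X \<in> ob C" "Y \<in> ob C" "Z \<in> ob C" and g: "g \<in> Hn i Y Z" and f: "f \<in> Hn j X Y"
  shows "(\<lambda>x. g (f x)) \<in> Hn (i + j) X Z"
proof -
  note s = Hs_subspace[OF assms(1)] Hs_subspace[OF assms(2)] Hs_subspace[OF assms(3)]
  have "sch p (i + j) (Hs X) (Hs Z) (\<lambda>x. g (f x))"
    using sch_comp[OF HnD(3)[OF f] HnD(3)[OF g] s p0] by (simp add: add.commute)
  moreover have "sch p (i + j + 1) (Hs X) (Hs Z) (\<lambda>x. dF i Y Z g (f x) + (-1) ^ i *\<^sub>C g (dF j X Y f x))"
    using sch_add[OF sch_comp[OF HnD(3)[OF f] HnD(4)[OF g] s p0] sch_scale[OF sch_comp[OF HnD(4)[OF f] HnD(3)[OF g] s p0, unfolded add.assoc add.commute[of 1]] s(3), unfolded add.assoc] s(3) p0, of "(-1) ^ i"]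
    by (simp add: add_ac)
  moreover have "g (f x) = 0" if "x \<notin> Hs X" for x
    using HnD(1)[OF f that] clinear_on_zero[OF HnD(6)[OF g] s(2)] by simp
  ultimately show ?thesis
    using parity_comp[OF HnD(2)[OF g] HnD(2)[OF f]]
    by (simp add: Hn_def dF_comp[OF assms] plus_fun_def scaleC_fun_def)
qed

lemma dF_dF:
  assumes "X \<in> ob C" "Y \<in> ob C" "T \<in> Hn n X Y" shows "dF (n + 1) X Y (dF n X Y T) = 0"
proof
  fix x
  show "dF (n + 1) X Y (dF n X Y T) x = 0 x"
  proof (cases "x \<in> Hs X")
    case True
    have m: "T x \<in> Hs Y" "T (F X x) \<in> Hs Y" "F X x \<in> Hs X" "F Y (T x) \<in> Hs Y"
      using True HnD(5)[OF assms(3)] F_mem assms by auto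
    have e: "(- ((-1) ^ (n + 1))) * (- ((-1) ^ n)) = (-1::complex)" by (simp add: power_mult_distrib[symmetric])
    have "F Y (F Y (T x) + (- ((-1) ^ n)) *\<^sub>C T (F X x)) = T x + (- ((-1) ^ n)) *\<^sub>C F Y (T (F X x))"
      using m F_lin(2)[OF assms(2)] F_diff[OF assms(2)] cvs.subspace_scale[OF Hs_subspace[OF assms(2)] m(2)] F(3)[OF assms(2)] by simp
    then show ?thesis using True m e F(3)[OF assms(1) True]
      by (simp add: dF_def scaleC_add_right scaleC_scaleC del: cvs.scale_minus_left) (simp add: algebra_simps)
  qed (simp add: dF_def)
qed

lemma Hn_dF:
  assumes "X \<in> ob C" "Y \<in> ob C" "T \<in> Hn n X Y" shows "dF n X Y T \<in> Hn (n + 1) X Y"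
proof -
  have "parity (n + 1) (K X) (K Y) (\<lambda>x. F Y (T x))" "parity (n + 1) (K X) (K Y) (\<lambda>x. T (F X x))"
    using parity_comp[OF F(2)[OF assms(2)] HnD(2)[OF assms(3)]] parity_comp[OF HnD(2)[OF assms(3)] F(2)[OF assms(1)]] by simp_all
  from parity_lin(1)[OF K[OF assms(2)] this(1) parity_lin(2)[OF K[OF assms(2)] this(2,2)]]
  have "parity (n + 1) (K X) (K Y) (\<lambda>x. F Y (T x) + (- ((-1) ^ n)) *\<^sub>C T (F X x))" .
  from parity_cong[OF K[OF assms(1)] this] have "parity (n + 1) (K X) (K Y) (dF n X Y T)"
    by (simp add: dF_def fm_space_def)
  then show ?thesis
    using HnD(4)[OF assms(3)] dF_dF[OF assms] sch_zero[OF Hs_subspace[OF assms(2)], of p "n + 1 + 1" "Hs X"]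
    by (simp add: Hn_def zero_fun_def) (simp add: dF_def)
qed

definition rho0 :: "'o \<Rightarrow> 'o \<Rightarrow> 'a \<Rightarrow> 'h \<Rightarrow> 'h"
  where "rho0 X Y f x = (if x \<in> Hs X then fm_map M X Y f x else 0)"

lemma map: "X \<in> ob C \<Longrightarrow> Y \<in> ob C \<Longrightarrow> f \<in> hom C X Y \<Longrightarrow> bounded_op (Hs X) (Hs Y) (fm_map M X Y f)"
  "X \<in> ob C \<Longrightarrow> Y \<in> ob C \<Longrightarrow> f \<in> hom C X Y \<Longrightarrow> parity 0 (K X) (K Y) (fm_map M X Y f)"
  "X \<in> ob C \<Longrightarrow> Y \<in> ob C \<Longrightarrow> x \<in> Hs X \<Longrightarrow> clinear_on (hom C X Y) (Hs Y) (\<lambda>f. fm_map M X Y f x)"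
  "X \<in> ob C \<Longrightarrow> x \<in> Hs X \<Longrightarrow> fm_map M X X (ident C X) x = x"
  "X \<in> ob C \<Longrightarrow> Y \<in> ob C \<Longrightarrow> Z \<in> ob C \<Longrightarrow> g \<in> hom C Y Z \<Longrightarrow> f' \<in> hom C X Y \<Longrightarrow> x \<in> Hs X \<Longrightarrow>
    fm_map M X Z (comp C X Y Z g f') x = fm_map M Y Z g (fm_map M X Y f' x)"
  "X \<in> ob C \<Longrightarrow> Y \<in> ob C \<Longrightarrow> f \<in> hom C X Y \<Longrightarrow> fm_comm M X Y f \<in> schatten_class p (Hs X) (Hs Y)"
  using M by (simp_all add: even_fredholm_module_def parity_def)

lemma dF_rho0: "X \<in> ob C \<Longrightarrow> x \<in> Hs X \<Longrightarrow> dF 0 X Y (rho0 X Y f) x = fm_comm M X Y f x"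
  using F_mem by (simp add: dF_def rho0_def fm_comm_def)

text \<open>Summability of the module is precisely the requirement on \<open>dF\<close> in degree
  0.\<close>

lemma rho0_mem:
  assumes "X \<in> ob C" "Y \<in> ob C" "f \<in> hom C X Y" shows "rho0 X Y f \<in> Hn 0 X Y"
proof -
  note V = Hs_subspace[OF assms(1)] and W = Hs_subspace[OF assms(2)]
  have "sch p 0 (Hs X) (Hs Y) (rho0 X Y f)"
    by (rule sch_cong[OF sch_bounded[OF map(1)[OF assms] W] V]) (simp add: rho0_def)
  moreover have "sch p 1 (Hs X) (Hs Y) (dF 0 X Y (rho0 X Y f))"
    by (rule sch_cong[OF schatten_class_sch[OF map(6)[OF assms] V W p] V]) (simp add: dF_rho0[OF assms(1)])
  moreover have "parity 0 (K X) (K Y) (rho0 X Y f)"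
    by (rule parity_cong[OF K[OF assms(1)] map(2)[OF assms]]) (simp add: rho0_def fm_space_def)
  ultimately show ?thesis by (simp add: Hn_def rho0_def)
qed

text \<open>The trace component has the default value 0: the functionals of the degrees 2m, 2m + 1
  and 2m + 2 all live on this DG-semicategory and are supplied separately.\<close>

definition fcyc :: "('o, 'a, 'o, 'h \<Rightarrow> 'h) cyc"
  where "fcyc = \<lparr>cyc_dg = \<lparr>dg_ob = ob C, dg_hom = Hn, dg_comp = (\<lambda>i j X Y Z g f x. g (f x)), dg_d = dF\<rparr>,
    cyc_tr = (\<lambda>X \<omega>. 0), cyc_ob = (\<lambda>X. X), cyc_mor = rho0\<rparr>"

lemma comp_linear:
  assumes "X \<in> ob C" "Y \<in> ob C" "Z \<in> ob C"
  shows "cbilinear_on (Hn i Y Z) (Hn j X Y) (Hn (i + j) X Z) (\<lambda>g f x. g (f x))"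
proof -
  have "g ((f + f') x) = g (f x) + g (f' x)" "g ((a *\<^sub>C f) x) = a *\<^sub>C g (f x)"
    if g: "g \<in> Hn i Y Z" and f: "f \<in> Hn j X Y" "f' \<in> Hn j X Y" for g f f' a x
  proof -
    have "f x \<in> Hs Y" "f' x \<in> Hs Y"
      using HnD(1)[OF f(1)] HnD(1)[OF f(2)] HnD(5)[OF f(1)] HnD(5)[OF f(2)] cvs.subspace_0[OF Hs_subspace[OF assms(2)]] by metis+
    then show "g ((f + f') x) = g (f x) + g (f' x)" "g ((a *\<^sub>C f) x) = a *\<^sub>C g (f x)"
      using Hn_lin[OF g] by (simp_all add: scaleC_fun_apply)
  qed
  then show ?thesis
    using Hn_comp[OF assms] by (auto simp: cbilinear_on_def clinear_on_def fun_eq_iff scaleC_fun_apply)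
qed

lemma fcyc_words: "dg_words C fcyc"
proof
  show "linear_category C" by (rule C)
  show "dg_semicategory (cyc_dg fcyc)"
    unfolding dg_semicategory_def
    using Hn_subspace comp_linear Hn_dF dF_add dF_scale dF_dF dF_comp
    by (simp add: fcyc_def clinear_on_def scaleC_fun_def)
  show "cyc_ob fcyc X \<in> dg_ob (cyc_dg fcyc)" if "X \<in> ob C" for X using that by (simp add: fcyc_def)
  show "clinear_on (hom C X Y) (dg_hom (cyc_dg fcyc) 0 (cyc_ob fcyc X) (cyc_ob fcyc Y)) (cyc_mor fcyc X Y)"
    if "X \<in> ob C" "Y \<in> ob C" for X Y
    using rho0_mem[OF that] clinear_on_add[OF map(3)[OF that]] clinear_on_scale[OF map(3)[OF that]]
    by (auto simp: fcyc_def clinear_on_def rho0_def fun_eq_iff scaleC_fun_apply)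
  show "cyc_mor fcyc X Z (comp C X Y Z g f) = dg_comp (cyc_dg fcyc) 0 0 (cyc_ob fcyc X) (cyc_ob fcyc Y) (cyc_ob fcyc Z)
      (cyc_mor fcyc Y Z g) (cyc_mor fcyc X Y f)"
    if h: "X \<in> ob C" "Y \<in> ob C" "Z \<in> ob C" "g \<in> hom C Y Z" "f \<in> hom C X Y" for X Y Z g f
    using map(5)[OF h] bounded_op_mem[OF map(1)[OF h(1,2,5)]] clinear_on_zero[OF bounded_op_linear[OF map(1)[OF h(2,3,4)]] Hs_subspace[OF h(2)]]
    by (auto simp: fcyc_def rho0_def fun_eq_iff)
qed

interpretation W: dg_words C fcyc by (rule fcyc_words)

lemma W_simps: "W.H n X Y = Hn n X Y" "W.cmp i j X Y Z g f = (\<lambda>x. g (f x))" "W.dd n X Y = dF n X Y"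
  "cyc_mor fcyc = rho0"
  unfolding W.H_def W.cmp_def W.dd_def by (simp_all add: fcyc_def)

definition theta :: "'o \<Rightarrow> ('h \<Rightarrow> 'h) \<Rightarrow> complex"
  where "theta X \<omega> = op_trace (Hs X) (\<lambda>x. eps X (F X (\<omega> x)))"

definition tau :: "'o \<Rightarrow> ('h \<Rightarrow> 'h) \<Rightarrow> complex"
  where "tau X \<omega> = op_trace (Hs X) (\<lambda>x. eps X (\<omega> x))"

definition half_theta :: "nat \<Rightarrow> 'o \<Rightarrow> ('h \<Rightarrow> 'h) \<Rightarrow> complex"
  where "half_theta n X \<omega> = 1 / 2 * theta X (dF n X X \<omega>)"

section \<open>The functionals \<theta> and \<tau>\<close>

lemma sch_postcomp:
  assumes "X \<in> ob C" "Y \<in> ob C" "sch p n (Hs Y) (Hs X) A" "bounded_op (Hs X) (Hs X) B"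
  shows "sch p n (Hs Y) (Hs X) (\<lambda>x. B (A x))"
  using sch_comp[OF assms(3) sch_bounded[OF assms(4) Hs_subspace[OF assms(1)]]
      Hs_subspace[OF assms(2)] Hs_subspace[OF assms(1)] Hs_subspace[OF assms(1)] p0] by simp

lemmas sch_eps = sch_postcomp[OF _ _ _ eps_bounded]
lemmas sch_F = sch_postcomp[OF _ _ _ F(1)]

text \<open>Rotation of \<open>A\<close> against the identity, which as a bounded operator has
  degree 0.\<close>

lemma trace_exists:
  assumes X: "X \<in> ob C" and A: "sch p n (Hs X) (Hs X) A" and n: "p \<le> real n"
  obtains t where "has_trace (Hs X) A t"
proof -
  have "bounded_op (Hs X) (Hs X) (\<lambda>x. x)"
    by (auto simp: bounded_op_def clinear_on_def intro: exI[of _ 1])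
  note B = sch_bounded[OF this Hs_subspace[OF X]]
  have "p \<le> real (n + 0)" using n by simp
  from sch_trace_rotate[OF A B p this Hs_hilbert[OF X] Hs_hilbert[OF X]] show ?thesis
    by (elim exE conjE) (rule that)
qed

lemma F_eps:
  assumes X: "X \<in> ob C" and x: "x \<in> Hs X" shows "F X (eps X x) = - eps X (F X x)"
  using grading_op_parity[OF K[OF X] K[OF X] bounded_op_linear[OF F(1)[OF X], unfolded fm_space_def] F(2)[OF X] x[unfolded fm_space_def]]
  by (simp add: cvs.scale_minus_left)

lemma Hn_eps:
  assumes X: "X \<in> ob C" and Y: "Y \<in> ob C" and T: "T \<in> Hn n X Y" and x: "x \<in> Hs X"
  shows "eps Y (T x) = (-1) ^ n *\<^sub>C T (eps X x)"
  using grading_op_parity[OF K[OF X] K[OF Y] HnD(6)[OF T, unfolded fm_space_def] HnD(2)[OF T] x[unfolded fm_space_def]] .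

lemma theta_linear:
  assumes X: "X \<in> ob C" and n: "p \<le> real n" shows "clinear_on (Hn n X X) UNIV (theta X)"
proof -
  note V = Hs_hilbert[OF X]
  have tr: "has_trace (Hs X) (\<lambda>x. eps X (F X (T x))) (theta X T)" if T: "T \<in> Hn n X X" for T
  proof -
    obtain t where t: "has_trace (Hs X) (\<lambda>x. eps X (F X (T x))) t"
      by (rule trace_exists[OF X sch_eps[OF X X sch_F[OF X X HnD(3)[OF T] X] X] n])
    then show ?thesis using op_trace_eq[OF V t] by (simp add: theta_def)
  qed
  have "theta X (S + T) = theta X S + theta X T" if S: "S \<in> Hn n X X" and T: "T \<in> Hn n X X" for S T
  proof -
    have "has_trace (Hs X) (\<lambda>x. eps X (F X ((S + T) x))) (theta X S + theta X T)"
      by (rule has_trace_cong[OF has_trace_add[OF tr[OF S] tr[OF T]]])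
        (simp add: F_lin[OF X] eps_lin[OF X] F_mem[OF X] HnD(5)[OF S] HnD(5)[OF T])
    from op_trace_eq[OF V this] show ?thesis by (simp add: theta_def)
  qed
  moreover have "theta X (a *\<^sub>C T) = a * theta X T" if T: "T \<in> Hn n X X" for a T
  proof -
    have "has_trace (Hs X) (\<lambda>x. eps X (F X ((a *\<^sub>C T) x))) (a * theta X T)"
      by (rule has_trace_cong[OF has_trace_scale[OF tr[OF T]]])
        (simp add: F_lin[OF X] eps_lin[OF X] F_mem[OF X] HnD(5)[OF T] scaleC_fun_apply)
    from op_trace_eq[OF V this] show ?thesis by (simp add: theta_def)
  qed
  ultimately show ?thesis by (simp add: clinear_on_def scaleC_complex_def)
qed

text \<open>By definition F g = dg + (-1)^i g F, and (-1)^i \<epsilon> g = g \<epsilon>, so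
  \<epsilon> F g g' = \<epsilon> dg g' + g \<epsilon> F g'. The last term is rotated into \<epsilon>
  F g' g; the degrees of the two factors add up to at least p.\<close>

lemma theta_comm:
  assumes N: "p \<le> real (i + j)" "odd (i + j)" and X: "X \<in> ob C" and Y: "Y \<in> ob C" and g: "g \<in> Hn i Y X" and g': "g' \<in> Hn j X Y"
  shows "theta X (\<lambda>x. g (g' x)) = theta Y (\<lambda>x. g' (g x)) + tau X (\<lambda>x. dF i Y X g (g' x))"
proof -
  obtain t where t: "has_trace (Hs X) (\<lambda>x. g (eps Y (F Y (g' x)))) t" "has_trace (Hs Y) (\<lambda>x. eps Y (F Y (g' (g x)))) t"
    using sch_trace_rotate[OF HnD(3)[OF g] sch_eps[OF Y X sch_F[OF Y X HnD(3)[OF g'] Y] Y] p N(1) Hs_hilbert[OF Y] Hs_hilbert[OF X]]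
    by blast
  have "sch p (j + (i + 1)) (Hs X) (Hs X) (\<lambda>x. dF i Y X g (g' x))"
    using sch_comp[OF HnD(3)[OF g'] HnD(4)[OF g] Hs_subspace[OF X] Hs_subspace[OF Y] Hs_subspace[OF X] p0] .
  moreover have "p \<le> real (j + (i + 1))" using N by simp
  ultimately obtain u where u: "has_trace (Hs X) (\<lambda>x. eps X (dF i Y X g (g' x))) u"
    using trace_exists[OF X sch_eps[OF X X _ X]] by blast
  have "has_trace (Hs X) (\<lambda>x. eps X (F X (g (g' x)))) (u + t)"
  proof (rule has_trace_cong[OF has_trace_add[OF u t(1)]])
    fix x assume x: "x \<in> Hs X"
    have m: "g' x \<in> Hs Y" "F Y (g' x) \<in> Hs Y" "g (F Y (g' x)) \<in> Hs X" "F X (g (g' x)) \<in> Hs X"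
      using x HnD(5)[OF g'] HnD(5)[OF g] F_mem X Y by auto
    have "eps X (dF i Y X g (g' x)) = eps X (F X (g (g' x))) + (- ((-1) ^ i)) *\<^sub>C eps X (g (F Y (g' x)))"
      unfolding dF_def using m eps_lin[OF X] cvs.subspace_scale[OF Hs_subspace[OF X] m(3)] by (simp del: cvs.scale_minus_left)
    also have "eps X (g (F Y (g' x))) = (-1) ^ i *\<^sub>C g (eps Y (F Y (g' x)))" by (rule Hn_eps[OF Y X g m(2)])
    finally show "eps X (dF i Y X g (g' x)) + g (eps Y (F Y (g' x))) = eps X (F X (g (g' x)))"
      by (simp add: cvs.scale_minus_left scaleC_scaleC scaleC_one power_mult_distrib[symmetric])
  qed
  from op_trace_eq[OF Hs_hilbert[OF X] this] op_trace_eq[OF Hs_hilbert[OF X] u] op_trace_eq[OF Hs_hilbert[OF Y] t(2)]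
  show ?thesis by (simp add: theta_def tau_def)
qed

text \<open>In odd degree dT = FT + TF. Rotating F turns \<epsilon> T F into F \<epsilon> T =
  -\<epsilon> F T, so the two traces cancel.\<close>

lemma tau_dF:
  assumes N: "p \<le> real n" "odd n" and X: "X \<in> ob C" and T: "T \<in> Hn n X X"
  shows "tau X (dF n X X T) = 0"
proof -
  note V = Hs_hilbert[OF X]
  have N0: "p \<le> real (n + 0)" using N by simp
  obtain t where t: "has_trace (Hs X) (\<lambda>x. eps X (T (F X x))) t" "has_trace (Hs X) (\<lambda>x. F X (eps X (T x))) t"
    using sch_trace_rotate[OF sch_eps[OF X X HnD(3)[OF T] X] sch_bounded[OF F(1)[OF X] Hs_subspace[OF X]] p N0 V V] by blast
  have 1: "has_trace (Hs X) (\<lambda>x. eps X (F X (T x))) (- 1 * t)"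
    by (rule has_trace_cong[OF has_trace_scale[OF t(2), of "- 1"]])
      (simp add: F_eps[OF X] HnD(5)[OF T] cvs.scale_minus_left scaleC_one)
  have "has_trace (Hs X) (\<lambda>x. eps X (dF n X X T x)) (- 1 * t + t)"
    by (rule has_trace_cong[OF has_trace_add[OF 1 t(1)]])
      (use N in \<open>simp add: dF_def eps_lin[OF X] F_mem[OF X] HnD(5)[OF T] scaleC_one\<close>)
  from op_trace_eq[OF V this] show ?thesis by (simp add: tau_def)
qed

text \<open>In even degree F dT = T - F T F, and rotating the last F gives Tr(\<epsilon> F T F) =
  Tr(F \<epsilon> F T) = -Tr(\<epsilon> T). Both terms contribute Tr(\<epsilon> T), which explains
  the factor 1/2.\<close>

lemma tau_half_theta:
  assumes N: "p \<le> real n" "even n" and X: "X \<in> ob C" and T: "T \<in> Hn n X X"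
  shows "tau X T = half_theta n X T"
proof -
  note V = Hs_hilbert[OF X]
  have N0: "p \<le> real (n + 0)" using N by simp
  obtain t where t: "has_trace (Hs X) (\<lambda>x. eps X (F X (T (F X x)))) t" "has_trace (Hs X) (\<lambda>x. F X (eps X (F X (T x)))) t"
    using sch_trace_rotate[OF sch_eps[OF X X sch_F[OF X X HnD(3)[OF T] X] X] sch_bounded[OF F(1)[OF X] Hs_subspace[OF X]] p N0 V V] by blast
  have 1: "has_trace (Hs X) (\<lambda>x. eps X (T x)) (- 1 * t)"
    by (rule has_trace_cong[OF has_trace_scale[OF t(2), of "- 1"]])
      (simp add: F_eps[OF X] F_mem[OF X] HnD(5)[OF T] F(3)[OF X] cvs.scale_minus_left scaleC_one)
  have "has_trace (Hs X) (\<lambda>x. eps X (F X (dF n X X T x))) (- 1 * t - t)"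
    by (rule has_trace_cong[OF has_trace_diff[OF 1 t(1)]])
      (use N in \<open>simp add: dF_def F_diff[OF X] eps_diff[OF X] F_mem[OF X] HnD(5)[OF T] F(3)[OF X] cvs.scale_minus_left scaleC_one\<close>)
  from op_trace_eq[OF V this] op_trace_eq[OF V 1] show ?thesis by (simp add: tau_def half_theta_def theta_def)
qed

lemma half_theta_graded_trace:
  assumes q: "p \<le> 2 * real q + 1" shows "W.graded_trace (2 * q) (half_theta (2 * q))"
proof -
  have N: "p \<le> real (2 * q + 1)" "odd (2 * q + 1)" using q by simp_all
  have "W.graded_trace (2 * q) (\<lambda>X \<omega>. 1 / 2 * theta X (W.dd (2 * q) X X \<omega>))"
  proof (rule W.graded_trace_half[OF refl])
    show "clinear_on (W.H (2 * q + 1) X X) UNIV (theta X)" if "X \<in> ob C" for X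
      unfolding W_simps by (rule theta_linear[OF that N(1)])
    show "theta X (W.cmp i j X Y X g g') = theta Y (W.cmp j i Y X Y g' g) + tau X (W.cmp (i + 1) j X Y X (W.dd i Y X g) g')"
      if "i + j = 2 * q + 1" "X \<in> ob C" "Y \<in> ob C" "g \<in> W.H i Y X" "g' \<in> W.H j X Y" for i j X Y g g'
      unfolding W_simps by (rule theta_comm) (use that N W_simps in simp_all)
    show d: "tau X (W.dd (2 * q + 1) X X \<omega>) = 0" if "X \<in> ob C" "\<omega> \<in> W.H (2 * q + 1) X X" for X \<omega>
      unfolding W_simps by (rule tau_dF[OF N that(1)]) (use that W_simps in simp)
    show "tau X 0 = 0" if X: "X \<in> ob C" for X
      using d[OF X cvs.subspace_0[OF W.H_subspace[OF X X]]]
      unfolding clinear_on_zero[OF W.dd_linear[OF X X] W.H_subspace[OF X X]] .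
  qed
  then show ?thesis by (simp add: half_theta_def[abs_def] W_simps)
qed

section \<open>Characters of the Fredholm module and the comparison\<close>

lemma word_fm_word:
  assumes l: "l \<in> chains C n" shows "i \<le> n \<Longrightarrow> x \<in> Hs (obj l (i + 1)) \<Longrightarrow> W.word l i x = fm_word M l i x"
proof (induction i arbitrary: x)
  case 0
  then show ?case using chains_length[OF l] by (simp add: W.word_def W_simps rho0_def mor_eq_fmor)
next
  case (Suc i)
  note O = chains_obj[OF l]
  have x: "x \<in> Hs (obj l (i + 2))" using Suc.prems by simp
  let ?y = "fm_comm M (obj l (i + 2)) (obj l (i + 1)) (mor l (i + 1)) x"
  have m: "mor l (i + 1) = fmor l (i + 1)" using chains_length[OF l] Suc.prems by (simp add: mor_eq_fmor)
  have y: "W.df l (i + 1) x = ?y"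
    unfolding W.df_def W_simps m using dF_rho0[OF O x] by (simp add: numeral_2_eq_2)
  have "W.df l (i + 1) \<in> Hn 1 (obj l (i + 2)) (obj l (i + 1))"
    using W.df_mem[OF l, of "i + 1"] by (simp add: W_simps numeral_2_eq_2)
  from HnD(5)[OF this x] have "?y \<in> Hs (obj l (i + 1))" unfolding y .
  then show ?case using Suc.IH[of ?y] Suc.prems y by (simp add: W.word_Suc W_simps)
qed

lemma fm_character_wfun:
  assumes n: "even n" shows "fm_character C M n = W.wfun n (half_theta n)"
proof
  fix l
  show "fm_character C M n l = W.wfun n (half_theta n) l"
  proof (cases "l \<in> chains C n")
    case l: True
    let ?X = "obj l 0"
    note X = chains_obj[OF l, of 0]
    have w: "W.word l n x = fm_word M l n x" if "x \<in> Hs ?X" for x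
      using word_fm_word[OF l, of n x] that chains_wrap(2)[OF l] by simp
    have "op_trace (Hs ?X) (\<lambda>x. eps ?X (F ?X (graded_comm M ?X n (fm_word M l n) x))) =
        op_trace (Hs ?X) (\<lambda>x. eps ?X (F ?X (dF n ?X ?X (W.word l n) x)))"
      by (rule op_trace_cong) (use n in \<open>simp add: graded_comm_def dF_def w F_mem[OF X] cvs.scale_minus_left scaleC_one\<close>)
    then show ?thesis using l by (simp add: fm_character_def W.wfun_def half_theta_def theta_def supertrace_def)
  qed (simp add: fm_character_def W.wfun_def)
qed

lemma rho0_ident:
  assumes "X \<in> ob C" "Y \<in> ob C" "\<omega> \<in> Hn n X Y"
  shows "(\<lambda>x. rho0 Y Y (ident C Y) (\<omega> x)) = \<omega>" "(\<lambda>x. \<omega> (rho0 X X (ident C X) x)) = \<omega>"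
proof -
  have z: "\<omega> 0 = 0" "rho0 Y Y (ident C Y) 0 = 0"
    using clinear_on_zero[OF HnD(6)[OF assms(3)] Hs_subspace[OF assms(1)]]
      map(4)[OF assms(2) cvs.subspace_0[OF Hs_subspace[OF assms(2)]]] by (simp_all add: rho0_def)
  show "(\<lambda>x. rho0 Y Y (ident C Y) (\<omega> x)) = \<omega>"
  proof
    fix x show "rho0 Y Y (ident C Y) (\<omega> x) = \<omega> x"
      using z HnD(1)[OF assms(3)] HnD(5)[OF assms(3)] map(4)[OF assms(2)]
      by (cases "x \<in> Hs X") (simp_all add: rho0_def)
  qed
  show "(\<lambda>x. \<omega> (rho0 X X (ident C X) x)) = \<omega>"
  proof
    fix x show "\<omega> (rho0 X X (ident C X) x) = \<omega> x"
      using z HnD(1)[OF assms(3)] map(4)[OF assms(1)] by (cases "x \<in> Hs X") (simp_all add: rho0_def)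
  qed
qed

theorem periodicity_fredholm:
  assumes q: "p \<le> 2 * real m + 1"
  shows "(periodicity C (2 * m) (fm_character C M (2 * m)),
    - of_nat (m + 1) *\<^sub>C fm_character C M (2 * m + 2)) \<in> cyclic_cohomologous C (2 * m + 2)"
proof -
  let ?N = "2 * m + 1" and ?T = "half_theta (2 * m)" and ?T' = "half_theta (2 * m + 2)"
  have N: "p \<le> real ?N" "odd ?N" using q by simp_all
  note t = half_theta_graded_trace[OF q]
  have "2 * Suc m = ?N + 1" "2 * Suc m = 2 * m + 2" "p \<le> 2 * real (Suc m) + 1" using q by simp_all
  \<comment> \<open>In degree 2m + 2 this functional coincides with \<tau>, the error term of
    \<theta> in degree 2m + 1. So the general computation applies with an error cochain that is the
    next character.\<close>
  then have t': "W.graded_trace (?N + 1) ?T'" using half_theta_graded_trace[of "Suc m"] by metis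
  \<comment> \<open>Provides a standard cycle with the character of dimension 2m, hence the
    existence part of the description in \<open>sharp\<close>.\<close>
  interpret U: unital_cycle C fcyc "2 * m" ?T
  proof unfold_locales
    show "W.graded_trace (2 * m) ?T" by (rule t)
    show "W.cmp 0 n X Y Y (cyc_mor fcyc Y Y (ident C Y)) \<omega> = \<omega>" if "X \<in> ob C" "Y \<in> ob C" "\<omega> \<in> W.H n X Y" for X Y n \<omega>
      using rho0_ident(1)[OF that[unfolded W_simps]] by (simp add: W_simps)
    show "W.cmp n 0 X X Y \<omega> (cyc_mor fcyc X X (ident C X)) = \<omega>" if "X \<in> ob C" "Y \<in> ob C" "\<omega> \<in> W.H n X Y" for X Y n \<omega>
      using rho0_ident(2)[OF that[unfolded W_simps]] by (simp add: W_simps)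
  qed
  have th: "clinear_on (W.H ?N X X) UNIV (theta X)" if "X \<in> ob C" for X
    unfolding W_simps by (rule theta_linear[OF that N(1)])
  have comm: "theta X (W.cmp i j X Y X g g') = theta Y (W.cmp j i Y X Y g' g) + ?T' X (W.cmp (i + 1) j X Y X (W.dd i Y X g) g')"
    if ij: "i + j = ?N" and X: "X \<in> ob C" and Y: "Y \<in> ob C" and g: "g \<in> W.H i Y X" and g': "g' \<in> W.H j X Y" for i j X Y g g'
  proof -
    have n: "i + 1 + j = 2 * m + 2" using ij by simp
    have "W.cmp (i + 1) j X Y X (W.dd i Y X g) g' \<in> Hn (2 * m + 2) X X"
      using W.cmp_mem[OF X Y X W.dd_mem[OF Y X g] g'] unfolding n W_simps .
    moreover have "p \<le> real (2 * m + 2)" "even (2 * m + 2)" using q by simp_all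
    ultimately have "tau X (W.cmp (i + 1) j X Y X (W.dd i Y X g) g') = ?T' X (W.cmp (i + 1) j X Y X (W.dd i Y X g) g')"
      using tau_half_theta X by blast
    moreover have "theta X (W.cmp i j X Y X g g') = theta Y (W.cmp j i Y X Y g' g) + tau X (W.cmp (i + 1) j X Y X (W.dd i Y X g) g')"
      unfolding W_simps by (rule theta_comm) (use ij N X Y g g' W_simps in simp_all)
    ultimately show ?thesis by simp
  qed
  have T: "?T X \<omega> = 1 / 2 * theta X (W.dd (2 * m) X X \<omega>)" for X \<omega>
    by (simp add: half_theta_def W_simps)
  define \<xi> where "\<xi> = cyclic_sum C ?N (W.wfun ?N theta)"
  have \<xi>0: "W.wfun ?N theta \<in> cochains C ?N" by (rule W.wfun_cochain[OF th])
  have \<xi>: "\<xi> \<in> cyclic_cochains C ?N" unfolding \<xi>_def by (rule cyclic_sum_cyclic[OF C \<xi>0])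
  define B where "B = hochschild_b C ?N \<xi>"
  have N1: "?N + 1 = 2 * m + 2" by simp
  have B: "B \<in> cyclic_cocycles C (2 * m + 2)"
    using hochschild_b_cyclic_sum_cocycle[OF C \<xi>0] unfolding B_def \<xi>_def N1 .
  define \<phi>' where "\<phi>' = fm_character C M (2 * m + 2)"
  have \<phi>'_eq: "\<phi>' = W.wfun (2 * m + 2) ?T'" unfolding \<phi>'_def by (rule fm_character_wfun) simp
  have \<phi>': "\<phi>' \<in> cyclic_cocycles C (2 * m + 2)" using W.wfun_cocycle[OF t'] unfolding \<phi>'_eq N1 .
  have \<phi>: "fm_character C M (2 * m) = W.wfun (2 * m) ?T" by (rule fm_character_wfun) simp
  have eq: "periodicity C (2 * m) (fm_character C M (2 * m)) = (- 1 / 2) *\<^sub>C B - of_nat (m + 1) *\<^sub>C \<phi>'"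
  proof
    fix l
    show "periodicity C (2 * m) (fm_character C M (2 * m)) l = ((- 1 / 2) *\<^sub>C B - of_nat (m + 1) *\<^sub>C \<phi>') l"
    proof (cases "l \<in> chains C (2 * m + 2)")
      case l: True
      then have l': "l \<in> chains C (?N + 1)" by simp
      have "periodicity C (2 * m) (fm_character C M (2 * m)) l = W.Sfun (2 * m) ?T l"
        unfolding \<phi> periodicity_formula[OF C U.qcyc_cycle U.qcyc_character psi_cyc_cycle psi_cyc_character l]
        by (rule W.Sfun_wfun[OF W.graded_trace_linear[OF t] l, symmetric])
      also have "\<dots> = - 1 / 2 * B l - of_nat (m + 1) * \<phi>' l"
        using W.Sfun_eq[of ?N m theta ?T' ?T, OF refl th t' comm T l'] unfolding B_def \<xi>_def \<phi>'_eq N1 .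
      finally show ?thesis by (simp add: scaleC_fun_apply scaleC_complex_def)
    next
      case False
      then show ?thesis
        by (simp add: periodicity_def B_def hochschild_b_def \<phi>'_def fm_character_def scaleC_fun_apply scaleC_complex_def)
    qed
  qed
  note sub = cyclic_cocycles_subspace[of C "2 * m + 2"]
  have "periodicity C (2 * m) (fm_character C M (2 * m)) \<in> cyclic_cocycles C (2 * m + 2)"
    unfolding eq by (intro cvs.subspace_diff[OF sub] cvs.subspace_scale[OF sub] B \<phi>')
  moreover have "- of_nat (m + 1) *\<^sub>C \<phi>' \<in> cyclic_cocycles C (2 * m + 2)"
    by (rule cvs.subspace_scale[OF sub \<phi>'])
  \<comment> \<open>The difference of the two classes is bounded by -1/2 times the cyclic sum of the
    cochain of \<theta>.\<close>
  moreover have "periodicity C (2 * m) (fm_character C M (2 * m)) - (- of_nat (m + 1) *\<^sub>C \<phi>') = hochschild_b C ?N ((- 1 / 2) *\<^sub>C \<xi>)"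
    unfolding eq hochschild_b_scale B_def[symmetric] cvs.scale_minus_left by simp
  moreover have "hochschild_b C ?N ((- 1 / 2) *\<^sub>C \<xi>) \<in> cyclic_coboundaries C (2 * m + 2)"
    using cvs.subspace_scale[OF cyclic_cochains_subspace \<xi>, of "- 1 / 2"] by (simp add: cyclic_coboundaries_def)
  ultimately show ?thesis unfolding cyclic_cohomologous_def \<phi>'_def by simp
qed

end

theorem theorem7p3:
  fixes C :: "('o, 'a::complex_vector) lin_cat"
    and M :: "('o, 'a, 'h::complex_hilbert) fredholm"
    and p :: real and m :: nat
  assumes "linear_category C"
    and "1 \<le> p"
    and "even_fredholm_module C p M"
    and "2 * real m \<ge> p - 1"
  shows "(periodicity C (2 * m) (fm_character C M (2 * m)),
          - of_nat (m + 1) *\<^sub>C fm_character C M (2 * m + 2)) \<in> cyclic_cohomologous C (2 * m + 2)"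
proof -
  interpret fredholm_module C M p using assms(1-3) by unfold_locales
  show ?thesis by (rule periodicity_fredholm) (use assms(4) in simp)
qed

end
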